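(* Let $d\in\mathbb{N}$, $d\ge2$, $\sigma>0$, and assume that $V:\mathbb{R}^d \rightarrow \mathbb{R}$ is locally Lipschitz continuous and bounded from below. Then the spherical velocity Langevin operator $(L,C_c^\infty(\mathbb{M}))$ is essentially m-dissipative on $L^2(\mathbb{M},\mu)$.
   Context: $\mathbb{S}$ is the unit sphere in $\mathbb{R}^d$, $\mathbb{M}=\mathbb{R}^d\times\mathbb{S}$ with points $(x,\omega)$, $\nu$ is the normalized surface measure on $\mathbb{S}$, and $\mu=e^{-V}\mathrm{d}x\otimes\nu$ (not assumed to be finite). $L^2$-spaces are real. Since $V$ is locally Lipschitz, $\nabla V$ exists a.e. and lies in $L^\infty_{\text{loc}}(\mathbb{R}^d)$. On $C_c^\infty(\mathbb{M})$ (smooth compactly supported functions) define $$L= \omega \cdot \nabla_x - \text{grad}_{\mathbb{S}} \Phi \cdot \nabla_\omega + \tfrac{1}{2} \sigma^2 \, \Delta_{\mathbb{S}},\qquad \Phi(x,\omega)= \tfrac{1}{d-1} \,\nabla V(x) \cdot \omega \ \text{ (a.e.)},$$ where $\Delta_{\mathbb{S}}$ is the Laplace–Beltrami operator on $\mathbb{S}$ acting on $\omega$, and $\text{grad}_{\mathbb{S}}\Phi(x,\omega)=\frac{1}{d-1}(I-\omega\omega^T)\nabla V(x)$ is the spherical gradient in $\omega$; $\text{grad}_{\mathbb{S}} \Phi \cdot \nabla_\omega f$ is the derivative of $f(x,\cdot)$ in the direction of this tangent vector. A densely defined operator is essentially m-dissipative if it is dissipative and its closure is m-dissipative (equivalently,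 it is dissipative and the range of $I-L$ is dense). *)

theory Defs
  imports "HOL-Analysis.Analysis"
begin

section \<open>Operators on real $L^2$-spaces\<close>

text \<open>
  The distribution has no type of $L^2$-classes over an arbitrary measure. Elements of
  $L^2(M)$ are represented by square-integrable functions, and every identity between
  elements of $L^2(M)$ is an identity almost everywhere. A (possibly unbounded) operator is
  represented by its graph.
\<close>

definition L2 :: "'p measure \<Rightarrow> ('p \<Rightarrow> real) set" where
  "L2 M = {f \<in> borel_measurable M. integrable M (\<lambda>p. (f p)\<^sup>2)}"

definition l2_inner :: "'p measure \<Rightarrow> ('p \<Rightarrow> real) \<Rightarrow> ('p \<Rightarrow> real) \<Rightarrow> real" where
  "l2_inner M f g = (\<integral>p. f p * g p \<partial>M)"

definition l2_dist :: "'p measure \<Rightarrow> ('p \<Rightarrow> real) \<Rightarrow> ('p \<Rightarrow> real) \<Rightarrow> real" where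
  "l2_dist M f g = sqrt (\<integral>p. (f p - g p)\<^sup>2 \<partial>M)"

text \<open>
  A linear subspace of $L^2(M) \times L^2(M)$ that is single-valued, i.e. the graph of a
  linear operator; all three requirements are about classes.
\<close>

definition l2_operator :: "'p measure \<Rightarrow> (('p \<Rightarrow> real) \<times> ('p \<Rightarrow> real)) set \<Rightarrow> bool" where
  "l2_operator M A \<longleftrightarrow>
     A \<subseteq> L2 M \<times> L2 M \<and> A \<noteq> {} \<and>
     (\<forall>(f, g) \<in> A. \<forall>(f', g') \<in> A. \<forall>a b. \<exists>(h, k) \<in> A.
        (AE p in M. h p = a * f p + b * f' p) \<and> (AE p in M. k p = a * g p + b * g' p)) \<and>
     (\<forall>(f, g) \<in> A. \<forall>(f', g') \<in> A.
        (AE p in M. f p = f' p) \<longrightarrow> (AE p in M. g p = g' p))"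

definition densely_defined :: "'p measure \<Rightarrow> (('p \<Rightarrow> real) \<times> ('p \<Rightarrow> real)) set \<Rightarrow> bool" where
  "densely_defined M A \<longleftrightarrow> (\<forall>h \<in> L2 M. \<forall>\<epsilon> > 0. \<exists>(f, g) \<in> A. l2_dist M h f < \<epsilon>)"

definition dissipative :: "'p measure \<Rightarrow> (('p \<Rightarrow> real) \<times> ('p \<Rightarrow> real)) set \<Rightarrow> bool" where
  "dissipative M A \<longleftrightarrow> (\<forall>(f, g) \<in> A. l2_inner M g f \<le> 0)"

definition m_dissipative :: "'p measure \<Rightarrow> (('p \<Rightarrow> real) \<times> ('p \<Rightarrow> real)) set \<Rightarrow> bool" where
  "m_dissipative M A \<longleftrightarrow>
     dissipative M A \<and> (\<forall>h \<in> L2 M. \<exists>(f, g) \<in> A. AE p in M. f p - g p = h p)"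

definition graph_closure ::
    "'p measure \<Rightarrow> (('p \<Rightarrow> real) \<times> ('p \<Rightarrow> real)) set \<Rightarrow> (('p \<Rightarrow> real) \<times> ('p \<Rightarrow> real)) set" where
  "graph_closure M A =
     {(f, g). f \<in> L2 M \<and> g \<in> L2 M \<and>
        (\<forall>\<epsilon> > 0. \<exists>(f', g') \<in> A. l2_dist M f f' < \<epsilon> \<and> l2_dist M g g' < \<epsilon>)}"

text \<open>
  The fourth conjunct is closability: the closure of the graph is again the graph of an
  operator. It is implied by the second and third, and is stated so that ``the closure'' of
  the operator makes sense on its own.
\<close>

definition essentially_m_dissipative ::
    "'p measure \<Rightarrow> (('p \<Rightarrow> real) \<times> ('p \<Rightarrow> real)) set \<Rightarrow> bool" where
  "essentially_m_dissipative M A \<longleftrightarrow>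
     l2_operator M A \<and> densely_defined M A \<and> dissipative M A \<and>
     l2_operator M (graph_closure M A) \<and> m_dissipative M (graph_closure M A)"


section \<open>Calculus on the sphere and on $\mathbb{R}^d \times \mathbb{S}$\<close>

text \<open>The value 0 where \<^term>\<open>f\<close> is not differentiable keeps the gradient of a continuous
  function Borel measurable.\<close>

definition grad :: "('a::euclidean_space \<Rightarrow> real) \<Rightarrow> 'a \<Rightarrow> 'a" where
  "grad f x = (if \<exists>D. GDERIV f x :> D then THE D. GDERIV f x :> D else 0)"

text \<open>
  A function on the sphere is extended to the punctured space to be constant along rays,
  i.e. composed with \<^term>\<open>sgn\<close>, where \<open>sgn y = y /\<^sub>R norm y\<close>; only its values on the unit
  sphere are used. The Euclidean gradient of this extension is tangential on the sphere, and
  the radial direction does not contribute to its Euclidean divergence, so that on the unit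
  sphere the following are the Riemannian gradient, the Riemannian divergence of a tangent
  vector field, and the Laplace-Beltrami operator (divergence of the gradient).
\<close>

definition sphere_grad :: "('a::euclidean_space \<Rightarrow> real) \<Rightarrow> 'a \<Rightarrow> 'a" where
  "sphere_grad g \<omega> = grad (\<lambda>y. g (sgn y)) \<omega>"

definition sphere_div :: "('a::euclidean_space \<Rightarrow> 'a) \<Rightarrow> 'a \<Rightarrow> real" where
  "sphere_div X \<omega> = (\<Sum>b\<in>Basis. frechet_derivative (\<lambda>y. X (sgn y)) (at \<omega>) b \<bullet> b)"

definition laplace_beltrami :: "('a::euclidean_space \<Rightarrow> real) \<Rightarrow> 'a \<Rightarrow> real" where
  "laplace_beltrami g = sphere_div (sphere_grad g)"

primrec Ck_on :: "nat \<Rightarrow> 'a::real_normed_vector set \<Rightarrow> ('a \<Rightarrow> real) \<Rightarrow> bool" where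
  "Ck_on 0 U f \<longleftrightarrow> continuous_on U f"
| "Ck_on (Suc k) U f \<longleftrightarrow>
     (\<forall>x\<in>U. f differentiable (at x)) \<and> (\<forall>v. Ck_on k U (\<lambda>x. frechet_derivative f (at x) v))"

definition smooth_on :: "'a::real_normed_vector set \<Rightarrow> ('a \<Rightarrow> real) \<Rightarrow> bool" where
  "smooth_on U f \<longleftrightarrow> (\<forall>k. Ck_on k U f)"

definition phase_space :: "('a::euclidean_space \<times> 'a) set" where
  "phase_space = UNIV \<times> sphere 0 1"

text \<open>
  Smoothness on the embedded submanifold means having a smooth extension to an open
  neighbourhood. The values of \<^term>\<open>f\<close> off the phase space are irrelevant here and in all
  later definitions.
\<close>

definition test_functions :: "('a::euclidean_space \<times> 'a \<Rightarrow> real) set" where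
  "test_functions =
     {f. (\<exists>U F. open U \<and> phase_space \<subseteq> U \<and> smooth_on U F \<and> (\<forall>p\<in>phase_space. F p = f p)) \<and>
         compact (closure {p \<in> phase_space. f p \<noteq> 0})}"


section \<open>The spherical velocity Langevin operator\<close>

text \<open>
  Normalized surface measure, by polar coordinates: the normalized surface area of
  \<open>A \<subseteq> \<S>\<close> is the fraction of the unit ball covered by the cone over \<open>A\<close>.
\<close>

definition sphere_measure :: "'a::euclidean_space measure" where
  "sphere_measure =
     restrict_space (distr (uniform_measure lborel (ball 0 1)) borel sgn) (sphere 0 1)"

definition langevin_measure :: "('a::euclidean_space \<Rightarrow> real) \<Rightarrow> ('a \<times> 'a) measure" where
  "langevin_measure V =
     density (lborel \<Otimes>\<^sub>M sphere_measure) (\<lambda>(x, \<omega>). ennreal (exp (- V x)))"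

definition langevin_Phi :: "('a::euclidean_space \<Rightarrow> real) \<Rightarrow> 'a \<Rightarrow> 'a \<Rightarrow> real" where
  "langevin_Phi V x \<omega> = 1 / (real DIM('a) - 1) * (grad V x \<bullet> \<omega>)"

definition langevin_op ::
    "('a::euclidean_space \<Rightarrow> real) \<Rightarrow> real \<Rightarrow> ('a \<times> 'a \<Rightarrow> real) \<Rightarrow> 'a \<times> 'a \<Rightarrow> real" where
  "langevin_op V \<sigma> f = (\<lambda>(x, \<omega>).
     \<omega> \<bullet> grad (\<lambda>x'. f (x', \<omega>)) x
     - sphere_grad (langevin_Phi V x) \<omega> \<bullet> sphere_grad (\<lambda>\<omega>'. f (x, \<omega>')) \<omega>
     + 1/2 * \<sigma>\<^sup>2 * laplace_beltrami (\<lambda>\<omega>'. f (x, \<omega>')) \<omega>)"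

definition langevin_graph ::
    "('a::euclidean_space \<Rightarrow> real) \<Rightarrow> real \<Rightarrow> (('a \<times> 'a \<Rightarrow> real) \<times> ('a \<times> 'a \<Rightarrow> real)) set" where
  "langevin_graph V \<sigma> = {(f, langevin_op V \<sigma> f) | f. f \<in> test_functions}"



subsection \<open>Consistency checks\<close>

lemma space_langevin_measure: "space (langevin_measure V) = phase_space"
  by (simp add: langevin_measure_def sphere_measure_def phase_space_def space_pair_measure
      space_restrict_space)

lemma emeasure_sphere_measure:
  "emeasure (sphere_measure :: 'a::euclidean_space measure) (sphere 0 1) = 1"
proof -
  let ?B = "ball 0 1 :: 'a set"
  have fin: "emeasure lborel ?B \<noteq> \<infinity>"
    using emeasure_lborel_ball_finite[of "0::'a" 1] by auto
  have nz: "emeasure lborel ?B \<noteq> 0"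
    using content_ball_pos[of 1 "0::'a"] by (auto simp: measure_def)
  have vim: "sgn -` sphere 0 1 = - {0 :: 'a}"
    by (auto simp: norm_sgn)
  have "emeasure (sphere_measure :: 'a measure) (sphere 0 1) =
      emeasure (distr (uniform_measure lborel ?B) borel sgn) (sphere 0 1)"
    by (simp add: sphere_measure_def emeasure_restrict_space)
  also have "\<dots> = emeasure (uniform_measure lborel ?B) (- {0})"
    by (simp add: emeasure_distr vim)
  also have "\<dots> = emeasure lborel (?B - {0}) / emeasure lborel ?B"
    by (simp add: Diff_eq)
  also have "emeasure lborel (?B - {0}) = emeasure lborel ?B"
    by (rule emeasure_Diff_null_set) auto
  also have "emeasure lborel ?B / emeasure lborel ?B = 1"
    by (rule ennreal_divide_self[OF nz]) (use fin in \<open>simp add: less_top\<close>)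
  finally show ?thesis .
qed

lemma grad_eqI:
  assumes "GDERIV f x :> D"
  shows "grad f x = D"
proof -
  have "D' = D" if "GDERIV f x :> D'" for D'
  proof -
    have "(\<lambda>h. h \<bullet> D') = (\<lambda>h. h \<bullet> D)"
      using has_derivative_unique assms that unfolding gderiv_def by blast
    then show ?thesis by (metis vector_eq_ldot)
  qed
  then show ?thesis
    using assms unfolding grad_def by (metis (mono_tags, lifting) the_equality)
qed

lemma has_derivative_sgn:
  fixes \<omega> :: "'a::euclidean_space"
  assumes "norm \<omega> = 1"
  shows "(sgn has_derivative (\<lambda>h. h - (h \<bullet> \<omega>) *\<^sub>R \<omega>)) (at \<omega>)"
proof -
  have nz: "\<omega> \<noteq> 0" using assms by auto
  have s: "sgn \<omega> = \<omega>" using assms by (simp add: sgn_div_norm)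
  have n: "(norm has_derivative (\<lambda>h. h \<bullet> \<omega>)) (at \<omega>)"
    using has_derivative_norm[OF nz] s by simp
  have i: "((\<lambda>y. inverse (norm y)) has_derivative (\<lambda>h. - (h \<bullet> \<omega>))) (at \<omega>)"
    using Deriv.has_derivative_inverse[OF _ n] nz assms by simp
  have "((\<lambda>y. inverse (norm y) *\<^sub>R y) has_derivative
      (\<lambda>h. inverse (norm \<omega>) *\<^sub>R h + (- (h \<bullet> \<omega>)) *\<^sub>R \<omega>)) (at \<omega>)"
    by (rule has_derivative_scaleR[OF i has_derivative_ident])
  moreover have "(\<lambda>y. inverse (norm y) *\<^sub>R y) = (sgn :: 'a \<Rightarrow> 'a)"
    by (simp add: sgn_div_norm fun_eq_iff)
  ultimately show ?thesis using assms by simp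
qed

lemma sphere_grad_inner:
  fixes \<omega> :: "'a::euclidean_space"
  assumes "norm \<omega> = 1"
  shows "sphere_grad (\<lambda>y. v \<bullet> y) \<omega> = v - (\<omega> \<bullet> v) *\<^sub>R \<omega>"
proof -
  have "((\<lambda>y. v \<bullet> sgn y) has_derivative
      (\<lambda>h. v \<bullet> (h - (h \<bullet> \<omega>) *\<^sub>R \<omega>))) (at \<omega>)"
    by (intro has_derivative_inner_right has_derivative_sgn assms)
  moreover have "(\<lambda>h. v \<bullet> (h - (h \<bullet> \<omega>) *\<^sub>R \<omega>)) = (\<lambda>h. h \<bullet> (v - (\<omega> \<bullet> v) *\<^sub>R \<omega>))"
    by (simp add: fun_eq_iff inner_diff_right inner_commute)
  ultimately show ?thesis
    unfolding sphere_grad_def by (intro grad_eqI) (simp add: gderiv_def)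
qed

lemma sphere_grad_langevin_Phi:
  fixes \<omega> :: "'a::euclidean_space"
  assumes "norm \<omega> = 1"
  shows "sphere_grad (langevin_Phi V x) \<omega> =
    (1 / (real DIM('a) - 1)) *\<^sub>R (grad V x - (\<omega> \<bullet> grad V x) *\<^sub>R \<omega>)"
proof -
  let ?c = "1 / (real DIM('a) - 1)"
  have "langevin_Phi V x = (\<lambda>y. (?c *\<^sub>R grad V x) \<bullet> y)"
    by (simp add: langevin_Phi_def fun_eq_iff)
  then show ?thesis
    by (simp only: sphere_grad_inner[OF assms]) (simp add: scaleR_diff_right)
qed

lemma laplace_beltrami_inner:
  fixes \<omega> :: "'a::euclidean_space"
  assumes "norm \<omega> = 1"
  shows "laplace_beltrami (\<lambda>y. v \<bullet> y) \<omega> = - (real DIM('a) - 1) * (v \<bullet> \<omega>)"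
proof -
  let ?P = "\<lambda>h. h - (h \<bullet> \<omega>) *\<^sub>R \<omega>"
  have nz: "\<omega> \<noteq> 0" using assms by auto
  have s: "sgn \<omega> = \<omega>" using assms by (simp add: sgn_div_norm)
  have 1: "((\<lambda>y. v - (sgn y \<bullet> v) *\<^sub>R sgn y) has_derivative
      (\<lambda>h. - ((\<omega> \<bullet> v) *\<^sub>R ?P h + (?P h \<bullet> v) *\<^sub>R \<omega>))) (at \<omega>)"
    using has_derivative_diff[OF has_derivative_const[of v]
        has_derivative_scaleR[OF has_derivative_inner_left[OF has_derivative_sgn[OF assms]]
          has_derivative_sgn[OF assms]]] unfolding s by simp
  have 2: "((\<lambda>y. sphere_grad (\<lambda>y. v \<bullet> y) (sgn y)) has_derivative
      (\<lambda>h. - ((\<omega> \<bullet> v) *\<^sub>R ?P h + (?P h \<bullet> v) *\<^sub>R \<omega>))) (at \<omega>)"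
    by (rule has_derivative_transform_within_open[OF 1, of "- {0}"])
       (use nz in \<open>auto simp: sphere_grad_inner norm_sgn\<close>)
  have "laplace_beltrami (\<lambda>y. v \<bullet> y) \<omega> =
      (\<Sum>b\<in>Basis. - ((\<omega> \<bullet> v) *\<^sub>R ?P b + (?P b \<bullet> v) *\<^sub>R \<omega>) \<bullet> b)"
    unfolding laplace_beltrami_def sphere_div_def frechet_derivative_at[OF 2, symmetric] by (rule refl)
  also have "\<dots> = (\<Sum>b\<in>Basis. - (\<omega> \<bullet> v) + 2 * (\<omega> \<bullet> v) * ((\<omega> \<bullet> b) * (\<omega> \<bullet> b)) - (v \<bullet> b) * (\<omega> \<bullet> b))"
  proof (rule sum.cong)
    fix b :: 'a assume b: "b \<in> Basis"
    have [simp]: "b \<bullet> \<omega> = \<omega> \<bullet> b" "b \<bullet> v = v \<bullet> b" "b \<bullet> b = 1"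
      using b by (auto simp: inner_commute inner_same_Basis)
    show "- ((\<omega> \<bullet> v) *\<^sub>R ?P b + (?P b \<bullet> v) *\<^sub>R \<omega>) \<bullet> b =
        - (\<omega> \<bullet> v) + 2 * (\<omega> \<bullet> v) * ((\<omega> \<bullet> b) * (\<omega> \<bullet> b)) - (v \<bullet> b) * (\<omega> \<bullet> b)"
      by (simp add: inner_diff_left inner_add_left) algebra
  qed simp
  also have "\<dots> = - real DIM('a) * (\<omega> \<bullet> v) + 2 * (\<omega> \<bullet> v) * (\<omega> \<bullet> \<omega>) - v \<bullet> \<omega>"
    unfolding euclidean_inner[of \<omega> \<omega>] euclidean_inner[of v \<omega>]
    by (simp add: sum.distrib sum_subtractf sum_distrib_left)
  also have "\<dots> = - (real DIM('a) - 1) * (v \<bullet> \<omega>)"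
    using assms by (simp add: dot_square_norm inner_commute[of \<omega> v] left_diff_distrib)
  finally show ?thesis .
qed

end

theory Submission
  imports Defs "HOL-Computational_Algebra.Polynomial"
begin

text \<open>
After conjugation with \<open>exp (V / 2)\<close> the operator acts on the unweighted space over \<open>\<R>\<^sup>d \<times> \<S>\<close> as
the sum of a nonpositive spherical Laplacian, the antisymmetric transport \<open>\<omega> \<bullet> \<nabla>\<^sub>x\<close>, and an
antisymmetric first order term \<open>drift\<close> whose coefficient is the gradient of \<open>V\<close>. Dissipativity is then
integration by parts, and by the Lumer-Phillips criterion (\<open>essentially_m_dissipativeI\<close>) what remains is
that \<open>I - L\<close> has dense range. The dense range is built up in four steps.

The resolvent of the spherical Laplacian has dense range because the Laplacian is triangular on the
functions \<open>a x * (\<omega> \<bullet> v) ^ n\<close>, whose span is dense (\<open>dense_range_sphere_resolvent\<close>). The transport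
commutes with translations in \<open>x\<close>; it is first replaced by its difference quotients, which are bounded,
so that a Neumann-type continuity argument applies, and mollification in \<open>x\<close> makes the error of the
quotients harmless (\<open>dense_range_free\<close>). A bounded drift is added by the continuity method: the energy
identity bounds the spherical derivatives of a function by the residual, so the drift is a perturbation that
can be switched on in finitely many steps of equal size (\<open>dense_range_drift\<close>). Finally, for a locally
bounded gradient one truncates: given \<open>h\<close>, solve with the gradient cut off outside a ball of radius \<open>2 r\<close>
and multiply the solution by a cutoff at scale \<open>r\<close>. The commutator of the cutoff with the transport is of
order \<open>1 / r\<close>, and antisymmetry of the drift bounds the solution independently of \<open>r\<close>
(\<open>langevin_range\<close>).

The conjugating factor \<open>exp (V / 2)\<close> is not smooth, so the test functions use mollified potentials whose
gradients stay bounded and converge wherever \<open>V\<close> is differentiable (\<open>smooth_potentials\<close>). That this is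
almost everywhere is Rademacher's theorem (\<open>Rademacher_local\<close>), which also identifies the pointwise
gradient in the operator with the weak gradient in the integrations by parts. Derivatives along the sphere are
expressed throughout by the rotations of coordinate planes; these are linear vector fields on the ambient
space that preserve the surface measure.
\<close>

section \<open>Smooth functions\<close>

abbreviation (input) tends_to (infix "---->" 60) where
 "X ----> L \<equiv> X \<longlonglongrightarrow> L"


abbreviation dderiv :: "'a::real_normed_vector => ('a => real) => 'a => real" where
 "dderiv v f x \<equiv> frechet_derivative f (at x) v"

lemma dderiv_eqI: "(f has_derivative f') (at x) ==> dderiv v f x=f' v"
 by (metis frechet_derivative_at)

lemma Ck_on_cong:
 assumes "open U" "!!x. x\<in>U ==> f x=g x" "Ck_on k U f"
 shows "Ck_on k U g"
 using assms(2,3)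
proof (induction k arbitrary: f g)
 case 0
 then show ?case by (simp cong: continuous_on_cong)
next
 case (Suc k)
 have d: "(g has_derivative frechet_derivative f (at x)) (at x)" if "x\<in>U" for x
  using Suc.prems that assms(1)
  by (intro has_derivative_transform_within_open[of f _ x UNIV U g])
    (auto simp: frechet_derivative_works)
 have e: "dderiv v g x=dderiv v f x" if "x\<in>U" for x v
  by (rule dderiv_eqI[OF d[OF that]])
 have "Ck_on k U (dderiv v g)" for v
  using Suc.IH[of "dderiv v f" "dderiv v g"] Suc.prems(2) e by simp
 then show ?case using d by (auto simp: differentiable_def)
qed

lemma Ck_on_mono: "Ck_on k U f ==> U' \<subseteq> U ==> Ck_on k U' f"
 by (induction k arbitrary: f) (auto intro: continuous_on_subset)

lemma Ck_on_Un:
 assumes "open U" "open W"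
 shows "Ck_on k U f ==> Ck_on k W f ==> Ck_on k (U \<union> W) f"
 by (induction k arbitrary: f) (auto intro: continuous_on_open_Un assms)

lemma Ck_on_Suc_imp: "Ck_on (Suc k) U f ==> Ck_on k U f"
proof (induction k arbitrary: f)
 case 0
 then show ?case
  by (auto intro!: continuous_at_imp_continuous_on differentiable_imp_continuous_within)
next
 case (Suc k)
 have "Ck_on (Suc k) U (dderiv v f)" for v using Suc.prems unfolding Ck_on.simps(2)[of "Suc k"] by blast
 then show ?case using Suc unfolding Ck_on.simps(2)[of "Suc k"] Ck_on.simps(2)[of k] by blast
qed

lemma Ck_on_const: "open U ==> Ck_on k U (%_. c)"
proof (induction k arbitrary: c)
 case (Suc k)
 have "dderiv v (%_. c)=(%_. 0)" for v :: 'a by (simp add: fun_eq_iff)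
 then show ?case using Suc by simp
qed simp

lemma Ck_on_linear:
 assumes "open U" "bounded_linear f" shows "Ck_on k U f"
proof (cases k)
 case 0
 then show ?thesis using assms linear_continuous_on by auto
next
 case (Suc k)
 have "dderiv v f=(%_. f v)" for v
  using bounded_linear_imp_has_derivative[OF assms(2)] by (auto simp: dderiv_eqI)
 then show ?thesis using assms Suc Ck_on_const
  by (auto simp: bounded_linear_imp_differentiable)
qed

lemma Ck_on_add:
 assumes "open U"
 shows "Ck_on k U f ==> Ck_on k U g ==> Ck_on k U (%x. f x+g x)"
proof (induction k arbitrary: f g)
 case (Suc k)
 have d: "((%x. f x+g x) has_derivative (%v. dderiv v f x+dderiv v g x)) (at x)" if "x\<in>U" for x
  using Suc.prems that by (auto intro!: has_derivative_add simp: frechet_derivative_works)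
 have c: "Ck_on k U (%x. dderiv v f x+dderiv v g x)" for v
  using Suc.prems by (intro Suc.IH) auto
 have "Ck_on k U (dderiv v (%x. f x+g x))" for v
  by (rule Ck_on_cong[OF assms _ c[of v]]) (simp add: dderiv_eqI[OF d])
 then show ?case using d by (auto simp: differentiable_def)
qed (auto intro: continuous_on_add)

lemma Ck_on_mult:
 assumes "open U"
 shows "Ck_on k U f ==> Ck_on k U g ==> Ck_on k U (%x. f x * g x)"
proof (induction k arbitrary: f g)
 case (Suc k)
 have d: "((%x. f x * g x) has_derivative (%v. f x * dderiv v g x+dderiv v f x * g x)) (at x)"
  if "x\<in>U" for x
  using Suc.prems that by (auto intro!: has_derivative_mult simp: frechet_derivative_works)
 have c: "Ck_on k U (%x. f x * dderiv v g x+dderiv v f x * g x)" for v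
  using Suc.prems Ck_on_Suc_imp by (intro Ck_on_add Suc.IH assms) auto
 have "Ck_on k U (dderiv v (%x. f x * g x))" for v
  by (rule Ck_on_cong[OF assms _ c[of v]]) (simp add: dderiv_eqI[OF d])
 then show ?case using d by (auto simp: differentiable_def)
qed (auto intro: continuous_on_mult)

lemma Ck_on_compose_real:
 assumes "open U" and b: "!!n s. s\<in>W ==> (\<beta> n has_real_derivative \<beta> (Suc n) s) (at s)"
  and q: "!!x. x\<in>U ==> q x\<in>W"
 shows "Ck_on k U q ==> Ck_on k U (%x. \<beta> n (q x))"
proof (induction k arbitrary: n)
 case 0
 have "continuous_on W (\<beta> n)"
  using b by (auto intro!: continuous_at_imp_continuous_on DERIV_isCont)
 with 0 show ?case using q by (auto intro: continuous_on_compose2)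
next
 case (Suc k)
 have d: "((%x. \<beta> n (q x)) has_derivative (%v. dderiv v q x * \<beta> (Suc n) (q x))) (at x)"
  if "x\<in>U" for x
  using Suc.prems that q
   has_derivative_compose[of q "frechet_derivative q (at x)" x UNIV "\<beta> n" "%h. h * \<beta> (Suc n) (q x)"]
   b[of "q x" n]
  by (auto simp: frechet_derivative_works has_field_derivative_def mult.commute[of _ "\<beta> (Suc n) (q x)"])
 have c: "Ck_on k U (%x. dderiv v q x * \<beta> (Suc n) (q x))" for v
  using Suc.prems Ck_on_Suc_imp by (intro Ck_on_mult Suc.IH assms) auto
 have "Ck_on k U (dderiv v (%x. \<beta> n (q x)))" for v
  by (rule Ck_on_cong[OF assms(1) _ c[of v]]) (simp add: dderiv_eqI[OF d])
 then show ?case using d by (auto simp: differentiable_def)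
qed

lemma Ck_on_compose_linear:
 assumes A: "bounded_linear A"
 shows "Ck_on k UNIV f ==> Ck_on k UNIV (%x. f (A x))"
proof (induction k arbitrary: f)
 case 0
 then show ?case using A by (auto intro: continuous_on_compose2 linear_continuous_on)
next
 case (Suc k)
 have d: "((%x. f (A x)) has_derivative (%v. dderiv (A v) f (A x))) (at x)" for x
  using Suc.prems has_derivative_compose[OF bounded_linear_imp_has_derivative[OF A], of f _ x UNIV]
  by (auto simp: frechet_derivative_works)
 have "Ck_on k UNIV (dderiv v (%x. f (A x)))" for v
  using Suc.IH[of "dderiv (A v) f"] Suc.prems by (simp add: dderiv_eqI[OF d])
 then show ?case using d by (auto simp: differentiable_def)
qed

text \<open>A class of functions that is closed under directional derivatives consists of smooth functions; this replaces an induction on the order of differentiability.\<close>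

lemma smooth_on_coinduct:
 assumes "open U" "f\<in>G"
  and "!!f x. f\<in>G ==> x\<in>U ==> f differentiable (at x)"
  and "!!f v. f\<in>G ==> \<exists>g\<in>G. \<forall>x\<in>U. dderiv v f x=g x"
 shows "smooth_on U f"
proof -
 have "Ck_on k U f" for k
  using assms(2)
 proof (induction k arbitrary: f)
  case 0
  have "isCont f x" if "x\<in>U" for x
   using assms(3)[OF 0 that] by (rule differentiable_imp_continuous_within)
  then show ?case by (simp add: continuous_at_imp_continuous_on)
 next
  case (Suc k)
  have "Ck_on k U (dderiv v f)" for v
  proof -
   obtain g where g: "g\<in>G" "\<forall>x\<in>U. dderiv v f x=g x" using assms(4)[OF Suc.prems, of v] ..
   show ?thesis
    by (rule Ck_on_cong[OF assms(1) _ Suc.IH[OF g(1)]]) (use g(2) in simp)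
  qed
  then show ?case unfolding Ck_on.simps using assms(3)[OF Suc.prems] by blast
 qed
 then show ?thesis by (simp add: smooth_on_def)
qed

lemma smooth_on_differentiable: "smooth_on U f ==> x\<in>U ==> f differentiable (at x)"
 unfolding smooth_on_def by (drule spec[of _ "Suc 0"]) simp

lemma smooth_on_has_derivative:
 "smooth_on U f ==> x\<in>U ==> (f has_derivative (%v. dderiv v f x)) (at x)"
 using smooth_on_differentiable[of U f x] frechet_derivative_works[of f "at x"] by simp

lemma smooth_on_continuous: "smooth_on U f ==> continuous_on U f"
 unfolding smooth_on_def by (drule spec[of _ 0]) simp

lemma smooth_on_dderiv: "smooth_on U f ==> smooth_on U (dderiv v f)"
 unfolding smooth_on_def
proof
 fix k assume "\<forall>k. Ck_on k U f"
 then have "Ck_on (Suc k) U f" ..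
 then show "Ck_on k U (dderiv v f)" by simp
qed

lemma smooth_on_subset: "smooth_on U f ==> U' \<subseteq> U ==> smooth_on U' f"
 unfolding smooth_on_def by (intro allI, rule Ck_on_mono, erule spec)

lemma smooth_on_cong: "open U ==> (!!x. x\<in>U ==> f x=g x) ==> smooth_on U f ==> smooth_on U g"
 unfolding smooth_on_def by (intro allI, rule Ck_on_cong, assumption, assumption, erule spec)

lemma smooth_on_Un: "open U ==> open W ==> smooth_on U f ==> smooth_on W f ==> smooth_on (U \<union> W) f"
 unfolding smooth_on_def by (simp add: Ck_on_Un)

lemma smooth_on_const: "open U ==> smooth_on U (%_. c)"
 unfolding smooth_on_def by (simp add: Ck_on_const)

lemma smooth_on_linear: "open U ==> bounded_linear f ==> smooth_on U f"
 unfolding smooth_on_def by (simp add: Ck_on_linear)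

lemma smooth_on_add: "open U ==> smooth_on U f ==> smooth_on U g ==> smooth_on U (%x. f x+g x)"
 unfolding smooth_on_def by (simp add: Ck_on_add)

lemma smooth_on_mult: "open U ==> smooth_on U f ==> smooth_on U g ==> smooth_on U (%x. f x * g x)"
 unfolding smooth_on_def by (simp add: Ck_on_mult)

lemma smooth_on_diff: "open U ==> smooth_on U f ==> smooth_on U g ==> smooth_on U (%x. f x-g x)"
 using smooth_on_add[of U f "%x. (-1) * g x"] smooth_on_mult[of U "%_. -1" g]
  smooth_on_const[of U "-1"] by simp

lemma smooth_on_sum:
 "open U ==> (!!i. i\<in>I ==> smooth_on U (f i)) ==> smooth_on U (%x. \<Sum>i\<in>I. f i x)"
 by (induction I rule: infinite_finite_induct) (auto intro: smooth_on_const smooth_on_add)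

lemma smooth_on_power: "open U ==> smooth_on U f ==> smooth_on U (%x. f x ^ n)"
 by (induction n) (auto intro: smooth_on_const smooth_on_mult)

lemma smooth_on_compose_real:
 assumes "open U" "!!n s. s\<in>W ==> (\<beta> n has_real_derivative \<beta> (Suc n) s) (at s)"
  "!!x. x\<in>U ==> q x\<in>W" "smooth_on U q"
 shows "smooth_on U (%x. \<beta> n (q x))"
 unfolding smooth_on_def
proof
 fix k
 have "Ck_on k U q" using assms(4) by (simp add: smooth_on_def)
 with assms(1-3) show "Ck_on k U (%x. \<beta> n (q x))" by (rule Ck_on_compose_real[where W = W])
qed

lemma smooth_on_compose_linear:
 "bounded_linear A ==> smooth_on UNIV f ==> smooth_on UNIV (%x. f (A x))"
 unfolding smooth_on_def by (simp add: Ck_on_compose_linear)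

lemma smooth_on_exp: "open U ==> smooth_on U q ==> smooth_on U (%x. exp (q x))"
 by (rule smooth_on_compose_real[where W = UNIV and \<beta> = "%_. exp" and n = 0 and q = q]) (simp_all add: DERIV_exp)

lemma smooth_on_inverse:
 assumes "open U" "smooth_on U q" "!!x. x\<in>U ==> q x > 0"
 shows "smooth_on U (%x. inverse (q x))"
proof -
 define \<beta> :: "nat => real => real" where "\<beta> n s=(-1) ^ n * fact n * inverse s ^ Suc n" for n s
 have d: "(\<beta> n has_real_derivative \<beta> (Suc n) s) (at s)" if "s\<in>{0<..}" for n s
  unfolding \<beta>_def
  by (rule DERIV_cong[OF DERIV_cmult[OF DERIV_power[OF DERIV_inverse]]])
    (use that in \<open>simp_all only: greaterThan_iff fact_Suc power_Suc diff_Suc_1 of_nat_mult mult_minus_left mult_minus_right mult_1_left mult.assoc mult.commute mult.left_commute\<close>, simp)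
 have "smooth_on U (%x. \<beta> 0 (q x))"
  by (rule smooth_on_compose_real[where W = "{0<..}" and \<beta> = \<beta> and n = 0 and q = q]) (use assms d in auto)
 then show ?thesis by (simp add: \<beta>_def)
qed

lemma smooth_on_norm_sq: "open U ==> smooth_on U (%x::'a::euclidean_space. x\<bullet>x)"
 by (subst euclidean_inner)
   (intro smooth_on_sum smooth_on_mult smooth_on_linear bounded_linear_inner_left; simp)

section \<open>Bump functions and cutoffs\<close>

text \<open>The derivatives of \<open>exp (- 1 / t)\<close> are of this form, which makes the class closed under differentiation.\<close>

definition flat_poly :: "real poly \<Rightarrow> real \<Rightarrow> real" where
 "flat_poly p t = (if t > 0 then poly p (1/t) * exp (- 1/t) else 0)"

lemma poly_div_exp_tendsto_0: "((\<lambda>u. poly p u / exp u) \<longlongrightarrow> (0::real)) at_top"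
proof -
 have "(\<lambda>u. poly p u / exp u) = (\<lambda>u. \<Sum>i\<le>degree p. coeff p i * (u ^ i / exp u))"
  by (simp add: fun_eq_iff poly_altdef sum_divide_distrib)
 moreover have "((\<lambda>u. \<Sum>i\<le>degree p. coeff p i * (u ^ i / exp u)) \<longlongrightarrow> (\<Sum>i\<le>degree p. coeff p i * 0)) at_top"
  by (intro tendsto_intros tendsto_power_div_exp_0)
 ultimately show ?thesis by simp
qed

lemma flat_poly_tendsto_0: "(flat_poly p \<longlongrightarrow> 0) (at 0)"
proof -
 have "((%t. poly p (inverse t)/exp (inverse t)) \<longlongrightarrow> 0) (at_right 0)"
  by (rule filterlim_compose[OF poly_div_exp_tendsto_0 filterlim_inverse_at_top_right])
 then have "(flat_poly p \<longlongrightarrow> 0) (at_right 0)"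
  by (rule Lim_transform_eventually)
    (auto simp: eventually_at_filter flat_poly_def exp_minus divide_simps)
 moreover have "(flat_poly p \<longlongrightarrow> 0) (at_left 0)"
  by (rule Lim_transform_eventually[OF tendsto_const])
    (auto simp: eventually_at_filter flat_poly_def)
 ultimately show ?thesis by (simp add: filterlim_split_at)
qed

lemma flat_poly_deriv:
 "(flat_poly p has_real_derivative flat_poly (([:0,0,1:])*(p-pderiv p)) t) (at t)"
proof (cases "t=0")
 case True
 have "(flat_poly (pCons 0 p) \<longlongrightarrow> 0) (at 0)" by (rule flat_poly_tendsto_0)
 moreover have "flat_poly (pCons 0 p)=(%h. (flat_poly p (0+h)-flat_poly p 0)/h)"
  by (simp add: flat_poly_def fun_eq_iff)
 ultimately have "(%h. (flat_poly p (0+h)-flat_poly p 0)/h) \<midarrow>0\<rightarrow> 0" by simp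
 then show ?thesis unfolding True by (simp add: DERIV_def flat_poly_def)
next
 case False
 show ?thesis
 proof (cases "t > 0")
  case True
  have i: "((%t. 1/t) has_real_derivative (- (1/t)*(1/t))) (at t)"
   using True by (auto intro!: derivative_eq_intros)
  have m: "((%t.-1/t) has_real_derivative ((1/t)*(1/t))) (at t)"
   using True by (auto intro!: derivative_eq_intros)
  have "((%t. poly p (1/t) * exp (- 1/t)) has_real_derivative
    flat_poly (([:0,0,1:])*(p-pderiv p)) t) (at t)"
   by (rule DERIV_cong[OF DERIV_mult[OF DERIV_chain2[OF poly_DERIV i] DERIV_chain2[OF DERIV_exp m]]])
     (use True in \<open>simp add: flat_poly_def algebra_simps\<close>)
  then show ?thesis
   by (rule DERIV_cong_ev[THEN iffD1, rotated 3])
     (use True in \<open>auto simp: flat_poly_def eventually_nhds intro!: exI[of _ "{0<..}"]\<close>)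
 next
  case nt: False
  have "((%_. 0) has_real_derivative 0) (at t)" by simp
  then have "(flat_poly p has_real_derivative 0) (at t)"
   by (rule DERIV_cong_ev[THEN iffD1, rotated 3])
     (use False nt in \<open>auto simp: flat_poly_def eventually_nhds intro!: exI[of _ "{..<0}"]\<close>)
  then show ?thesis using nt by (simp add: flat_poly_def)
 qed
qed

definition flat_exp :: "real => real" where "flat_exp t=(if t > 0 then exp (- 1/t) else 0)"

lemma smooth_on_flat_exp:
 assumes "open U" "smooth_on U q" shows "smooth_on U (%x. flat_exp (q x))"
proof -
 define P :: "nat => real poly" where "P n=((%p. [:0,0,1:] * (p-pderiv p)) ^^ n) 1" for n
 have "smooth_on U (%x. flat_poly (P 0) (q x))"
  by (rule smooth_on_compose_real[where W = UNIV and \<beta> = "%n. flat_poly (P n)" and n = 0 and q = q])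
    (use assms flat_poly_deriv in \<open>simp_all add: P_def\<close>)
 moreover have "flat_poly (P 0)=flat_exp" by (auto simp: P_def flat_poly_def flat_exp_def)
 ultimately show ?thesis by simp
qed

definition smooth_step :: "real => real" where
 "smooth_step t=flat_exp t * inverse (flat_exp t+flat_exp (1-t))"

lemma flat_exp_nonneg: "flat_exp t \<ge> 0" and flat_exp_pos: "t > 0 ==> flat_exp t > 0"
 and flat_exp_eq_0: "t<=0 ==> flat_exp t=0"
 by (auto simp: flat_exp_def)

lemma flat_exp_sum_pos: "flat_exp t+flat_exp (1-t) > 0"
 by (cases "t > 0") (auto simp: flat_exp_def add_pos_nonneg)

lemma smooth_on_smooth_step: "open U ==> smooth_on U q ==> smooth_on U (%x. smooth_step (q x))"
 unfolding smooth_step_def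
 by (intro smooth_on_mult smooth_on_inverse smooth_on_add smooth_on_flat_exp
   smooth_on_diff smooth_on_const) (auto intro: flat_exp_sum_pos)

lemma smooth_step_eq_1: "t \<ge> 1 ==> smooth_step t=1"
 by (simp add: smooth_step_def flat_exp_eq_0 flat_exp_def)

lemma smooth_step_eq_0: "t<=0 ==> smooth_step t=0"
 by (simp add: smooth_step_def flat_exp_eq_0)

lemma smooth_step_nonneg: "smooth_step t \<ge> 0"
 unfolding smooth_step_def using flat_exp_nonneg flat_exp_sum_pos[of t] by simp

lemma smooth_step_le_1: "smooth_step t<=1"
 unfolding smooth_step_def using flat_exp_nonneg[of "1-t"] flat_exp_sum_pos[of t]
 by (simp add: field_simps)

section \<open>Compactly supported smooth functions\<close>

definition Cc :: "('a::euclidean_space => real) set" where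
 "Cc={F. smooth_on UNIV F \<and> (\<exists>R. \<forall>p. R < norm p \<longrightarrow> F p=0)}"

lemma CcI: "smooth_on UNIV F ==> (!!p. R < norm p ==> F p=0) ==> F\<in>Cc"
 unfolding Cc_def by blast

lemma Cc_smooth: "F\<in>Cc ==> smooth_on UNIV F"
 unfolding Cc_def by blast

lemma Cc_support:
 assumes "F\<in>Cc" obtains R where "R > 0" "!!p. R < norm p ==> F p=0"
proof -
 obtain R where R: "\<forall>p. R < norm p \<longrightarrow> F p=0" using assms unfolding Cc_def by blast
 show thesis by (rule that[of "max R 1"]) (use R in auto)
qed

lemma Cc_has_derivative:
 "F\<in>Cc ==> (F has_derivative (%v. dderiv v F p)) (at p)"
 using smooth_on_has_derivative[OF Cc_smooth] by blast

lemma Cc_continuous: "F\<in>Cc ==> continuous_on A F"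
 using smooth_on_continuous[OF Cc_smooth] continuous_on_subset by blast

lemma Cc_measurable[measurable_dest]: "F\<in>Cc ==> F\<in>borel_measurable borel"
 using Cc_continuous borel_measurable_continuous_onI by blast

lemma Cc_dderiv:
 fixes F :: "'a::euclidean_space => real"
 assumes "F\<in>Cc" shows "dderiv v F\<in>Cc"
proof -
 obtain R where R: "R > 0" "!!p. R < norm p ==> F p=0" using Cc_support[OF assms] by blast
 show ?thesis
 proof (rule CcI)
  show "smooth_on UNIV (dderiv v F)" by (rule smooth_on_dderiv[OF Cc_smooth[OF assms]])
  fix p :: 'a assume p: "R < norm p"
  have "(F has_derivative (%_. 0)) (at p)"
  proof (rule has_derivative_transform_within_open)
   show "((%_. 0) has_derivative (%_. 0)) (at p)" by simp
   show "open {p. R < norm p}" by (intro open_Collect_less continuous_intros)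
  qed (use p R in auto)
  then show "dderiv v F p=0" by (rule dderiv_eqI)
 qed
qed

lemma Cc_mult:
 assumes "smooth_on UNIV g" "F\<in>Cc" shows "(%x. g x * F x)\<in>Cc"
proof -
 obtain R where "R > 0" "!!p. R < norm p ==> F p=0" using Cc_support[OF assms(2)] by blast
 then show ?thesis using smooth_on_mult[OF open_UNIV assms(1) Cc_smooth[OF assms(2)]]
  by (intro CcI[of _ R]) simp_all
qed

lemma Cc_cmult: "F\<in>Cc ==> (%x. c * F x)\<in>Cc"
 using Cc_mult[of "%_. c" F] smooth_on_const[of UNIV c] by simp

lemma Cc_add:
 assumes "F\<in>Cc" "G\<in>Cc" shows "(%x. F x+G x)\<in>Cc"
proof -
 obtain R where R: "!!p. R < norm p ==> F p=0" using Cc_support[OF assms(1)] by blast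
 obtain R' where R': "!!p. R' < norm p ==> G p=0" using Cc_support[OF assms(2)] by blast
 show ?thesis
  using smooth_on_add[OF open_UNIV Cc_smooth[OF assms(1)] Cc_smooth[OF assms(2)]]
  by (intro CcI[of _ "max R R'"]) (simp_all add: R R')
qed

lemma Cc_diff: "F\<in>Cc ==> G\<in>Cc ==> (%x. F x-G x)\<in>Cc"
 using Cc_add[of F "%x. (-1) * G x"] Cc_cmult[of G "-1"] by simp

lemma Cc_0: "(%_. 0)\<in>Cc"
 by (rule CcI) (auto intro: smooth_on_const)

lemma Cc_sum: "(!!i. i\<in>I ==> F i\<in>Cc) ==> (%x. \<Sum>i\<in>I. F i x)\<in>Cc"
 by (induction I rule: infinite_finite_induct) (auto intro: Cc_0 Cc_add)

lemma Cc_compose_linear: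
 fixes A :: "'a::euclidean_space => 'b::euclidean_space"
 assumes "F\<in>Cc" "bounded_linear A" "c > 0" "!!p. c * norm p<=norm (A p)"
 shows "(%p. F (A p))\<in>Cc"
proof -
 obtain R where R: "R > 0" "!!p. R < norm p ==> F p=0" using Cc_support[OF assms(1)] by blast
 show ?thesis
 proof (rule CcI[of _ "R/c"])
  show "smooth_on UNIV (%p. F (A p))"
   using smooth_on_compose_linear[OF assms(2) Cc_smooth[OF assms(1)]] .
  fix p :: 'a assume "R/c < norm p"
  then show "F (A p)=0"
   using assms(3,4) R by (intro R(2)) (smt (verit) mult.commute pos_divide_less_eq)
 qed
qed

lemma Cc_bounded:
 assumes "F\<in>Cc" obtains C where "C > 0" "!!p. \<bar>F p\<bar><=C"
proof -
 obtain R where R: "!!p. R < norm p ==> F p=0" using Cc_support[OF assms] by blast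
 have "bounded (F ` cball 0 R)"
  using Cc_continuous[OF assms] by (intro compact_imp_bounded compact_continuous_image) auto
 then obtain C where C: "C > 0" "\<forall>y\<in>F ` cball 0 R. norm y<=C" using bounded_pos by blast
 have "\<bar>F p\<bar><=C" for p
  using C R[of p] by (cases "norm p<=R") auto
 then show thesis using that C(1) by blast
qed

lemma dderiv_linear: "f differentiable (at p) ==> linear (%v. dderiv v f p)"
 by (simp add: linear_frechet_derivative)

lemma dderiv_basis:
 fixes p :: "'a::euclidean_space"
 assumes "f differentiable (at p)"
 shows "dderiv v f p=(\<Sum>b\<in>Basis. (v\<bullet>b) * dderiv b f p)"
proof -
 have "dderiv v f p=dderiv (\<Sum>b\<in>Basis. (v\<bullet>b) *\<^sub>R b) f p" by (simp add: euclidean_representation)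
 also have "...=(\<Sum>b\<in>Basis. (v\<bullet>b) *\<^sub>R dderiv b f p)"
  using dderiv_linear[OF assms] by (simp add: linear_sum linear_cmul o_def)
 finally show ?thesis by simp
qed

lemma Cc_dderiv_bound:
 fixes F :: "'a::euclidean_space => real"
 assumes "F\<in>Cc" obtains C where "C > 0" "!!p v. \<bar>dderiv v F p\<bar><=C * norm v"
proof -
 have "\<exists>C>0. \<forall>p. \<bar>dderiv b F p\<bar><=C" for b
  using Cc_bounded[OF Cc_dderiv[OF assms, of b]] by metis
 then obtain C where C: "!!b. C b > 0" "!!b p. \<bar>dderiv b F p\<bar><=C b" by metis
 have "\<bar>dderiv v F p\<bar><=(1+(\<Sum>b\<in>Basis. C b)) * norm v" for p v
 proof -
  have "\<bar>dderiv v F p\<bar><=(\<Sum>b\<in>Basis. \<bar>(v\<bullet>b) * dderiv b F p\<bar>)"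
   using dderiv_basis[of F p v] smooth_on_differentiable[OF Cc_smooth[OF assms], of p] by simp
  also have "...<=(\<Sum>b\<in>Basis. norm v * C b)"
   by (intro sum_mono) (auto simp: abs_mult Basis_le_norm C intro!: mult_mono)
  also have "...=(\<Sum>b\<in>Basis. C b) * norm v" by (simp add: sum_distrib_left mult.commute)
  also have "...<=(1+(\<Sum>b\<in>Basis. C b)) * norm v" by (simp add: distrib_right)
  finally show ?thesis .
 qed
 moreover have "1+(\<Sum>b\<in>Basis. C b) > 0"
  using C(1) by (smt (verit) sum_nonneg)
 ultimately show thesis using that by blast
qed

lemma Cc_Lipschitz:
 fixes F :: "'a::euclidean_space => real"
 assumes "F\<in>Cc" obtains C where "C > 0" "!!p q. \<bar>F q-F p\<bar><=C * norm (q-p)"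
proof -
 obtain C where C: "C > 0" "!!p v. \<bar>dderiv v F p\<bar><=C * norm v" using Cc_dderiv_bound[OF assms] by blast
 have "norm (F q-F p)<=C * norm (q-p)" for p q
  by (rule differentiable_bound[of UNIV F "%p v. dderiv v F p"])
    (use C Cc_has_derivative[OF assms] in \<open>auto intro!: onorm_le\<close>)
 then show thesis using that C(1) by auto
qed

text \<open>A Taylor bound that is uniform in the base point, which is what lets derivatives pass through
  integrals against arbitrary weights.\<close>

lemma Cc_taylor:
 fixes F :: "'a::euclidean_space => real"
 assumes F: "F\<in>Cc"
 obtains C where "C > 0" "!!p v. \<bar>F (p+v)-F p-dderiv v F p\<bar><=C * (norm v)\<^sup>2"
proof -
 have "\<exists>C>0. \<forall>p q. \<bar>dderiv b F q-dderiv b F p\<bar><=C * norm (q-p)" for b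
  using Cc_Lipschitz[OF Cc_dderiv[OF F, of b]] by metis
 then obtain C where C: "!!b. C b > 0" "!!b p q. \<bar>dderiv b F q-dderiv b F p\<bar><=C b * norm (q-p)" by metis
 define B where "B=(\<Sum>b\<in>Basis. C b)"
 have B0: "B \<ge> 0" unfolding B_def using C(1) by (simp add: less_imp_le sum_nonneg)
 have diff: "F differentiable (at p)" for p
  using smooth_on_differentiable[OF Cc_smooth[OF F], of p] by simp
 have D: "\<bar>dderiv v F q-dderiv v F p\<bar><=(B * norm (q-p)) * norm v" for p q v
 proof -
  have "dderiv v F q-dderiv v F p=(\<Sum>b\<in>Basis. (v\<bullet>b)*(dderiv b F q-dderiv b F p))"
   using dderiv_basis[where v = v, OF diff[of p]] dderiv_basis[where v = v, OF diff[of q]]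
   by (simp add: sum_subtractf right_diff_distrib)
  also have "\<bar>...\<bar><=(\<Sum>b\<in>Basis. \<bar>(v\<bullet>b)*(dderiv b F q-dderiv b F p)\<bar>)" by simp
  also have "...<=(\<Sum>b\<in>Basis. norm v * (C b * norm (q-p)))"
   by (intro sum_mono) (auto simp: abs_mult Basis_le_norm C intro!: mult_mono)
  also have "...=(B * norm (q-p)) * norm v"
   by (simp add: B_def sum_distrib_left sum_distrib_right mult_ac)
  finally show ?thesis .
 qed
 have "\<bar>F (p+v)-F p-dderiv v F p\<bar><=(B+1)*(norm v)\<^sup>2" for p v
 proof -
  have "norm (F (p+v)-F p-dderiv ((p+v)-p) F p)<=norm ((p+v)-p)*(B * norm v)"
  proof (rule differentiable_bound_linearization[where S = "cball p (norm v)" and f' = "%q v. dderiv v F q" and ?x0.0 = p])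
   fix t :: real assume "t\<in>{0..1}"
   then show "p+t *\<^sub>R (p+v-p)\<in>cball p (norm v)"
    by (simp add: dist_norm mult_left_le_one_le)
  next
   fix q assume q: "q\<in>cball p (norm v)"
   show "(F has_derivative (%v. dderiv v F q)) (at q within cball p (norm v))"
    using Cc_has_derivative[OF F] by (rule has_derivative_at_withinI)
   show "onorm ((%v. dderiv v F q)-(%v. dderiv v F p))<=B * norm v"
   proof (rule onorm_le)
    fix w
    have "norm (((%v. dderiv v F q)-(%v. dderiv v F p)) w)<=(B * norm (q-p)) * norm w"
     using D by simp
    also have "...<=(B * norm v) * norm w"
     using q B0 by (intro mult_right_mono mult_left_mono) (auto simp: dist_norm norm_minus_commute)
    finally show "norm (((%v. dderiv v F q)-(%v. dderiv v F p)) w)<=B * norm v * norm w" .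
   qed
  qed simp
  then have "\<bar>F (p+v)-F p-dderiv v F p\<bar><=B * (norm v)\<^sup>2"
   by (simp add: power2_eq_square mult_ac)
  also have "...<=(B+1)*(norm v)\<^sup>2" by (simp add: distrib_right)
  finally show ?thesis .
 qed
 then show thesis using that[of "B+1"] B0 by auto
qed

lemma has_derivative_quadraticI:
 fixes f :: "'a::real_normed_vector => 'b::real_normed_vector"
 assumes "bounded_linear f'" "!!v. norm (f (x+v)-f x-f' v)<=K * (norm v)\<^sup>2"
 shows "(f has_derivative f') (at x)"
proof (rule has_derivativeI_sandwich[of 1, OF _ assms(1)])
 fix y assume "y \<noteq> x"
 moreover have "norm (f y-f x-f' (y-x))<=K * (norm (y-x))\<^sup>2"
  using assms(2)[of "y-x"] by simp
 ultimately show "norm (f y-f x-f' (y-x))/norm (y-x)<=K * norm (y-x)"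
  by (simp add: divide_simps power2_eq_square mult_ac)
next
 have "((%y. K * norm (y-x)) \<longlongrightarrow> K * norm (x-x)) (at x)" by (intro tendsto_intros)
 then show "((%y. K * norm (y-x)) \<longlongrightarrow> 0) (at x)" by simp
qed simp

lemma integrable_bounded_mult:
 fixes w :: "'c => real"
 assumes "integrable M w" "g\<in>borel_measurable M" "!!z. \<bar>g z\<bar><=C"
 shows "integrable M (%z. g z * w z)"
proof (rule Bochner_Integration.integrable_bound[of M "%z. C * \<bar>w z\<bar>"])
 show "integrable M (%z. C * \<bar>w z\<bar>)" using assms by auto
 show "AE z in M. norm (g z * w z)<=norm (C * \<bar>w z\<bar>)"
  using assms(3) order_trans[OF abs_ge_zero assms(3)] by (auto simp: abs_mult intro!: mult_right_mono)
qed (use assms in measurable)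

lemma Cc_translate_measurable:
 assumes "F\<in>Cc" "\<iota>\<in>borel_measurable M"
 shows "(%z. F (x-\<iota> z))\<in>borel_measurable M"
 using measurable_compose[OF borel_measurable_diff[OF measurable_const[of x borel M] assms(2)]
   Cc_measurable[OF assms(1)]] by simp

lemma integrable_weighted_translate:
 fixes F :: "'a::euclidean_space => real"
 assumes "F\<in>Cc" "\<iota>\<in>borel_measurable M" "integrable M w"
 shows "integrable M (%z. F (x-\<iota> z) * w z)"
proof -
 obtain C where "C > 0" "!!p. \<bar>F p\<bar><=C" using Cc_bounded[OF assms(1)] by blast
 then show ?thesis
  by (intro integrable_bounded_mult[OF assms(3) Cc_translate_measurable[OF assms(1,2)]]) auto
qed

lemma weighted_translate_has_derivative:
 fixes F :: "'a::euclidean_space => real"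
 assumes F: "F\<in>Cc" and i: "\<iota>\<in>borel_measurable M" and w: "integrable M w"
 shows "((%x. \<integral>z. F (x-\<iota> z) * w z\<partial>M) has_derivative
  (%v. \<integral>z. dderiv v F (x-\<iota> z) * w z\<partial>M)) (at x)"
proof -
 obtain C where C: "C > 0" "!!p v. \<bar>F (p+v)-F p-dderiv v F p\<bar><=C * (norm v)\<^sup>2"
  using Cc_taylor[OF F] by blast
 obtain D where D: "D > 0" "!!p v. \<bar>dderiv v F p\<bar><=D * norm v" using Cc_dderiv_bound[OF F] by blast
 note int = integrable_weighted_translate[OF _ i w]
 note lin = dderiv_linear[OF smooth_on_differentiable[OF Cc_smooth[OF F] UNIV_I]]
 show ?thesis
 proof (rule has_derivative_quadraticI[where K = "C * (\<integral>z. \<bar>w z\<bar>\<partial>M)"])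
  show "bounded_linear (%v. \<integral>z. dderiv v F (x-\<iota> z) * w z\<partial>M)"
  proof (rule bounded_linear_intro[where K = "D * (\<integral>z. \<bar>w z\<bar>\<partial>M)"])
   show "(\<integral>z. dderiv (u+v) F (x-\<iota> z) * w z\<partial>M) =
     (\<integral>z. dderiv u F (x-\<iota> z) * w z\<partial>M)+(\<integral>z. dderiv v F (x-\<iota> z) * w z\<partial>M)" for u v
    using int[OF Cc_dderiv[OF F]]
    by (subst Bochner_Integration.integral_add[symmetric]) (simp_all add: linear_add[OF lin] distrib_right)
   show "(\<integral>z. dderiv (r *\<^sub>R v) F (x-\<iota> z) * w z\<partial>M)=r *\<^sub>R (\<integral>z. dderiv v F (x-\<iota> z) * w z\<partial>M)" for r v
    using integral_mult_right_zero[of M r] by (simp add: linear_cmul[OF lin] mult.assoc)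
   fix v
   have "norm (\<integral>z. dderiv v F (x-\<iota> z) * w z\<partial>M)<=(\<integral>z. (D * norm v)*\<bar>w z\<bar>\<partial>M)"
    using w D(2) integrable_norm[OF int[OF Cc_dderiv[OF F, of v], of x]]
    by (intro order_trans[OF integral_norm_bound] integral_mono) (auto intro!: mult_right_mono simp: abs_mult)
   then show "norm (\<integral>z. dderiv v F (x-\<iota> z) * w z\<partial>M)<=norm v * (D * (\<integral>z. \<bar>w z\<bar>\<partial>M))"
    by (simp add: mult_ac)
  qed
  fix v
  have "(\<integral>z. F (x+v-\<iota> z) * w z\<partial>M)-(\<integral>z. F (x-\<iota> z) * w z\<partial>M)-(\<integral>z. dderiv v F (x-\<iota> z) * w z\<partial>M)
    = (\<integral>z. (F (x-\<iota> z+v)-F (x-\<iota> z)-dderiv v F (x-\<iota> z)) * w z\<partial>M)"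
   using int[OF F] int[OF Cc_dderiv[OF F]]
   by (subst Bochner_Integration.integral_diff[symmetric], simp, simp)+ (simp add: algebra_simps)
  also have "norm ...<=(\<integral>z. (C * (norm v)\<^sup>2)*\<bar>w z\<bar>\<partial>M)"
  proof (rule order_trans[OF integral_norm_bound], rule integral_mono)
   have "integrable M (%z. F (x-\<iota> z+v) * w z)"
    using int[OF F, of "x+v"] by (simp add: algebra_simps)
   then show "integrable M (%z. norm ((F (x-\<iota> z+v)-F (x-\<iota> z)-dderiv v F (x-\<iota> z)) * w z))"
    using int[OF F, of x] int[OF Cc_dderiv[OF F, of v], of x]
    by (intro integrable_norm) (simp add: left_diff_distrib)
   show "integrable M (%z. C * (norm v)\<^sup>2*\<bar>w z\<bar>)" using w by auto
   fix z assume "z\<in>space M"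
   show "norm ((F (x-\<iota> z+v)-F (x-\<iota> z)-dderiv v F (x-\<iota> z)) * w z)<=C * (norm v)\<^sup>2*\<bar>w z\<bar>"
    using C(2)[of "x-\<iota> z" v] by (simp add: abs_mult mult_right_mono)
  qed
  finally show "norm ((\<integral>z. F (x+v-\<iota> z) * w z\<partial>M)-(\<integral>z. F (x-\<iota> z) * w z\<partial>M)
    - (\<integral>z. dderiv v F (x-\<iota> z) * w z\<partial>M))<=C * (\<integral>z. \<bar>w z\<bar>\<partial>M)*(norm v)\<^sup>2"
   by (simp add: mult_ac)
 qed
qed

text \<open>Convolutions with an arbitrary integrable weight inherit the smoothness of the kernel. The map \<open>\<iota>\<close> covers both a full convolution and one in a single variable.\<close>

lemma smooth_on_weighted_translate:
 fixes F :: "'a::euclidean_space => real"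
 assumes "F\<in>Cc" "\<iota>\<in>borel_measurable M" "integrable M w"
 shows "smooth_on UNIV (%x. \<integral>z. F (x-\<iota> z) * w z\<partial>M)"
proof (rule smooth_on_coinduct[where G = "(%F x. \<integral>z. F (x-\<iota> z) * w z\<partial>M) ` Cc"])
 note d = weighted_translate_has_derivative[OF _ assms(2,3)]
 show "f differentiable at x" if "f\<in>(%F x. \<integral>z. F (x-\<iota> z) * w z\<partial>M) ` Cc" for f x
  using that d unfolding differentiable_def by blast
 show "\<exists>g\<in>(%F x. \<integral>z. F (x-\<iota> z) * w z\<partial>M) ` Cc. \<forall>x\<in>UNIV. dderiv v f x=g x"
  if f: "f\<in>(%F x. \<integral>z. F (x-\<iota> z) * w z\<partial>M) ` Cc" for f v
 proof -
  obtain G where G: "G\<in>Cc" "f=(%x. \<integral>z. G (x-\<iota> z) * w z\<partial>M)" using f by blast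
  have "dderiv v f x=(\<integral>z. dderiv v G (x-\<iota> z) * w z\<partial>M)" for x
   unfolding G(2) by (rule dderiv_eqI[OF d[OF G(1)]])
  then show ?thesis
   by (intro bexI[of _ "%x. \<integral>z. dderiv v G (x-\<iota> z) * w z\<partial>M"]) (auto intro: Cc_dderiv[OF G(1)])
 qed
qed (use assms in auto)

definition cutoff :: "real => 'a::euclidean_space => real" where
 "cutoff R x=smooth_step (2-((x /\<^sub>R R)\<bullet>(x /\<^sub>R R)))"

lemma cutoff_bounds: "0<=cutoff R x" "cutoff R x<=1"
 unfolding cutoff_def by (rule smooth_step_nonneg smooth_step_le_1)+

lemma cutoff_scale: "cutoff R x=cutoff 1 (x /\<^sub>R R)"
 by (simp add: cutoff_def)

lemma cutoff_eq_1: assumes "R > 0" "norm x<=R" shows "cutoff R x=1"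
proof -
 have "norm (x /\<^sub>R R)<=1" using assms by (simp add: divide_simps)
 then have "(x /\<^sub>R R)\<bullet>(x /\<^sub>R R)<=1"
  unfolding dot_square_norm by (simp add: power_le_one)
 then show ?thesis unfolding cutoff_def by (intro smooth_step_eq_1) simp
qed

lemma cutoff_eq_0: assumes "R > 0" "norm x \<ge> 2 * R" shows "cutoff R x=0"
proof -
 have "norm (x /\<^sub>R R) \<ge> 2" using assms by (simp add: divide_simps mult.commute)
 then have "(norm (x /\<^sub>R R))\<^sup>2 \<ge> 2\<^sup>2" by (intro power_mono) auto
 then show ?thesis unfolding cutoff_def dot_square_norm by (intro smooth_step_eq_0) simp
qed

lemma cutoff_smooth: "smooth_on UNIV (cutoff R)"
proof -
 have "smooth_on UNIV (cutoff 1 :: 'a => real)"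
  unfolding cutoff_def
  using smooth_on_smooth_step[OF open_UNIV smooth_on_diff[OF open_UNIV
     smooth_on_const[OF open_UNIV, of 2] smooth_on_norm_sq[OF open_UNIV]]] by simp
 from smooth_on_compose_linear[OF bounded_linear_scaleR_right this, of "inverse R"]
 have "smooth_on UNIV (%x::'a. cutoff 1 (x /\<^sub>R R))" .
 then show ?thesis unfolding cutoff_scale[of R, symmetric] by simp
qed

lemma cutoff_Cc: "R > 0 ==> cutoff R\<in>Cc"
 by (rule CcI[of _ "2 * R"]) (auto intro: cutoff_smooth cutoff_eq_0)

text \<open>The gradient of a cutoff at scale \<open>R\<close> is of order \<open>1 / R\<close>.\<close>

lemma cutoff_dderiv_bound:
 obtains C where "C > 0"
  "!!R v x::'a::euclidean_space. R > 0 ==> \<bar>dderiv v (cutoff R) x\<bar><=C/R * norm v"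
proof -
 obtain C where C: "C > 0" "!!p v::'a. \<bar>dderiv v (cutoff 1) p\<bar><=C * norm v"
  using Cc_dderiv_bound[OF cutoff_Cc[OF zero_less_one]] by metis
 have "\<bar>dderiv v (cutoff R) x\<bar><=C/R * norm v" if "R > 0" for R and v x :: 'a
 proof -
  have "((%x::'a. cutoff 1 (x /\<^sub>R R)) has_derivative (%v. dderiv (v /\<^sub>R R) (cutoff 1) (x /\<^sub>R R))) (at x)"
   using has_derivative_compose[OF bounded_linear_imp_has_derivative[OF bounded_linear_scaleR_right]
     Cc_has_derivative[OF cutoff_Cc[OF zero_less_one]]] .
  then have "dderiv v (cutoff R) x=dderiv (v /\<^sub>R R) (cutoff 1) (x /\<^sub>R R)"
   unfolding cutoff_scale[of R, symmetric] by (rule dderiv_eqI)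
  also have "\<bar>...\<bar><=C * norm (v /\<^sub>R R)" by (rule C)
  finally show ?thesis using that by (simp add: divide_simps mult.commute)
 qed
 then show thesis using that C(1) by blast
qed

text \<open>A linear vector field acting on functions as a derivation.\<close>

definition lin_field :: "('a => 'a) => ('a::euclidean_space => real) => 'a => real" where
 "lin_field A F p=dderiv (A p) F p"

lemma smooth_on_lin_field:
 assumes "smooth_on UNIV F" "bounded_linear A" shows "smooth_on UNIV (lin_field A F)"
proof -
 have e: "lin_field A F=(%p. \<Sum>b\<in>Basis. (A p\<bullet>b) * dderiv b F p)"
  unfolding lin_field_def using smooth_on_differentiable[OF assms(1)] by (auto intro!: ext dderiv_basis)
 have "bounded_linear (%p. A p\<bullet>b)" for b
  using bounded_linear_compose[OF bounded_linear_inner_left assms(2)] .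
 then show ?thesis unfolding e
  by (intro smooth_on_sum smooth_on_mult smooth_on_linear smooth_on_dderiv assms) auto
qed

lemma Cc_lin_field:
 fixes F :: "'a::euclidean_space => real"
 assumes "F\<in>Cc" "bounded_linear A" shows "lin_field A F\<in>Cc"
proof -
 obtain R where R: "!!p v. R < norm p ==> dderiv v F p=0"
 proof -
  obtain R where R: "R > 0" "!!p. R < norm p ==> F p=0" using Cc_support[OF assms(1)] by blast
  have "dderiv v F p=0" if "R < norm p" for p v
  proof -
   have "(F has_derivative (%_. 0)) (at p)"
   proof (rule has_derivative_transform_within_open)
    show "((%_. 0) has_derivative (%_. 0)) (at p)" by simp
    show "open {p::'a. R < norm p}" by (intro open_Collect_less continuous_intros)
   qed (use that R in auto)
   then show ?thesis by (rule dderiv_eqI)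
  qed
  then show thesis using that by blast
 qed
 show ?thesis
  by (rule CcI[of _ R]) (use assms R in \<open>auto intro: smooth_on_lin_field Cc_smooth simp: lin_field_def\<close>)
qed

lemma lin_field_add:
 "smooth_on UNIV F ==> smooth_on UNIV G ==> lin_field A (%p. F p+G p)=(%p. lin_field A F p+lin_field A G p)"
 unfolding lin_field_def
 by (rule ext, rule dderiv_eqI, rule has_derivative_add) (auto intro: smooth_on_has_derivative)

lemma lin_field_mult:
 "smooth_on UNIV F ==> smooth_on UNIV G ==>
  lin_field A (%p. F p * G p)=(%p. F p * lin_field A G p+lin_field A F p * G p)"
 unfolding lin_field_def
 by (rule ext, rule dderiv_eqI, rule has_derivative_mult) (auto intro: smooth_on_has_derivative)

lemma lin_field_const: "lin_field A (%_. c)=(%_. 0)"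
 unfolding lin_field_def by (simp add: fun_eq_iff)

lemma lin_field_cmult: "smooth_on UNIV F ==> lin_field A (%p. c * F p)=(%p. c * lin_field A F p)"
 using lin_field_mult[of "%_. c" F A] by (simp add: lin_field_const smooth_on_const)

lemma lin_field_compose:
 assumes "smooth_on UNIV q" "!!s. (\<beta> has_real_derivative \<beta>' s) (at s)"
 shows "lin_field A (%p. \<beta> (q p))=(%p. \<beta>' (q p) * lin_field A q p)"
proof
 fix p
 have "((%p. \<beta> (q p)) has_derivative (%v. \<beta>' (q p) * dderiv v q p)) (at p)"
  using has_derivative_compose[OF smooth_on_has_derivative[OF assms(1) UNIV_I]
    assms(2)[unfolded has_field_derivative_def]] .
 then show "lin_field A (%p. \<beta> (q p)) p=\<beta>' (q p) * lin_field A q p"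
  unfolding lin_field_def by (rule dderiv_eqI)
qed

section \<open>The space of square-integrable functions\<close>

definition l2_norm :: "'p measure => ('p => real) => real" where
 "l2_norm M f=sqrt (\<integral>p. (f p)\<^sup>2\<partial>M)"

lemma l2_dist_norm: "l2_dist M f g=l2_norm M (%p. f p-g p)"
 by (simp add: l2_dist_def l2_norm_def)

lemma l2_norm_nonneg: "l2_norm M f \<ge> 0"
 by (simp add: l2_norm_def)

lemma l2_norm_sq: "(l2_norm M f)\<^sup>2=(\<integral>p. (f p)\<^sup>2\<partial>M)"
 by (simp add: l2_norm_def)

lemma L2_meas[measurable_dest]: "f\<in>L2 M ==> f\<in>borel_measurable M"
 by (simp add: L2_def)

lemma L2_int: "f\<in>L2 M ==> integrable M (%p. (f p)\<^sup>2)"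
 by (simp add: L2_def)

lemma L2_bounded_by:
 assumes "f\<in>borel_measurable M" "g\<in>L2 M" "AE p in M. \<bar>f p\<bar><=\<bar>g p\<bar>"
 shows "f\<in>L2 M"
 unfolding L2_def using assms
 by (auto intro!: Bochner_Integration.integrable_bound[OF L2_int[OF assms(2)]] simp: abs_le_square_iff)

lemma L2_mult_integrable:
 assumes "f\<in>L2 M" "g\<in>L2 M" shows "integrable M (%p. f p * g p)"
proof (rule Bochner_Integration.integrable_bound)
 show "integrable M (%p. (f p)\<^sup>2+(g p)\<^sup>2)" using assms[THEN L2_int] by simp
 have "\<bar>a * b\<bar><=a\<^sup>2+b\<^sup>2" for a b :: real
  using sum_squares_bound[of "\<bar>a\<bar>" "\<bar>b\<bar>"] mult_nonneg_nonneg[OF abs_ge_zero[of a] abs_ge_zero[of b]]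
  unfolding abs_mult power2_abs by linarith
 then show "AE p in M. norm (f p * g p)<=norm ((f p)\<^sup>2+(g p)\<^sup>2)" by simp
qed (use assms in measurable)

lemma L2_lincomb:
 assumes "f\<in>L2 M" "g\<in>L2 M" shows "(%p. a * f p+b * g p)\<in>L2 M"
proof -
 have "(%p. (a * f p+b * g p)\<^sup>2)=(%p. a\<^sup>2*(f p)\<^sup>2+2 * a * b * (f p * g p)+b\<^sup>2*(g p)\<^sup>2)"
  by (simp add: fun_eq_iff power2_eq_square algebra_simps)
 moreover have "integrable M ..."
  using assms[THEN L2_int] L2_mult_integrable[OF assms] by simp
 ultimately show ?thesis unfolding L2_def using assms[THEN L2_meas] by simp
qed

lemma L2_add: "f\<in>L2 M ==> g\<in>L2 M ==> (%p. f p+g p)\<in>L2 M"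
 using L2_lincomb[of f M g 1 1] by simp

lemma L2_diff: "f\<in>L2 M ==> g\<in>L2 M ==> (%p. f p-g p)\<in>L2 M"
 using L2_lincomb[of f M g 1 "-1"] by simp

lemma L2_cmult: "f\<in>L2 M ==> (%p. c * f p)\<in>L2 M"
 using L2_lincomb[of f M f c 0] by simp

lemma L2_0: "(%_. 0)\<in>L2 M"
 by (simp add: L2_def)

lemma L2_sum: "(!!i. i\<in>I ==> f i\<in>L2 M) ==> (%p. \<Sum>i\<in>I. f i p)\<in>L2 M"
 by (induction I rule: infinite_finite_induct) (auto intro: L2_0 L2_add)

lemma l2_norm_cong_AE:
 assumes "f\<in>borel_measurable M" "g\<in>borel_measurable M" "AE p in M. f p=g p"
 shows "l2_norm M f=l2_norm M g"
proof -
 have "(\<integral>p. (f p)\<^sup>2\<partial>M)=(\<integral>p. (g p)\<^sup>2\<partial>M)"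
  using assms by (intro integral_cong_AE) auto
 then show ?thesis by (simp add: l2_norm_def)
qed

lemma l2_norm_mono:
 assumes "f\<in>borel_measurable M" "g\<in>L2 M" "AE p in M. \<bar>f p\<bar><=\<bar>g p\<bar>"
 shows "l2_norm M f<=l2_norm M g"
 unfolding l2_norm_def using L2_bounded_by[OF assms] assms
 by (auto intro!: integral_mono_AE L2_int simp: abs_le_square_iff)

lemma l2_norm_eq_0_iff:
 assumes "f\<in>L2 M" shows "l2_norm M f=0 \<longleftrightarrow> (AE p in M. f p=0)"
 unfolding l2_norm_def using integral_nonneg_eq_0_iff_AE[OF L2_int[OF assms]] by simp

lemma l2_norm_cmult: "l2_norm M (%p. c * f p)=\<bar>c\<bar> * l2_norm M f"
 by (simp add: l2_norm_def power_mult_distrib real_sqrt_mult)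

lemma l2_norm_minus: "l2_norm M (%p. f p-g p)=l2_norm M (%p. g p-f p)"
 unfolding l2_norm_def by (simp add: power2_commute)

lemma l2_inner_self: "l2_inner M f f=(l2_norm M f)\<^sup>2"
 unfolding l2_norm_sq by (simp add: l2_inner_def power2_eq_square)

lemma l2_inner_commute: "l2_inner M f g=l2_inner M g f"
 by (simp add: l2_inner_def mult.commute)

lemma l2_inner_lincomb:
 assumes "f\<in>L2 M" "g\<in>L2 M" "h\<in>L2 M"
 shows "l2_inner M (%p. a * f p+b * g p) h=a * l2_inner M f h+b * l2_inner M g h"
 using L2_mult_integrable[OF assms(1,3)] L2_mult_integrable[OF assms(2,3)]
 by (simp add: l2_inner_def distrib_right mult.assoc)

lemma l2_inner_diff:
 assumes "f\<in>L2 M" "g\<in>L2 M" "h\<in>L2 M"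
 shows "l2_inner M (%p. f p-g p) h=l2_inner M f h-l2_inner M g h"
 using l2_inner_lincomb[OF assms, of 1 "-1"] by simp

lemma l2_inner_cong_AE:
 assumes "f\<in>borel_measurable M" "g\<in>borel_measurable M" "f'\<in>borel_measurable M" "g'\<in>borel_measurable M"
  "AE p in M. f p=f' p" "AE p in M. g p=g' p"
 shows "l2_inner M f g=l2_inner M f' g'"
 unfolding l2_inner_def using assms by (intro integral_cong_AE) auto

lemma l2_Cauchy_Schwarz:
 assumes f: "f\<in>L2 M" and g: "g\<in>L2 M"
 shows "l2_inner M f g<=l2_norm M f * l2_norm M g"
proof (cases "l2_norm M f=0 \<or> l2_norm M g=0")
 case True
 then have "(AE p in M. f p=0) \<or> (AE p in M. g p=0)" using l2_norm_eq_0_iff f g by blast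
 then have "AE p in M. f p * g p=0" by auto
 then have "l2_inner M f g=0"
  unfolding l2_inner_def using f g by (subst integral_cong_AE[where g = "%_. 0"]) auto
 then show ?thesis by (simp add: l2_norm_nonneg)
next
 case False
 define a b where "a=l2_norm M f" and "b=l2_norm M g"
 have ab: "a > 0" "b > 0" using False l2_norm_nonneg[of M f] l2_norm_nonneg[of M g] by (auto simp: a_def b_def)
 have "0<=(\<integral>p. (b * f p-a * g p)\<^sup>2\<partial>M)" by simp
 also have "...=(\<integral>p. b\<^sup>2*(f p)\<^sup>2+a\<^sup>2*(g p)\<^sup>2-2 * a * b * (f p * g p)\<partial>M)"
  by (intro Bochner_Integration.integral_cong) (auto simp: power2_eq_square algebra_simps)
 also have "...=b\<^sup>2 * a\<^sup>2+a\<^sup>2 * b\<^sup>2-2 * a * b * l2_inner M f g"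
  using L2_int[OF f] L2_int[OF g] L2_mult_integrable[OF f g]
  by (simp add: a_def b_def l2_norm_sq l2_inner_def)
 finally have "2*(a * b) * l2_inner M f g<=2*(a * b)*(a * b)"
  by (simp add: power2_eq_square algebra_simps)
 then show ?thesis using ab by (simp add: a_def b_def)
qed

lemma l2_triangle:
 assumes f: "f\<in>L2 M" and g: "g\<in>L2 M"
 shows "l2_norm M (%p. f p+g p)<=l2_norm M f+l2_norm M g"
proof (rule power2_le_imp_le)
 have "(l2_norm M (%p. f p+g p))\<^sup>2=(\<integral>p. (f p)\<^sup>2+2*(f p * g p)+(g p)\<^sup>2\<partial>M)"
  unfolding l2_norm_sq by (intro Bochner_Integration.integral_cong) (auto simp: power2_eq_square algebra_simps)
 also have "...=(l2_norm M f)\<^sup>2+2 * l2_inner M f g+(l2_norm M g)\<^sup>2"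
  using L2_int[OF f] L2_int[OF g] L2_mult_integrable[OF f g] by (simp add: l2_norm_sq l2_inner_def)
 also have "...<=(l2_norm M f+l2_norm M g)\<^sup>2"
  using l2_Cauchy_Schwarz[OF f g] by (simp add: power2_sum)
 finally show "(l2_norm M (%p. f p+g p))\<^sup>2<=(l2_norm M f+l2_norm M g)\<^sup>2" .
qed (simp add: l2_norm_nonneg)

lemma l2_triangle_minus:
 assumes "f\<in>L2 M" "g\<in>L2 M"
 shows "l2_norm M (%p. f p-g p)<=l2_norm M f+l2_norm M g"
 using l2_triangle[OF assms(1) L2_cmult[OF assms(2), of "-1"]] l2_norm_cmult[of M "-1" g] by simp

lemma l2_triangle_diff:
 assumes "f\<in>L2 M" "g\<in>L2 M" "h\<in>L2 M"
 shows "l2_norm M (%p. f p-h p)<=l2_norm M (%p. f p-g p)+l2_norm M (%p. g p-h p)"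
 using l2_triangle[OF L2_diff[OF assms(1,2)] L2_diff[OF assms(2,3)]] by simp

lemma l2_norm_le_diff:
 assumes "f\<in>L2 M" "g\<in>L2 M"
 shows "l2_norm M f<=l2_norm M (%p. f p-g p)+l2_norm M g"
 using l2_triangle[OF L2_diff[OF assms] assms(2)] by simp

lemma l2_norm_sum:
 "finite I ==> (!!i. i\<in>I ==> f i\<in>L2 M) ==> l2_norm M (%p. \<Sum>i\<in>I. f i p)<=(\<Sum>i\<in>I. l2_norm M (f i))"
proof (induction I rule: finite_induct)
 case (insert x F)
 then show ?case
  using l2_triangle[of "f x" M "%p. \<Sum>i\<in>F. f i p"] L2_sum[of F f M] by simp
qed (simp add: l2_norm_def)

lemma l2_dominated_convergence:
 assumes "!!k. u k\<in>borel_measurable M" "f\<in>borel_measurable M" "w\<in>L2 M"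
  "!!k. AE p in M. \<bar>u k p-f p\<bar><=w p" "AE p in M. (%k. u k p) ----> f p"
 shows "(%k. l2_norm M (%p. u k p-f p)) ----> 0"
proof -
 have "(%k. \<integral>p. (u k p-f p)\<^sup>2\<partial>M) ----> (\<integral>p. 0\<partial>M)"
 proof (rule integral_dominated_convergence[where w = "%p. (w p)\<^sup>2"])
  show "integrable M (%p. (w p)\<^sup>2)" by (rule L2_int[OF assms(3)])
  show "AE p in M. norm ((u k p-f p)\<^sup>2)<=(w p)\<^sup>2" for k
   using assms(4)[of k] by eventually_elim (simp add: abs_le_square_iff[symmetric])
  show "AE p in M. (%k. (u k p-f p)\<^sup>2) ----> 0"
   using assms(5)
  proof eventually_elim
   case (elim p)
   then have "(%k. (u k p-f p)\<^sup>2) ----> (f p-f p)\<^sup>2" by (intro tendsto_intros)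
   then show ?case by simp
  qed
 qed (use assms in measurable)
 then have "(%k. sqrt (\<integral>p. (u k p-f p)\<^sup>2\<partial>M)) ----> sqrt 0" by (intro tendsto_real_sqrt) simp
 then show ?thesis by (simp add: l2_norm_def)
qed

text \<open>Riesz-Fischer: along a subsequence whose increments decay geometrically, the Borel-Cantelli
  lemma gives convergence almost everywhere, and Fatou's lemma identifies the limit in norm.\<close>

lemma l2_complete:
 assumes F: "!!n. F n\<in>L2 M"
  and Cauchy: "\<And>\<epsilon>. \<epsilon> > 0 \<Longrightarrow> \<exists>N. \<forall>m\<ge>N. \<forall>n\<ge>N. l2_norm M (\<lambda>p. F m p - F n p) < \<epsilon>"
 obtains f where "f \<in> L2 M" "(\<lambda>n. l2_norm M (\<lambda>p. F n p - f p)) \<longlonglongrightarrow> 0"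
proof -
 have "\<exists>N. \<forall>m\<ge>N. \<forall>n\<ge>N. l2_norm M (\<lambda>p. F m p - F n p) < (1/4) ^ k" for k :: nat
  by (rule Cauchy) simp
 then obtain N where N: "\<And>k m n. m \<ge> N k \<Longrightarrow> n \<ge> N k \<Longrightarrow> l2_norm M (\<lambda>p. F m p - F n p) < (1/4) ^ k"
  by metis
 define r where "r k = (\<Sum>i\<le>k. N i) + k" for k
 have rN: "r k \<ge> N k" for k unfolding r_def by (simp add: member_le_sum trans_le_add1)
 have rk: "r k \<ge> k" for k by (simp add: r_def)
 have rS: "r (Suc k) \<ge> r k" for k by (simp add: r_def)
 define g where "g k p=F (r (Suc k)) p-F (r k) p" for k p
 have g: "g k\<in>L2 M" for k unfolding g_def by (intro L2_diff F)
 have gn: "l2_norm M (g k) < (1/4) ^ k" for k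
  unfolding g_def using rN[of k] rS[of k] by (intro N) auto
 define A where "A k={p\<in>space M. (g k p)\<^sup>2 \<ge> ((1/2) ^ k)\<^sup>2}" for k
 have A[measurable]: "A k\<in>sets M" for k unfolding A_def using g[of k] by measurable
 have eA: "emeasure M (A k)<=ennreal ((1/4) ^ k)" for k
 proof -
  have "emeasure M (A k)<=(1/((1/2) ^ k)\<^sup>2)*(\<integral>p. (g k p)\<^sup>2\<partial>M)"
   unfolding A_def using integral_Markov_inequality[OF L2_int[OF g[of k]], of "((1/2) ^ k)\<^sup>2"] by simp
  also have "...<=ennreal ((1/4) ^ k)"
  proof (rule ennreal_leI)
   have "(\<integral>p. (g k p)\<^sup>2\<partial>M)<=((1/4) ^ k)\<^sup>2"
    unfolding l2_norm_sq[symmetric] using gn[of k] by (intro power_mono) (auto simp: l2_norm_nonneg)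
   then have "(1/((1/2) ^ k)\<^sup>2)*(\<integral>p. (g k p)\<^sup>2\<partial>M)<=(1/((1/2) ^ k)\<^sup>2)*((1/4) ^ k)\<^sup>2"
    by (intro mult_left_mono) auto
   also have "...=(1/4) ^ k" by (simp add: power2_eq_square power_mult_distrib[symmetric] power_divide[symmetric] divide_simps)
   finally show "(1/((1/2) ^ k)\<^sup>2)*(\<integral>p. (g k p)\<^sup>2\<partial>M)<=(1/4) ^ k" .
  qed
  finally show ?thesis .
 qed
 have "AE p in M. eventually (%k. p\<in>space M-A k) sequentially"
 proof (rule borel_cantelli_AE1)
  show "emeasure M (A k) < \<infinity>" for k using eA[of k] by (simp add: order_le_less_trans)
  have "measure M (A k)<=(1/4) ^ k" for k
   unfolding measure_def using enn2real_mono[OF eA[of k]] by simp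
  then show "summable (%k. measure M (A k))"
   by (intro summable_comparison_test[OF _ summable_geometric[of "1/4::real"]]) auto
 qed simp
 then have conv: "AE p in M. convergent (%k. F (r k) p)"
 proof eventually_elim
  case (elim p)
  then have ev: "eventually (%k. \<bar>g k p\<bar><=(1/2) ^ k) sequentially"
  proof eventually_elim
   case (elim k)
   then have "(g k p)\<^sup>2<=((1/2) ^ k)\<^sup>2" by (auto simp: A_def)
   then show ?case by (simp add: abs_le_square_iff[symmetric])
  qed
  have "summable (%k. g k p)"
   using ev by (intro summable_comparison_test_ev[OF _ summable_geometric[of "1/2::real"]]) auto
  then have "convergent (%n. \<Sum>k<n. g k p)" by (simp add: summable_iff_convergent)
  then have "convergent (%n. F (r 0) p+(\<Sum>k<n. g k p))" by (intro convergent_add convergent_const)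
  moreover have "F (r 0) p+(\<Sum>k<n. g k p)=F (r n) p" for n
   unfolding g_def by (simp add: sum_lessThan_telescope[of "%k. F (r k) p"])
  ultimately show ?case by simp
 qed
 define f where "f p=lim (%k. F (r k) p)" for p
 have Fm[measurable]: "F n\<in>borel_measurable M" for n using F by (rule L2_meas)
 have f[measurable]: "f\<in>borel_measurable M" unfolding f_def by measurable
 have lim: "AE p in M. (%k. F (r k) p) ----> f p"
  using conv by eventually_elim (simp add: f_def convergent_LIMSEQ_iff)
 have fatou: "(\<integral>\<^sup>+p. ennreal ((F n p-f p)\<^sup>2)\<partial>M)<=ennreal (((1/4) ^ k)\<^sup>2)" if n: "n \<ge> N k" for n k
 proof -
  have "(\<integral>\<^sup>+p. ennreal ((F n p-f p)\<^sup>2)\<partial>M)=(\<integral>\<^sup>+p. liminf (%j. ennreal ((F n p-F (r j) p)\<^sup>2))\<partial>M)"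
  proof (rule nn_integral_cong_AE, use lim in eventually_elim)
   case (elim p)
   have "(%j. ennreal ((F n p-F (r j) p)\<^sup>2)) ----> ennreal ((F n p-f p)\<^sup>2)"
    by (intro tendsto_intros elim)
   then show ?case by (rule lim_imp_Liminf[OF sequentially_bot, symmetric])
  qed
  also have "...<=liminf (%j. \<integral>\<^sup>+p. ennreal ((F n p-F (r j) p)\<^sup>2)\<partial>M)"
   by (rule nn_integral_liminf) simp
  also have "...<=ennreal (((1/4) ^ k)\<^sup>2)"
  proof (rule Liminf_le)
   have "(\<integral>\<^sup>+p. ennreal ((F n p-F (r j) p)\<^sup>2)\<partial>M)<=ennreal (((1/4) ^ k)\<^sup>2)" if "j \<ge> N k" for j
   proof -
    have "(\<integral>\<^sup>+p. ennreal ((F n p-F (r j) p)\<^sup>2)\<partial>M)=ennreal ((l2_norm M (%p. F n p-F (r j) p))\<^sup>2)"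
     unfolding l2_norm_sq by (intro nn_integral_eq_integral L2_int L2_diff F) simp
    also have "...<=ennreal (((1/4) ^ k)\<^sup>2)"
     using N[of k n "r j"] n that rk[of j]
     by (intro ennreal_leI power_mono) (auto simp: l2_norm_nonneg less_imp_le)
    finally show ?thesis .
   qed
   then show "eventually (%j. (\<integral>\<^sup>+p. ennreal ((F n p-F (r j) p)\<^sup>2)\<partial>M)<=ennreal (((1/4) ^ k)\<^sup>2)) sequentially"
    using eventually_ge_at_top[of "N k"] by (rule eventually_mono[rotated]) 
  qed simp
  finally show ?thesis .
 qed
 have L: "(%p. F n p-f p)\<in>L2 M" if "n \<ge> N k" for n k
  unfolding L2_def using order_le_less_trans[OF fatou[OF that]]
  by (auto intro!: integrableI_bounded)
 have fL: "f\<in>L2 M" using L2_diff[OF F L[OF order_refl, of 0], of "N 0"] by simp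
 have le: "l2_norm M (%p. F n p-f p)<=(1/4) ^ k" if "n \<ge> N k" for n k
 proof (rule power2_le_imp_le)
  have "ennreal ((l2_norm M (%p. F n p-f p))\<^sup>2)<=ennreal (((1/4) ^ k)\<^sup>2)"
   unfolding l2_norm_sq
   using fatou[OF that] nn_integral_eq_integral[OF L2_int[OF L[OF that]]] by simp
  then show "(l2_norm M (%p. F n p-f p))\<^sup>2<=((1/4) ^ k)\<^sup>2"
   by (simp add: ennreal_le_iff)
 qed simp
 have "(%n. l2_norm M (%p. F n p-f p)) ----> 0"
 proof (rule LIMSEQ_I)
  fix e :: real assume "e > 0"
  then obtain k where "(1/4) ^ k < e" using real_arch_pow_inv[of e "1/4"] by auto
  then show "\<exists>n0. \<forall>n\<ge>n0. norm (l2_norm M (%p. F n p-f p)-0) < e"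
   using le[of k] by (intro exI[of _ "N k"]) (auto simp: l2_norm_nonneg intro: order_le_less_trans)
 qed
 then show thesis using that fL by blast
qed

section \<open>Essential m-dissipativity from a dense range\<close>

text \<open>A dissipative relation with dense domain is single-valued: if \<open>(0, k)\<close> belongs to it, then
  dissipativity of \<open>(u, v) + t (0, k)\<close> for all real \<open>t\<close> forces \<open>k\<close> to be orthogonal to every \<open>u\<close> in the
  domain.\<close>

lemma dissipative_single_valued:
 assumes sub: "B \<subseteq> L2 M \<times> L2 M"
  and lin: "!!f g f' g' a b. (f, g)\<in>B ==> (f', g')\<in>B ==> \<exists>(h, k)\<in>B.
    (AE p in M. h p=a * f p+b * f' p) \<and> (AE p in M. k p=a * g p+b * g' p)"
  and dis: "dissipative M B" and dense: "densely_defined M B"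
  and fg: "(f, g)\<in>B" "(f', g')\<in>B" "AE p in M. f p=f' p"
 shows "AE p in M. g p=g' p"
proof -
 define k where "k p=g p-g' p" for p
 have L: "f\<in>L2 M" "g\<in>L2 M" "f'\<in>L2 M" "g'\<in>L2 M" using sub fg by auto
 have k: "k\<in>L2 M" unfolding k_def using L by (intro L2_diff)
 obtain h0 k0 where hk: "(h0, k0)\<in>B" "AE p in M. h0 p=1 * f p+(-1) * f' p" "AE p in M. k0 p=1 * g p+(-1) * g' p"
  using lin[OF fg(1,2), of 1 "-1"] by blast
 have L0: "h0\<in>L2 M" "k0\<in>L2 M" using hk sub by auto
 have h0: "AE p in M. h0 p=0" using hk(2) fg(3) by eventually_elim simp
 have k0: "AE p in M. k0 p=k p" using hk(3) by eventually_elim (simp add: k_def)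
 have orth: "l2_inner M k u=0" if uv: "(u, v)\<in>B" for u v
 proof -
  have Lu: "u\<in>L2 M" "v\<in>L2 M" using uv sub by auto
  have "l2_inner M v u+t * l2_inner M k u<=0" for t
  proof -
   obtain a b where ab: "(a, b)\<in>B" "AE p in M. a p=1 * u p+t * h0 p" "AE p in M. b p=1 * v p+t * k0 p"
    using lin[OF uv hk(1), of 1 t] by blast
   have Lab: "a\<in>L2 M" "b\<in>L2 M" using ab sub by auto
   have "l2_inner M b a=l2_inner M (%p. 1 * v p+t * k p) u"
   proof (rule l2_inner_cong_AE)
    show "AE p in M. b p=1 * v p+t * k p" using ab(3) k0 by eventually_elim simp
    show "AE p in M. a p=u p" using ab(2) h0 by eventually_elim simp
   qed (use Lab Lu k in measurable)
   also have "...=l2_inner M v u+t * l2_inner M k u"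
    using l2_inner_lincomb[OF Lu(2) k Lu(1), of 1 t] by simp
   finally show ?thesis using dis ab(1) unfolding dissipative_def by auto
  qed
  from this[of "(1-l2_inner M v u)/l2_inner M k u"] show ?thesis
   by (cases "l2_inner M k u=0") auto
 qed
 have "l2_norm M k<=e" if e: "e > 0" for e
 proof -
  obtain u v where uv: "(u, v)\<in>B" "l2_dist M k u < e"
   using dense k e unfolding densely_defined_def by blast
  have u: "u\<in>L2 M" using uv sub by auto
  have "(l2_norm M k)\<^sup>2=l2_inner M (%p. k p-u p) k"
   using l2_inner_diff[OF k u k] orth[OF uv(1)] by (simp add: l2_inner_self l2_inner_commute[of M u])
  also have "...<=l2_norm M (%p. k p-u p) * l2_norm M k"
   by (intro l2_Cauchy_Schwarz L2_diff k u)
  also have "...<=e * l2_norm M k"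
   using uv(2) by (intro mult_right_mono) (auto simp: l2_dist_norm l2_norm_nonneg)
  finally show ?thesis using e l2_norm_nonneg[of M k]
   by (cases "l2_norm M k=0") (auto simp: power2_eq_square)
 qed
 then have "l2_norm M k=0" using l2_norm_nonneg[of M k] by (meson dense_ge dual_order.antisym)
 then have "AE p in M. k p=0" using l2_norm_eq_0_iff[OF k] by simp
 then show ?thesis by eventually_elim (simp add: k_def)
qed

lemma graph_closure_dissipative:
 assumes sub: "A \<subseteq> L2 M \<times> L2 M" and dis: "dissipative M A"
 shows "dissipative M (graph_closure M A)"
 unfolding dissipative_def
proof clarify
 fix f g assume fg: "(f, g)\<in>graph_closure M A"
 then have L: "f\<in>L2 M" "g\<in>L2 M" by (auto simp: graph_closure_def)
 define C where "C=l2_norm M f+l2_norm M g+2"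
 have C: "C > 0" using l2_norm_nonneg[of M f] l2_norm_nonneg[of M g] by (simp add: C_def)
 have "l2_inner M g f<=e" if e: "e > 0" for e
 proof -
  define d where "d=min 1 (e/C)"
  have d: "d > 0" "d<=1" "d * C<=e" using e C by (auto simp: d_def min_def field_simps)
  obtain f' g' where fg': "(f', g')\<in>A" "l2_dist M f f' < d" "l2_dist M g g' < d"
   using fg d(1) unfolding graph_closure_def by blast
  have L': "f'\<in>L2 M" "g'\<in>L2 M" using fg'(1) sub by auto
  have "l2_inner M g f=l2_inner M (%p. g p-g' p) f+l2_inner M (%p. f p-f' p) g'+l2_inner M g' f'"
   using l2_inner_diff[OF L(2) L'(2) L(1)] l2_inner_diff[OF L(1) L'(1) L'(2)] by (simp add: l2_inner_commute)
  also have "...<=d * l2_norm M f+d * (l2_norm M g+1)+0"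
  proof (intro add_mono)
   show "l2_inner M (%p. g p-g' p) f<=d * l2_norm M f"
    using l2_Cauchy_Schwarz[OF L2_diff[OF L(2) L'(2)] L(1)] fg'(3)
     mult_right_mono[OF less_imp_le[OF fg'(3)] l2_norm_nonneg[of M f]] by (simp add: l2_dist_norm)
   have "l2_norm M g'<=l2_norm M g+1"
    using l2_norm_le_diff[OF L'(2) L(2)] fg'(3) d(2) l2_norm_minus[of M g g'] by (simp add: l2_dist_norm)
   then have "l2_norm M (%p. f p-f' p) * l2_norm M g'<=d * (l2_norm M g+1)"
    using fg'(2) d(1) by (intro mult_mono) (auto simp: l2_dist_norm l2_norm_nonneg)
   then show "l2_inner M (%p. f p-f' p) g'<=d * (l2_norm M g+1)"
    using l2_Cauchy_Schwarz[OF L2_diff[OF L(1) L'(1)] L'(2)] by linarith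
   show "l2_inner M g' f'<=0" using dis fg'(1) unfolding dissipative_def by auto
  qed
  also have "...<=d * C" using d(1) by (simp add: C_def algebra_simps)
  finally show ?thesis using d(3) by linarith
 qed
 then show "l2_inner M g f<=0" by (meson dense_ge)
qed

lemma graph_closure_linear:
 assumes sub: "A \<subseteq> L2 M \<times> L2 M"
  and lin: "!!f g f' g' a b. (f, g)\<in>A ==> (f', g')\<in>A ==> \<exists>(h, k)\<in>A.
    (AE p in M. h p=a * f p+b * f' p) \<and> (AE p in M. k p=a * g p+b * g' p)"
  and fg: "(f, g)\<in>graph_closure M A" "(f', g')\<in>graph_closure M A"
 shows "(%p. a * f p+b * f' p, %p. a * g p+b * g' p)\<in>graph_closure M A"
proof -
 have L: "f\<in>L2 M" "g\<in>L2 M" "f'\<in>L2 M" "g'\<in>L2 M" using fg by (auto simp: graph_closure_def)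
 have est: "l2_dist M (%p. a * u p+b * u' p) h<=\<bar>a\<bar> * l2_dist M u v+\<bar>b\<bar> * l2_dist M u' v'"
  if "u\<in>L2 M" "u'\<in>L2 M" "v\<in>L2 M" "v'\<in>L2 M" "h\<in>L2 M" "AE p in M. h p=a * v p+b * v' p" for u u' v v' h
 proof -
  have "l2_dist M (%p. a * u p+b * u' p) h=l2_norm M (%p. a * (u p-v p)+b * (u' p-v' p))"
   unfolding l2_dist_norm
  proof (rule l2_norm_cong_AE)
   show "AE p in M. a * u p+b * u' p-h p=a * (u p-v p)+b * (u' p-v' p)"
    using that(6) by eventually_elim (simp add: algebra_simps)
  qed (use that(1-5) in measurable)
  also have "...<=l2_norm M (%p. a * (u p-v p))+l2_norm M (%p. b * (u' p-v' p))"
   using that by (intro l2_triangle L2_cmult L2_diff)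
  finally show ?thesis by (simp add: l2_norm_cmult l2_dist_norm)
 qed
 have "\<exists>(h, k)\<in>A. l2_dist M (%p. a * f p+b * f' p) h < e \<and> l2_dist M (%p. a * g p+b * g' p) k < e" if e: "e > 0" for e
 proof -
  define d where "d=e/(\<bar>a\<bar>+\<bar>b\<bar>+1)"
  have d: "d > 0" using e by (auto simp: d_def intro!: divide_pos_pos)
  have ab: "\<bar>a\<bar> * x+\<bar>b\<bar> * y < e" if "x < d" "y < d" for x y
  proof -
   have "\<bar>a\<bar> * x+\<bar>b\<bar> * y<=\<bar>a\<bar> * d+\<bar>b\<bar> * d" using that by (intro add_mono mult_left_mono) auto
   also have "... < (\<bar>a\<bar>+\<bar>b\<bar>+1) * d" using d by (simp add: algebra_simps)
   also have "...=e" unfolding d_def by (simp add: field_simps add_nonneg_pos[THEN less_imp_neq, symmetric])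
   finally show ?thesis .
  qed
  obtain v w where vw: "(v, w)\<in>A" "l2_dist M f v < d" "l2_dist M g w < d"
   using fg(1) d unfolding graph_closure_def by blast
  obtain v' w' where vw': "(v', w')\<in>A" "l2_dist M f' v' < d" "l2_dist M g' w' < d"
   using fg(2) d unfolding graph_closure_def by blast
  obtain h k where hk: "(h, k)\<in>A" "AE p in M. h p=a * v p+b * v' p" "AE p in M. k p=a * w p+b * w' p"
   using lin[OF vw(1) vw'(1), of a b] by blast
  have L': "v\<in>L2 M" "w\<in>L2 M" "v'\<in>L2 M" "w'\<in>L2 M" "h\<in>L2 M" "k\<in>L2 M"
   using sub vw vw' hk by auto
  show ?thesis
   using hk(1) est[OF L(1,3) L'(1,3,5) hk(2)] est[OF L(2,4) L'(2,4,6) hk(3)]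
    ab[OF vw(2) vw'(2)] ab[OF vw(3) vw'(3)] by (intro bexI[of _ "(h, k)"]) auto
 qed
 then show ?thesis using L unfolding graph_closure_def by (auto intro!: L2_lincomb)
qed

lemma subset_graph_closure: "A \<subseteq> L2 M \<times> L2 M ==> A \<subseteq> graph_closure M A"
 unfolding graph_closure_def by (auto simp: l2_dist_def intro!: bexI)

text \<open>The Lumer-Phillips criterion: dissipativity makes \<open>f \<mapsto> f - A f\<close> expand distances, so approximate
  solutions of the resolvent equation converge.\<close>

theorem essentially_m_dissipativeI:
 assumes sub: "A \<subseteq> L2 M \<times> L2 M" and ne: "A \<noteq> {}"
  and lin: "!!f g f' g' a b. (f, g)\<in>A ==> (f', g')\<in>A ==> \<exists>(h, k)\<in>A.
    (AE p in M. h p=a * f p+b * f' p) \<and> (AE p in M. k p=a * g p+b * g' p)"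
  and dis: "dissipative M A" and dense: "densely_defined M A"
  and range: "!!h e. h\<in>L2 M ==> e > 0 ==> \<exists>(f, g)\<in>A. l2_norm M (%p. f p-g p-h p) < e"
 shows "essentially_m_dissipative M A"
proof -
 let ?C = "graph_closure M A"
 have AC: "A \<subseteq> ?C" by (rule subset_graph_closure[OF sub])
 have subC: "?C \<subseteq> L2 M \<times> L2 M" by (auto simp: graph_closure_def)
 have linC: "\<exists>(h, k)\<in>?C. (AE p in M. h p=a * f p+b * f' p) \<and> (AE p in M. k p=a * g p+b * g' p)"
  if "(f, g)\<in>?C" "(f', g')\<in>?C" for f g f' g' a b
  by (rule bexI[OF _ graph_closure_linear[OF sub lin that, of a b]]) simp_all
 have disC: "dissipative M ?C" by (rule graph_closure_dissipative[OF sub dis])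
 have denseC: "densely_defined M ?C" using dense AC unfolding densely_defined_def by blast
 have svC: "AE p in M. g p=g' p" if "(f, g)\<in>?C" "(f', g')\<in>?C" "AE p in M. f p=f' p" for f g f' g'
  using dissipative_single_valued[OF subC linC disC denseC that] .
 have svA: "AE p in M. g p=g' p" if "(f, g)\<in>A" "(f', g')\<in>A" "AE p in M. f p=f' p" for f g f' g'
  using dissipative_single_valued[OF sub lin dis dense that] .
 have opA: "l2_operator M A"
  unfolding l2_operator_def
 proof (intro conjI sub ne)
  show "\<forall>(f, g)\<in>A. \<forall>(f', g')\<in>A. \<forall>a b. \<exists>(h, k)\<in>A.
    (AE p in M. h p=a * f p+b * f' p) \<and> (AE p in M. k p=a * g p+b * g' p)"
   by (clarify, rule lin)
  show "\<forall>(f, g)\<in>A. \<forall>(f', g')\<in>A. (AE p in M. f p=f' p) \<longrightarrow> (AE p in M. g p=g' p)"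
  proof (unfold case_prod_beta, intro ballI impI)
   fix x y assume "x\<in>A" "y\<in>A" "AE p in M. fst x p=fst y p"
   then show "AE p in M. snd x p=snd y p"
    by (intro svA[of "fst x" "snd x" "fst y" "snd y"]) simp_all
  qed
 qed
 have opC: "l2_operator M ?C"
  unfolding l2_operator_def
 proof (intro conjI subC)
  show "?C \<noteq> {}" using ne AC by blast
  show "\<forall>(f, g)\<in>?C. \<forall>(f', g')\<in>?C. \<forall>a b. \<exists>(h, k)\<in>?C.
    (AE p in M. h p=a * f p+b * f' p) \<and> (AE p in M. k p=a * g p+b * g' p)"
   by (clarify, rule linC)
  show "\<forall>(f, g)\<in>?C. \<forall>(f', g')\<in>?C. (AE p in M. f p=f' p) \<longrightarrow> (AE p in M. g p=g' p)"
  proof (unfold case_prod_beta, intro ballI impI)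
   fix x y assume "x\<in>?C" "y\<in>?C" "AE p in M. fst x p=fst y p"
   then show "AE p in M. snd x p=snd y p"
    by (intro svC[of "fst x" "snd x" "fst y" "snd y"]) simp_all
  qed
 qed
 have "\<exists>(f, g)\<in>?C. AE p in M. f p-g p=h p" if h: "h\<in>L2 M" for h
 proof -
  have "\<exists>f g. (f, g)\<in>A \<and> l2_norm M (%p. f p-g p-h p) < 1/real (Suc n)" for n
   using range[OF h, of "1/real (Suc n)"] by auto
  then obtain F G where FG: "!!n. (F n, G n)\<in>A" "!!n. l2_norm M (%p. F n p-G n p-h p) < 1/real (Suc n)"
   by metis
  have L: "F n\<in>L2 M" "G n\<in>L2 M" for n using FG(1) sub by auto
  have expand: "l2_norm M (%p. F m p-F n p)<=l2_norm M (%p. F m p-G m p-h p)+l2_norm M (%p. F n p-G n p-h p)" for m n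
  proof -
   obtain u v where uv: "(u, v)\<in>A" "AE p in M. u p=1 * F m p+(-1) * F n p" "AE p in M. v p=1 * G m p+(-1) * G n p"
    using lin[OF FG(1)[of m] FG(1)[of n], of 1 "-1"] by blast
   have Luv: "u\<in>L2 M" "v\<in>L2 M" using uv sub by auto
   have "(l2_norm M u)\<^sup>2<=l2_inner M (%p. u p-v p) u"
    using dis uv(1) l2_inner_diff[OF Luv Luv(1)] by (auto simp: l2_inner_self dissipative_def)
   also have "...<=l2_norm M (%p. u p-v p) * l2_norm M u"
    by (intro l2_Cauchy_Schwarz L2_diff Luv)
   finally have "l2_norm M u<=l2_norm M (%p. u p-v p)"
    using l2_norm_nonneg[of M u] l2_norm_nonneg[of M "%p. u p-v p"]
    by (cases "l2_norm M u=0") (auto simp: power2_eq_square)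
   moreover have "l2_norm M u=l2_norm M (%p. F m p-F n p)"
   proof (rule l2_norm_cong_AE)
    show "AE p in M. u p=F m p-F n p" using uv(2) by eventually_elim simp
   qed (use Luv L in measurable)
   moreover have "l2_norm M (%p. u p-v p)=l2_norm M (%p. (F m p-G m p-h p)-(F n p-G n p-h p))"
   proof (rule l2_norm_cong_AE)
    show "AE p in M. u p-v p=(F m p-G m p-h p)-(F n p-G n p-h p)"
     using uv(2,3) by eventually_elim simp
   qed (use Luv L h in measurable)
   moreover have "...<=l2_norm M (%p. F m p-G m p-h p)+l2_norm M (%p. F n p-G n p-h p)"
    by (intro l2_triangle_minus L2_diff L h)
   ultimately show ?thesis by simp
  qed
  have "\<exists>N. \<forall>m\<ge>N. \<forall>n\<ge>N. l2_norm M (%p. F m p-F n p) < e" if e: "e > 0" for e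
  proof -
   obtain N where N: "2/e < real N" using reals_Archimedean2 by blast
   have "l2_norm M (%p. F m p-G m p-h p) < e/2" if "m \<ge> N" for m
   proof -
    have "1/real (Suc m) < e/2"
     using N that e by (simp add: field_simps) (smt (verit) mult_left_mono of_nat_mono)
    then show ?thesis using FG(2)[of m] by linarith
   qed
   then show ?thesis using expand by (intro exI[of _ N]) (smt (verit) field_sum_of_halves)
  qed
  then obtain f where f: "f\<in>L2 M" "(%n. l2_norm M (%p. F n p-f p)) ----> 0"
   using l2_complete[of F M] L(1) by blast
  have "(f, %p. f p-h p)\<in>?C"
   unfolding graph_closure_def
  proof (clarify, intro conjI allI impI)
   fix e :: real assume e: "e > 0"
   have "eventually (%n. l2_norm M (%p. F n p-f p) < e/2) sequentially"
    using f(2) e by (intro order_tendstoD(2)[of _ 0]) auto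
   moreover have "(%n. 1/real (Suc n)) ----> 0" using LIMSEQ_inverse_real_of_nat by (simp add: inverse_eq_divide)
   then have "eventually (%n. 1/real (Suc n) < e/2) sequentially"
    using e by (intro order_tendstoD(2)[of _ 0]) auto
   ultimately have "eventually (%n. l2_norm M (%p. F n p-f p) < e/2 \<and> 1/real (Suc n) < e/2) sequentially"
    by (rule eventually_conj)
   then obtain n where n: "l2_norm M (%p. F n p-f p) < e/2" "1/real (Suc n) < e/2"
    using eventually_happens by force
   have "l2_norm M (%p. (F n p-G n p-h p)+(f p-F n p))
     <= l2_norm M (%p. F n p-G n p-h p)+l2_norm M (%p. f p-F n p)"
    by (intro l2_triangle L2_diff L f h)
   also have "... < e" using n FG(2)[of n] l2_norm_minus[of M f "F n"] by simp
   finally have "l2_dist M (%p. f p-h p) (G n) < e" by (simp add: l2_dist_norm algebra_simps)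
   moreover have "l2_dist M f (F n) < e" using n(1) e l2_norm_minus[of M f "F n"] by (simp add: l2_dist_norm)
   ultimately show "\<exists>(f', g')\<in>A. l2_dist M f f' < e \<and> l2_dist M (%p. f p-h p) g' < e"
    using FG(1)[of n] by (intro bexI[of _ "(F n, G n)"]) auto
  qed (use f h in \<open>auto intro: L2_diff\<close>)
  then show ?thesis by (rule bexI[rotated]) simp
 qed
 then show ?thesis
  unfolding essentially_m_dissipative_def m_dissipative_def using opA opC dense dis disC by blast
qed

section \<open>The continuity method\<close>

definition dense_range :: "'p measure => ('p => real) set => (('p => real) => 'p => real) => bool" where
 "dense_range M D A \<longleftrightarrow> (\<forall>h\<in>L2 M. \<forall>e>0. \<exists>\<phi>\<in>D. l2_norm M (%p. h p-A \<phi> p) < e)"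

text \<open>One step of the continuity method: if the perturbation is bounded by a fraction of the operator, a Neumann series argument preserves density of the range.\<close>

lemma dense_range_step:
 assumes D: "(%_. 0)\<in>D" "!!\<phi> \<psi>. \<phi>\<in>D ==> \<psi>\<in>D ==> (%p. \<phi> p+\<psi> p)\<in>D"
  and L: "!!\<phi>. \<phi>\<in>D ==> P \<phi>\<in>L2 M" "!!\<phi>. \<phi>\<in>D ==> Q \<phi>\<in>L2 M"
  and Qadd: "!!\<phi> \<psi>. \<phi>\<in>D ==> \<psi>\<in>D ==> Q (%p. \<phi> p+\<psi> p)=(%p. Q \<phi> p+Q \<psi> p)"
  and close: "!!\<phi>. \<phi>\<in>D ==> l2_norm M (%p. P \<phi> p-Q \<phi> p)<=1/2 * l2_norm M (P \<phi>)"
  and P: "dense_range M D P"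
 shows "dense_range M D Q"
proof -
 have Q0: "Q (%_. 0)=(%_. 0)"
  using Qadd[OF D(1) D(1)] by (simp add: fun_eq_iff) 
 have one: "\<exists>\<phi>\<in>D. l2_norm M (%p. h p-Q \<phi> p)<=3/4 * l2_norm M h" if h: "h\<in>L2 M" for h
 proof (cases "l2_norm M h=0")
  case True
  then show ?thesis using D(1) by (intro bexI[of _ "%_. 0"]) (simp_all add: Q0)
 next
  case False
  then have pos: "l2_norm M h > 0" using l2_norm_nonneg[of M h] by simp
  then obtain \<phi> where \<phi>: "\<phi>\<in>D" "l2_norm M (%p. h p-P \<phi> p) < l2_norm M h/8"
   using P h unfolding dense_range_def by (meson divide_pos_pos zero_less_numeral)
  have "l2_norm M (P \<phi>)<=9/8 * l2_norm M h"
   using l2_norm_le_diff[OF L(1)[OF \<phi>(1)] h] \<phi>(2) l2_norm_minus[of M h "P \<phi>"] by simp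
  then have "l2_norm M (%p. h p-Q \<phi> p)<=3/4 * l2_norm M h"
   using l2_triangle_diff[OF h L(1)[OF \<phi>(1)] L(2)[OF \<phi>(1)]] close[OF \<phi>(1)] \<phi>(2) pos by linarith
  then show ?thesis using \<phi>(1) by blast
 qed
 have iter: "\<exists>\<phi>\<in>D. l2_norm M (%p. h p-Q \<phi> p)<=(3/4)^n * l2_norm M h" if h: "h\<in>L2 M" for h n
 proof (induction n)
  case 0
  then show ?case using D(1) by (intro bexI[of _ "%_. 0"]) (simp_all add: Q0)
 next
  case (Suc n)
  then obtain \<phi> where \<phi>: "\<phi>\<in>D" "l2_norm M (%p. h p-Q \<phi> p)<=(3/4)^n * l2_norm M h" by blast
  obtain \<psi> where \<psi>: "\<psi>\<in>D" "l2_norm M (%p. h p-Q \<phi> p-Q \<psi> p)<=3/4 * l2_norm M (%p. h p-Q \<phi> p)"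
   using one[OF L2_diff[OF h L(2)[OF \<phi>(1)]]] by blast
  have "l2_norm M (%p. h p-Q (%p. \<phi> p+\<psi> p) p)<=(3/4)^Suc n * l2_norm M h"
   using \<phi>(2) \<psi>(2) by (simp add: Qadd[OF \<phi>(1) \<psi>(1)] diff_diff_eq)
  then show ?case using D(2)[OF \<phi>(1) \<psi>(1)] by blast
 qed
 show ?thesis
  unfolding dense_range_def
 proof (intro ballI allI impI)
  fix h e assume h: "h\<in>L2 M" and e: "(e::real) > 0"
  have "(%n. (3/4)^n * l2_norm M h) ----> 0 * l2_norm M h"
   by (intro tendsto_intros LIMSEQ_power_zero) auto
  then have "eventually (%n. (3/4)^n * l2_norm M h < e) sequentially"
   using e by (intro order_tendstoD(2)) auto
  then obtain n where "(3/4)^n * l2_norm M h < e" using eventually_happens by force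
  then show "\<exists>\<phi>\<in>D. l2_norm M (%p. h p-Q \<phi> p) < e" using iter[OF h, of n] by force
 qed
qed

text \<open>If \<open>B\<close> is bounded relative to \<open>A - t B\<close> with a constant that does not depend on
  \<open>t \<in> [0, 1]\<close>, density of the range passes from \<open>A\<close> to \<open>A - B\<close> in finitely many small steps.\<close>

lemma dense_range_perturb:
 assumes D: "(%_. 0)\<in>D" "!!\<phi> \<psi>. \<phi>\<in>D ==> \<psi>\<in>D ==> (%p. \<phi> p+\<psi> p)\<in>D"
  and L: "!!\<phi>. \<phi>\<in>D ==> A \<phi>\<in>L2 M" "!!\<phi>. \<phi>\<in>D ==> B \<phi>\<in>L2 M"
  and Aadd: "!!\<phi> \<psi>. \<phi>\<in>D ==> \<psi>\<in>D ==> A (%p. \<phi> p+\<psi> p)=(%p. A \<phi> p+A \<psi> p)"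
  and Badd: "!!\<phi> \<psi>. \<phi>\<in>D ==> \<psi>\<in>D ==> B (%p. \<phi> p+\<psi> p)=(%p. B \<phi> p+B \<psi> p)"
  and bound: "!!t \<phi>. 0<=t ==> t<=1 ==> \<phi>\<in>D ==> l2_norm M (B \<phi>)<=C * l2_norm M (%p. A \<phi> p-t * B \<phi> p)"
  and A: "dense_range M D A"
 shows "dense_range M D (%\<phi> p. A \<phi> p-B \<phi> p)"
proof -
 obtain N :: nat where N: "2*\<bar>C\<bar>+1 < real N" using reals_Archimedean2 by blast
 then have N0: "real N > 0" by linarith
 have L2: "(%p. A \<phi> p-c * B \<phi> p)\<in>L2 M" if "\<phi>\<in>D" for c \<phi>
  using that L by (intro L2_diff L2_cmult)
 have lin: "(%p. A (%p. \<phi> p+\<psi> p) p-c * B (%p. \<phi> p+\<psi> p) p)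
   = (%p. (A \<phi> p-c * B \<phi> p)+(A \<psi> p-c * B \<psi> p))" if "\<phi>\<in>D" "\<psi>\<in>D" for c \<phi> \<psi>
  unfolding Aadd[OF that] Badd[OF that] by (simp add: fun_eq_iff algebra_simps)
 have "dense_range M D (%\<phi> p. A \<phi> p-(real k/real N) * B \<phi> p)" if "k<=N" for k
  using that
 proof (induction k)
  case 0
  then show ?case using A by simp
 next
  case (Suc k)
  show ?case
  proof (rule dense_range_step[OF D, where P = "%\<phi> p. A \<phi> p-(real k/real N) * B \<phi> p"])
   show "dense_range M D (%\<phi> p. A \<phi> p-real k/real N * B \<phi> p)" using Suc by simp
   fix \<phi> assume \<phi>: "\<phi>\<in>D"
   have "(%p. A \<phi> p-real k/real N * B \<phi> p-(A \<phi> p-real (Suc k)/real N * B \<phi> p))=(%p. (1/real N) * B \<phi> p)"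
    using N0 by (simp add: fun_eq_iff field_simps)
   then have "l2_norm M (%p. A \<phi> p-real k/real N * B \<phi> p-(A \<phi> p-real (Suc k)/real N * B \<phi> p))=1/real N * l2_norm M (B \<phi>)"
    by (simp only: l2_norm_cmult) simp
   also have "...<=1/real N * (C * l2_norm M (%p. A \<phi> p-(real k/real N) * B \<phi> p))"
    using bound[of "real k/real N" \<phi>] \<phi> Suc.prems N0 by (intro mult_left_mono) auto
   also have "...<=1/2 * l2_norm M (%p. A \<phi> p-real k/real N * B \<phi> p)"
   proof -
    have "1/real N * C<=1/2" using N N0 by (simp add: field_simps)
    from mult_right_mono[OF this l2_norm_nonneg] show ?thesis by (simp add: mult.assoc)
   qed
   finally show "l2_norm M (%p. A \<phi> p-real k/real N * B \<phi> p-(A \<phi> p-real (Suc k)/real N * B \<phi> p))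
     <= 1/2 * l2_norm M (%p. A \<phi> p-real k/real N * B \<phi> p)" .
  qed (use L2 lin in blast)+
 qed
 from this[of N] show ?thesis using N0 by simp
qed

section \<open>Invariance of the phase space measure\<close>

text \<open>Lebesgue measure is the only translation invariant measure with its values on balls; this gives
  invariance under isometries without reference to determinants.\<close>

lemma translation_invariant_eq_lborel:
 fixes M :: "'a::euclidean_space measure"
 assumes sets[measurable_cong, simp]: "sets M=sets borel"
  and ball: "!!r. emeasure M (ball 0 r)=emeasure lborel (ball (0::'a) r)"
  and inv: "!!c. distr M borel ((+) c)=M"
 shows "M=lborel"
proof (rule measure_eqI)
 show "sets M=sets lborel" by simp
 interpret M: sigma_finite_measure M
 proof
  show "\<exists>A. countable A \<and> A \<subseteq> sets M \<and> \<Union> A=space M \<and> (\<forall>a\<in>A. emeasure M a \<noteq> \<infinity>)"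
  proof (intro exI[of _ "range (%n::nat. ball 0 (real n))"] conjI)
   show "\<Union> (range (%n::nat. ball (0::'a) (real n)))=space M"
    using sets_eq_imp_space_eq[OF sets] by (auto simp: reals_Archimedean2)
  qed (use emeasure_lborel_ball_finite ball in \<open>auto simp: less_top[symmetric]\<close>)
 qed
 interpret P: pair_sigma_finite M lborel ..
 let ?B = "ball (0::'a) 1"
 fix A assume "A\<in>sets M"
 then have A[measurable, simp]: "A\<in>sets borel" by simp
 have Bb[measurable, simp]: "?B\<in>sets borel" by (intro borel_open open_ball)
 have iA: "(\<integral>\<^sup>+x. indicator A x\<partial>M)=emeasure M A" by (rule nn_integral_indicator) simp
 have iL: "(\<integral>\<^sup>+x. indicator A x\<partial>lborel)=emeasure lborel A" by (rule nn_integral_indicator) simp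
 have iB: "(\<integral>\<^sup>+x. indicator ?B x\<partial>lborel)=emeasure lborel ?B" by (rule nn_integral_indicator) simp
 have iBM: "(\<integral>\<^sup>+x. indicator ?B x\<partial>M)=emeasure M ?B" by (rule nn_integral_indicator) simp
 have invM: "(\<integral>\<^sup>+x. f (c+x)\<partial>M)=(\<integral>\<^sup>+x. f x\<partial>M)" if "f\<in>borel_measurable borel" for f :: "'a => ennreal" and c
  using nn_integral_distr[of "(+) c" M borel f] that inv[of c] by simp
 have invL: "(\<integral>\<^sup>+x. f (c+x)\<partial>lborel)=(\<integral>\<^sup>+x. f x\<partial>lborel)" if "f\<in>borel_measurable borel" for f :: "'a => ennreal" and c
  using nn_integral_distr[of "(+) c" lborel borel f] that lborel_distr_plus[of c] by simp
 have "emeasure M A * emeasure lborel ?B=(\<integral>\<^sup>+y. indicator ?B y * (\<integral>\<^sup>+x. indicator A x\<partial>M)\<partial>lborel)"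
  by (subst nn_integral_multc, measurable) (simp only: iA iB mult.commute)
 also have "...=(\<integral>\<^sup>+y. (\<integral>\<^sup>+x. indicator ?B y * indicator A (y+x)\<partial>M)\<partial>lborel)"
  by (rule nn_integral_cong) (simp add: nn_integral_cmult invM)
 also have "...=(\<integral>\<^sup>+x. (\<integral>\<^sup>+y. indicator ?B y * indicator A (y+x)\<partial>lborel)\<partial>M)"
  by (rule P.Fubini') measurable
 also have "...=(\<integral>\<^sup>+x. (\<integral>\<^sup>+y. indicator ?B (y-x) * indicator A y\<partial>lborel)\<partial>M)"
 proof (rule nn_integral_cong)
  fix x
  show "(\<integral>\<^sup>+y. indicator ?B y * indicator A (y+x)\<partial>lborel)=(\<integral>\<^sup>+y. indicator ?B (y-x) * indicator A y\<partial>lborel)"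
   using invL[of "%y. indicator ?B (y-x) * indicator A y" x] by (simp add: add.commute)
 qed
 also have "...=(\<integral>\<^sup>+y. (\<integral>\<^sup>+x. indicator ?B (y-x) * indicator A y\<partial>M)\<partial>lborel)"
  by (rule P.Fubini'[symmetric]) measurable
 also have "...=(\<integral>\<^sup>+y. indicator A y * emeasure M ?B\<partial>lborel)"
 proof (rule nn_integral_cong)
  fix y
  have e: "indicator ?B (y-x)=(indicator ?B (- y+x) :: ennreal)" for x
   by (simp add: indicator_def norm_minus_commute add.commute)
  have "(\<integral>\<^sup>+x. indicator ?B (y-x) * indicator A y\<partial>M)=(\<integral>\<^sup>+x. indicator ?B (- y+x)\<partial>M) * indicator A y"
   unfolding e by (rule nn_integral_multc) measurable
  also have "(\<integral>\<^sup>+x. indicator ?B (- y+x)\<partial>M)=emeasure M ?B"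
   by (subst invM, rule borel_measurable_indicator[OF Bb], rule iBM)
  finally show "(\<integral>\<^sup>+x. indicator ?B (y-x) * indicator A y\<partial>M)=indicator A y * emeasure M ?B"
   by (simp add: mult.commute)
 qed
 also have "...=emeasure lborel A * emeasure lborel ?B"
  by (subst nn_integral_multc, measurable) (simp only: iL ball)
 finally have eq: "emeasure M A * emeasure lborel ?B=emeasure lborel A * emeasure lborel ?B" .
 have "emeasure lborel ?B \<noteq> 0" "emeasure lborel ?B \<noteq> \<infinity>"
  using emeasure_lborel_ball_finite[of "0::'a" 1] content_ball_pos[of 1 "0::'a"] by (auto simp: measure_def)
 then show "emeasure M A=emeasure lborel A"
  using eq ennreal_mult_cancel_left[of "emeasure lborel ?B" "emeasure M A" "emeasure lborel A"]
  by (auto simp: mult.commute less_top)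
qed

lemma lborel_distr_isometry:
 fixes R :: "'a::euclidean_space => 'a"
 assumes lin: "linear R" and iso: "!!y. norm (R y)=norm y"
 shows "distr lborel borel R=lborel"
proof (rule translation_invariant_eq_lborel)
 have Rm[measurable]: "R\<in>borel_measurable borel"
  using lin by (intro borel_measurable_continuous_onI linear_continuous_on) (simp add: linear_conv_bounded_linear)
 have "inj R" unfolding linear_injective_0[OF lin] using iso by (metis norm_eq_zero)
 then have surj: "surj R" using lin by (simp add: linear_injective_imp_surjective)
 show "emeasure (distr lborel borel R) (ball 0 r)=emeasure lborel (ball (0::'a) r)" for r
 proof -
  have "R -` ball 0 r=ball 0 r" by (auto simp: iso)
  then show ?thesis by (simp add: emeasure_distr)
 qed
 show "distr (distr lborel borel R) borel ((+) c)=distr lborel borel R" for c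
 proof -
  obtain a where a: "c=R a" using surj by blast
  have "distr (distr lborel borel R) borel ((+) c)=distr lborel borel (%y. c+R y)"
   by (subst distr_distr) (auto simp: o_def)
  also have "...=distr lborel borel (%y. R (a+y))" by (simp add: a linear_add[OF lin])
  also have "...=distr (distr lborel borel ((+) a)) borel R"
   by (subst distr_distr) (auto simp: o_def)
  finally show ?thesis by (simp add: lborel_distr_plus)
 qed
qed simp

lemma sets_sphere_measure: "sets (sphere_measure :: 'a::euclidean_space measure)=sets (restrict_space borel (sphere 0 1))"
 unfolding sphere_measure_def by (intro sets_restrict_space_cong) simp

lemma space_sphere_measure: "space (sphere_measure :: 'a::euclidean_space measure)=sphere 0 1"
 unfolding sphere_measure_def by (simp add: space_restrict_space)

lemma measurable_sphere_id[measurable]: "(%y. y)\<in>measurable (sphere_measure :: 'a::euclidean_space measure) borel"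
proof -
 have "(%y::'a. y)\<in>measurable (restrict_space borel (sphere 0 1)) borel"
  by (intro measurable_restrict_space1) simp
 then show ?thesis using measurable_cong_sets[OF sets_sphere_measure refl] by blast
qed

interpretation sphere_measure: finite_measure "sphere_measure :: 'a::euclidean_space measure"
 by (rule finite_measureI) (simp add: space_sphere_measure emeasure_sphere_measure)

lemma emeasure_sphere_measure_eq:
 fixes A :: "'a::euclidean_space set"
 assumes "A\<in>sets (sphere_measure :: 'a measure)"
 shows "emeasure sphere_measure A=emeasure (uniform_measure lborel (ball 0 1)) (sgn -` A)"
proof -
 have S: "sphere 0 1\<in>sets (borel :: 'a measure)" by simp
 have A: "A\<in>sets borel" "A \<subseteq> sphere 0 1"
  using assms S unfolding sets_sphere_measure by (auto simp: sets_restrict_space_iff)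
 have m: "sgn\<in>measurable (uniform_measure lborel (ball (0::'a) 1)) borel"
  by (simp add: uniform_measure_def)
 have "emeasure sphere_measure A=emeasure (distr (uniform_measure lborel (ball 0 1)) borel sgn) A"
  unfolding sphere_measure_def using A by (intro emeasure_restrict_space) auto
 then show ?thesis unfolding emeasure_distr[OF m A(1)] by simp
qed

text \<open>The cone over a rotated set is the rotated cone, so invariance is inherited from Lebesgue measure on the ball.\<close>

lemma sphere_measure_isometry:
 fixes R :: "'a::euclidean_space => 'a"
 assumes lin: "linear R" and iso: "!!y. norm (R y)=norm y"
 shows "R\<in>measurable sphere_measure sphere_measure"
  and "distr sphere_measure sphere_measure R=sphere_measure"
proof -
 have Rm[measurable]: "R\<in>borel_measurable borel"
  using lin by (intro borel_measurable_continuous_onI linear_continuous_on) (simp add: linear_conv_bounded_linear)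
 have "R\<in>measurable (restrict_space borel (sphere 0 1)) (restrict_space borel (sphere 0 1))"
  by (intro measurable_restrict_space3) (auto simp: iso)
 then show Rs: "R\<in>measurable sphere_measure sphere_measure"
  using measurable_cong_sets[OF sets_sphere_measure sets_sphere_measure] by blast
 show "distr sphere_measure sphere_measure R=sphere_measure"
 proof (rule measure_eqI)
  fix A assume "A\<in>sets (distr sphere_measure sphere_measure R)"
  then have A: "A\<in>sets (sphere_measure :: 'a measure)" by simp
  then have Ab: "A\<in>sets borel" "A \<subseteq> sphere 0 1"
   unfolding sets_sphere_measure by (auto simp: sets_restrict_space_iff)
  have RA: "R -` A \<inter> space (sphere_measure :: 'a measure)\<in>sets (sphere_measure :: 'a measure)"
   using measurable_sets[OF Rs A] .
  have sgnR: "sgn (R y)=R (sgn y)" for y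
   by (simp add: sgn_div_norm iso linear_cmul[OF lin])
  have e1: "sgn -` (R -` A \<inter> space sphere_measure)=R -` (sgn -` A)"
  proof -
   have "sgn y\<in>sphere 0 1" if "sgn (R y)\<in>A" for y
    using that Ab(2) iso[of "sgn y"] by (auto simp: sgnR)
   then show ?thesis unfolding space_sphere_measure by (auto simp: sgnR)
  qed
  have sA: "sgn -` A\<in>sets borel" using measurable_sets_borel[of sgn borel A] Ab(1) by simp
  have RsA: "R -` (sgn -` A)\<in>sets borel" using measurable_sets_borel[of R borel "sgn -` A"] sA by simp
  have B: "ball 0 1 \<inter> R -` (sgn -` A)=R -` (ball 0 1 \<inter> sgn -` A)" by (auto simp: iso)
  have "emeasure lborel (R -` (ball 0 1 \<inter> sgn -` A))=emeasure (distr lborel borel R) (ball 0 1 \<inter> sgn -` A)"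
   using sA by (simp add: emeasure_distr)
  also have "...=emeasure lborel (ball 0 1 \<inter> sgn -` A)" by (simp add: lborel_distr_isometry[OF lin iso])
  finally have e2: "emeasure lborel (ball 0 1 \<inter> R -` (sgn -` A))=emeasure lborel (ball 0 1 \<inter> sgn -` A)"
   by (simp add: B)
  have "emeasure (distr sphere_measure sphere_measure R) A=emeasure sphere_measure (R -` A \<inter> space sphere_measure)"
   by (rule emeasure_distr[OF Rs A])
  also have "...=emeasure (uniform_measure lborel (ball 0 1)) (R -` (sgn -` A))"
   unfolding emeasure_sphere_measure_eq[OF RA] e1 ..
  also have "...=emeasure (uniform_measure lborel (ball 0 1)) (sgn -` A)"
   using sA RsA by (simp add: e2)
  finally show "emeasure (distr sphere_measure sphere_measure R) A=emeasure sphere_measure A"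
   unfolding emeasure_sphere_measure_eq[OF A] .
 qed simp
qed

abbreviation phaseM :: "('a::euclidean_space \<times> 'a) measure" where
 "phaseM \<equiv> lborel \<Otimes>\<^sub>M sphere_measure"

lemma space_phase_measure: "space (phaseM :: ('a::euclidean_space \<times> 'a) measure)=phase_space"
 by (simp add: space_pair_measure space_sphere_measure phase_space_def)

lemma measurable_phase_id: "(%p. p)\<in>measurable (phaseM :: ('a::euclidean_space \<times> 'a) measure) borel"
proof -
 have "(%p::'a\<times>'a. (fst p, snd p))\<in>measurable phaseM (borel \<Otimes>\<^sub>M borel)"
 proof (intro measurable_Pair)
  show "fst\<in>measurable (phaseM :: ('a \<times> 'a) measure) borel"
   using measurable_fst[of lborel "sphere_measure::'a measure"] by simp
  show "snd\<in>measurable (phaseM :: ('a \<times> 'a) measure) borel"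
   using measurable_compose[OF measurable_snd measurable_sphere_id] .
 qed
 then show ?thesis by (simp add: borel_prod)
qed

lemma measurable_phase:
 "f\<in>measurable borel N ==> f\<in>measurable (phaseM :: ('a::euclidean_space \<times> 'a) measure) N"
 using measurable_compose[OF measurable_phase_id] .

lemma measurable_phase_fst:
 "m\<in>borel_measurable borel ==> (%p. m (fst p))\<in>borel_measurable (phaseM :: ('a::euclidean_space \<times> 'a) measure)"
 using measurable_compose[OF measurable_fst[of lborel "sphere_measure :: 'a measure"], of m borel] by simp

interpretation phase: pair_sigma_finite "lborel :: 'a::euclidean_space measure" "sphere_measure :: 'a measure" ..

lemma integrable_phase_bounded:
 fixes f :: "'a::euclidean_space \<times> 'a => real"
 assumes f: "f\<in>borel_measurable phaseM"
  and bd: "!!p. p\<in>phase_space ==> \<bar>f p\<bar><=C" and supp: "!!p. p\<in>phase_space ==> R < norm (fst p) ==> f p=0"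
 shows "integrable phaseM f"
proof -
 let ?K = "cball 0 R \<times> sphere 0 1 :: ('a \<times> 'a) set"
 have S: "sphere 0 1\<in>sets (sphere_measure :: 'a measure)"
  using sets.top[of "sphere_measure :: 'a measure"] by (simp add: space_sphere_measure)
 have K: "?K\<in>sets phaseM" using S by simp
 have "emeasure phaseM ?K=emeasure lborel (cball (0::'a) R)*1"
  using S by (simp add: sphere_measure.emeasure_pair_measure_Times emeasure_sphere_measure)
 also have "... < \<infinity>" using emeasure_lborel_cball_finite[of "0::'a" R] by simp
 finally have "emeasure phaseM ?K < \<infinity>" .
 then have i: "integrable phaseM (%p. indicator ?K p *\<^sub>R C)"
  using K by (intro integrable_indicator integrable_scaleR_left) auto
 show ?thesis
 proof (rule Bochner_Integration.integrable_bound[OF i f])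
  show "AE p in phaseM. norm (f p)<=norm (indicator ?K p *\<^sub>R C)"
  proof (rule AE_I2)
   fix p :: "'a \<times> 'a" assume "p\<in>space phaseM"
   then have p: "p\<in>phase_space" by (simp add: space_phase_measure)
   show "norm (f p)<=norm (indicator ?K p *\<^sub>R C)"
    using bd[OF p] supp[OF p] p by (cases "norm (fst p)<=R") (auto simp: indicator_def phase_space_def)
  qed
 qed
qed

lemma Cc_support_fst:
 fixes F :: "'a::euclidean_space \<times> 'b::euclidean_space => real"
 assumes "F\<in>Cc" obtains R where "R > 0" "!!p. R < norm (fst p) ==> F p=0"
proof -
 obtain R where R: "R > 0" "!!p. R < norm p ==> F p=0" using Cc_support[OF assms] by blast
 have "F p=0" if "R < norm (fst p)" for p
  using R(2)[of p] that norm_fst_le[of "fst p" "snd p"] by simp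
 with R(1) show thesis by (rule that)
qed

lemma integrable_phase_Cc:
 fixes F :: "'a::euclidean_space \<times> 'a => real"
 assumes F: "F\<in>Cc" and m: "m\<in>borel_measurable borel"
  and bd: "!!R. \<exists>C. \<forall>x. norm x<=R \<longrightarrow> \<bar>m x\<bar><=C"
 shows "integrable phaseM (%p. m (fst p) * F p)"
proof -
 obtain R where R: "R > 0" "!!p. R < norm (fst p) ==> F p=0" using Cc_support_fst[OF F] by blast
 obtain B where B: "B > 0" "!!p. \<bar>F p\<bar><=B" using Cc_bounded[OF F] by blast
 obtain C where C: "!!x. norm x<=R ==> \<bar>m x\<bar><=C" using bd[of R] by blast
 show ?thesis
 proof (rule integrable_phase_bounded[where C = "\<bar>C\<bar> * B" and R = R])
  fix p :: "'a \<times> 'a"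
  show "\<bar>m (fst p) * F p\<bar><=\<bar>C\<bar> * B"
  proof (cases "norm (fst p)<=R")
   case True
   have "\<bar>m (fst p)\<bar>*\<bar>F p\<bar><=\<bar>C\<bar> * B"
    using C[OF True] B(2)[of p] by (intro mult_mono) auto
   then show ?thesis by (simp add: abs_mult)
  qed (use R B in auto)
 next
  show "(%p. m (fst p) * F p)\<in>borel_measurable phaseM"
   by (intro borel_measurable_times measurable_phase_fst[OF m] measurable_phase[OF Cc_measurable[OF F]])
 qed (use R in auto)
qed

subsection \<open>Derivatives along measure preserving flows integrate to zero\<close>

text \<open>A vector field whose flow preserves the measure integrates derivatives to zero: the difference quotients along the flow have integral zero and converge dominatedly.\<close>

lemma integral_flow_derivative:
 fixes F :: "'a::euclidean_space \<times> 'a => real" and \<phi> :: "nat => 'a \<times> 'a => 'a \<times> 'a"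
 assumes F: "F\<in>Cc" and m: "m\<in>borel_measurable borel"
  and bd: "!!R. \<exists>C. \<forall>x. norm x<=R \<longrightarrow> \<bar>m x\<bar><=C"
  and \<phi>: "!!n. \<phi> n\<in>measurable phaseM phaseM" "!!n. distr phaseM phaseM (\<phi> n)=phaseM"
  and minv: "!!n p. m (fst (\<phi> n p))=m (fst p)"
  and s: "!!n. 0 < s n" "!!n. s n<=1" "s ----> 0"
  and K: "!!n p. p\<in>phase_space ==> norm (\<phi> n p-p)<=K * s n" "K \<ge> 0"
  and lim: "!!p. p\<in>phase_space ==> (%n. (\<phi> n p-p) /\<^sub>R s n) ----> A p"
  and A: "bounded_linear A"
 shows "(\<integral>p. m (fst p) * lin_field A F p\<partial>phaseM)=0"
proof -
 obtain R where R: "R > 0" "!!p. R < norm p ==> F p=0" using Cc_support[OF F] by blast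
 obtain L where L: "L > 0" "!!p q. \<bar>F q-F p\<bar><=L * norm (q-p)" using Cc_Lipschitz[OF F] by blast
 obtain T where T: "T > 0" "!!p v. \<bar>F (p+v)-F p-dderiv v F p\<bar><=T * (norm v)\<^sup>2"
  using Cc_taylor[OF F] by blast
 obtain C where C: "!!x. norm x<=R+K ==> \<bar>m x\<bar><=C" using bd[of "R+K"] by blast
 have C0: "C \<ge> 0" using C[of 0] R K(2) by simp
 let ?u = "%n p. m (fst p)*((F (\<phi> n p)-F p)/s n)"
 let ?w = "%p. (C * (L * K)) * indicator (cball 0 (R+K)) (fst p)"
 have Fm[measurable]: "F\<in>borel_measurable phaseM"
  using measurable_phase[OF Cc_measurable[OF F]] .
 have mm[measurable]: "(%p. m (fst p))\<in>borel_measurable phaseM"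
  by (rule measurable_phase_fst[OF m])
 have F\<phi>[measurable]: "(%p. F (\<phi> n p))\<in>borel_measurable phaseM" for n
  using measurable_compose[OF \<phi>(1) Fm] .
 have c: "(%n. \<integral>p. ?u n p\<partial>phaseM) ----> (\<integral>p. m (fst p) * lin_field A F p\<partial>phaseM)"
 proof (rule integral_dominated_convergence[where w = ?w])
  show "(%p. m (fst p) * lin_field A F p)\<in>borel_measurable phaseM"
   using measurable_phase[OF Cc_measurable[OF Cc_lin_field[OF F A]]] by measurable
  show "?u n\<in>borel_measurable phaseM" for n by measurable
  show "integrable phaseM ?w"
  proof (rule integrable_phase_bounded[where C = "C * (L * K)" and R = "R+K"])
   show "?w\<in>borel_measurable phaseM"
    by (intro borel_measurable_times borel_measurable_const measurable_phase_fst borel_measurable_indicator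
      borel_closed closed_cball)
  qed (use C0 L(1) K(2) in \<open>auto simp: indicator_def\<close>)
  show "AE p in phaseM. (%n. ?u n p) ----> m (fst p) * lin_field A F p"
  proof (rule AE_I2, rule tendsto_mult_left)
   fix p :: "'a \<times> 'a" assume "p\<in>space phaseM"
   then have p: "p\<in>phase_space" by (simp add: space_phase_measure)
   have bl: "bounded_linear (%v. dderiv v F p)"
    using Cc_has_derivative[OF F] has_derivative_bounded_linear by blast
   have "(%n. dderiv ((\<phi> n p-p) /\<^sub>R s n) F p) ----> dderiv (A p) F p"
    using bounded_linear.tendsto[OF bl lim[OF p]] .
   moreover have "(%n. (F (\<phi> n p)-F p)/s n-dderiv ((\<phi> n p-p) /\<^sub>R s n) F p) ----> 0"
   proof (rule Lim_null_comparison)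
    show "(%n. T * K\<^sup>2 * s n) ----> 0" using tendsto_mult_left[OF s(3), of "T * K\<^sup>2"] by simp
    show "\<forall>\<^sub>F n in sequentially. norm ((F (\<phi> n p)-F p)/s n-dderiv ((\<phi> n p-p) /\<^sub>R s n) F p)<=T * K\<^sup>2 * s n"
    proof (rule always_eventually, rule allI)
     fix n
     have "(F (\<phi> n p)-F p)/s n-dderiv ((\<phi> n p-p) /\<^sub>R s n) F p=(F (p+(\<phi> n p-p))-F p-dderiv (\<phi> n p-p) F p)/s n"
      using linear_cmul[OF bounded_linear.linear[OF bl]] by (simp add: divide_inverse right_diff_distrib mult.commute)
     also have "norm ...<=(T * (norm (\<phi> n p-p))\<^sup>2)/s n"
      using T(2)[of p "\<phi> n p-p"] s(1)[of n] by (simp add: divide_right_mono)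
     also have "...<=(T * (K * s n)\<^sup>2)/s n"
      using K(1)[OF p, of n] T(1) s(1)[of n] by (intro divide_right_mono mult_left_mono power_mono) auto
     also have "...=T * K\<^sup>2 * s n" using s(1)[of n] by (simp add: power2_eq_square)
     finally show "norm ((F (\<phi> n p)-F p)/s n-dderiv ((\<phi> n p-p) /\<^sub>R s n) F p)<=T * K\<^sup>2 * s n" .
    qed
   qed
   ultimately have "(%n. dderiv ((\<phi> n p-p) /\<^sub>R s n) F p+((F (\<phi> n p)-F p)/s n-dderiv ((\<phi> n p-p) /\<^sub>R s n) F p))
     ----> dderiv (A p) F p+0" by (rule tendsto_add)
   then show "(%n. (F (\<phi> n p)-F p)/s n) ----> lin_field A F p"
    unfolding lin_field_def by simp
  qed
  show "AE p in phaseM. norm (?u n p)<=?w p" for n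
  proof (rule AE_I2)
   fix p :: "'a \<times> 'a" assume "p\<in>space phaseM"
   then have p: "p\<in>phase_space" by (simp add: space_phase_measure)
   have Kn: "norm (\<phi> n p-p)<=K"
    using K(1)[OF p, of n] mult_left_mono[OF s(2)[of n] K(2)] by simp
   show "norm (?u n p)<=?w p"
   proof (cases "norm (fst p)<=R+K")
    case True
    have "\<bar>F (\<phi> n p)-F p\<bar><=L * (K * s n)"
     using order_trans[OF L(2)[of "\<phi> n p" p] mult_left_mono[OF K(1)[OF p, of n] less_imp_le[OF L(1)]]] .
    then have "\<bar>(F (\<phi> n p)-F p)/s n\<bar><=L * K" using s(1)[of n] by (simp add: field_simps)
    then have "\<bar>m (fst p)\<bar>*\<bar>(F (\<phi> n p)-F p)/s n\<bar><=C * (L * K)"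
     using C[OF True] C0 by (intro mult_mono) auto
    then show ?thesis using True by (simp add: abs_mult)
   next
    case False
    then have np: "norm p > R+K" using norm_fst_le[of "fst p" "snd p"] by simp
    then have "norm (\<phi> n p) > R" using Kn norm_triangle_ineq2[of p "p-\<phi> n p"] by (simp add: norm_minus_commute)
    then show ?thesis using np R(2) K(2) False by simp
   qed
  qed
 qed
 have z: "(\<integral>p. ?u n p\<partial>phaseM)=0" for n
 proof -
  have i: "integrable phaseM (%p. m (fst p) * F p)" by (rule integrable_phase_Cc[OF F m bd])
  have i2: "integrable phaseM (%p. m (fst p) * F (\<phi> n p))"
   using integrable_distr[OF \<phi>(1)[of n], of "%p. m (fst p) * F p"] i \<phi>(2)[of n] by (simp add: minv)
  have "(\<integral>p. m (fst p) * F p\<partial>phaseM)=(\<integral>p. m (fst (\<phi> n p)) * F (\<phi> n p)\<partial>phaseM)"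
   using integral_distr[OF \<phi>(1)[of n], of "%p. m (fst p) * F p"] \<phi>(2)[of n] by simp
  then have "(\<integral>p. m (fst p) * F (\<phi> n p)-m (fst p) * F p\<partial>phaseM)=0"
   using i i2 by (simp add: minv)
  then have "(\<integral>p. (m (fst p) * F (\<phi> n p)-m (fst p) * F p)/s n\<partial>phaseM)=0" by simp
  then show ?thesis by (simp add: right_diff_distrib diff_divide_distrib)
 qed
 show ?thesis using c unfolding z by (simp add: LIMSEQ_const_iff)
qed

text \<open>The generator of the rotations in the plane of \<open>b\<close> and \<open>b'\<close>.\<close>

definition rot_gen :: "'a::euclidean_space => 'a => 'a => 'a" where
 "rot_gen b b' y=(y\<bullet>b) *\<^sub>R b'-(y\<bullet>b') *\<^sub>R b"

definition rot :: "'a::euclidean_space => 'a => real => 'a => 'a" where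
 "rot b b' t y=y+((cos t-1)*(y\<bullet>b)-sin t * (y\<bullet>b')) *\<^sub>R b
  + (sin t * (y\<bullet>b)+(cos t-1)*(y\<bullet>b')) *\<^sub>R b'"

lemma linear_rot: "linear (rot b b' t)"
 by (rule linearI) (simp_all add: rot_def inner_add_left algebra_simps)

lemma linear_rot_gen: "linear (rot_gen b b')"
 by (rule linearI) (simp_all add: rot_gen_def inner_add_left algebra_simps)

lemma norm_rot:
 fixes y :: "'a::euclidean_space"
 assumes b: "b\<in>Basis" "b'\<in>Basis" "b \<noteq> b'"
 shows "norm (rot b b' t y)=norm y"
proof -
 define a c u v where "a=y\<bullet>b" and "c=y\<bullet>b'" and "u=(cos t-1) * a-sin t * c"
  and "v=sin t * a+(cos t-1) * c"
 have r: "rot b b' t y=y+u *\<^sub>R b+v *\<^sub>R b'" by (simp add: rot_def a_def c_def u_def v_def)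
 have i: "b\<bullet>b=1" "b'\<bullet>b'=1" "b\<bullet>b'=0" "b'\<bullet>b=0" "b\<bullet>y=a" "b'\<bullet>y=c" "y\<bullet>b=a" "y\<bullet>b'=c"
  using b by (auto simp: inner_Basis a_def c_def inner_commute)
 have sc: "sin t * sin t+cos t * cos t=1" using sin_cos_squared_add[of t] by (simp add: power2_eq_square)
 have "rot b b' t y\<bullet>rot b b' t y=y\<bullet>y+(u * u+v * v+2 * u * a+2 * v * c)"
  unfolding r by (simp add: inner_add_left inner_add_right i algebra_simps)
 also have "u * u+v * v+2 * u * a+2 * v * c=0"
  unfolding u_def v_def using sc by algebra
 finally show ?thesis by (simp add: norm_eq_sqrt_inner)
qed

lemma rot_bound:
 fixes y :: "'a::euclidean_space"
 assumes b: "b\<in>Basis" "b'\<in>Basis" and y: "norm y=1" and t: "t > 0"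
 shows "norm (rot b b' t y-y)<=4 * t"
proof -
 have s: "\<bar>sin t\<bar><=t" using abs_sin_x_le_abs_x[of t] t by simp
 have c: "\<bar>cos t-1\<bar><=t"
 proof -
  have "cos t=1-2*(sin (t/2))\<^sup>2" using cos_double_sin[of "t/2"] by simp
  then have "\<bar>cos t-1\<bar>=2*(\<bar>sin (t/2)\<bar>*\<bar>sin (t/2)\<bar>)" by (simp add: power2_eq_square abs_mult)
  also have "...<=2*(\<bar>t/2\<bar>*1)"
   by (intro mult_left_mono mult_mono abs_sin_x_le_abs_x abs_sin_le_one) auto
  finally show ?thesis using t by simp
 qed
 have yb: "\<bar>y\<bullet>b\<bar><=1" "\<bar>y\<bullet>b'\<bar><=1" using Basis_le_norm[OF b(1), of y] Basis_le_norm[OF b(2), of y] y by auto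
 have p: "\<bar>x * z\<bar><=t" if "\<bar>x\<bar><=t" "\<bar>z\<bar><=1" for x z :: real
  using mult_mono[OF that] t by (simp add: abs_mult)
 have "norm (rot b b' t y-y)<=norm (((cos t-1)*(y\<bullet>b)-sin t * (y\<bullet>b')) *\<^sub>R b)
   + norm ((sin t * (y\<bullet>b)+(cos t-1)*(y\<bullet>b')) *\<^sub>R b')"
  unfolding rot_def using norm_triangle_ineq by (metis (no_types, opaque_lifting) add.assoc add_diff_cancel_left')
 also have "...=\<bar>(cos t-1)*(y\<bullet>b)-sin t * (y\<bullet>b')\<bar>+\<bar>sin t * (y\<bullet>b)+(cos t-1)*(y\<bullet>b')\<bar>"
  using b by simp
 also have "...<=4 * t"
  using p[OF c yb(1)] p[OF s yb(2)] p[OF s yb(1)] p[OF c yb(2)] by linarith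
 finally show ?thesis .
qed

lemma tendsto_sin_quotient: "s ----> 0 ==> (!!n. s n > (0::real)) ==> (%n. sin (s n)/s n) ----> 1"
 and tendsto_cos_quotient: "s ----> 0 ==> (!!n. s n > (0::real)) ==> (%n. (cos (s n)-1)/s n) ----> 0"
proof -
 assume s: "s ----> 0" "!!n. s n > 0"
 have f: "filterlim s (at 0) sequentially"
  using s by (auto simp: filterlim_at less_imp_neq[symmetric] always_eventually)
 have "((%h. (sin (0+h)-sin 0)/h) \<longlongrightarrow> cos 0) (at (0::real))"
  using DERIV_sin[of "0::real"] unfolding DERIV_def .
 from filterlim_compose[OF this f] show "(%n. sin (s n)/s n) ----> 1" by simp
 have "((%h. (cos (0+h)-cos 0)/h) \<longlongrightarrow>-sin 0) (at (0::real))"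
  using DERIV_cos[of "0::real"] unfolding DERIV_def .
 from filterlim_compose[OF this f] show "(%n. (cos (s n)-1)/s n) ----> 0" by simp
qed

definition rot_field :: "'a::euclidean_space => 'a => 'a \<times> 'a => 'a \<times> 'a" where
 "rot_field b b' p=(0, rot_gen b b' (snd p))"

definition transport_field :: "'a::euclidean_space \<times> 'a => 'a \<times> 'a" where
 "transport_field p=(snd p, 0)"

lemma bounded_linear_rot_field: "bounded_linear (rot_field b b')"
proof -
 have "linear (rot_field b b')"
  by (rule linearI) (simp_all add: rot_field_def linear_add[OF linear_rot_gen] linear_cmul[OF linear_rot_gen])
 then show ?thesis by (simp add: linear_conv_bounded_linear)
qed

lemma bounded_linear_transport_field: "bounded_linear transport_field"
proof -
 have "linear (transport_field :: 'a \<times> 'a => 'a \<times> 'a)" by (rule linearI) (simp_all add: transport_field_def)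
 then show ?thesis by (simp add: linear_conv_bounded_linear)
qed

lemma step_sequence: "0 < 1/real (Suc n)" "1/real (Suc n)<=1" "(%n. 1/real (Suc n)) ----> 0"
 using LIMSEQ_inverse_real_of_nat by (auto simp: inverse_eq_divide)

lemma integral_rot_field:
 fixes F :: "'a::euclidean_space \<times> 'a => real"
 assumes F: "F\<in>Cc" and m: "m\<in>borel_measurable borel"
  and bd: "!!R. \<exists>C. \<forall>x. norm x<=R \<longrightarrow> \<bar>m x\<bar><=C"
  and b: "b\<in>Basis" "b'\<in>Basis"
 shows "(\<integral>p. m (fst p) * lin_field (rot_field b b') F p\<partial>phaseM)=0"
proof (cases "b=b'")
 case True
 have "rot_field b b' p=0" for p :: "'a \<times> 'a" by (simp add: rot_field_def rot_gen_def True zero_prod_def)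
 moreover have "dderiv 0 F p=0" for p
  using linear_0[OF dderiv_linear[OF smooth_on_differentiable[OF Cc_smooth[OF F] UNIV_I]]] .
 ultimately show ?thesis by (simp add: lin_field_def)
next
 case False
 let ?s = "%n. 1/real (Suc n)"
 let ?\<phi> = "%n (x, y). (x, rot b b' (?s n) y)"
 note iso = norm_rot[OF b False]
 show ?thesis
 proof (rule integral_flow_derivative[OF F m bd, where \<phi> = ?\<phi> and s = ?s and K = 4])
  note R = sphere_measure_isometry[OF linear_rot iso]
  show "?\<phi> n\<in>measurable phaseM phaseM" for n
   unfolding split_beta' by (intro measurable_Pair measurable_fst measurable_compose[OF measurable_snd R(1)])
  have "distr (lborel \<Otimes>\<^sub>M sphere_measure) (lborel \<Otimes>\<^sub>M sphere_measure) (?\<phi> n)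
    = distr lborel lborel (%x. x) \<Otimes>\<^sub>M distr sphere_measure sphere_measure (rot b b' (?s n))" for n
   by (rule pair_measure_distr[symmetric])
     (use R(1) in \<open>simp_all add: R(2) sphere_measure.sigma_finite_measure_axioms\<close>)
  then show "distr phaseM phaseM (?\<phi> n)=phaseM" for n
   by (simp add: R(2))
  show "norm (?\<phi> n p-p)<=4*?s n" if "p\<in>phase_space" for n p
   using that rot_bound[OF b, of "snd p" "?s n"] by (auto simp: phase_space_def norm_Pair)
  show "(%n. (?\<phi> n p-p) /\<^sub>R ?s n) ----> rot_field b b' p" if "p\<in>phase_space" for p
  proof -
   obtain x y where p: "p=(x, y)" by (cases p)
   have c: "(%n. (cos (?s n)-1)/?s n) ----> 0" and s: "(%n. sin (?s n)/?s n) ----> 1"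
    using tendsto_cos_quotient[OF step_sequence(3,1)] tendsto_sin_quotient[OF step_sequence(3,1)] by auto
   have "(%n. (x-x, ((cos (?s n)-1)/?s n * (y\<bullet>b)-sin (?s n)/?s n * (y\<bullet>b')) *\<^sub>R b
     + (sin (?s n)/?s n * (y\<bullet>b)+(cos (?s n)-1)/?s n * (y\<bullet>b')) *\<^sub>R b'))
     ----> (x-x, (0*(y\<bullet>b)-1*(y\<bullet>b')) *\<^sub>R b+(1*(y\<bullet>b)+0*(y\<bullet>b')) *\<^sub>R b')"
    by (intro tendsto_intros c s)
   moreover have "(?\<phi> n p-p) /\<^sub>R ?s n=(x-x, ((cos (?s n)-1)/?s n * (y\<bullet>b)-sin (?s n)/?s n * (y\<bullet>b')) *\<^sub>R b
     + (sin (?s n)/?s n * (y\<bullet>b)+(cos (?s n)-1)/?s n * (y\<bullet>b')) *\<^sub>R b')" for n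
    unfolding p by (simp add: rot_def algebra_simps scaleR_add_right[symmetric])
   ultimately show ?thesis by (simp add: p rot_field_def rot_gen_def)
  qed
 qed (use step_sequence bounded_linear_rot_field in auto)
qed

lemma phase_measure_transport:
 fixes s :: real
 shows "(%p. (fst p+s *\<^sub>R snd p, snd p))\<in>measurable (phaseM :: ('a::euclidean_space \<times> 'a) measure) phaseM"
  and "distr phaseM phaseM (%p. (fst p+s *\<^sub>R snd p, snd p))=(phaseM :: ('a \<times> 'a) measure)"
proof -
 let ?\<phi> = "%p :: 'a \<times> 'a. (fst p+s *\<^sub>R snd p, snd p)"
 have f: "fst\<in>measurable (phaseM :: ('a \<times> 'a) measure) borel"
  using measurable_fst[of lborel "sphere_measure :: 'a measure"] by simp
 have g: "snd\<in>measurable (phaseM :: ('a \<times> 'a) measure) borel"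
  using measurable_compose[OF measurable_snd measurable_sphere_id] .
 have st: "(%p. fst p+s *\<^sub>R snd p)\<in>measurable (phaseM :: ('a \<times> 'a) measure) lborel"
  using f g by simp
 show \<phi>m: "?\<phi>\<in>measurable phaseM phaseM"
  by (rule measurable_Pair[OF _ measurable_snd]) (use st in \<open>simp add: o_def\<close>)
 show "distr phaseM phaseM ?\<phi>=phaseM"
 proof (rule measure_eqI)
  fix A assume "A\<in>sets (distr phaseM phaseM ?\<phi>)"
  then have A: "A\<in>sets (phaseM :: ('a \<times> 'a) measure)" by simp
  let ?A = "?\<phi> -` A \<inter> space (phaseM :: ('a \<times> 'a) measure)"
  have A': "?A\<in>sets (phaseM :: ('a \<times> 'a) measure)" using measurable_sets[OF \<phi>m A] .
  have "emeasure (distr phaseM phaseM ?\<phi>) A=emeasure phaseM ?A"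
   by (rule emeasure_distr[OF \<phi>m A])
  also have "...=(\<integral>\<^sup>+y. emeasure lborel ((%x. (x, y)) -` ?A)\<partial>sphere_measure)"
   by (rule phase.emeasure_pair_measure_alt2[OF A'])
  also have "...=(\<integral>\<^sup>+y. emeasure lborel ((%x. (x, y)) -` A)\<partial>sphere_measure)"
  proof (rule nn_integral_cong)
   fix y :: 'a assume y: "y\<in>space sphere_measure"
   have As: "(%x. (x, y)) -` A\<in>sets borel" using sets_Pair2[OF A, of y] by simp
   have "(%x. (x, y)) -` ?A=(+) (s *\<^sub>R y) -` ((%x. (x, y)) -` A)"
    using y by (auto simp: space_pair_measure add.commute)
   then have "emeasure lborel ((%x. (x, y)) -` ?A)=emeasure (distr lborel borel ((+) (s *\<^sub>R y))) ((%x. (x, y)) -` A)"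
    using As by (simp add: emeasure_distr)
   then show "emeasure lborel ((%x. (x, y)) -` ?A)=emeasure lborel ((%x. (x, y)) -` A)"
    by (simp add: lborel_distr_plus)
  qed
  also have "...=emeasure phaseM A"
   by (rule phase.emeasure_pair_measure_alt2[OF A, symmetric])
  finally show "emeasure (distr phaseM phaseM ?\<phi>) A=emeasure phaseM A" .
 qed simp
qed

lemma integral_transport_field:
 fixes F :: "'a::euclidean_space \<times> 'a => real"
 assumes F: "F\<in>Cc"
 shows "(\<integral>p. lin_field transport_field F p\<partial>phaseM)=0"
proof -
 let ?s = "%n. 1/real (Suc n)"
 let ?\<phi> = "%n (p :: 'a \<times> 'a). (fst p+?s n *\<^sub>R snd p, snd p)"
 have "(\<integral>p. 1 * lin_field transport_field F p\<partial>phaseM)=0"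
 proof (rule integral_flow_derivative[OF F, where \<phi> = ?\<phi> and s = ?s and K = 1])
  show "norm (?\<phi> n p-p)<=1*?s n" if "p\<in>phase_space" for n p
   using that by (cases p) (auto simp: phase_space_def norm_Pair)
  show "(%n. (?\<phi> n p-p) /\<^sub>R ?s n) ----> transport_field p" if "p\<in>phase_space" for p
  proof -
   have "(?\<phi> n p-p) /\<^sub>R ?s n=transport_field p" for n
    by (cases p) (simp add: transport_field_def)
   then show ?thesis by simp
  qed
 qed (use step_sequence bounded_linear_transport_field phase_measure_transport in \<open>auto intro: exI[of _ 1]\<close>)
 then show ?thesis by simp
qed

section \<open>Density of tensor products\<close>

inductive exp_sum :: "('a::euclidean_space => real) => bool" where
 exp_sum_base: "exp_sum (%p. c * exp (w\<bullet>p))"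
| exp_sum_add: "exp_sum f ==> exp_sum g ==> exp_sum (%p. f p+g p)"

lemma exp_sum_mult: "exp_sum f ==> exp_sum g ==> exp_sum (%p. f p * g p)"
proof (induction rule: exp_sum.induct)
 case (exp_sum_base c w)
 from exp_sum_base show ?case
 proof (induction rule: exp_sum.induct)
  case (exp_sum_base d u)
  have "(%p. c * exp (w\<bullet>p)*(d * exp (u\<bullet>p)))=(%p. (c * d) * exp ((w+u)\<bullet>p))"
   by (simp add: fun_eq_iff inner_add_left exp_add)
  then show ?case using exp_sum.exp_sum_base by metis
 next
  case (exp_sum_add f g)
  then show ?case using exp_sum.exp_sum_add[OF exp_sum_add.IH] by (simp add: distrib_left)
 qed
next
 case (exp_sum_add f h)
 then show ?case using exp_sum.exp_sum_add[of "%p. f p * g p" "%p. h p * g p"] by (simp add: distrib_right)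
qed

lemma exp_sum_continuous: "exp_sum f ==> continuous_on A f"
 by (induction rule: exp_sum.induct) (auto intro!: continuous_intros)

lemma exp_sum_approximation:
 fixes h :: "'a::euclidean_space => real"
 assumes "compact K" "continuous_on K h" "e > 0"
 obtains g where "exp_sum g" "!!p. p\<in>K ==> \<bar>h p-g p\<bar> < e"
proof -
 interpret function_ring_on "Collect exp_sum" K
 proof
  show "(%_. c)\<in>Collect exp_sum" for c
   using exp_sum_base[of c 0] by simp
  show "\<exists>f\<in>Collect exp_sum. f p \<noteq> f q" if "p\<in>K" "q\<in>K" "p \<noteq> q" for p q
  proof (rule bexI)
   have "(p-q)\<bullet>(p-q) \<noteq> 0" using that by simp
   then have "(p-q)\<bullet>p \<noteq> (p-q)\<bullet>q" by (simp add: inner_diff_right)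
   then show "1 * exp ((p-q)\<bullet>p) \<noteq> 1 * exp ((p-q)\<bullet>q)" by simp
   show "(%z. 1 * exp ((p-q)\<bullet>z))\<in>Collect exp_sum" using exp_sum_base by blast
  qed
 qed (use assms in \<open>auto intro: exp_sum_add exp_sum_mult exp_sum_continuous\<close>)
 show thesis using Stone_Weierstrass_basic[OF assms(2,3)] that by blast
qed

definition phase_retract :: "'a::euclidean_space \<times> 'a => 'a \<times> 'a" where
 "phase_retract p=(fst p, if snd p=0 then (SOME b. b\<in>Basis) else sgn (snd p))"

lemma phase_retract_measurable: "phase_retract\<in>measurable borel (phaseM :: ('a::euclidean_space \<times> 'a) measure)"
proof -
 have "(%y::'a. if y=0 then (SOME b. b\<in>Basis) else sgn y)\<in>measurable borel (restrict_space borel (sphere 0 1))"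
  by (rule measurable_restrict_space2) (auto simp: norm_sgn SOME_Basis)
 then have s: "(%y::'a. if y=0 then (SOME b. b\<in>Basis) else sgn y)\<in>measurable borel sphere_measure"
  using measurable_cong_sets[OF refl sets_sphere_measure] by blast
 have f: "fst\<in>measurable (borel :: ('a \<times> 'a) measure) lborel" by (simp add: borel_prod[symmetric])
 have g: "snd\<in>measurable (borel :: ('a \<times> 'a) measure) borel" by (simp add: borel_prod[symmetric])
 show ?thesis unfolding phase_retract_def
  using measurable_Pair[OF f measurable_compose[OF g s]] by simp
qed

lemma phase_retract_id: "p\<in>phase_space ==> phase_retract p=p"
 by (cases p) (auto simp: phase_space_def phase_retract_def sgn_div_norm)

lemma l2_norm_indicator:
 assumes "A\<in>sets M" shows "l2_norm M (%p. c * indicator A p)=\<bar>c\<bar> * sqrt (measure M A)"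
proof -
 have "(%p. (indicator A p :: real)\<^sup>2)=indicator A" by (auto simp: indicator_def)
 then have "l2_norm M (indicator A)=sqrt (measure M A)"
  using assms by (simp add: l2_norm_def sets.Int_space_eq2 Int_absorb1 sets.sets_into_space Int_commute)
 then show ?thesis by (simp add: l2_norm_cmult)
qed

text \<open>Approximation of indicators by compact sets from inside, which leads from continuous to square-integrable functions.\<close>

lemma inner_regular_approx:
 fixes Q :: "'a::{second_countable_topology, complete_space} measure"
 assumes "finite_measure Q" "sets Q=sets borel" "B\<in>sets borel" "e > 0"
 obtains K where "compact K" "K \<subseteq> B" "measure Q (B-K) < e"
proof -
 interpret finite_measure Q by fact
 have "\<exists>K. compact K \<and> K \<subseteq> B \<and> measure Q B < measure Q K+e"
 proof (rule ccontr)
  assume nex: "\<nexists>K. compact K \<and> K \<subseteq> B \<and> measure Q B < measure Q K+e"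
  have *: "measure Q K<=measure Q B-e" if "compact K" "K \<subseteq> B" for K
  proof (rule ccontr)
   assume "\<not> measure Q K<=measure Q B-e"
   then have "measure Q B < measure Q K+e" by simp
   with nex that show False by blast
  qed
  have "emeasure Q B=(SUP K\<in>{K. K \<subseteq> B \<and> compact K}. emeasure Q K)"
   using assms(2,3) by (intro inner_regular) (auto simp: emeasure_eq_measure)
  also have "...<=ennreal (measure Q B-e)"
  proof (rule SUP_least)
   fix K assume "K\<in>{K. K \<subseteq> B \<and> compact K}"
   then show "emeasure Q K<=ennreal (measure Q B-e)"
    unfolding emeasure_eq_measure by (intro ennreal_leI *) auto
  qed
  finally have "ennreal (measure Q B)<=ennreal (measure Q B-e)" by (simp only: emeasure_eq_measure)
  moreover have "0<=measure Q B-e" using *[of "{}"] by simp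
  ultimately have "measure Q B<=measure Q B-e" by (simp only: ennreal_le_iff)
  then show False using assms(4) by simp
 qed
 then obtain K where K: "compact K" "K \<subseteq> B" "measure Q B < measure Q K+e" by blast
 have "K\<in>sets Q" using K(1) assms(2) by (simp add: compact_imp_closed borel_closed)
 then have "measure Q (B-K)=measure Q B-measure Q K"
  using K(2) assms(2,3) by (intro finite_measure_Diff) auto
 then show thesis using that K by simp
qed

text \<open>A closed subspace of \<open>L2\<close> that contains the products of test functions of \<open>x\<close> with exponentials of
  \<open>\<omega>\<close> is everything: the Stone-Weierstrass theorem gives the continuous functions of bounded support in \<open>x\<close>,
  inner regularity the indicators of bounded Borel sets, and truncation the rest.\<close>

theorem tensor_dense:
 fixes M :: "('a::euclidean_space \<times> 'a) measure" and G :: "('a \<times> 'a => real) set"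
 assumes sets: "sets M=sets phaseM"
  and fin: "!!R. emeasure M (cball 0 R \<times> sphere 0 1) < \<infinity>"
  and G: "G \<subseteq> L2 M"
  and add: "!!f g. f\<in>G ==> g\<in>G ==> (%p. f p+g p)\<in>G"
  and cmult: "!!f c. f\<in>G ==> (%p. c * f p)\<in>G"
  and closed: "!!f. f\<in>L2 M ==> (!!e. e > 0 ==> \<exists>g\<in>G. l2_norm M (%p. f p-g p) < e) ==> f\<in>G"
  and tensor: "!!a v. a\<in>Cc ==> (%p. a (fst p) * exp (v\<bullet>snd p))\<in>G"
  and h: "h\<in>L2 M"
 shows "h\<in>G"
proof -
 let ?K = "%R. cball 0 R \<times> sphere 0 1 :: ('a \<times> 'a) set"
 have space: "space M=phase_space" using sets_eq_imp_space_eq[OF sets] by (simp add: space_phase_measure)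
 have meas: "f\<in>borel_measurable M" if "f\<in>borel_measurable borel" for f :: "'a \<times> 'a => real"
  using measurable_phase[OF that] measurable_cong_sets[OF sets refl] by blast
 have Kset: "?K R\<in>sets M" for R
 proof -
  have "sphere 0 1\<in>sets (sphere_measure :: 'a measure)"
   using sets.top[of "sphere_measure :: 'a measure"] by (simp add: space_sphere_measure)
  then show ?thesis unfolding sets by (intro pair_measureI) auto
 qed
 have Kspace: "p\<in>?K R \<longleftrightarrow> norm (fst p)<=R" if "p\<in>space M" for p R
  using that by (auto simp: space phase_space_def)
 have zero: "(%_. 0)\<in>G" using cmult[OF tensor[OF Cc_0], of 0] by simp
 have sum: "(%p. \<Sum>i\<in>I. f i p)\<in>G" if "!!i. i\<in>I ==> f i\<in>G" "finite I" for f :: "real => 'a \<times> 'a => real" and I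
  using that(2,1) by (induction I rule: finite_induct) (auto intro: zero add)
 have indK: "(%p. c * indicator (?K R) p)\<in>L2 M" for c R
 proof -
  have "(%p. (indicator (?K R) p :: real)\<^sup>2)=indicator (?K R)" by (auto simp: indicator_def)
  then have "indicator (?K R)\<in>L2 M" unfolding L2_def using Kset[of R] fin[of R] by simp
  then show ?thesis by (rule L2_cmult)
 qed
 have L2bd: "f\<in>L2 M" if "f\<in>borel_measurable M" "!!p. p\<in>space M ==> \<bar>f p\<bar><=c * indicator (?K R) p" for f c R
  by (rule L2_bounded_by[OF that(1) indK[of c R]]) (rule AE_I2, rule order_trans[OF that(2) abs_ge_self])
 have normbd: "l2_norm M f<=c * sqrt (measure M (?K R))"
  if "f\<in>borel_measurable M" "!!p. p\<in>space M ==> \<bar>f p\<bar><=c * indicator (?K R) p" "c \<ge> 0" for f c R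
 proof -
  have "l2_norm M f<=l2_norm M (%p. c * indicator (?K R) p)"
   by (rule l2_norm_mono[OF that(1) indK]) (rule AE_I2, rule order_trans[OF that(2) abs_ge_self])
  then show ?thesis using that(3) l2_norm_indicator[OF Kset] by simp
 qed
 have expG: "(%p. cutoff R (fst p) * f p)\<in>G" if "exp_sum f" "R > 0" for f R
  using that(1)
 proof (induction rule: exp_sum.induct)
  case (exp_sum_base c w)
  obtain u v where w: "w=(u, v)" by (cases w)
  have "smooth_on UNIV (%x::'a. exp (x\<bullet>u))"
   by (intro smooth_on_exp smooth_on_linear bounded_linear_inner_left open_UNIV)
  from Cc_mult[OF this cutoff_Cc[OF that(2)]] have "(%x. exp (x\<bullet>u) * cutoff R x)\<in>Cc" .
  from cmult[OF tensor[OF this, of v], of c] show ?case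
   unfolding w by (simp add: inner_Pair_0 inner_prod_def exp_add inner_commute mult_ac)
 next
  case (exp_sum_add f g)
  then show ?case using add by (simp add: distrib_left)
 qed
 have contG: "h\<in>G" if cont: "continuous_on UNIV h" and supp: "!!p. norm (fst p) > R ==> h p=0" and R: "R > 0" for h R
 proof (rule closed)
  have hm: "h\<in>borel_measurable M" using cont by (intro meas borel_measurable_continuous_onI)
  have comp: "compact (?K (2 * R))" by (intro compact_Times) auto
  have "bounded (h ` ?K (2 * R))"
   using cont by (intro compact_imp_bounded compact_continuous_image comp) (auto intro: continuous_on_subset)
  then obtain c where c: "\<forall>y\<in>h ` ?K (2 * R). norm y<=c" using bounded_iff by blast
  show "h\<in>L2 M"
  proof (rule L2bd[OF hm, where c = c and R = "2 * R"])
   fix p assume p: "p\<in>space M"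
   show "\<bar>h p\<bar><=c * indicator (?K (2 * R)) p"
    using c supp[of p] R Kspace[OF p, of "2 * R"] by (cases "p\<in>?K (2 * R)") auto
  qed
  fix e :: real assume e: "e > 0"
  define d where "d=e/(sqrt (measure M (?K (2 * R)))+1)"
  have sq: "sqrt (measure M (?K (2 * R)))+1 > 0" by (simp add: add_nonneg_pos)
  have d: "d > 0" using e sq by (simp add: d_def)
  obtain g where g: "exp_sum g" "!!p. p\<in>?K (2 * R) ==> \<bar>h p-g p\<bar> < d"
   using exp_sum_approximation[OF comp continuous_on_subset[OF cont subset_UNIV] d] by blast
  have "l2_norm M (%p. h p-cutoff R (fst p) * g p)<=d * sqrt (measure M (?K (2 * R)))"
  proof (rule normbd)
   show "(%p. h p-cutoff R (fst p) * g p)\<in>borel_measurable M"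
    using hm expG[OF g(1) R] G L2_meas by (intro borel_measurable_diff) auto
   fix p assume p: "p\<in>space M"
   show "\<bar>h p-cutoff R (fst p) * g p\<bar><=d * indicator (?K (2 * R)) p"
   proof (cases "norm (fst p)<=2 * R")
    case True
    have hc: "h p=cutoff R (fst p) * h p" using supp[of p] cutoff_eq_1[OF R, of "fst p"] by (cases "norm (fst p)<=R") auto
    have "\<bar>h p-cutoff R (fst p) * g p\<bar>=cutoff R (fst p)*\<bar>h p-g p\<bar>"
     by (subst hc) (simp add: right_diff_distrib[symmetric] abs_mult cutoff_bounds)
    also have "...<=1 * d"
     using g(2)[of p] True Kspace[OF p] by (intro mult_mono cutoff_bounds) auto
    finally show ?thesis using True Kspace[OF p] by simp
   next
    case False
    then show ?thesis using supp[of p] cutoff_eq_0[OF R, of "fst p"] R Kspace[OF p] by auto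
   qed
  qed (use d in simp)
  also have "... < d * (sqrt (measure M (?K (2 * R)))+1)" using d by simp
  also have "...=e" using sq by (simp add: d_def)
  finally show "\<exists>g\<in>G. l2_norm M (%p. h p-g p) < e" by (rule bexI[OF _ expG[OF g(1) R]])
 qed
 have indG: "indicator A\<in>G" if A: "A\<in>sets M" and AR: "!!p. p\<in>A ==> norm (fst p)<=R" and R: "R > 0" for A R
 proof (rule closed)
  have Asp: "A \<subseteq> phase_space" using sets.sets_into_space[OF A] space by simp
  show "indicator A\<in>L2 M"
   by (rule L2bd[where c = 1 and R = R]) (use A AR Kspace in \<open>auto simp: indicator_def\<close>)
  fix e :: real assume e: "e > 0"
  define A' where "A'=phase_retract -` A"
  have A'[measurable]: "A'\<in>sets borel"
   unfolding A'_def using measurable_sets_borel[of phase_retract phaseM A] phase_retract_measurable A sets by simp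
  have A'A: "p\<in>A' \<longleftrightarrow> p\<in>A" if "p\<in>phase_space" for p using phase_retract_id[OF that] by (simp add: A'_def)
  define Q where "Q=distr (density M (indicator (?K (2 * R)))) borel (%p. p)"
  have idm: "(%p. p)\<in>measurable (density M (indicator (?K (2 * R)))) borel"
   using measurable_phase_id measurable_cong_sets[OF sets refl] by auto
  have Qe: "emeasure Q B=emeasure M (?K (2 * R) \<inter> B)" if "B\<in>sets borel" for B
  proof -
   have Bs: "B \<inter> space M\<in>sets M"
    using measurable_sets[OF idm that] by simp
   have "emeasure Q B=emeasure (density M (indicator (?K (2 * R)))) (B \<inter> space M)"
    unfolding Q_def using emeasure_distr[OF idm that] by simp
   also have "...=emeasure M (?K (2 * R) \<inter> (B \<inter> space M))"
    by (rule emeasure_restricted[OF Kset Bs])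
   also have "?K (2 * R) \<inter> (B \<inter> space M)=?K (2 * R) \<inter> B" using sets.sets_into_space[OF Kset[of "2 * R"]] by blast
   finally show ?thesis .
  qed
  have Qs: "sets Q=sets borel" by (simp add: Q_def)
  have Qfin: "finite_measure Q"
  proof (rule finite_measureI)
   have "emeasure Q UNIV < \<infinity>" using Qe[of UNIV] fin[of "2 * R"] by simp
   then show "emeasure Q (space Q) \<noteq> \<infinity>" by (simp add: Q_def)
  qed
  define d where "d=e\<^sup>2/3"
  have d: "d > 0" using e by (simp add: d_def)
  obtain K1 where K1: "compact K1" "K1 \<subseteq> A'" "measure Q (A'-K1) < d"
   using inner_regular_approx[OF Qfin Qs A' d] by blast
  obtain K2 where K2: "compact K2" "K2 \<subseteq>-A'" "measure Q (- A'-K2) < d"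
   using inner_regular_approx[OF Qfin Qs _ d, of "- A'"] A' by auto
  have "K1 \<inter> K2={}" using K1(2) K2(2) by blast
  then obtain g :: "'a \<times> 'a => real" where g: "continuous_on UNIV g" "!!p. g p\<in>closed_segment 1 0"
   "!!p. p\<in>K1 ==> g p=1" "!!p. p\<in>K2 ==> g p=0"
   using Urysohn[OF compact_imp_closed[OF K1(1)] compact_imp_closed[OF K2(1)], of 1 0] by metis
  have g01: "0<=g p" "g p<=1" for p using g(2)[of p] by (auto simp: closed_segment_eq_real_ivl)
  define u where "u p=cutoff R (fst p) * g p" for p
  have ucont: "continuous_on UNIV u" unfolding u_def
   by (intro continuous_on_mult g(1) continuous_on_compose2[OF Cc_continuous[OF cutoff_Cc[OF R]]] continuous_on_fst continuous_on_id) auto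
  have u: "u\<in>G"
   by (rule contG[OF ucont, of "2 * R"]) (use R in \<open>auto simp: u_def cutoff_eq_0\<close>)
  define E where "E=?K (2 * R) \<inter> (- (K1 \<union> K2))"
  have K12: "K1\<in>sets borel" "K2\<in>sets borel"
   using K1(1) K2(1) by (auto intro: borel_closed compact_imp_closed)
  have AK: "A'-K1\<in>sets Q" "- A'-K2\<in>sets Q"
   unfolding Qs by (intro sets.Diff A' K12 borel_comp)+
  have KK: "- (K1 \<union> K2)\<in>sets borel" 
   by (rule borel_comp) (intro borel_closed compact_imp_closed compact_Un K1(1) K2(1))
  have Es: "E\<in>sets M"
  proof -
   have "?K (2 * R) \<inter> ((- (K1 \<union> K2)) \<inter> space M)\<in>sets M"
    using measurable_sets[OF idm KK] Kset[of "2 * R"] by (simp add: sets.Int)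
   moreover have "?K (2 * R) \<inter> ((- (K1 \<union> K2)) \<inter> space M)=E"
    unfolding E_def using sets.sets_into_space[OF Kset[of "2 * R"]] by blast
   ultimately show ?thesis by simp
  qed
  have "measure M E=measure Q (- (K1 \<union> K2))" unfolding E_def measure_def using Qe[OF KK] by simp
  also have "...<=measure Q ((A'-K1) \<union> (- A'-K2))"
   by (intro finite_measure.finite_measure_mono[OF Qfin] sets.Un AK) auto
  also have "...<=measure Q (A'-K1)+measure Q (- A'-K2)"
   by (intro measure_Un_le AK)
  finally have mE: "measure M E < e\<^sup>2" using K1(3) K2(3) e by (simp add: d_def) (smt (verit) zero_less_power)
  have "l2_norm M (%p. indicator A p-u p)<=l2_norm M (%p. 1 * indicator E p)"
  proof (rule l2_norm_mono)
   show "(%p. indicator A p-u p)\<in>borel_measurable M" using A u G L2_meas by (intro borel_measurable_diff) auto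
   show "(%p. 1 * indicator E p)\<in>L2 M"
   proof (rule L2bd[where c = 1 and R = "2 * R"])
    show "(%p. 1 * indicator E p :: real)\<in>borel_measurable M" using Es by simp
   qed (auto simp: E_def indicator_def)
   show "AE p in M. \<bar>indicator A p-u p\<bar><=\<bar>1 * indicator E p :: real\<bar>"
   proof (rule AE_I2)
    fix p assume p: "p\<in>space M"
    then have pp: "p\<in>phase_space" by (simp add: space)
    show "\<bar>indicator A p-u p\<bar><=\<bar>1 * indicator E p :: real\<bar>"
    proof (cases "p\<in>E")
     case True
     have "0<=u p" "u p<=1" unfolding u_def using g01[of p] cutoff_bounds[of R "fst p"] by (auto intro: mult_le_one)
     then show ?thesis using True by (auto simp: indicator_def)
    next
     case False
     consider "norm (fst p) > 2 * R" | "norm (fst p)<=2 * R" "p\<in>K1" | "norm (fst p)<=2 * R" "p\<in>K2"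
      using False Kspace[OF p, of "2 * R"] by (auto simp: E_def)
     then have "indicator A p-u p=0"
     proof cases
      case 1
      then show ?thesis using AR[of p] R cutoff_eq_0[OF R, of "fst p"] by (auto simp: u_def indicator_def)
     next
      case 2
      then have "p\<in>A" using K1(2) A'A[OF pp] by blast
      then show ?thesis using AR[of p] cutoff_eq_1[OF R, of "fst p"] g(3)[OF 2(2)] by (simp add: u_def)
     next
      case 3
      then have "p \<notin> A" using K2(2) A'A[OF pp] by blast
      then show ?thesis using g(4)[OF 3(2)] by (simp add: u_def)
     qed
     then show ?thesis by simp
    qed
   qed
  qed
  also have "...=sqrt (measure M E)" using l2_norm_indicator[OF Es, of 1] by simp
  also have "... < e" using mE e by (metis real_sqrt_less_iff real_sqrt_unique less_imp_le)
  finally show "\<exists>g\<in>G. l2_norm M (%p. indicator A p-g p) < e" by (rule bexI[OF _ u])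
 qed
 have limG: "f\<in>G" if "f\<in>L2 M" "!!k. u k\<in>G" "w\<in>L2 M" "!!k p. p\<in>space M ==> \<bar>u k p-f p\<bar><=w p"
  "!!p. p\<in>space M ==> (%k. u k p) ----> f p" for f w and u :: "nat => 'a \<times> 'a => real"
 proof (rule closed[OF that(1)])
  fix e :: real assume e: "e > 0"
  have "(%k. l2_norm M (%p. u k p-f p)) ----> 0"
  proof (rule l2_dominated_convergence[where w = w])
   show "u k\<in>borel_measurable M" for k using that(2)[of k] G L2_meas by blast
  qed (use that in \<open>auto intro: L2_meas\<close>)
  then have "eventually (%k. l2_norm M (%p. u k p-f p) < e) sequentially"
   using e by (intro order_tendstoD(2)) auto
  then obtain k where "l2_norm M (%p. u k p-f p) < e" using eventually_happens by force
  then show "\<exists>g\<in>G. l2_norm M (%p. f p-g p) < e"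
   unfolding l2_norm_minus[of M "u k" f] by (rule bexI[OF _ that(2)[of k]])
 qed
 have bsupp: "f\<in>G" if f: "f\<in>L2 M" and supp: "!!p. p\<in>space M ==> norm (fst p) > R ==> f p=0" and R: "R > 0" for f R
 proof -
  obtain u where u: "!!i. simple_function M (u i)" "!!p. p\<in>space M ==> (%i. u i p) ----> f p"
   "!!i p. p\<in>space M ==> dist (u i p) 0<=2 * dist (f p) 0"
   using borel_measurable_implies_sequence_metric[OF L2_meas[OF f], of 0] by metis
  have uG: "u i\<in>G" for i
  proof (rule closed)
   show ui: "u i\<in>L2 M"
    by (rule L2_bounded_by[OF borel_measurable_simple_function[OF u(1)] L2_cmult[OF f, of 2]])
      (use u(3) in \<open>auto intro!: AE_I2 simp: abs_mult\<close>)
   let ?S = "%p. \<Sum>y\<in>u i ` space M-{0}. y * indicator (u i -` {y} \<inter> space M) p"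
   have SG: "?S\<in>G"
   proof (rule sum)
    show "finite (u i ` space M-{0})" using simple_functionD(1)[OF u(1)[of i]] by simp
    fix y assume y: "y\<in>u i ` space M-{0}"
    have "indicator (u i -` {y} \<inter> space M)\<in>G"
    proof (rule indG[OF _ _ R])
     show "u i -` {y} \<inter> space M\<in>sets M" using simple_functionD(2)[OF u(1)[of i]] .
     fix p assume p: "p\<in>u i -` {y} \<inter> space M"
     then have "u i p \<noteq> 0" using y by auto
     then have "f p \<noteq> 0" using u(3)[of p i] p by auto
     then show "norm (fst p)<=R" using supp[of p] p by force
    qed
    then show "(%p. y * indicator (u i -` {y} \<inter> space M) p)\<in>G" by (rule cmult)
   qed
   have eq: "u i p=?S p" if "p\<in>space M" for p
   proof (cases "u i p=0")
    case True
    then show ?thesis by (auto simp: indicator_def intro!: sum.neutral[symmetric])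
   next
    case False
    have "?S p=(\<Sum>y\<in>u i ` space M-{0}. if y=u i p then u i p else 0)"
     using that by (intro sum.cong) (auto simp: indicator_def)
    also have "...=u i p"
     using that False simple_functionD(1)[OF u(1)[of i]] by (subst sum.delta) auto
    finally show ?thesis by simp
   qed
   have "(u i p-?S p)\<^sup>2=0" if "p\<in>space M" for p
    unfolding zero_eq_power2 right_minus_eq by (rule eq[OF that])
   then have "(\<integral>p. (u i p-?S p)\<^sup>2\<partial>M)=(\<integral>p. 0\<partial>M)"
    by (rule Bochner_Integration.integral_cong[OF refl])
   then have n0: "l2_norm M (%p. u i p-?S p)=0" unfolding l2_norm_def by (simp only:) simp
   show "\<exists>g\<in>G. l2_norm M (%p. u i p-g p) < e" if "e > 0" for e
    by (rule bexI[OF _ SG]) (simp only: n0 that)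
  qed
  have abs: "(%p. \<bar>f p\<bar>)\<in>L2 M" by (rule L2_bounded_by[OF _ f]) (use f in auto)
  show ?thesis
  proof (rule limG[OF f uG L2_cmult[OF abs, of 3]])
   fix k p assume p: "p\<in>space M"
   show "\<bar>u k p-f p\<bar><=3*\<bar>f p\<bar>" using u(3)[OF p, of k] by (simp add: dist_real_def)
  qed (use u(2) in auto)
 qed
 show "h\<in>G"
 proof -
  have abs: "(%p. \<bar>h p\<bar>)\<in>L2 M" by (rule L2_bounded_by[OF _ h]) (use h in auto)
  let ?u = "%k p. indicator (?K (real (Suc k))) p * h p"
  show ?thesis
  proof (rule limG[OF h _ abs])
   show "?u k\<in>G" for k
   proof (rule bsupp)
    show "?u k\<in>L2 M"
     by (rule L2_bounded_by[OF _ h]) (use h Kset in \<open>auto intro!: AE_I2 simp: indicator_def\<close>)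
    show "norm (fst p) > real (Suc k) ==> ?u k p=0" if "p\<in>space M" for p
     using Kspace[OF that, of "real (Suc k)"] by auto
   qed simp
   fix p assume p: "p\<in>space M"
   show "\<bar>?u k p-h p\<bar><=\<bar>h p\<bar>" for k by (auto simp: indicator_def)
   obtain N :: nat where N: "norm (fst p)<=real N" using real_arch_simple by blast
   have "eventually (%k. ?u k p=h p) sequentially"
    using eventually_ge_at_top[of N]
   proof eventually_elim
    case (elim k)
    then have "p\<in>?K (real (Suc k))" using N Kspace[OF p, of "real (Suc k)"] by simp
    then show ?case by simp
   qed
   then show "(%k. ?u k p) ----> h p" by (rule tendsto_eventually)
  qed
 qed
qed

section \<open>Calculus on the sphere by infinitesimal rotations\<close>

abbreviation rot_deriv :: "'a::euclidean_space => 'a => ('a \<times> 'a => real) => 'a \<times> 'a => real" where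
 "rot_deriv b b' \<equiv> lin_field (rot_field b b')"

abbreviation transport :: "('a::euclidean_space \<times> 'a => real) => 'a \<times> 'a => real" where
 "transport \<equiv> lin_field transport_field"

text \<open>Half the sum of squares of the rotation fields, each coordinate plane being counted twice: the Casimir operator of the rotation group, which is the Laplace-Beltrami operator on the sphere.\<close>

definition sphere_lap :: "('a::euclidean_space \<times> 'a => real) => 'a \<times> 'a => real" where
 "sphere_lap F p=1/2*(\<Sum>b\<in>Basis. \<Sum>b'\<in>Basis. rot_deriv b b' (rot_deriv b b' F) p)"

text \<open>The derivative along the tangential projection of \<open>c\<close>, written in rotation fields.\<close>

definition tan_deriv :: "'a::euclidean_space => ('a \<times> 'a => real) => 'a \<times> 'a => real" where
 "tan_deriv c F p=1/2*(\<Sum>b\<in>Basis. \<Sum>b'\<in>Basis. (rot_gen b b' (snd p)\<bullet>c) * rot_deriv b b' F p)"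

lemma rot_gen_orthogonal: "rot_gen b b' y\<bullet>y=0"
 by (simp add: rot_gen_def inner_diff_left inner_commute[of b y] inner_commute[of b' y] mult.commute)

lemma rot_gen_inner: "rot_gen b b' y\<bullet>h=(y\<bullet>b)*(h\<bullet>b')-(y\<bullet>b')*(h\<bullet>b)"
 by (simp add: rot_gen_def inner_diff_left inner_commute[of b h] inner_commute[of b' h])

lemma sum_swap3: "(\<Sum>c\<in>A. \<Sum>b\<in>B. \<Sum>b'\<in>C. f c b b')=(\<Sum>b\<in>B. \<Sum>b'\<in>C. \<Sum>c\<in>A. f c b b')"
proof -
 have "(\<Sum>c\<in>A. \<Sum>b\<in>B. \<Sum>b'\<in>C. f c b b')=(\<Sum>b\<in>B. \<Sum>c\<in>A. \<Sum>b'\<in>C. f c b b')" by (rule sum.swap)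
 also have "...=(\<Sum>b\<in>B. \<Sum>b'\<in>C. \<Sum>c\<in>A. f c b b')" by (intro sum.cong refl sum.swap)
 finally show ?thesis .
qed

lemma sum_rot_gen_projection:
 fixes y h :: "'a::euclidean_space"
 shows "(1/2) *\<^sub>R (\<Sum>b\<in>Basis. \<Sum>b'\<in>Basis. (rot_gen b b' y\<bullet>h) *\<^sub>R rot_gen b b' y)=(y\<bullet>y) *\<^sub>R h-(h\<bullet>y) *\<^sub>R y"
proof (rule euclidean_eqI)
 fix c :: 'a assume c: "c\<in>Basis"
 let ?A = "%b b'. (y\<bullet>b)*(h\<bullet>b')-(y\<bullet>b')*(h\<bullet>b)"
 have "(\<Sum>b\<in>Basis. \<Sum>b'\<in>Basis. (rot_gen b b' y\<bullet>h) *\<^sub>R rot_gen b b' y)\<bullet>c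
   = (\<Sum>b\<in>Basis. \<Sum>b'\<in>Basis. ?A b b'*((y\<bullet>b)*(if b'=c then 1 else 0)-(y\<bullet>b')*(if b=c then 1 else 0)))"
  using c by (simp add: inner_sum_left rot_gen_inner) (intro sum.cong refl, simp add: inner_Basis)
 also have "...=(\<Sum>b\<in>Basis. \<Sum>b'\<in>Basis. if b'=c then ?A b c * (y\<bullet>b) else 0)
   - (\<Sum>b\<in>Basis. \<Sum>b'\<in>Basis. if b=c then ?A c b'*(y\<bullet>b') else 0)"
  unfolding sum_subtractf[symmetric] by (intro sum.cong refl) simp
 also have "...=(\<Sum>b\<in>Basis. ?A b c * (y\<bullet>b))-(\<Sum>b'\<in>Basis. ?A c b'*(y\<bullet>b'))"
 proof -
  have "(\<Sum>b\<in>Basis. \<Sum>b'\<in>Basis. if b=c then ?A c b'*(y\<bullet>b') else 0)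
    = (\<Sum>b\<in>Basis. if b=c then (\<Sum>b'\<in>Basis. ?A c b'*(y\<bullet>b')) else 0)"
   by (intro sum.cong refl) simp
  then show ?thesis using c by (simp add: sum.delta)
 qed
 also have "...=2*((h\<bullet>c)*(y\<bullet>y)-(y\<bullet>c)*(h\<bullet>y))"
  unfolding euclidean_inner[of y y] euclidean_inner[of h y]
  by (simp add: sum_subtractf sum_distrib_left left_diff_distrib right_diff_distrib mult_ac sum_negf)
 finally show "((1/2) *\<^sub>R (\<Sum>b\<in>Basis. \<Sum>b'\<in>Basis. (rot_gen b b' y\<bullet>h) *\<^sub>R rot_gen b b' y))\<bullet>c=((y\<bullet>y) *\<^sub>R h-(h\<bullet>y) *\<^sub>R y)\<bullet>c"
  by (simp add: inner_diff_left mult.commute)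
qed

lemma sum_rot_gen_square:
 fixes y c :: "'a::euclidean_space"
 shows "1/2*(\<Sum>b\<in>Basis. \<Sum>b'\<in>Basis. rot_gen b b' (rot_gen b b' y)\<bullet>c) =-(real DIM('a)-1)*(y\<bullet>c)"
proof -
 have "(\<Sum>b\<in>Basis. \<Sum>b'\<in>Basis. rot_gen b b' (rot_gen b b' y)\<bullet>c)
   = (\<Sum>b\<in>Basis. \<Sum>b'\<in>Basis. (if b=b' then 2*((y\<bullet>b)*(c\<bullet>b)) else 0)-(y\<bullet>b')*(c\<bullet>b')-(y\<bullet>b)*(c\<bullet>b))"
  by (intro sum.cong refl) (auto simp: rot_gen_inner inner_Basis)
 also have "...=2*(y\<bullet>c)-real DIM('a)*(y\<bullet>c)-real DIM('a)*(y\<bullet>c)"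
  unfolding euclidean_inner[of y c] by (simp add: sum_subtractf sum.delta sum_distrib_left mult_ac)
 finally show ?thesis by (simp add: algebra_simps)
qed

lemma rot_deriv_eq: "rot_deriv b b' F (x, y)=dderiv (0, rot_gen b b' y) F (x, y)"
 by (simp add: lin_field_def rot_field_def)

lemma smooth_on_rot_deriv: "smooth_on UNIV F ==> smooth_on UNIV (rot_deriv b b' F)"
 by (rule smooth_on_lin_field[OF _ bounded_linear_rot_field])

lemma Cc_rot_deriv: "F\<in>Cc ==> rot_deriv b b' F\<in>Cc"
 by (rule Cc_lin_field[OF _ bounded_linear_rot_field])

lemma Cc_transport: "F\<in>Cc ==> transport F\<in>Cc"
 by (rule Cc_lin_field[OF _ bounded_linear_transport_field])

lemma Cc_sphere_lap: "F\<in>Cc ==> sphere_lap F\<in>Cc"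
 unfolding sphere_lap_def by (intro Cc_cmult Cc_sum Cc_rot_deriv)

lemma bounded_linear_rot_gen_snd: "bounded_linear (%p. rot_gen b b' (snd p)\<bullet>c)"
proof -
 have "bounded_linear (rot_gen b b')" using linear_rot_gen by (simp add: linear_conv_bounded_linear)
 from bounded_linear_compose[OF bounded_linear_inner_left bounded_linear_compose[OF this bounded_linear_snd]]
 show ?thesis .
qed

lemma Cc_tan_deriv: "F\<in>Cc ==> tan_deriv c F\<in>Cc"
 unfolding tan_deriv_def
 by (intro Cc_cmult Cc_sum Cc_mult Cc_rot_deriv smooth_on_linear bounded_linear_rot_gen_snd open_UNIV)

lemma has_derivative_sphere_ext:
 fixes F :: "'a::euclidean_space \<times> 'a => real"
 assumes F: "smooth_on UNIV F" and \<omega>: "norm \<omega>=1"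
 shows "((%y. F (x, sgn y)) has_derivative (%h. dderiv (0, h-(h\<bullet>\<omega>) *\<^sub>R \<omega>) F (x, \<omega>))) (at \<omega>)"
proof -
 have s: "sgn \<omega>=\<omega>" using \<omega> by (simp add: sgn_div_norm)
 have "((%y. (x, sgn y)) has_derivative (%h. (0, h-(h\<bullet>\<omega>) *\<^sub>R \<omega>))) (at \<omega>)"
  by (intro has_derivative_Pair has_derivative_const has_derivative_sgn \<omega>)
 moreover have "(F has_derivative (%v. dderiv v F (x, sgn \<omega>))) (at (x, sgn \<omega>))"
  by (rule smooth_on_has_derivative[OF F UNIV_I])
 ultimately show ?thesis unfolding s using has_derivative_compose[of "%y. (x, sgn y)" _ \<omega> UNIV F] s by simp
qed

lemma dderiv_snd_linear:
 "smooth_on UNIV F ==> linear (%h. dderiv (0, h) F p)"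
proof -
 assume F: "smooth_on UNIV F"
 note l = dderiv_linear[OF smooth_on_differentiable[OF F UNIV_I, of p]]
 show ?thesis
 proof (rule linearI)
  fix u v and r :: real
  show "dderiv (0, u+v) F p=dderiv (0, u) F p+dderiv (0, v) F p"
   using linear_add[OF l, of "(0, u)" "(0, v)"] by simp
  show "dderiv (0, r *\<^sub>R u) F p=r *\<^sub>R dderiv (0, u) F p"
   using linear_cmul[OF l, of r "(0, u)"] by simp
 qed
qed

lemma sphere_grad_eq:
 fixes F :: "'a::euclidean_space \<times> 'a => real"
 assumes F: "smooth_on UNIV F" and \<omega>: "norm \<omega>=1"
 shows "sphere_grad (%y. F (x, y)) \<omega>=(1/2) *\<^sub>R (\<Sum>b\<in>Basis. \<Sum>b'\<in>Basis. rot_deriv b b' F (x, \<omega>) *\<^sub>R rot_gen b b' \<omega>)"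
proof -
 let ?D = "(1/2) *\<^sub>R (\<Sum>b\<in>Basis. \<Sum>b'\<in>Basis. rot_deriv b b' F (x, \<omega>) *\<^sub>R rot_gen b b' \<omega>)"
 note l = dderiv_snd_linear[OF F, of "(x, \<omega>)"]
 have e: "dderiv (0, h-(h\<bullet>\<omega>) *\<^sub>R \<omega>) F (x, \<omega>)=h\<bullet>?D" for h
 proof -
  have "h-(h\<bullet>\<omega>) *\<^sub>R \<omega>=(1/2) *\<^sub>R (\<Sum>b\<in>Basis. \<Sum>b'\<in>Basis. (rot_gen b b' \<omega>\<bullet>h) *\<^sub>R rot_gen b b' \<omega>)"
   using sum_rot_gen_projection[of \<omega> h] \<omega> by (simp add: dot_square_norm)
  then have "dderiv (0, h-(h\<bullet>\<omega>) *\<^sub>R \<omega>) F (x, \<omega>)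
    = 1/2*(\<Sum>b\<in>Basis. \<Sum>b'\<in>Basis. (rot_gen b b' \<omega>\<bullet>h) * dderiv (0, rot_gen b b' \<omega>) F (x, \<omega>))"
   by (simp only: linear_sum[OF l] linear_cmul[OF l] real_scaleR_def)
  also have "...=h\<bullet>?D" by (simp add: inner_sum_right rot_deriv_eq inner_commute mult.commute)
  finally show ?thesis .
 qed
 have "((%y. F (x, sgn y)) has_derivative (%h. h\<bullet>?D)) (at \<omega>)"
  using has_derivative_sphere_ext[OF F \<omega>, of x] unfolding e .
 then show ?thesis unfolding sphere_grad_def by (intro grad_eqI) (simp only: gderiv_def)
qed

lemma laplace_beltrami_eq:
 fixes F :: "'a::euclidean_space \<times> 'a => real"
 assumes F: "smooth_on UNIV F" and \<omega>: "norm \<omega>=1"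
 shows "laplace_beltrami (%y. F (x, y)) \<omega>=sphere_lap F (x, \<omega>)"
proof -
 let ?P = "%h. h-(h\<bullet>\<omega>) *\<^sub>R \<omega>"
 let ?W = "%y. (1/2) *\<^sub>R (\<Sum>b\<in>Basis. \<Sum>b'\<in>Basis. rot_deriv b b' F (x, sgn y) *\<^sub>R rot_gen b b' (sgn y))"
 let ?W' = "%h. (1/2) *\<^sub>R (\<Sum>b\<in>Basis. \<Sum>b'\<in>Basis. rot_deriv b b' F (x, sgn \<omega>) *\<^sub>R rot_gen b b' (?P h)
   + dderiv (0, ?P h) (rot_deriv b b' F) (x, \<omega>) *\<^sub>R rot_gen b b' (sgn \<omega>))"
 have s: "sgn \<omega>=\<omega>" using \<omega> by (simp add: sgn_div_norm)
 have nz: "\<omega> \<noteq> 0" using \<omega> by auto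
 have rg: "((%y. rot_gen b b' (sgn y)) has_derivative (%h. rot_gen b b' (?P h))) (at \<omega>)" for b b'
  using has_derivative_compose[OF has_derivative_sgn[OF \<omega>]
    bounded_linear_imp_has_derivative[OF linear_rot_gen[unfolded linear_conv_bounded_linear]]] .
 have d1: "(?W has_derivative ?W') (at \<omega>)"
  by (intro has_derivative_scaleR_right has_derivative_sum has_derivative_scaleR rg
    has_derivative_sphere_ext[OF smooth_on_rot_deriv[OF F] \<omega>])
 have d: "((%y. sphere_grad (%y. F (x, y)) (sgn y)) has_derivative ?W') (at \<omega>)"
  by (rule has_derivative_transform_within_open[OF d1, of "- {0}"])
    (use nz in \<open>auto simp: sphere_grad_eq[OF F] norm_sgn\<close>)
 have "laplace_beltrami (%y. F (x, y)) \<omega>=(\<Sum>c\<in>Basis. ?W' c\<bullet>c)"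
  unfolding laplace_beltrami_def sphere_div_def frechet_derivative_at[OF d, symmetric] ..
 also have "...=1/2*(\<Sum>b\<in>Basis. \<Sum>b'\<in>Basis. \<Sum>c\<in>Basis. rot_deriv b b' F (x, \<omega>)*(rot_gen b b' (?P c)\<bullet>c)
   + dderiv (0, ?P c) (rot_deriv b b' F) (x, \<omega>)*(rot_gen b b' \<omega>\<bullet>c))"
  unfolding s by (simp add: inner_sum_left inner_add_left sum_distrib_left[symmetric] sum_divide_distrib[symmetric])
   (rule sum_swap3)
 also have "...=1/2*(\<Sum>b\<in>Basis. \<Sum>b'\<in>Basis. rot_deriv b b' (rot_deriv b b' F) (x, \<omega>))"
 proof -
  have "(\<Sum>c\<in>Basis. rot_deriv b b' F (x, \<omega>)*(rot_gen b b' (?P c)\<bullet>c)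
   + dderiv (0, ?P c) (rot_deriv b b' F) (x, \<omega>)*(rot_gen b b' \<omega>\<bullet>c))=rot_deriv b b' (rot_deriv b b' F) (x, \<omega>)"
   if b: "b\<in>Basis" "b'\<in>Basis" for b b' :: 'a
  proof -
   have "(\<Sum>c\<in>Basis. rot_gen b b' (?P c)\<bullet>c)=(\<Sum>c\<in>Basis. rot_gen b b' c\<bullet>c)-(\<Sum>c\<in>Basis. (\<omega>\<bullet>c)*(rot_gen b b' \<omega>\<bullet>c))"
    unfolding linear_diff[OF linear_rot_gen] linear_cmul[OF linear_rot_gen] inner_diff_left sum_subtractf
    by (simp add: inner_commute[of \<omega>])
   also have "(\<Sum>c\<in>Basis. rot_gen b b' c\<bullet>c)=0"
    by (intro sum.neutral) (simp add: rot_gen_orthogonal)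
   also have "(\<Sum>c\<in>Basis. (\<omega>\<bullet>c)*(rot_gen b b' \<omega>\<bullet>c))=\<omega>\<bullet>rot_gen b b' \<omega>"
    by (rule euclidean_inner[symmetric])
   finally have 1: "(\<Sum>c\<in>Basis. rot_gen b b' (?P c)\<bullet>c)=0"
    using rot_gen_orthogonal[of b b' \<omega>] by (simp add: inner_commute)
   note l = dderiv_snd_linear[OF smooth_on_rot_deriv[OF F, of b b'], of "(x, \<omega>)"]
   have "(\<Sum>c\<in>Basis. dderiv (0, ?P c) (rot_deriv b b' F) (x, \<omega>)*(rot_gen b b' \<omega>\<bullet>c))
     = dderiv (0, \<Sum>c\<in>Basis. (rot_gen b b' \<omega>\<bullet>c) *\<^sub>R ?P c) (rot_deriv b b' F) (x, \<omega>)"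
    by (simp only: linear_sum[OF l] linear_cmul[OF l] real_scaleR_def mult.commute)
   also have "(\<Sum>c\<in>Basis. (rot_gen b b' \<omega>\<bullet>c) *\<^sub>R ?P c)
     = (\<Sum>c\<in>Basis. (rot_gen b b' \<omega>\<bullet>c) *\<^sub>R c)-(\<Sum>c\<in>Basis. (rot_gen b b' \<omega>\<bullet>c)*(\<omega>\<bullet>c)) *\<^sub>R \<omega>"
    by (simp add: scaleR_diff_right sum_subtractf scaleR_sum_left inner_commute)
   also have "...=rot_gen b b' \<omega>"
    using rot_gen_orthogonal[of b b' \<omega>] euclidean_inner[of "rot_gen b b' \<omega>" \<omega>]
    by (simp add: euclidean_representation)
   finally have 2: "(\<Sum>c\<in>Basis. dderiv (0, ?P c) (rot_deriv b b' F) (x, \<omega>)*(rot_gen b b' \<omega>\<bullet>c))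
     = rot_deriv b b' (rot_deriv b b' F) (x, \<omega>)" by (simp add: rot_deriv_eq)
   show ?thesis unfolding sum.distrib 2 sum_distrib_left[symmetric] 1 by simp
  qed
  then show ?thesis by simp
 qed
 finally show ?thesis by (simp add: sphere_lap_def)
qed

lemma has_derivative_cong_open:
 assumes "open U" "x\<in>U" "!!y. y\<in>U ==> f y=g y"
 shows "(f has_derivative D) (at x) \<longleftrightarrow> (g has_derivative D) (at x)"
proof
 assume "(f has_derivative D) (at x)"
 then show "(g has_derivative D) (at x)"
  by (rule has_derivative_transform_within_open[OF _ assms(1,2)]) (rule assms(3))
next
 assume "(g has_derivative D) (at x)"
 then show "(f has_derivative D) (at x)"
  by (rule has_derivative_transform_within_open[OF _ assms(1,2)]) (rule assms(3)[symmetric])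
qed

lemma grad_cong_open:
 assumes "open U" "x\<in>U" "!!y. y\<in>U ==> f y=g y" shows "grad f x=grad g x"
proof -
 have "(f has_derivative D) (at x) \<longleftrightarrow> (g has_derivative D) (at x)" for D
  by (rule has_derivative_cong_open[OF assms])
 then have "gderiv f x=gderiv g x" by (simp add: gderiv_def fun_eq_iff)
 then show ?thesis by (simp add: grad_def)
qed

lemma frechet_derivative_cong_open:
 assumes "open U" "x\<in>U" "!!y. y\<in>U ==> f y=g y" shows "frechet_derivative f (at x)=frechet_derivative g (at x)"
proof -
 have "(f has_derivative D) (at x) \<longleftrightarrow> (g has_derivative D) (at x)" for D
  by (rule has_derivative_cong_open[OF assms])
 then show ?thesis by (simp add: frechet_derivative_def)
qed

lemma sphere_grad_cong:
 assumes "!!y. norm y=1 ==> f y=g y" "norm \<omega>=1" shows "sphere_grad f \<omega>=sphere_grad g \<omega>"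
 unfolding sphere_grad_def
 by (rule grad_cong_open[of "- {0}"]) (use assms in \<open>auto simp: norm_sgn\<close>)

lemma laplace_beltrami_cong:
 assumes "!!y. norm y=1 ==> f y=g y" "norm \<omega>=1" shows "laplace_beltrami f \<omega>=laplace_beltrami g \<omega>"
proof -
 have "frechet_derivative (%y. sphere_grad f (sgn y)) (at \<omega>)=frechet_derivative (%y. sphere_grad g (sgn y)) (at \<omega>)"
  by (rule frechet_derivative_cong_open[of "- {0}"])
    (use assms in \<open>auto simp: norm_sgn intro!: sphere_grad_cong\<close>)
 then show ?thesis by (simp add: laplace_beltrami_def sphere_div_def)
qed

lemma langevin_op_cong:
 assumes "!!p. p\<in>phase_space ==> f p=g p" "p\<in>phase_space"
 shows "langevin_op V \<sigma> f p=langevin_op V \<sigma> g p"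
proof -
 obtain x \<omega> where p: "p=(x, \<omega>)" by (cases p)
 have \<omega>: "norm \<omega>=1" using assms(2) by (simp add: p phase_space_def)
 have e: "f (x', y)=g (x', y)" if "norm y=1" for x' y using assms(1) that by (simp add: phase_space_def)
 show ?thesis
  unfolding langevin_op_def p prod.case
  using sphere_grad_cong[of "%y. f (x, y)" "%y. g (x, y)", OF e \<omega>]
   laplace_beltrami_cong[of "%y. f (x, y)" "%y. g (x, y)", OF e \<omega>] e[OF \<omega>] by simp
qed

lemma tan_deriv_inner:
 fixes F :: "'a::euclidean_space \<times> 'a => real"
 assumes F: "smooth_on UNIV F" and \<omega>: "norm \<omega>=1"
 shows "v\<bullet>sphere_grad (%y. F (x, y)) \<omega>=(\<Sum>c\<in>Basis. (v\<bullet>c) * tan_deriv c F (x, \<omega>))"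
proof -
 have "v\<bullet>sphere_grad (%y. F (x, y)) \<omega>=(\<Sum>c\<in>Basis. (v\<bullet>c)*(sphere_grad (%y. F (x, y)) \<omega>\<bullet>c))"
  by (rule euclidean_inner)
 moreover have "sphere_grad (%y. F (x, y)) \<omega>\<bullet>c=tan_deriv c F (x, \<omega>)" for c
  unfolding sphere_grad_eq[OF assms] tan_deriv_def by (simp add: inner_sum_left mult.commute)
 ultimately show ?thesis by simp
qed

lemma transport_eq:
 fixes F :: "'a::euclidean_space \<times> 'a => real"
 assumes F: "smooth_on UNIV F"
 shows "\<omega>\<bullet>grad (%x'. F (x', \<omega>)) x=transport F (x, \<omega>)"
proof -
 note l = dderiv_linear[OF smooth_on_differentiable[OF F UNIV_I, of "(x, \<omega>)"]]
 let ?D = "\<Sum>b\<in>Basis. dderiv (b, 0) F (x, \<omega>) *\<^sub>R b"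
 have e: "dderiv (h, 0) F (x, \<omega>)=h\<bullet>?D" for h
 proof -
  have "(h, 0::'a)=(\<Sum>b\<in>Basis. (h\<bullet>b) *\<^sub>R (b, 0))"
   by (simp add: prod_eq_iff fst_sum snd_sum euclidean_representation)
  then have "dderiv (h, 0) F (x, \<omega>)=(\<Sum>b\<in>Basis. (h\<bullet>b) * dderiv (b, 0) F (x, \<omega>))"
   using l by (simp add: linear_sum linear_cmul del: scaleR_Pair)
  then show ?thesis by (simp add: inner_sum_right mult.commute)
 qed
 have "((%x'. (x', \<omega>)) has_derivative (%h. (h, 0))) (at x)"
  by (intro has_derivative_Pair has_derivative_ident has_derivative_const)
 from has_derivative_compose[OF this smooth_on_has_derivative[OF F UNIV_I]]
 have "((%x'. F (x', \<omega>)) has_derivative (%h. dderiv (h, 0) F (x, \<omega>))) (at x)" .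
 moreover have "(%h. dderiv (h, 0) F (x, \<omega>))=(%h. h\<bullet>?D)" by (rule ext, rule e)
 ultimately have "((%x'. F (x', \<omega>)) has_derivative (%h. h\<bullet>?D)) (at x)" by (simp only:)
 then have "grad (%x'. F (x', \<omega>)) x=?D" by (intro grad_eqI) (simp only: gderiv_def)
 then have "\<omega>\<bullet>grad (%x'. F (x', \<omega>)) x=dderiv (\<omega>, 0) F (x, \<omega>)" by (simp only: e[symmetric])
 then show ?thesis by (simp only: lin_field_def transport_field_def snd_conv)
qed

lemma langevin_op_eq:
 fixes F :: "'a::euclidean_space \<times> 'a => real"
 assumes F: "smooth_on UNIV F" and p: "p\<in>phase_space"
 shows "langevin_op V \<sigma> F p=transport F p
  - 1/(real DIM('a)-1)*(\<Sum>c\<in>Basis. (grad V (fst p)\<bullet>c) * tan_deriv c F p)+\<sigma>\<^sup>2/2 * sphere_lap F p"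
proof -
 obtain x \<omega> where q: "p=(x, \<omega>)" by (cases p)
 have \<omega>: "norm \<omega>=1" using p by (simp add: q phase_space_def)
 have orth: "\<omega>\<bullet>sphere_grad (%y. F (x, y)) \<omega>=0"
  unfolding sphere_grad_eq[OF F \<omega>] by (simp add: inner_sum_right inner_commute[of \<omega>] rot_gen_orthogonal)
 have "sphere_grad (langevin_Phi V x) \<omega>\<bullet>sphere_grad (%y. F (x, y)) \<omega>
   = 1/(real DIM('a)-1)*(grad V x\<bullet>sphere_grad (%y. F (x, y)) \<omega>)"
  unfolding sphere_grad_langevin_Phi[OF \<omega>] by (simp add: inner_diff_left orth)
 then show ?thesis
  unfolding langevin_op_def q prod.case transport_eq[OF F] laplace_beltrami_eq[OF F \<omega>]
  by (simp add: tan_deriv_inner[OF F \<omega>])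
qed

section \<open>Integration by parts on the phase space\<close>

definition loc_bounded :: "('a::euclidean_space => real) => bool" where
 "loc_bounded m \<longleftrightarrow> m\<in>borel_measurable borel \<and> (\<forall>R. \<exists>C. \<forall>x. norm x<=R \<longrightarrow> \<bar>m x\<bar><=C)"

lemma loc_boundedD: "loc_bounded m ==> m\<in>borel_measurable borel" "loc_bounded m ==> \<exists>C. \<forall>x. norm x<=R \<longrightarrow> \<bar>m x\<bar><=C"
 by (auto simp: loc_bounded_def)

lemma loc_bounded_const: "loc_bounded (%_. c)"
 by (auto simp: loc_bounded_def)

lemma loc_bounded_mult:
 assumes "loc_bounded m" "loc_bounded n" shows "loc_bounded (%x. m x * n x)"
 unfolding loc_bounded_def
proof (intro conjI allI)
 show "(%x. m x * n x)\<in>borel_measurable borel" using assms by (auto simp: loc_bounded_def)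
 fix R
 obtain C where C: "\<forall>x. norm x<=R \<longrightarrow> \<bar>m x\<bar><=C" using loc_boundedD(2)[OF assms(1)] by blast
 obtain C' where C': "\<forall>x. norm x<=R \<longrightarrow> \<bar>n x\<bar><=C'" using loc_boundedD(2)[OF assms(2)] by blast
 have "\<bar>m x * n x\<bar><=\<bar>C\<bar>*\<bar>C'\<bar>" if "norm x<=R" for x
  unfolding abs_mult using C C' that by (intro mult_mono) (auto intro: order_trans[OF _ abs_ge_self])
 then show "\<exists>C. \<forall>x. norm x<=R \<longrightarrow> \<bar>m x * n x\<bar><=C" by blast
qed

lemma loc_bounded_continuous:
 assumes "continuous_on UNIV m" shows "loc_bounded m"
 unfolding loc_bounded_def
proof (intro conjI allI)
 show "m\<in>borel_measurable borel" using assms by (rule borel_measurable_continuous_onI)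
 fix R
 have "bounded (m ` cball 0 R)"
  using assms by (intro compact_imp_bounded compact_continuous_image) (auto intro: continuous_on_subset)
 then obtain C where "\<forall>y\<in>m ` cball 0 R. norm y<=C" using bounded_iff by blast
 then show "\<exists>C. \<forall>x. norm x<=R \<longrightarrow> \<bar>m x\<bar><=C" by (intro exI[of _ C]) auto
qed

lemma Cc_prod: "F\<in>Cc ==> G\<in>Cc ==> (%p. F p * G p)\<in>Cc"
 by (rule Cc_mult[OF Cc_smooth])

lemma integrable_weighted_Cc:
 fixes F :: "'a::euclidean_space \<times> 'a => real"
 assumes "loc_bounded m" "F\<in>Cc" shows "integrable phaseM (%p. m (fst p) * F p)"
 by (rule integrable_phase_Cc[OF assms(2) loc_boundedD(1)[OF assms(1)] loc_boundedD(2)[OF assms(1)]])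

lemma L2_phase_weighted:
 fixes F :: "'a::euclidean_space \<times> 'a => real"
 assumes m: "loc_bounded m" and F: "F\<in>Cc" shows "(%p. m (fst p) * F p)\<in>L2 phaseM"
proof -
 have "integrable phaseM (%p. (m (fst p) * m (fst p))*(F p * F p))"
  by (rule integrable_weighted_Cc[OF loc_bounded_mult[OF m m] Cc_prod[OF F F]])
 moreover have "(%p. m (fst p) * F p)\<in>borel_measurable phaseM"
  by (intro borel_measurable_times measurable_phase_fst loc_boundedD m measurable_phase[OF Cc_measurable[OF F]])
 ultimately show ?thesis unfolding L2_def by (simp add: power2_eq_square mult_ac)
qed

lemma L2_phase_Cc: "F\<in>Cc ==> F\<in>L2 (phaseM :: ('a::euclidean_space \<times> 'a) measure)"
 using L2_phase_weighted[OF loc_bounded_const, of F 1] by simp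

lemma rot_deriv_by_parts:
 fixes F G :: "'a::euclidean_space \<times> 'a => real"
 assumes m: "loc_bounded m" and F: "F\<in>Cc" and G: "G\<in>Cc" and b: "b\<in>Basis" "b'\<in>Basis"
 shows "(\<integral>p. m (fst p)*(rot_deriv b b' F p * G p)\<partial>phaseM)
  =-(\<integral>p. m (fst p)*(F p * rot_deriv b b' G p)\<partial>phaseM)"
proof -
 note i = integrable_weighted_Cc[OF m Cc_prod[OF F Cc_rot_deriv[OF G, of b b']]]
  integrable_weighted_Cc[OF m Cc_prod[OF Cc_rot_deriv[OF F, of b b'] G]]
 have "0=(\<integral>p. m (fst p) * rot_deriv b b' (%p. F p * G p) p\<partial>phaseM)"
  by (rule integral_rot_field[OF Cc_prod[OF F G] loc_boundedD(1)[OF m] loc_boundedD(2)[OF m] b, symmetric])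
 also have "...=(\<integral>p. m (fst p)*(F p * rot_deriv b b' G p)+m (fst p)*(rot_deriv b b' F p * G p)\<partial>phaseM)"
  unfolding lin_field_mult[OF Cc_smooth[OF F] Cc_smooth[OF G]] by (simp only: distrib_left)
 also have "...=(\<integral>p. m (fst p)*(F p * rot_deriv b b' G p)\<partial>phaseM)
   + (\<integral>p. m (fst p)*(rot_deriv b b' F p * G p)\<partial>phaseM)"
  by (rule Bochner_Integration.integral_add[OF i])
 finally show ?thesis by simp
qed

lemma transport_by_parts:
 fixes F G :: "'a::euclidean_space \<times> 'a => real"
 assumes F: "F\<in>Cc" and G: "G\<in>Cc"
 shows "(\<integral>p. transport F p * G p\<partial>phaseM) =-(\<integral>p. F p * transport G p\<partial>phaseM)"
proof -
 note i = integrable_weighted_Cc[OF loc_bounded_const Cc_prod[OF F Cc_transport[OF G]], of 1]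
  integrable_weighted_Cc[OF loc_bounded_const Cc_prod[OF Cc_transport[OF F] G], of 1]
 have "0=(\<integral>p. transport (%p. F p * G p) p\<partial>phaseM)"
  by (rule integral_transport_field[OF Cc_prod[OF F G], symmetric])
 also have "...=(\<integral>p. F p * transport G p+transport F p * G p\<partial>phaseM)"
  unfolding lin_field_mult[OF Cc_smooth[OF F] Cc_smooth[OF G]] ..
 also have "...=(\<integral>p. F p * transport G p\<partial>phaseM)+(\<integral>p. transport F p * G p\<partial>phaseM)"
  using i by (intro Bochner_Integration.integral_add) simp_all
 finally show ?thesis by simp
qed

lemma sphere_lap_by_parts:
 fixes F :: "'a::euclidean_space \<times> 'a => real"
 assumes m: "loc_bounded m" and F: "F\<in>Cc"
 shows "(\<integral>p. m (fst p)*(sphere_lap F p * F p)\<partial>phaseM)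
  =-1/2*(\<Sum>b\<in>Basis. \<Sum>b'\<in>Basis. \<integral>p. m (fst p)*(rot_deriv b b' F p)\<^sup>2\<partial>phaseM)"
proof -
 note X = Cc_rot_deriv[OF F]
 note i = integrable_weighted_Cc[OF m Cc_prod[OF Cc_rot_deriv[OF X] F]]
 have "(\<integral>p. m (fst p)*(sphere_lap F p * F p)\<partial>phaseM)
   = (\<integral>p. 1/2*(\<Sum>b\<in>Basis. \<Sum>b'\<in>Basis. m (fst p)*(rot_deriv b b' (rot_deriv b b' F) p * F p))\<partial>phaseM)"
  unfolding sphere_lap_def by (simp add: sum_distrib_left sum_distrib_right mult_ac)
 also have "...=1/2*(\<Sum>b\<in>Basis. \<Sum>b'\<in>Basis. \<integral>p. m (fst p)*(rot_deriv b b' (rot_deriv b b' F) p * F p)\<partial>phaseM)"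
  using i by (simp add: Bochner_Integration.integral_sum)
 also have "...=1/2*(\<Sum>b\<in>Basis. \<Sum>b'\<in>Basis.-(\<integral>p. m (fst p)*(rot_deriv b b' F p)\<^sup>2\<partial>phaseM))"
 proof -
  have "(\<integral>p. m (fst p)*(rot_deriv b b' (rot_deriv b b' F) p * F p)\<partial>phaseM)
    =-(\<integral>p. m (fst p)*(rot_deriv b b' F p)\<^sup>2\<partial>phaseM)" if "b\<in>Basis" "b'\<in>Basis" for b b'
   using rot_deriv_by_parts[OF m X F that, of b b'] by (simp add: power2_eq_square)
  then show ?thesis by simp
 qed
 finally show ?thesis by (simp add: sum_negf)
qed

text \<open>The field \<open>tan_deriv c\<close> has spherical divergence \<open>- (d - 1) (c \<bullet> \<omega>)\<close>.\<close>

lemma tan_deriv_by_parts: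
 fixes F :: "'a::euclidean_space \<times> 'a => real"
 assumes m: "loc_bounded m" and F: "F\<in>Cc"
 shows "(\<integral>p. m (fst p)*(tan_deriv c F p * F p)\<partial>phaseM)
  = (real DIM('a)-1)/2*(\<integral>p. m (fst p)*((snd p\<bullet>c)*(F p)\<^sup>2)\<partial>phaseM)"
proof -
 define r where "r b b' p=rot_gen b b' (snd p)\<bullet>c" for b b' :: 'a and p :: "'a \<times> 'a"
 define r2 where "r2 b b' p=rot_gen b b' (rot_gen b b' (snd p))\<bullet>c" for b b' :: 'a and p :: "'a \<times> 'a"
 have FF: "(%p. F p * F p)\<in>Cc" by (rule Cc_prod[OF F F])
 have sr: "smooth_on UNIV (r b b')" for b b'
  unfolding r_def by (intro smooth_on_linear bounded_linear_rot_gen_snd open_UNIV)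
 have Xr: "rot_deriv b b' (r b b')=r2 b b'" for b b'
 proof
  fix p
  have "(r b b' has_derivative r b b') (at p)"
   unfolding r_def by (rule bounded_linear_imp_has_derivative[OF bounded_linear_rot_gen_snd])
  then show "rot_deriv b b' (r b b') p=r2 b b' p"
   unfolding lin_field_def by (simp add: dderiv_eqI rot_field_def r_def r2_def)
 qed
 have r2s: "smooth_on UNIV (r2 b b')" for b b' unfolding Xr[symmetric] by (rule smooth_on_rot_deriv[OF sr])
 have one: "(\<integral>p. m (fst p)*(r b b' p * rot_deriv b b' F p * F p)\<partial>phaseM)
   =-1/2*(\<integral>p. m (fst p)*(r2 b b' p * (F p * F p))\<partial>phaseM)" if b: "b\<in>Basis" "b'\<in>Basis" for b b'
 proof -
  have e: "rot_deriv b b' (%p. r b b' p * (F p * F p)) p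
    = 2*(r b b' p * rot_deriv b b' F p * F p)+r2 b b' p * (F p * F p)" for p
   unfolding lin_field_mult[OF sr Cc_smooth[OF FF]] lin_field_mult[OF Cc_smooth[OF F] Cc_smooth[OF F]] Xr
   by (simp add: algebra_simps)
  have i1: "integrable phaseM (%p. m (fst p)*(r b b' p * rot_deriv b b' F p * F p))"
   by (rule integrable_weighted_Cc[OF m]) (intro Cc_prod Cc_mult sr Cc_rot_deriv F)
  have i2: "integrable phaseM (%p. m (fst p)*(r2 b b' p * (F p * F p)))"
   by (rule integrable_weighted_Cc[OF m]) (intro Cc_mult r2s FF)
  have "0=(\<integral>p. m (fst p) * rot_deriv b b' (%p. r b b' p * (F p * F p)) p\<partial>phaseM)"
   by (rule integral_rot_field[OF Cc_mult[OF sr FF] loc_boundedD(1)[OF m] loc_boundedD(2)[OF m] b, symmetric])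
  also have "...=(\<integral>p. 2*(m (fst p)*(r b b' p * rot_deriv b b' F p * F p))+m (fst p)*(r2 b b' p * (F p * F p))\<partial>phaseM)"
   unfolding e by (simp add: algebra_simps)
  also have "...=2*(\<integral>p. m (fst p)*(r b b' p * rot_deriv b b' F p * F p)\<partial>phaseM)
    + (\<integral>p. m (fst p)*(r2 b b' p * (F p * F p))\<partial>phaseM)"
   using i1 i2 by simp
  finally show ?thesis by simp
 qed
 have "(\<integral>p. m (fst p)*(tan_deriv c F p * F p)\<partial>phaseM)
   = (\<integral>p. 1/2*(\<Sum>b\<in>Basis. \<Sum>b'\<in>Basis. m (fst p)*(r b b' p * rot_deriv b b' F p * F p))\<partial>phaseM)"
  unfolding tan_deriv_def r_def by (simp add: sum_distrib_left sum_distrib_right mult_ac)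
 also have "...=1/2*(\<Sum>b\<in>Basis. \<Sum>b'\<in>Basis. \<integral>p. m (fst p)*(r b b' p * rot_deriv b b' F p * F p)\<partial>phaseM)"
 proof -
  have "integrable phaseM (%p. m (fst p)*(r b b' p * rot_deriv b b' F p * F p))" for b b'
   by (rule integrable_weighted_Cc[OF m]) (intro Cc_prod Cc_mult sr Cc_rot_deriv F)
  then show ?thesis by (simp add: Bochner_Integration.integral_sum)
 qed
 also have "...=1/2*(\<Sum>b\<in>Basis. \<Sum>b'\<in>Basis.-1/2*(\<integral>p. m (fst p)*(r2 b b' p * (F p * F p))\<partial>phaseM))"
  using one by simp
 also have "... =-1/2*(\<integral>p. 1/2*(\<Sum>b\<in>Basis. \<Sum>b'\<in>Basis. m (fst p)*(r2 b b' p * (F p * F p)))\<partial>phaseM)"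
 proof -
  have "integrable phaseM (%p. m (fst p)*(r2 b b' p * (F p * F p)))" for b b'
   by (rule integrable_weighted_Cc[OF m]) (intro Cc_mult r2s FF)
  then show ?thesis by (simp add: Bochner_Integration.integral_sum sum_distrib_left)
 qed
 also have "(\<integral>p. 1/2*(\<Sum>b\<in>Basis. \<Sum>b'\<in>Basis. m (fst p)*(r2 b b' p * (F p * F p)))\<partial>phaseM)
   = (\<integral>p.-(real DIM('a)-1)*(m (fst p)*((snd p\<bullet>c)*(F p)\<^sup>2))\<partial>phaseM)"
 proof (rule Bochner_Integration.integral_cong[OF refl])
  fix p :: "'a \<times> 'a"
  have "1/2*(\<Sum>b\<in>Basis. \<Sum>b'\<in>Basis. m (fst p)*(r2 b b' p * (F p * F p)))
    = m (fst p)*(F p)\<^sup>2*(1/2*(\<Sum>b\<in>Basis. \<Sum>b'\<in>Basis. r2 b b' p))"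
   by (simp add: sum_distrib_left power2_eq_square mult_ac)
  then show "1/2*(\<Sum>b\<in>Basis. \<Sum>b'\<in>Basis. m (fst p)*(r2 b b' p * (F p * F p)))
    =-(real DIM('a)-1)*(m (fst p)*((snd p\<bullet>c)*(F p)\<^sup>2))"
   unfolding r2_def sum_rot_gen_square by (simp add: mult_ac)
 qed
 finally have E: "(\<integral>p. m (fst p)*(tan_deriv c F p * F p)\<partial>phaseM)
   =-1/2*(\<integral>p.-(real DIM('a)-1)*(m (fst p)*((snd p\<bullet>c)*(F p)\<^sup>2))\<partial>phaseM)" .
 have "- 1/2*(- (d-1) * I)=(d-1)/2 * I" for d I :: real by (simp add: field_simps)
 then show ?thesis unfolding E integral_mult_right_zero .
qed

section \<open>The range of the resolvent of the spherical Laplacian\<close>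

lemma lin_field_cong_open:
 assumes "open U" "p\<in>U" "!!q. q\<in>U ==> F q=G q" shows "lin_field A F p=lin_field A G p"
 unfolding lin_field_def using frechet_derivative_cong_open[OF assms] by simp

lemma sphere_lap_cong_open:
 assumes U: "open U" and p: "p\<in>U" and "!!q. q\<in>U ==> F q=G q" shows "sphere_lap F p=sphere_lap G p"
proof -
 have "rot_deriv b b' F q=rot_deriv b b' G q" if "q\<in>U" for b b' q
  by (rule lin_field_cong_open[OF U that assms(3)])
 then have "rot_deriv b b' (rot_deriv b b' F) p=rot_deriv b b' (rot_deriv b b' G) p" for b b'
  by (intro lin_field_cong_open[OF U p])
 then show ?thesis by (simp add: sphere_lap_def)
qed

lemma rot_deriv_inner_power:
 "rot_deriv b b' (%p. (snd p\<bullet>v) ^ n)=(%p. real n * (snd p\<bullet>v) ^ (n-1)*(rot_gen b b' (snd p)\<bullet>v))"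
proof
 fix p :: "'a \<times> 'a"
 have bl: "bounded_linear (%p::'a \<times> 'a. snd p\<bullet>v)"
  using bounded_linear_compose[OF bounded_linear_inner_left bounded_linear_snd] .
 have d: "((%p. snd p\<bullet>v) has_derivative (%h. snd h\<bullet>v)) (at p)" by (rule bounded_linear_imp_has_derivative[OF bl])
 have "((%p. (snd p\<bullet>v) ^ n) has_derivative (%h. of_nat n * (snd h\<bullet>v)*(snd p\<bullet>v) ^ (n-1))) (at p)"
  by (rule has_derivative_power[OF d])
 then show "rot_deriv b b' (%p. (snd p\<bullet>v) ^ n) p=real n * (snd p\<bullet>v) ^ (n-1)*(rot_gen b b' (snd p)\<bullet>v)"
  unfolding lin_field_def by (simp add: dderiv_eqI rot_field_def mult_ac)
qed

lemma rot_deriv_fst: "smooth_on UNIV a ==> rot_deriv b b' (%p. a (fst p))=(%_. 0)"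
proof
 fix p :: "'a \<times> 'a" assume a: "smooth_on UNIV a"
 have "((%p. a (fst p)) has_derivative (%h. dderiv (fst h) a (fst p))) (at p)"
  using has_derivative_compose[OF bounded_linear_imp_has_derivative[OF bounded_linear_fst] smooth_on_has_derivative[OF a UNIV_I]] .
 moreover have "dderiv 0 a (fst p)=0"
  by (rule linear_0[OF dderiv_linear[OF smooth_on_differentiable[OF a UNIV_I]]])
 ultimately show "rot_deriv b b' (%p. a (fst p)) p=0"
  unfolding lin_field_def by (simp add: dderiv_eqI rot_field_def)
qed

text \<open>On powers of a linear form the spherical Laplacian is triangular in the degree.\<close>

lemma sphere_lap_tensor_power:
 fixes a :: "'a::euclidean_space => real"
 assumes a: "smooth_on UNIV a" and p: "p\<in>phase_space"
 shows "sphere_lap (%p. a (fst p)*(snd p\<bullet>v) ^ n) p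
  = real n * (real n-1)*(v\<bullet>v)*(a (fst p)*(snd p\<bullet>v) ^ (n-2))
   - real n * (real n+real DIM('a)-2)*(a (fst p)*(snd p\<bullet>v) ^ n)"
proof -
 let ?l = "%p::'a \<times> 'a. snd p\<bullet>v"
 let ?r = "%b b' (p::'a \<times> 'a). rot_gen b b' (snd p)\<bullet>v"
 have sa: "smooth_on UNIV (%p::'a \<times> 'a. a (fst p))" by (rule smooth_on_compose_linear[OF bounded_linear_fst a])
 have sl: "smooth_on UNIV (%p. ?l p ^ k)" for k
  by (intro smooth_on_power smooth_on_linear open_UNIV bounded_linear_compose[OF bounded_linear_inner_left bounded_linear_snd])
 have sr: "smooth_on UNIV (?r b b')" for b b' by (intro smooth_on_linear bounded_linear_rot_gen_snd open_UNIV)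
 have Xr: "rot_deriv b b' (?r b b') p=rot_gen b b' (rot_gen b b' (snd p))\<bullet>v" for b b' p
  unfolding lin_field_def
  by (simp add: dderiv_eqI[OF bounded_linear_imp_has_derivative[OF bounded_linear_rot_gen_snd]] rot_field_def)
 have e1: "rot_deriv b b' (%p. a (fst p)*?l p ^ n)=(%p. real n * (a (fst p)*(?l p ^ (n-1)*?r b b' p)))" for b b'
  unfolding lin_field_mult[OF sa sl] rot_deriv_fst[OF a] rot_deriv_inner_power by (simp add: mult_ac)
 have e2: "rot_deriv b b' (rot_deriv b b' (%p. a (fst p)*?l p ^ n)) p
   = real n * (a (fst p)*(?l p ^ (n-1)*(rot_gen b b' (rot_gen b b' (snd p))\<bullet>v)
     + real (n-1)*?l p ^ (n-1-1)*(?r b b' p)\<^sup>2))" for b b'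
  unfolding e1 lin_field_cmult[OF smooth_on_mult[OF open_UNIV sa smooth_on_mult[OF open_UNIV sl sr]]]
   lin_field_mult[OF sa smooth_on_mult[OF open_UNIV sl sr]] lin_field_mult[OF sl sr] rot_deriv_fst[OF a]
   rot_deriv_inner_power Xr by (simp add: power2_eq_square mult_ac)
 have y: "snd p\<bullet>snd p=1" using p by (auto simp: phase_space_def dot_square_norm)
 have "1/2*(\<Sum>b\<in>Basis. \<Sum>b'\<in>Basis. (?r b b' p)\<^sup>2)=((1/2) *\<^sub>R (\<Sum>b\<in>Basis. \<Sum>b'\<in>Basis. (rot_gen b b' (snd p)\<bullet>v) *\<^sub>R rot_gen b b' (snd p)))\<bullet>v"
  by (simp add: inner_sum_left power2_eq_square)
 also have "...=v\<bullet>v-(?l p)\<^sup>2"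
  unfolding sum_rot_gen_projection y by (simp add: inner_diff_left power2_eq_square inner_commute[of v "snd p"])
 finally have s1: "1/2*(\<Sum>b\<in>Basis. \<Sum>b'\<in>Basis. (?r b b' p)\<^sup>2)=v\<bullet>v-(?l p)\<^sup>2" .
 have "sphere_lap (%p. a (fst p)*?l p ^ n) p
   = real n * a (fst p)*?l p ^ (n-1)*(1/2*(\<Sum>b\<in>Basis. \<Sum>b'\<in>Basis. rot_gen b b' (rot_gen b b' (snd p))\<bullet>v))
    + real n * a (fst p) * real (n-1)*?l p ^ (n-1-1)*(1/2*(\<Sum>b\<in>Basis. \<Sum>b'\<in>Basis. (?r b b' p)\<^sup>2))"
  unfolding sphere_lap_def e2 by (simp add: sum_distrib_left sum.distrib distrib_left mult_ac)
 also have "...=real n * a (fst p)*?l p ^ (n-1)*(- (real DIM('a)-1)*?l p)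
    + real n * a (fst p) * real (n-1)*?l p ^ (n-2)*(v\<bullet>v-(?l p)\<^sup>2)"
  unfolding s1 sum_rot_gen_square by (simp add: numeral_2_eq_2)
 also have "...=real n * (real n-1)*(v\<bullet>v)*(a (fst p)*?l p ^ (n-2))
   - real n * (real n+real DIM('a)-2)*(a (fst p)*?l p ^ n)"
 proof -
  consider "n=0" | "n=1" | k where "n=Suc (Suc k)" by (metis One_nat_def not0_implies_Suc)
  then show ?thesis by cases (auto simp: algebra_simps power2_eq_square)
 qed
 finally show ?thesis .
qed

lemma approx_closed:
 assumes "R \<subseteq> L2 M"
 defines "G \<equiv> {f\<in>L2 M. \<forall>e>0. \<exists>r\<in>R. l2_norm M (%p. f p-r p) < e}"
 shows "f\<in>L2 M ==> (!!e. e > 0 ==> \<exists>g\<in>G. l2_norm M (%p. f p-g p) < e) ==> f\<in>G"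
proof -
 assume f: "f\<in>L2 M" and ap: "!!e. e > 0 ==> \<exists>g\<in>G. l2_norm M (%p. f p-g p) < e"
 have "\<exists>r\<in>R. l2_norm M (%p. f p-r p) < e" if e: "e > 0" for e
 proof -
  obtain g where g: "g\<in>G" "l2_norm M (%p. f p-g p) < e/2" using ap[of "e/2"] e by auto
  have "e/2 > 0" using e by simp
  with g(1) have "\<exists>r\<in>R. l2_norm M (%p. g p-r p) < e/2" unfolding G_def by blast
  then obtain r where r: "r\<in>R" "l2_norm M (%p. g p-r p) < e/2" by blast
  have "l2_norm M (%p. f p-r p) < e"
   using l2_triangle_diff[of f M g r] f g r assms(1) by (auto simp: G_def)
  then show ?thesis by (rule bexI[OF _ r(1)])
 qed
 then show "f\<in>G" using f by (simp add: G_def)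
qed

lemma approx_subspace:
 assumes R: "R \<subseteq> L2 M" "!!f g. f\<in>R ==> g\<in>R ==> (%p. f p+g p)\<in>R" "!!f c. f\<in>R ==> (%p. c * f p)\<in>R"
 defines "G \<equiv> {f\<in>L2 M. \<forall>e>0. \<exists>r\<in>R. l2_norm M (%p. f p-r p) < e}"
 shows approx_add: "f\<in>G ==> g\<in>G ==> (%p. f p+g p)\<in>G"
  and approx_cmult: "f\<in>G ==> (%p. c * f p)\<in>G"
  and approx_self: "f\<in>R ==> f\<in>G"
proof -
 show "f\<in>R ==> f\<in>G" using R(1) by (auto simp: G_def intro!: bexI[of _ f]) (simp add: l2_norm_def)
 assume f: "f\<in>G"
 show "(%p. c * f p)\<in>G"
  unfolding G_def
 proof (intro CollectI conjI allI impI)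
  show "(%p. c * f p)\<in>L2 M" using f by (auto simp: G_def intro: L2_cmult)
  fix e :: real assume e: "e > 0"
  have "e/(\<bar>c\<bar>+1) > 0" using e by simp
  then obtain r where r: "r\<in>R" "l2_norm M (%p. f p-r p) < e/(\<bar>c\<bar>+1)" using f unfolding G_def by blast
  have "l2_norm M (%p. c * f p-c * r p)=\<bar>c\<bar> * l2_norm M (%p. f p-r p)"
   using l2_norm_cmult[of M c "%p. f p-r p"] by (simp add: right_diff_distrib)
  also have "...<=\<bar>c\<bar>*(e/(\<bar>c\<bar>+1))" using r(2) by (intro mult_left_mono) auto
  also have "... < e" using e by (simp add: field_simps)
  finally show "\<exists>r\<in>R. l2_norm M (%p. c * f p-r p) < e" by (rule bexI[OF _ R(3)[OF r(1)]])
 qed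
 assume g: "g\<in>G"
 show "(%p. f p+g p)\<in>G"
  unfolding G_def
 proof (intro CollectI conjI allI impI)
  show "(%p. f p+g p)\<in>L2 M" using f g by (auto simp: G_def intro: L2_add)
  fix e :: real assume e: "e > 0"
  then have e2: "e/2 > 0" by simp
  obtain r where r: "r\<in>R" "l2_norm M (%p. f p-r p) < e/2" using f e2 unfolding G_def by blast
  obtain s where s: "s\<in>R" "l2_norm M (%p. g p-s p) < e/2" using g e2 unfolding G_def by blast
  have "l2_norm M (%p. (f p-r p)+(g p-s p))<=l2_norm M (%p. f p-r p)+l2_norm M (%p. g p-s p)"
   using f g r(1) s(1) R(1) by (intro l2_triangle L2_diff) (auto simp: G_def)
  then have "l2_norm M (%p. f p+g p-(r p+s p)) < e" using r(2) s(2) by (simp add: algebra_simps)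
  then show "\<exists>r\<in>R. l2_norm M (%p. f p+g p-r p) < e" by (rule bexI[OF _ R(2)[OF r(1) s(1)]])
 qed
qed

lemma emeasure_phase_bounded: "emeasure phaseM (cball (0::'a::euclidean_space) R \<times> sphere 0 1) < \<infinity>"
proof -
 have S: "sphere 0 1\<in>sets (sphere_measure :: 'a measure)"
  using sets.top[of "sphere_measure :: 'a measure"] by (simp add: space_sphere_measure)
 have "emeasure phaseM (cball (0::'a) R \<times> sphere 0 1)=emeasure lborel (cball (0::'a) R)*1"
  using S by (simp add: sphere_measure.emeasure_pair_measure_Times emeasure_sphere_measure)
 then show ?thesis using emeasure_lborel_cball_finite[of "0::'a" R] by simp
qed

text \<open>The closure of the range contains every product of a test function of \<open>x\<close> with a power of a linear form in the velocity, by induction on the power, and hence the exponentials, whose span is dense.\<close>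

theorem dense_range_sphere_resolvent:
 assumes c: "c > 0"
 shows "dense_range (phaseM :: ('a::euclidean_space \<times> 'a) measure) Cc (%F p. F p-c * sphere_lap F p)"
proof -
 let ?M = "phaseM :: ('a \<times> 'a) measure"
 define A :: "('a \<times> 'a => real) => 'a \<times> 'a => real" where "A F=(%p. F p-c * sphere_lap F p)" for F
 have lapadd: "sphere_lap (%p. F p+G p)=(%p. sphere_lap F p+sphere_lap G p)" if "F\<in>Cc" "G\<in>Cc" for F G :: "'a \<times> 'a => real"
  unfolding sphere_lap_def
  by (simp add: lin_field_add[OF Cc_smooth[OF that(1)] Cc_smooth[OF that(2)]]
   lin_field_add[OF Cc_smooth[OF Cc_rot_deriv[OF that(1)]] Cc_smooth[OF Cc_rot_deriv[OF that(2)]]]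
   sum.distrib add_divide_distrib)
 have lapc: "sphere_lap (%p. k * F p)=(%p. k * sphere_lap F p)" if "F\<in>Cc" for F :: "'a \<times> 'a => real" and k
  unfolding sphere_lap_def
  by (simp add: lin_field_cmult[OF Cc_smooth[OF that]] lin_field_cmult[OF Cc_smooth[OF Cc_rot_deriv[OF that]]]
   sum_distrib_left)
 define R where "R=A ` Cc"
 have AC: "A F\<in>Cc" if "F\<in>Cc" for F
  unfolding A_def using that by (intro Cc_diff Cc_cmult Cc_sphere_lap)
 have R1: "R \<subseteq> L2 ?M" unfolding R_def using AC L2_phase_Cc by blast
 have R2: "(%p. f p+g p)\<in>R" if "f\<in>R" "g\<in>R" for f g
 proof -
  obtain F G where FG: "F\<in>Cc" "f=A F" "G\<in>Cc" "g=A G" using \<open>f \<in> R\<close> \<open>g \<in> R\<close> unfolding R_def by blast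
  have "(%p. f p+g p)=A (%p. F p+G p)"
   unfolding FG A_def lapadd[OF FG(1,3)] by (simp add: algebra_simps)
  then show ?thesis unfolding R_def using Cc_add[OF FG(1,3)] by simp
 qed
 have R3: "(%p. k * f p)\<in>R" if f: "f\<in>R" for f k
 proof -
  obtain F where F: "F\<in>Cc" "f=A F" using f unfolding R_def by blast
  have "(%p. k * f p)=A (%p. k * F p)" unfolding F A_def lapc[OF F(1)] by (simp add: algebra_simps)
  then show ?thesis unfolding R_def using Cc_cmult[OF F(1)] by simp
 qed
 define G where "G={f\<in>L2 ?M. \<forall>e>0. \<exists>r\<in>R. l2_norm ?M (%p. f p-r p) < e}"
 have Gadd: "(%p. f p+g p)\<in>G" if "f\<in>G" "g\<in>G" for f g
  unfolding G_def by (rule approx_add[OF R1 R2 R3]) (assumption | rule that[unfolded G_def])+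
 have Gc: "(%p. k * f p)\<in>G" if "f\<in>G" for f k
  unfolding G_def by (rule approx_cmult[OF R1 R2 R3]) (assumption | rule that[unfolded G_def])+
 have Gself: "f\<in>G" if "f\<in>R" for f
  unfolding G_def by (rule approx_self[OF R1 R2 R3]) (assumption | rule that)+
 have Gcl: "f\<in>G" if "f\<in>L2 ?M" "!!e. e > 0 ==> \<exists>g\<in>G. l2_norm ?M (%p. f p-g p) < e" for f
  unfolding G_def by (rule approx_closed[OF R1]) (rule that(1), rule that(2)[unfolded G_def])
 have GL: "G \<subseteq> L2 ?M" by (auto simp: G_def)
 have Gcong: "f\<in>G" if "g\<in>G" "f\<in>borel_measurable ?M" "!!p. p\<in>phase_space ==> f p=g p" for f g
 proof (rule Gcl)
  have ae: "AE p in ?M. f p=g p" using that(3) by (intro AE_I2) (simp add: space_phase_measure)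
  show f: "f\<in>L2 ?M"
   by (rule L2_bounded_by[OF that(2), of g]) (use that GL ae in \<open>auto elim: eventually_mono\<close>)
  have "l2_norm ?M (%p. f p-g p)=0"
   using f that(1) GL by (subst l2_norm_eq_0_iff) (auto intro!: L2_diff eventually_mono[OF ae])
  then show "\<exists>g\<in>G. l2_norm ?M (%p. f p-g p) < e" if "e > 0" for e
   by (intro bexI[OF _ \<open>g \<in> G\<close>]) (use that in simp)
 qed
 have meas: "(%p. a (fst p) * h (snd p))\<in>borel_measurable ?M" if "a\<in>Cc" "continuous_on UNIV h" for a h :: "'a => real"
 proof (rule measurable_phase, rule borel_measurable_continuous_onI)
  show "continuous_on UNIV (%p. a (fst p) * h (snd p))"
   by (intro continuous_on_mult continuous_on_compose2[OF Cc_continuous[OF that(1)]] continuous_on_compose2[OF that(2)]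
     continuous_on_fst continuous_on_snd continuous_on_id) auto
 qed
 have "A (%_. 0)\<in>R" unfolding R_def using Cc_0 by blast
 from Gself[OF R3[OF this, of 0]] have zero: "(%_. 0)\<in>G" by simp
 have power: "(%p. a (fst p)*(snd p\<bullet>v) ^ n)\<in>G" if a: "a\<in>Cc" for a v n
 proof (induction n rule: less_induct)
  case (less n)
  define \<psi> where "\<psi> p=(a (fst p) * cutoff 2 (snd p))*(snd p\<bullet>v) ^ n" for p :: "'a \<times> 'a"
  have sv: "smooth_on UNIV (%p::'a \<times> 'a. (snd p\<bullet>v) ^ n)"
   by (intro smooth_on_power smooth_on_linear open_UNIV bounded_linear_compose[OF bounded_linear_inner_left bounded_linear_snd])
  have ac: "(%p::'a\<times>'a. a (fst p) * cutoff 2 (snd p))\<in>Cc"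
  proof -
   obtain B where B: "B > 0" "!!x. B < norm x ==> a x=0" using Cc_support[OF a] by blast
   show ?thesis
   proof (rule CcI[of _ "B+4"])
    show "smooth_on UNIV (%p::'a\<times>'a. a (fst p) * cutoff 2 (snd p))"
     by (intro smooth_on_mult open_UNIV smooth_on_compose_linear[OF bounded_linear_fst Cc_smooth[OF a]]
       smooth_on_compose_linear[OF bounded_linear_snd cutoff_smooth])
    fix p :: "'a \<times> 'a" assume "B+4 < norm p"
    then have "B+4 < norm (fst p)+norm (snd p)" using norm_Pair_le[of "fst p" "snd p"] by simp
    then have "B < norm (fst p) \<or> 4<=norm (snd p)" by linarith
    then show "a (fst p) * cutoff 2 (snd p)=0" using B(2) cutoff_eq_0[of 2 "snd p"] by auto
   qed
  qed
  have \<psi>: "\<psi>\<in>Cc"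
   unfolding \<psi>_def using Cc_mult[OF sv ac] by (simp add: mult.commute)
  define U where "U={p::'a\<times>'a. norm (snd p) < 2}"
  have U: "open U" unfolding U_def by (intro open_Collect_less continuous_intros)
  have eU: "\<psi> p=a (fst p)*(snd p\<bullet>v) ^ n" if "p\<in>U" for p
   using that by (simp add: \<psi>_def U_def cutoff_eq_1)
  let ?k = "1+c * (real n * (real n+real DIM('a)-2))"
  have "DIM('a) \<ge> 1" by (simp add: DIM_positive Suc_leI)
  then have d1: "real DIM('a) \<ge> 1" by simp
  have "real n * (real n+real DIM('a)-2) \<ge> 0"
  proof (cases n)
   case (Suc k)
   then have "real n \<ge> 1" by simp
   then have "0<=real n" "0<=real n+real DIM('a)-2" using d1 by linarith+
   then show ?thesis by (rule mult_nonneg_nonneg)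
  qed simp
  then have k: "?k > 0" using c by (simp add: add_pos_nonneg)
  have rec: "a (fst p)*(snd p\<bullet>v) ^ n=1/?k * (A \<psi> p+(c * (real n * (real n-1)*(v\<bullet>v)))*(a (fst p)*(snd p\<bullet>v) ^ (n-2)))"
   if p: "p\<in>phase_space" for p
  proof -
   have pU: "p\<in>U" using p by (auto simp: U_def phase_space_def)
   have "A \<psi> p=a (fst p)*(snd p\<bullet>v) ^ n-c * sphere_lap (%p. a (fst p)*(snd p\<bullet>v) ^ n) p"
    unfolding A_def using sphere_lap_cong_open[OF U pU eU] eU[OF pU] by simp
   then have "A \<psi> p+(c * (real n * (real n-1)*(v\<bullet>v)))*(a (fst p)*(snd p\<bullet>v) ^ (n-2))
     = ?k * (a (fst p)*(snd p\<bullet>v) ^ n)"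
    unfolding sphere_lap_tensor_power[OF Cc_smooth[OF a] p] by (simp add: algebra_simps)
   then show ?thesis using k by simp
  qed
  have lower: "(%p. (c * (real n * (real n-1)*(v\<bullet>v)))*(a (fst p)*(snd p\<bullet>v) ^ (n-2)))\<in>G"
  proof (cases "n < 2")
   case True
   then have "real n * (real n-1)=0" by (cases n) auto
   then have "(%p. (c * (real n * (real n-1)*(v\<bullet>v)))*(a (fst p)*(snd p\<bullet>v) ^ (n-2)))=(%p::'a\<times>'a. 0)"
    by (simp only:) simp
   then show ?thesis using zero by (simp only:)
  next
   case False
   then show ?thesis by (intro Gc less.IH) simp
  qed
  have A\<psi>: "A \<psi>\<in>G" by (rule Gself) (use \<psi> in \<open>simp add: R_def\<close>)
  show ?case
   by (rule Gcong[OF Gc[OF Gadd[OF A\<psi> lower], of "1/?k"] meas[OF a] rec]) (intro continuous_intros)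
 qed
 have sums: "(%p. a (fst p)*(\<Sum>k<n. (snd p\<bullet>v) ^ k/fact k))\<in>G" if a: "a\<in>Cc" for a v and n :: nat
 proof (induction n)
  case 0
  then show ?case using zero by simp
 next
  case (Suc n)
  have "(%p. 1/fact n * (a (fst p)*(snd p\<bullet>v) ^ n))\<in>G" by (rule Gc[OF power[OF a]])
  from Gadd[OF Suc this] show ?case by (simp add: algebra_simps)
 qed
 have tensor: "(%p. a (fst p) * exp (v\<bullet>snd p))\<in>G" if a: "a\<in>Cc" for a v
 proof (rule Gcl)
  let ?f = "%p::'a \<times> 'a. a (fst p) * exp (v\<bullet>snd p)"
  let ?u = "%n (p::'a \<times> 'a). a (fst p)*(\<Sum>k<n. (snd p\<bullet>v) ^ k/fact k)"
  let ?w = "%p::'a \<times> 'a. (2 * exp (norm v))*\<bar>a (fst p)\<bar>"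
  have fm: "?f\<in>borel_measurable ?M" by (intro meas[OF a] continuous_intros)
  have ex: "(%k. s ^ k/fact k) sums exp s" for s :: real
   using exp_converges[of s] by (simp add: divide_inverse mult.commute)
  have part: "\<bar>\<Sum>k<n. s ^ k/fact k\<bar><=exp \<bar>s\<bar>" for s :: real and n
  proof -
   have "\<bar>\<Sum>k<n. s ^ k/fact k\<bar><=(\<Sum>k<n. \<bar>s\<bar> ^ k/fact k)"
    by (rule order_trans[OF sum_abs]) (simp add: power_abs)
   also have "...<=exp \<bar>s\<bar>" using sum_le_suminf[OF sums_summable[OF ex[of "\<bar>s\<bar>"]], of "{..<n}"] sums_unique[OF ex[of "\<bar>s\<bar>"]] by simp
   finally show ?thesis .
  qed
  have le: "exp \<bar>snd p\<bullet>v\<bar><=exp (norm v)" if "p\<in>phase_space" for p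
   using Cauchy_Schwarz_ineq2[of "snd p" v] that by (auto simp: phase_space_def)
  have aL: "(%p::'a\<times>'a. \<bar>a (fst p)\<bar>)\<in>L2 ?M"
  proof -
   have "(%p::'a\<times>'a. a (fst p)*(snd p\<bullet>v) ^ 0)\<in>L2 ?M" using power[OF a] GL by blast
   then have "(%p::'a\<times>'a. a (fst p))\<in>L2 ?M" by simp
   then show ?thesis by (rule L2_bounded_by[rotated]) (use \<open>(\<lambda>p. a (fst p)) \<in> L2 ?M\<close> in auto)
  qed
  show fL: "?f\<in>L2 ?M"
  proof (rule L2_bounded_by[OF fm L2_cmult[OF aL, of "exp (norm v)"]], rule AE_I2)
   fix p :: "'a \<times> 'a" assume "p\<in>space ?M"
   then have p: "p\<in>phase_space" by (simp add: space_phase_measure)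
   have "exp (v\<bullet>snd p)<=exp (norm v)" using le[OF p] by (simp add: inner_commute)
   from mult_left_mono[OF this abs_ge_zero[of "a (fst p)"]]
   show "\<bar>?f p\<bar><=\<bar>exp (norm v)*\<bar>a (fst p)\<bar>\<bar>" by (simp add: abs_mult mult.commute)
  qed
  have "(%n. l2_norm ?M (%p. ?u n p-?f p)) ----> 0"
  proof (rule l2_dominated_convergence[where w = ?w])
   show "?u n\<in>borel_measurable ?M" for n using sums[OF a] GL L2_meas by blast
   show "?w\<in>L2 ?M" by (rule L2_cmult[OF aL])
   show "AE p in ?M. \<bar>?u n p-?f p\<bar><=?w p" for n
   proof (rule AE_I2)
    fix p :: "'a \<times> 'a" assume "p\<in>space ?M"
    then have p: "p\<in>phase_space" by (simp add: space_phase_measure)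
    have "?u n p-?f p=a (fst p)*((\<Sum>k<n. (snd p\<bullet>v) ^ k/fact k)-exp (snd p\<bullet>v))"
     by (simp add: right_diff_distrib inner_commute)
    also have "\<bar>...\<bar><=\<bar>a (fst p)\<bar>*(2 * exp (norm v))"
     unfolding abs_mult
    proof (intro mult_left_mono)
     have "exp (snd p\<bullet>v)<=exp \<bar>snd p\<bullet>v\<bar>" by simp
     then show "\<bar>(\<Sum>k<n. (snd p\<bullet>v) ^ k/fact k)-exp (snd p\<bullet>v)\<bar><=2 * exp (norm v)"
      using part[of "snd p\<bullet>v" n] le[OF p] exp_gt_zero[of "snd p\<bullet>v"] by linarith
    qed simp
    finally show "\<bar>?u n p-?f p\<bar><=?w p" by (simp add: mult.commute)
   qed
   show "AE p in ?M. (%n. ?u n p) ----> ?f p"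
    using ex by (intro AE_I2 tendsto_mult_left) (simp add: sums_def inner_commute)
  qed (rule fm)
  then have lim: "(%n. l2_norm ?M (%p. ?f p-?u n p)) ----> 0" by (subst l2_norm_minus)
  fix e :: real assume "e > 0"
  then have "eventually (%n. l2_norm ?M (%p. ?f p-?u n p) < e) sequentially"
   using lim by (intro order_tendstoD(2)) auto
  then obtain n where "l2_norm ?M (%p. ?f p-?u n p) < e" using eventually_happens by force
  then show "\<exists>g\<in>G. l2_norm ?M (%p. ?f p-g p) < e" by (rule bexI[OF _ sums[OF a]])
 qed
 have "h\<in>G" if "h\<in>L2 ?M" for h
  by (rule tensor_dense[OF refl emeasure_phase_bounded GL Gadd Gc Gcl tensor that])
 then show ?thesis
  unfolding dense_range_def G_def R_def A_def by blast
qed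

section \<open>Adding the transport: finite differences and mollification\<close>

declare measurable_sphere_id[measurable del]

lemma sphere_lap_add:
 assumes "F\<in>Cc" "G\<in>Cc"
 shows "sphere_lap (%p. F p+G p)=(%p. sphere_lap F p+sphere_lap G p)"
 unfolding sphere_lap_def
 by (simp add: lin_field_add[OF Cc_smooth[OF assms(1)] Cc_smooth[OF assms(2)]]
  lin_field_add[OF Cc_smooth[OF Cc_rot_deriv[OF assms(1)]] Cc_smooth[OF Cc_rot_deriv[OF assms(2)]]]
  sum.distrib add_divide_distrib)

lemma sphere_lap_nonpos:
 fixes F :: "'a::euclidean_space \<times> 'a => real"
 assumes "F\<in>Cc"
 shows "l2_inner phaseM (sphere_lap F) F
  =-1/2*(\<Sum>b\<in>Basis. \<Sum>b'\<in>Basis. (l2_norm phaseM (rot_deriv b b' F))\<^sup>2)"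
 using sphere_lap_by_parts[OF loc_bounded_const assms, of 1] by (simp add: l2_inner_def l2_norm_sq)

lemma l2_inner_transport: "F\<in>Cc ==> l2_inner phaseM (transport F) F=0"
 using transport_by_parts[of F F] by (simp add: l2_inner_def mult.commute)

text \<open>The bounded difference quotient that stands in for the transport derivative.\<close>

definition shift_quot :: "real => ('a::euclidean_space \<times> 'a => real) => 'a \<times> 'a => real" where
 "shift_quot s F p=(F (fst p+s *\<^sub>R snd p, snd p)-F p)/s"

lemma Cc_shift:
 fixes F :: "'a::euclidean_space \<times> 'a => real"
 assumes F: "F\<in>Cc" shows "(%p. F (fst p+s *\<^sub>R snd p, snd p))\<in>Cc"
proof (rule Cc_compose_linear[OF F, where c = "1/(2+\<bar>s\<bar>)"])
 have "linear (%p::'a \<times> 'a. (fst p+s *\<^sub>R snd p, snd p))" by (rule linearI) (simp_all add: algebra_simps)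
 then show "bounded_linear (%p::'a \<times> 'a. (fst p+s *\<^sub>R snd p, snd p))" by (simp add: linear_conv_bounded_linear)
 fix p :: "'a \<times> 'a"
 let ?q = "(fst p+s *\<^sub>R snd p, snd p)"
 have "norm p<=norm (fst p)+norm (snd p)" using norm_Pair_le[of "fst p" "snd p"] by simp
 also have "norm (fst p)<=norm (fst p+s *\<^sub>R snd p)+\<bar>s\<bar> * norm (snd p)"
  using norm_triangle_ineq4[of "fst p+s *\<^sub>R snd p" "s *\<^sub>R snd p"] by simp
 also have "norm (fst p+s *\<^sub>R snd p)<=norm ?q" using norm_fst_le[of "fst p+s *\<^sub>R snd p" "snd p"] by simp
 also have "\<bar>s\<bar> * norm (snd p)<=\<bar>s\<bar> * norm ?q"
  using norm_snd_le[of "snd p" "fst p+s *\<^sub>R snd p"] by (intro mult_left_mono) auto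
 also have "norm (snd p)<=norm ?q" using norm_snd_le[of "snd p" "fst p+s *\<^sub>R snd p"] by simp
 finally have "norm p<=(2+\<bar>s\<bar>) * norm ?q" by (simp add: algebra_simps)
 then show "1/(2+\<bar>s\<bar>) * norm p<=norm ?q" by (simp add: divide_simps mult.commute)
qed simp

lemma Cc_shift_quot: "F\<in>Cc ==> shift_quot s F\<in>Cc"
 unfolding shift_quot_def using Cc_cmult[OF Cc_diff[OF Cc_shift], of F F "inverse s" s]
 by (simp add: divide_inverse mult.commute)

lemma l2_norm_shift:
 fixes F :: "'a::euclidean_space \<times> 'a => real"
 assumes F: "F\<in>Cc"
 shows "l2_norm phaseM (%p. F (fst p+s *\<^sub>R snd p, snd p))=l2_norm phaseM F"
proof -
 have "(%p. (F p)\<^sup>2)\<in>borel_measurable phaseM"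
  using measurable_phase[OF Cc_measurable[OF F]] by measurable
 from integral_distr[OF phase_measure_transport(1)[of s] this]
 show ?thesis unfolding phase_measure_transport(2) l2_norm_def by simp
qed

lemma shift_quot_bound:
 fixes F :: "'a::euclidean_space \<times> 'a => real"
 assumes F: "F\<in>Cc" and s: "s > 0"
 shows "l2_norm phaseM (shift_quot s F)<=2/s * l2_norm phaseM F"
  and "l2_inner phaseM (shift_quot s F) F<=0"
proof -
 let ?M = "phaseM :: ('a \<times> 'a) measure" and ?S = "%p. F (fst p+s *\<^sub>R snd p, snd p)"
 note L = L2_phase_Cc[OF F] L2_phase_Cc[OF Cc_shift[OF F, of s]]
 have e: "shift_quot s F=(%p. (1/s)*(?S p-F p))" by (simp add: shift_quot_def fun_eq_iff)
 have "l2_norm ?M (%p. ?S p-F p)<=2 * l2_norm ?M F"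
  using l2_triangle_minus[OF L(2,1)] l2_norm_shift[OF F, of s] by simp
 then show "l2_norm ?M (shift_quot s F)<=2/s * l2_norm ?M F"
  unfolding e l2_norm_cmult using s by (simp add: divide_right_mono)
 have "l2_inner ?M (%p. (1/s)*?S p+(- (1/s)) * F p) F=(1/s)*(l2_inner ?M ?S F-(l2_norm ?M F)\<^sup>2)"
  unfolding l2_inner_lincomb[OF L(2,1,1)] l2_inner_self by (simp add: right_diff_distrib)
 also have "...<=(1/s)*0"
  using l2_Cauchy_Schwarz[OF L(2,1)] l2_norm_shift[OF F, of s] s
  by (intro mult_left_mono) (auto simp: power2_eq_square)
 finally show "l2_inner ?M (shift_quot s F) F<=0" unfolding e by (simp add: right_diff_distrib)
qed

lemma shift_quot_add: "shift_quot s (%p. F p+G p)=(%p. shift_quot s F p+shift_quot s G p)"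
 by (simp add: shift_quot_def fun_eq_iff add_divide_distrib diff_divide_distrib)

lemma dissipative_lower_bound:
 assumes F: "F\<in>L2 M" "K\<in>L2 M" and d: "l2_inner M K F<=0"
 shows "l2_norm M F<=l2_norm M (%p. F p-K p)"
proof -
 have "(l2_norm M F)\<^sup>2<=l2_inner M (%p. F p-K p) F"
  using d l2_inner_diff[OF F(1) F(2) F(1)] by (simp add: l2_inner_self)
 also have "...<=l2_norm M (%p. F p-K p) * l2_norm M F" by (intro l2_Cauchy_Schwarz L2_diff F)
 finally show ?thesis using l2_norm_nonneg[of M F] l2_norm_nonneg[of M "%p. F p-K p"]
  by (cases "l2_norm M F=0") (auto simp: power2_eq_square)
qed

lemma sphere_lap_inner_nonpos: "F\<in>Cc ==> l2_inner phaseM (sphere_lap F) F<=0"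
 unfolding sphere_lap_nonpos by (simp add: sum_nonneg)

lemma dense_range_shift:
 assumes c: "c > 0" and s: "s > 0"
 shows "dense_range (phaseM :: ('a::euclidean_space \<times> 'a) measure) Cc
  (%F p. (F p-c * sphere_lap F p)-shift_quot s F p)"
proof (rule dense_range_perturb[where C = "2/s"])
 let ?M = "phaseM :: ('a \<times> 'a) measure"
 show "dense_range ?M Cc (%F p. F p-c * sphere_lap F p)" by (rule dense_range_sphere_resolvent[OF c])
 show "(%p. (F p+G p)-c * sphere_lap (%p. F p+G p) p)=(%p. (F p-c * sphere_lap F p)+(G p-c * sphere_lap G p))"
  if "F\<in>Cc" "G\<in>Cc" for F G :: "'a \<times> 'a => real"
  unfolding sphere_lap_add[OF that] by (simp add: algebra_simps)
 fix F :: "'a \<times> 'a => real" and t :: real assume F: "F\<in>Cc" and t: "0<=t" "t<=1"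
 note L = L2_phase_Cc[OF F] L2_phase_Cc[OF Cc_sphere_lap[OF F]] L2_phase_Cc[OF Cc_shift_quot[OF F, of s]]
 have "l2_inner ?M (%p. c * sphere_lap F p+t * shift_quot s F p) F<=0"
  unfolding l2_inner_lincomb[OF L(2,3,1)]
  using mult_nonneg_nonpos[of c, OF _ sphere_lap_inner_nonpos[OF F]] mult_nonneg_nonpos[OF t(1) shift_quot_bound(2)[OF F s]] c by simp
 then have "l2_norm ?M F<=l2_norm ?M (%p. F p-(c * sphere_lap F p+t * shift_quot s F p))"
  by (intro dissipative_lower_bound L L2_lincomb)
 then have "2/s * l2_norm ?M F<=2/s * l2_norm ?M (%p. F p-c * sphere_lap F p-t * shift_quot s F p)"
  using s by (intro mult_left_mono) (auto simp: diff_diff_eq)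
 with shift_quot_bound(1)[OF F s]
 show "l2_norm ?M (shift_quot s F)<=2/s * l2_norm ?M (%p. F p-c * sphere_lap F p-t * shift_quot s F p)" by linarith
qed (auto intro!: Cc_0 Cc_add L2_phase_Cc Cc_diff Cc_cmult Cc_sphere_lap Cc_shift_quot simp: shift_quot_add)

lemma phase_measure_translate:
 shows "(%p. (fst p-u, snd p))\<in>measurable (phaseM :: ('a::euclidean_space \<times> 'a) measure) phaseM"
  and "distr phaseM phaseM (%p. (fst p-u, snd p))=(phaseM :: ('a \<times> 'a) measure)"
proof -
 have m: "(%x. x-u)\<in>measurable lborel (lborel :: 'a measure)" by simp
 have d: "distr lborel lborel (%x. x-u)=(lborel :: 'a measure)"
 proof -
  have "distr lborel lborel (%x. x-u)=distr lborel borel ((+) (- u))" by (intro distr_cong) auto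
  then show ?thesis by (simp add: lborel_distr_plus)
 qed
 show "(%p. (fst p-u, snd p))\<in>measurable (phaseM :: ('a \<times> 'a) measure) phaseM"
  by (intro measurable_Pair measurable_compose[OF measurable_fst m] measurable_snd)
 have "distr lborel lborel (%x. x-u) \<Otimes>\<^sub>M distr sphere_measure sphere_measure (%y::'a. y)
   = distr phaseM phaseM (%(x, y). (x-u, y))"
  by (rule pair_measure_distr[OF m]) (simp_all add: sphere_measure.sigma_finite_measure_axioms)
 then show "distr phaseM phaseM (%p. (fst p-u, snd p))=(phaseM :: ('a \<times> 'a) measure)"
  by (simp add: d split_beta')
qed

text \<open>Young's inequality for convolution in \<open>x\<close>: by the Cauchy-Schwarz inequality the square of the
  convolution is at most \<open>(\<integral>k) (k * \<psi>\<^sup>2)\<close>, whose integral is computed by Fubini.\<close>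

lemma young_inequality:
 fixes \<psi> g :: "'a::euclidean_space \<times> 'a => real" and k :: "'a => real"
 assumes g: "g\<in>borel_measurable phaseM" and \<psi>: "\<psi>\<in>borel_measurable borel" "\<psi>\<in>L2 phaseM"
  and k: "integrable lborel k" "!!u. k u \<ge> 0"
  and le: "!!p. p\<in>phase_space ==> ennreal \<bar>g p\<bar><=(\<integral>\<^sup>+u. ennreal (k u) * ennreal \<bar>\<psi> (fst p-u, snd p)\<bar>\<partial>lborel)"
 shows "l2_norm phaseM g<=(\<integral>u. k u\<partial>lborel) * l2_norm phaseM \<psi>"
proof -
 let ?M = "phaseM :: ('a \<times> 'a) measure"
 define K where "K=(\<integral>u. k u\<partial>lborel)"
 have K0: "K \<ge> 0" unfolding K_def using k(2) by simp
 have km[measurable]: "k\<in>borel_measurable borel" using k(1) by simp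
 have eK: "(\<integral>\<^sup>+u. ennreal (k u)\<partial>lborel)=ennreal K"
  unfolding K_def using k by (intro nn_integral_eq_integral) auto
 note \<psi>m[measurable] = \<psi>(1)
 interpret U: pair_sigma_finite "lborel :: 'a measure" ?M
  by (intro pair_sigma_finite.intro lborel.sigma_finite_measure_axioms phase.sigma_finite_measure_axioms)
 have pm: "(%p. (fst p-u, snd p))\<in>borel_measurable borel" for u :: 'a
  by (intro borel_measurable_continuous_onI continuous_intros)
 have jm: "(%w. (fst (snd w)-fst w, snd (snd w)))\<in>measurable ((lborel :: 'a measure) \<Otimes>\<^sub>M ?M) (borel :: ('a \<times> 'a) measure)"
 proof -
  have 1: "(%w. (fst w, snd w))\<in>measurable ((lborel :: 'a measure) \<Otimes>\<^sub>M ?M) (borel \<Otimes>\<^sub>M borel)"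
   by (intro measurable_Pair measurable_compose[OF measurable_snd measurable_phase_id])
     (use measurable_fst[of "lborel :: 'a measure" ?M] in simp)
  have 2: "(%w::'a \<times> 'a \<times> 'a. (fst (snd w)-fst w, snd (snd w)))\<in>borel_measurable borel"
   by (intro borel_measurable_continuous_onI continuous_intros)
  show ?thesis using measurable_compose[OF 1[unfolded borel_prod] 2] by simp
 qed
 have pt: "(ennreal \<bar>g p\<bar>)\<^sup>2<=ennreal K * (\<integral>\<^sup>+u. ennreal (k u) * ennreal ((\<psi> (fst p-u, snd p))\<^sup>2)\<partial>lborel)"
  if p: "p\<in>phase_space" for p
 proof -
  have mu[measurable]: "(%u. \<psi> (fst p-u, snd p))\<in>borel_measurable borel"
   by (rule measurable_compose[OF _ \<psi>m]) (intro borel_measurable_continuous_onI continuous_intros)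
  have "(ennreal \<bar>g p\<bar>)\<^sup>2<=(\<integral>\<^sup>+u. ennreal (k u) * ennreal \<bar>\<psi> (fst p-u, snd p)\<bar>\<partial>lborel)\<^sup>2"
   using le[OF p] by (intro power_mono) auto
  also have "(\<integral>\<^sup>+u. ennreal (k u) * ennreal \<bar>\<psi> (fst p-u, snd p)\<bar>\<partial>lborel)
    = (\<integral>\<^sup>+u. ennreal (sqrt (k u)) * ennreal (sqrt (k u)*\<bar>\<psi> (fst p-u, snd p)\<bar>)\<partial>lborel)"
  proof (rule nn_integral_cong)
   fix u
   have "k u * \<bar>\<psi> (fst p-u, snd p)\<bar>=sqrt (k u)*(sqrt (k u)*\<bar>\<psi> (fst p-u, snd p)\<bar>)"
    using k(2)[of u] by (simp add: mult.assoc[symmetric])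
   then show "ennreal (k u) * ennreal \<bar>\<psi> (fst p-u, snd p)\<bar>=ennreal (sqrt (k u)) * ennreal (sqrt (k u)*\<bar>\<psi> (fst p-u, snd p)\<bar>)"
    using k(2)[of u] by (simp add: ennreal_mult[symmetric])
  qed
  also have "...\<^sup>2<=(\<integral>\<^sup>+u. (ennreal (sqrt (k u)))\<^sup>2\<partial>lborel)*(\<integral>\<^sup>+u. (ennreal (sqrt (k u)*\<bar>\<psi> (fst p-u, snd p)\<bar>))\<^sup>2\<partial>lborel)"
   by (rule Cauchy_Schwarz_nn_integral) measurable
  also have "(\<integral>\<^sup>+u. (ennreal (sqrt (k u)))\<^sup>2\<partial>lborel)=ennreal K"
   using eK k(2) by (simp add: ennreal_power)
  also have "(\<integral>\<^sup>+u. (ennreal (sqrt (k u)*\<bar>\<psi> (fst p-u, snd p)\<bar>))\<^sup>2\<partial>lborel)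
    = (\<integral>\<^sup>+u. ennreal (k u) * ennreal ((\<psi> (fst p-u, snd p))\<^sup>2)\<partial>lborel)"
   using k(2) by (simp add: ennreal_power power_mult_distrib ennreal_mult)
  finally show ?thesis .
 qed
 have "(\<integral>\<^sup>+p. ennreal ((g p)\<^sup>2)\<partial>?M)=(\<integral>\<^sup>+p. (ennreal \<bar>g p\<bar>)\<^sup>2\<partial>?M)"
  by (simp add: ennreal_power)
 also have "...<=(\<integral>\<^sup>+p. ennreal K * (\<integral>\<^sup>+u. ennreal (k u) * ennreal ((\<psi> (fst p-u, snd p))\<^sup>2)\<partial>lborel)\<partial>?M)"
  by (rule nn_integral_mono) (simp add: space_phase_measure pt)
 also have "...=ennreal K * (\<integral>\<^sup>+p. (\<integral>\<^sup>+u. ennreal (k u) * ennreal ((\<psi> (fst p-u, snd p))\<^sup>2)\<partial>lborel)\<partial>?M)"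
 proof (rule nn_integral_cmult)
  have "(%w. ennreal (k (fst w)) * ennreal ((\<psi> (fst (snd w)-fst w, snd (snd w)))\<^sup>2))\<in>borel_measurable (lborel \<Otimes>\<^sub>M ?M)"
   using measurable_compose[OF jm \<psi>m] by measurable
  from lborel.borel_measurable_nn_integral[OF measurable_pair_swap[OF this]]
  show "(%p. \<integral>\<^sup>+u. ennreal (k u) * ennreal ((\<psi> (fst p-u, snd p))\<^sup>2)\<partial>lborel)\<in>borel_measurable ?M"
   by simp
 qed
 also have "(\<integral>\<^sup>+p. (\<integral>\<^sup>+u. ennreal (k u) * ennreal ((\<psi> (fst p-u, snd p))\<^sup>2)\<partial>lborel)\<partial>?M)
   = (\<integral>\<^sup>+u. (\<integral>\<^sup>+p. ennreal (k u) * ennreal ((\<psi> (fst p-u, snd p))\<^sup>2)\<partial>?M)\<partial>lborel)"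
 proof -
  have "(%w. ennreal (k (fst w)) * ennreal ((\<psi> (fst (snd w)-fst w, snd (snd w)))\<^sup>2))\<in>borel_measurable (lborel \<Otimes>\<^sub>M ?M)"
   using measurable_compose[OF jm \<psi>m] by measurable
  then show ?thesis
   using U.Fubini'[of "%u p. ennreal (k u) * ennreal ((\<psi> (fst p-u, snd p))\<^sup>2)"] by (simp add: split_beta')
 qed
 also have "...=(\<integral>\<^sup>+u. ennreal (k u) * ennreal ((l2_norm ?M \<psi>)\<^sup>2)\<partial>lborel)"
 proof (rule nn_integral_cong)
  fix u :: 'a
  have m2: "(%p. ennreal ((\<psi> p)\<^sup>2))\<in>borel_measurable ?M" using measurable_phase[OF \<psi>m] by measurable
  have "(\<integral>\<^sup>+p. ennreal (k u) * ennreal ((\<psi> (fst p-u, snd p))\<^sup>2)\<partial>?M)=ennreal (k u)*(\<integral>\<^sup>+p. ennreal ((\<psi> (fst p-u, snd p))\<^sup>2)\<partial>?M)"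
   using measurable_compose[OF phase_measure_translate(1) m2] by (intro nn_integral_cmult)
  also have "(\<integral>\<^sup>+p. ennreal ((\<psi> (fst p-u, snd p))\<^sup>2)\<partial>?M)=(\<integral>\<^sup>+p. ennreal ((\<psi> p)\<^sup>2)\<partial>?M)"
   using nn_integral_distr[OF phase_measure_translate(1)[of u], of "%p. ennreal ((\<psi> p)\<^sup>2)"] m2
   unfolding phase_measure_translate(2) by simp
  also have "...=ennreal ((l2_norm ?M \<psi>)\<^sup>2)"
   unfolding l2_norm_sq by (rule nn_integral_eq_integral[OF L2_int[OF \<psi>(2)]]) simp
  finally show "(\<integral>\<^sup>+p. ennreal (k u) * ennreal ((\<psi> (fst p-u, snd p))\<^sup>2)\<partial>?M)=ennreal (k u) * ennreal ((l2_norm ?M \<psi>)\<^sup>2)" .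
 qed
 also have "...=ennreal K * ennreal ((l2_norm ?M \<psi>)\<^sup>2)"
  by (subst nn_integral_multc) (simp_all add: eK)
 also have "ennreal K * (ennreal K * ennreal ((l2_norm ?M \<psi>)\<^sup>2))=ennreal ((K * l2_norm ?M \<psi>)\<^sup>2)"
  using K0 by (simp add: ennreal_mult[symmetric] power2_eq_square mult_ac)
 finally have fin: "(\<integral>\<^sup>+p. ennreal ((g p)\<^sup>2)\<partial>?M)<=ennreal ((K * l2_norm ?M \<psi>)\<^sup>2)" .
 have "integrable ?M (%p. (g p)\<^sup>2)"
  using g order_le_less_trans[OF fin] by (intro integrableI_bounded) auto
 then have "ennreal ((l2_norm ?M g)\<^sup>2)<=ennreal ((K * l2_norm ?M \<psi>)\<^sup>2)"
  unfolding l2_norm_sq[of ?M g] using fin nn_integral_eq_integral[of ?M "%p. (g p)\<^sup>2"] by simp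
 then have "(l2_norm ?M g)\<^sup>2<=(K * l2_norm ?M \<psi>)\<^sup>2" by (simp add: ennreal_le_iff)
 then show ?thesis
  unfolding K_def[symmetric] by (rule power2_le_imp_le) (simp add: K0 l2_norm_nonneg)
qed

definition mollify :: "('a::euclidean_space => real) => ('a \<times> 'a => real) => 'a \<times> 'a => real" where
 "mollify \<eta> F p=(\<integral>z. F (p-(z, 0))*\<eta> z\<partial>lborel)"

lemma measurable_inject_fst:
 "(%z. (z, 0 :: 'b::euclidean_space))\<in>borel_measurable (lborel :: 'a::euclidean_space measure)"
proof -
 have "(%z::'a. (z, 0::'b))\<in>borel_measurable borel"
  by (intro borel_measurable_continuous_onI continuous_intros)
 then show ?thesis by simp
qed

lemma Cc_integrable_lborel: assumes "F\<in>Cc" shows "integrable lborel (F :: 'a::euclidean_space => real)"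
proof -
 obtain R where R: "R > 0" "!!p. R < norm p ==> F p=0" using Cc_support[OF assms] by blast
 obtain C where C: "C > 0" "!!p. \<bar>F p\<bar><=C" using Cc_bounded[OF assms] by blast
 have i: "integrable lborel (%x. indicator (cball (0::'a) R) x *\<^sub>R C)"
  using emeasure_lborel_cball_finite[of "0::'a" R] by (intro integrable_scaleR_left integrable_real_indicator) auto
 show ?thesis
  by (rule Bochner_Integration.integrable_bound[OF i])
    (use Cc_measurable[OF assms] R C in \<open>auto intro!: AE_I2 simp: indicator_def\<close>)
qed

lemma Cc_mollify:
 fixes F :: "'a::euclidean_space \<times> 'a => real"
 assumes F: "F\<in>Cc" and \<eta>: "\<eta>\<in>Cc"
 shows "mollify \<eta> F\<in>Cc"
proof -
 obtain R where R: "R > 0" "!!p. R < norm p ==> F p=0" using Cc_support[OF F] by blast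
 obtain r where r: "r > 0" "!!z. r < norm z ==> \<eta> z=0" using Cc_support[OF \<eta>] by blast
 show ?thesis
 proof (rule CcI[of _ "R+r"])
  show "smooth_on UNIV (mollify \<eta> F)"
   unfolding mollify_def by (rule smooth_on_weighted_translate[OF F measurable_inject_fst Cc_integrable_lborel[OF \<eta>]])
  fix p :: "'a \<times> 'a" assume p: "R+r < norm p"
  have "F (p-(z, 0))*\<eta> z=0" for z
  proof (cases "norm z<=r")
   case True
   then have "R < norm (p-(z, 0))" using p norm_triangle_ineq2[of p "(z, 0)"] by (simp add: norm_Pair)
   then show ?thesis using R by simp
  qed (use r in simp)
  then have "(%z. F (p-(z, 0))*\<eta> z)=(%_. 0)" by (rule ext)
  then show "mollify \<eta> F p=0" unfolding mollify_def by (simp only:) simp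
 qed
qed

lemma dderiv_mollify:
 fixes F :: "'a::euclidean_space \<times> 'a => real"
 assumes F: "F\<in>Cc" and \<eta>: "\<eta>\<in>Cc"
 shows "dderiv v (mollify \<eta> F) p=mollify \<eta> (dderiv v F) p"
 unfolding mollify_def
 by (rule dderiv_eqI) (rule weighted_translate_has_derivative[OF F measurable_inject_fst Cc_integrable_lborel[OF \<eta>]])

lemma lin_field_mollify:
 fixes F :: "'a::euclidean_space \<times> 'a => real"
 assumes F: "F\<in>Cc" and \<eta>: "\<eta>\<in>Cc" and A: "!!p z. A (p-(z, 0))=A p"
 shows "lin_field A (mollify \<eta> F)=mollify \<eta> (lin_field A F)"
proof
 fix p show "lin_field A (mollify \<eta> F) p=mollify \<eta> (lin_field A F) p"
  unfolding lin_field_def dderiv_mollify[OF F \<eta>] by (simp add: mollify_def A)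
qed

lemma integrable_mollify:
 fixes F :: "'a::euclidean_space \<times> 'a => real"
 shows "F\<in>Cc ==> \<eta>\<in>Cc ==> integrable lborel (%z. F (p-(z, 0))*\<eta> z)"
 by (rule integrable_weighted_translate[OF _ measurable_inject_fst Cc_integrable_lborel])

lemma mollify_diff:
 fixes F G :: "'a::euclidean_space \<times> 'a => real"
 assumes "F\<in>Cc" "G\<in>Cc" "\<eta>\<in>Cc"
 shows "mollify \<eta> (%p. F p-G p)=(%p. mollify \<eta> F p-mollify \<eta> G p)"
 unfolding mollify_def using integrable_mollify[OF assms(1,3)] integrable_mollify[OF assms(2,3)]
 by (simp add: left_diff_distrib)

lemma mollify_cmult: "mollify \<eta> (%p. c * F p)=(%p. c * mollify \<eta> F p)"
 unfolding mollify_def by (simp add: mult.assoc)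

lemma sphere_lap_mollify:
 fixes F :: "'a::euclidean_space \<times> 'a => real"
 assumes F: "F\<in>Cc" and \<eta>: "\<eta>\<in>Cc"
 shows "sphere_lap (mollify \<eta> F)=mollify \<eta> (sphere_lap F)"
proof
 fix p
 have r: "rot_field b b' (p-(z, 0))=rot_field b b' p" for b b' z and p :: "'a \<times> 'a" by (simp add: rot_field_def)
 have e: "rot_deriv b b' (rot_deriv b b' (mollify \<eta> F))=mollify \<eta> (rot_deriv b b' (rot_deriv b b' F))" for b b'
 proof -
  have 1: "rot_deriv b b' (mollify \<eta> F)=mollify \<eta> (rot_deriv b b' F)"
   by (rule lin_field_mollify[OF F \<eta>]) (rule r)
  show ?thesis unfolding 1 by (rule lin_field_mollify[OF Cc_rot_deriv[OF F] \<eta>]) (rule r)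
 qed
 have "sphere_lap (mollify \<eta> F) p=1/2*(\<Sum>b\<in>Basis. \<Sum>b'\<in>Basis. mollify \<eta> (rot_deriv b b' (rot_deriv b b' F)) p)"
  unfolding sphere_lap_def e ..
 also have "...=1/2 * mollify \<eta> (%p. \<Sum>b\<in>Basis. \<Sum>b'\<in>Basis. rot_deriv b b' (rot_deriv b b' F) p) p"
  unfolding mollify_def using integrable_mollify[OF Cc_rot_deriv[OF Cc_rot_deriv[OF F]] \<eta>]
  by (simp add: sum_distrib_right Bochner_Integration.integral_sum)
 also have "...=mollify \<eta> (sphere_lap F) p" unfolding sphere_lap_def mollify_cmult ..
 finally show "sphere_lap (mollify \<eta> F) p=mollify \<eta> (sphere_lap F) p" .
qed

lemma shift_quot_mollify:
 fixes F :: "'a::euclidean_space \<times> 'a => real"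
 assumes F: "F\<in>Cc" and \<eta>: "\<eta>\<in>Cc"
 shows "shift_quot s (mollify \<eta> F)=mollify \<eta> (shift_quot s F)"
proof
 fix p :: "'a \<times> 'a"
 have e: "shift_quot s F=(%p. (1/s)*(F (fst p+s *\<^sub>R snd p, snd p)-F p))"
  by (simp add: fun_eq_iff shift_quot_def)
 have "mollify \<eta> (shift_quot s F) p=mollify \<eta> (%p. F (fst p+s *\<^sub>R snd p, snd p)-F p) p/s"
  unfolding e mollify_cmult by simp
 also have "mollify \<eta> (%p. F (fst p+s *\<^sub>R snd p, snd p)-F p) p=mollify \<eta> F (fst p+s *\<^sub>R snd p, snd p)-mollify \<eta> F p"
  unfolding mollify_diff[OF Cc_shift[OF F] F \<eta>]
  by (simp add: mollify_def algebra_simps)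
 finally show "shift_quot s (mollify \<eta> F) p=mollify \<eta> (shift_quot s F) p"
  unfolding shift_quot_def[of s "mollify \<eta> F" p] by (rule sym)
qed

lemma mollify_contraction:
 fixes F :: "'a::euclidean_space \<times> 'a => real"
 assumes F: "F\<in>Cc" and \<eta>: "\<eta>\<in>Cc" "!!z. \<eta> z \<ge> 0" "(\<integral>z. \<eta> z\<partial>lborel)=1"
 shows "l2_norm phaseM (mollify \<eta> F)<=l2_norm phaseM F"
proof -
 have "l2_norm phaseM (mollify \<eta> F)<=(\<integral>z. \<eta> z\<partial>lborel) * l2_norm phaseM F"
 proof (rule young_inequality[OF _ Cc_measurable[OF F] L2_phase_Cc[OF F] Cc_integrable_lborel[OF \<eta>(1)] \<eta>(2)])
  show "mollify \<eta> F\<in>borel_measurable phaseM"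
   by (rule measurable_phase[OF Cc_measurable[OF Cc_mollify[OF F \<eta>(1)]]])
  fix p :: "'a \<times> 'a"
  have "ennreal \<bar>mollify \<eta> F p\<bar><=(\<integral>\<^sup>+z. norm (F (p-(z, 0))*\<eta> z)\<partial>lborel)"
   unfolding mollify_def using integral_norm_bound_ennreal[OF integrable_mollify[OF F \<eta>(1)], of p] by simp
  also have "...=(\<integral>\<^sup>+u. ennreal (\<eta> u) * ennreal \<bar>F (fst p-u, snd p)\<bar>\<partial>lborel)"
   using \<eta>(2) by (intro nn_integral_cong) (cases p, simp add: abs_mult ennreal_mult mult.commute)
  finally show "ennreal \<bar>mollify \<eta> F p\<bar><=(\<integral>\<^sup>+u. ennreal (\<eta> u) * ennreal \<bar>F (fst p-u, snd p)\<bar>\<partial>lborel)" .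
 qed
 then show ?thesis using \<eta>(3) by simp
qed

text \<open>The difference quotient of a mollified function differs from its transport derivative by a
  convolution with a kernel of size \<open>O(s)\<close>, by Taylor's formula for the mollifier; the derivative of
  the function itself never enters.\<close>

lemma shift_quot_mollify_error:
 fixes \<eta> :: "'a::euclidean_space => real"
 assumes \<eta>: "\<eta>\<in>Cc"
 obtains C where "C \<ge> 0" "!!s F. 0 < s ==> s<=1 ==> F\<in>Cc ==>
  l2_norm phaseM (%p. shift_quot s (mollify \<eta> F) p-transport (mollify \<eta> F) p)<=C * s * l2_norm phaseM F"
proof -
 obtain r where r: "r > 0" "!!z. r < norm z ==> \<eta> z=0" using Cc_support[OF \<eta>] by blast
 obtain T where T: "T > 0" "!!p v. \<bar>\<eta> (p+v)-\<eta> p-dderiv v \<eta> p\<bar><=T * (norm v)\<^sup>2"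
  using Cc_taylor[OF \<eta>] by blast
 have d0: "dderiv v \<eta> z=0" if "r < norm z" for v z
 proof -
  have "(\<eta> has_derivative (%_. 0)) (at z)"
  proof (rule has_derivative_transform_within_open)
   show "((%_. 0) has_derivative (%_. 0)) (at z)" by simp
   show "open {z::'a. r < norm z}" by (intro open_Collect_less continuous_intros)
  qed (use that r in auto)
  then show ?thesis by (rule dderiv_eqI)
 qed
 define B where "B=measure lborel (cball (0::'a) (r+1))"
 have fB: "emeasure lborel (cball (0::'a) (r+1)) < \<infinity>" by (rule emeasure_lborel_cball_finite)
 have est: "l2_norm phaseM (%p. shift_quot s (mollify \<eta> F) p-transport (mollify \<eta> F) p)
   <= (T * B) * s * l2_norm phaseM F" if s: "0 < s" "s<=1" and F: "F\<in>Cc" for s and F :: "'a \<times> 'a => real"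
 proof -
  let ?k = "%u::'a. (T * s) * indicator (cball 0 (r+1)) u :: real"
  let ?g = "%p. shift_quot s (mollify \<eta> F) p-transport (mollify \<eta> F) p"
  have J: "mollify \<eta> F\<in>Cc" by (rule Cc_mollify[OF F \<eta>])
  have Fi: "integrable lborel (%z. F (z, y))" for y
  proof -
   obtain R where R: "R > 0" "!!p. R < norm (fst p) ==> F p=0" using Cc_support_fst[OF F] by blast
   obtain C where C: "C > 0" "!!p. \<bar>F p\<bar><=C" using Cc_bounded[OF F] by blast
   have i: "integrable lborel (%x. indicator (cball (0::'a) R) x *\<^sub>R C)"
    using emeasure_lborel_cball_finite[of "0::'a" R] by (intro integrable_scaleR_left integrable_real_indicator) auto
   have m: "(%z. F (z, y))\<in>borel_measurable borel"
    by (intro borel_measurable_continuous_onI continuous_on_compose2[OF Cc_continuous[OF F, of UNIV]] continuous_intros) auto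
   show ?thesis
    by (rule Bochner_Integration.integrable_bound[OF i])
      (use m R C in \<open>auto intro!: AE_I2 simp: indicator_def\<close>)
  qed
  have swap: "mollify \<eta> F (x, y)=(\<integral>z. \<eta> (x-z) * F (z, y)\<partial>lborel)" for x y
  proof -
   have d: "distr lborel borel (%z. x-z)=(lborel :: 'a measure)"
    using lborel_affine[of "-1" x] by (simp add: density_1 one_ennreal_def[symmetric])
   have "(%z. \<eta> (x-z) * F (z, y))\<in>borel_measurable borel"
   proof (rule borel_measurable_continuous_onI, rule continuous_on_mult)
    show "continuous_on UNIV (%z. \<eta> (x-z))"
     by (rule continuous_on_compose2[OF Cc_continuous[OF \<eta>, of UNIV]]) (auto intro!: continuous_intros)
    show "continuous_on UNIV (%z. F (z, y))"
     by (rule continuous_on_compose2[OF Cc_continuous[OF F, of UNIV]]) (auto intro!: continuous_intros)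
   qed
   then have "(\<integral>z. \<eta> (x-z) * F (z, y)\<partial>distr lborel borel (%z. x-z))=(\<integral>z. \<eta> (x-(x-z)) * F (x-z, y)\<partial>lborel)"
    by (intro integral_distr) auto
   then show ?thesis unfolding d by (simp add: mollify_def mult.commute)
  qed
  have tr: "transport (mollify \<eta> F) (x, y)=(\<integral>z. dderiv y \<eta> (x-z) * F (z, y)\<partial>lborel)" for x y
  proof -
   have m: "(%z. z)\<in>borel_measurable (lborel :: 'a measure)" by simp
   have 1: "((%x. mollify \<eta> F (x, y)) has_derivative (%v. \<integral>z. dderiv v \<eta> (x-z) * F (z, y)\<partial>lborel)) (at x)"
    unfolding swap by (rule weighted_translate_has_derivative[OF \<eta> m Fi])
   have "((%x. (x, y)) has_derivative (%h. (h, 0))) (at x)"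
    by (intro has_derivative_Pair has_derivative_ident has_derivative_const)
   from has_derivative_compose[OF this Cc_has_derivative[OF J]]
   have 2: "((%x. mollify \<eta> F (x, y)) has_derivative (%h. dderiv (h, 0) (mollify \<eta> F) (x, y))) (at x)" .
   from has_derivative_unique[OF 1 2] show ?thesis
    by (simp add: lin_field_def transport_field_def fun_eq_iff)
  qed
  have "l2_norm phaseM ?g<=(\<integral>u. ?k u\<partial>lborel) * l2_norm phaseM F"
  proof (rule young_inequality[OF _ Cc_measurable[OF F] L2_phase_Cc[OF F]])
   show "?g\<in>borel_measurable phaseM"
    by (rule measurable_phase[OF Cc_measurable]) (intro Cc_diff Cc_shift_quot Cc_transport J)
   show "integrable lborel ?k" using fB by (intro integrable_mult_right integrable_real_indicator) auto
   show "?k u \<ge> 0" for u using T s by simp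
   fix p :: "'a \<times> 'a" assume p: "p\<in>phase_space"
   obtain x y where q: "p=(x, y)" by (cases p)
   have y: "norm y=1" using p by (simp add: q phase_space_def)
   let ?K = "%z. (\<eta> (x+s *\<^sub>R y-z)-\<eta> (x-z))/s-dderiv y \<eta> (x-z)"
   have m: "(%z. z)\<in>borel_measurable (lborel :: 'a measure)" by simp
   note i = integrable_weighted_translate[OF \<eta> m Fi[of y]] integrable_weighted_translate[OF Cc_dderiv[OF \<eta>] m Fi[of y]]
   have "?g p=((\<integral>z. \<eta> (x+s *\<^sub>R y-z) * F (z, y)\<partial>lborel)-(\<integral>z. \<eta> (x-z) * F (z, y)\<partial>lborel))/s
     - (\<integral>z. dderiv y \<eta> (x-z) * F (z, y)\<partial>lborel)"
    unfolding q tr by (simp add: shift_quot_def swap)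
   also have "...=(\<integral>z. (\<eta> (x+s *\<^sub>R y-z) * F (z, y)-\<eta> (x-z) * F (z, y))/s-dderiv y \<eta> (x-z) * F (z, y)\<partial>lborel)"
    using i by simp
   also have "...=(\<integral>z. ?K z * F (z, y)\<partial>lborel)"
    by (intro Bochner_Integration.integral_cong) (simp_all add: left_diff_distrib diff_divide_distrib)
   finally have e: "?g p=(\<integral>z. ?K z * F (z, y)\<partial>lborel)" .
   have Ki: "integrable lborel (%z. ?K z * F (z, y))"
   proof -
    have "integrable lborel (%z. (\<eta> (x+s *\<^sub>R y-z) * F (z, y)-\<eta> (x-z) * F (z, y))/s-dderiv y \<eta> (x-z) * F (z, y))"
     using i by simp
    then show ?thesis by (simp add: left_diff_distrib diff_divide_distrib)
   qed
   have Kb: "\<bar>?K z\<bar><=?k (x-z)" for z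
   proof (cases "norm (x-z)<=r+1")
    case True
    have "dderiv (s *\<^sub>R y) \<eta> (x-z)=s * dderiv y \<eta> (x-z)"
     using linear_cmul[OF dderiv_linear[OF smooth_on_differentiable[OF Cc_smooth[OF \<eta>] UNIV_I]]] by simp
    then have "?K z=(\<eta> (x-z+s *\<^sub>R y)-\<eta> (x-z)-dderiv (s *\<^sub>R y) \<eta> (x-z))/s"
     using s by (simp add: field_simps)
    also have "\<bar>...\<bar><=(T * (norm (s *\<^sub>R y))\<^sup>2)/s"
     using T(2)[of "x-z" "s *\<^sub>R y"] s by (simp add: divide_right_mono)
    also have "...=T * s" using s y by (simp add: power2_eq_square)
    finally show ?thesis using True by simp
   next
    case False
    have "norm (x+s *\<^sub>R y-z) \<ge> norm (x-z)-s"
     using norm_triangle_ineq2[of "x-z" "- (s *\<^sub>R y)"] y s by (simp add: algebra_simps)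
    then have "norm (x+s *\<^sub>R y-z) > r" using False s by linarith
    then show ?thesis using r(2) d0[of "x-z"] r(2)[of "x-z"] False T s by simp
   qed
   have "ennreal \<bar>?g p\<bar><=(\<integral>\<^sup>+z. norm (?K z * F (z, y))\<partial>lborel)"
    unfolding e using integral_norm_bound_ennreal[OF Ki] by simp
   also have "...<=(\<integral>\<^sup>+z. ennreal (?k (x-z)) * ennreal \<bar>F (z, y)\<bar>\<partial>lborel)"
   proof (rule nn_integral_mono)
    fix z
    have "\<bar>?K z\<bar>*\<bar>F (z, y)\<bar><=?k (x-z)*\<bar>F (z, y)\<bar>" by (rule mult_right_mono[OF Kb]) simp
    moreover have "0<=?k (x-z)" using T s by simp
    ultimately show "ennreal (norm (?K z * F (z, y)))<=ennreal (?k (x-z)) * ennreal \<bar>F (z, y)\<bar>"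
     by (subst ennreal_mult[symmetric]) (auto simp: abs_mult intro!: ennreal_leI)
   qed
   also have "...=(\<integral>\<^sup>+u. ennreal (?k u) * ennreal \<bar>F (x-u, y)\<bar>\<partial>lborel)"
   proof -
    have d: "distr lborel borel (%z. x-z)=(lborel :: 'a measure)"
     using lborel_affine[of "-1" x] by (simp add: density_1 one_ennreal_def[symmetric])
    have Fm: "(%z. F (z, y))\<in>borel_measurable borel"
     by (intro borel_measurable_continuous_onI continuous_on_compose2[OF Cc_continuous[OF F, of UNIV]] continuous_intros) auto
    have "?k\<in>borel_measurable borel"
     by (intro borel_measurable_times borel_measurable_const borel_measurable_indicator borel_closed closed_cball)
    from measurable_compose[OF _ this, of "%z. x-z" borel]
    have km: "(%z. ?k (x-z))\<in>borel_measurable borel" by simp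
    have "(\<integral>\<^sup>+z. ennreal (?k (x-z)) * ennreal \<bar>F (z, y)\<bar>\<partial>distr lborel borel (%z. x-z))
      = (\<integral>\<^sup>+u. ennreal (?k (x-(x-u))) * ennreal \<bar>F (x-u, y)\<bar>\<partial>lborel)"
     by (rule nn_integral_distr) (use Fm km in measurable)
    then show ?thesis unfolding d by simp
   qed
   finally show "ennreal \<bar>?g p\<bar><=(\<integral>\<^sup>+u. ennreal (?k u) * ennreal \<bar>F (fst p-u, snd p)\<bar>\<partial>lborel)"
    by (simp add: q)
  qed
  also have "(\<integral>u. ?k u\<partial>lborel)=T * B * s" by (simp add: B_def)
  finally show ?thesis .
 qed
 show thesis by (rule that[of "T * B"]) (use T est in \<open>auto simp: B_def\<close>)
qed

definition mollifier :: "real => 'a::euclidean_space => real" where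
 "mollifier e z=inverse (\<integral>x. cutoff e (x::'a)\<partial>lborel) * cutoff e z"

lemma integral_cutoff_pos:
 assumes "e > 0" shows "(\<integral>x. cutoff e (x::'a::euclidean_space)\<partial>lborel) > 0"
proof -
 have "0 < measure lborel (cball (0::'a) e)" using content_cball_pos[OF assms] by simp
 also have "...=(\<integral>x. indicator (cball (0::'a) e) x\<partial>lborel)" by simp
 also have "...<=(\<integral>x. cutoff e (x::'a)\<partial>lborel)"
 proof (rule integral_mono)
  show "integrable lborel (indicator (cball (0::'a) e) :: 'a => real)"
   using emeasure_lborel_cball_finite[of "0::'a" e] by (intro integrable_real_indicator) auto
  show "integrable lborel (cutoff e :: 'a => real)" by (rule Cc_integrable_lborel[OF cutoff_Cc[OF assms]])
  show "indicator (cball 0 e) x<=cutoff e x" for x :: 'a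
   using cutoff_eq_1[OF assms, of x] cutoff_bounds(1)[of e x] by (simp add: indicator_def)
 qed
 finally show ?thesis .
qed

lemma mollifier:
 fixes e :: real
 assumes e: "e > 0"
 shows mollifier_Cc: "(mollifier e :: 'a::euclidean_space => real)\<in>Cc"
  and mollifier_nonneg: "mollifier e (z::'a) \<ge> 0"
  and integral_mollifier: "(\<integral>z. mollifier e (z::'a)\<partial>lborel)=1"
  and mollifier_eq_0: "norm (z::'a) \<ge> 2 * e ==> mollifier e z=0"
proof -
 note pos = integral_cutoff_pos[OF e, where ?'a = 'a]
 show "(mollifier e :: 'a => real)\<in>Cc"
  unfolding mollifier_def[abs_def] by (rule Cc_cmult[OF cutoff_Cc[OF e]])
 show "mollifier e (z::'a) \<ge> 0" unfolding mollifier_def using pos cutoff_bounds(1)[of e z] by simp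
 show "(\<integral>z. mollifier e (z::'a)\<partial>lborel)=1" unfolding mollifier_def using pos by simp
 show "norm (z::'a) \<ge> 2 * e ==> mollifier e z=0" unfolding mollifier_def by (simp add: cutoff_eq_0[OF e])
qed

lemma mollify_approx:
 fixes F :: "'a::euclidean_space \<times> 'a => real"
 assumes F: "F\<in>Cc" and d: "d > 0"
 obtains e where "e > 0" "l2_norm phaseM (%p. mollify (mollifier e) F p-F p) < d"
proof -
 let ?M = "phaseM :: ('a \<times> 'a) measure"
 obtain R where R: "R > 0" "!!p. R < norm (fst p) ==> F p=0" using Cc_support_fst[OF F] by blast
 obtain L where L: "L > 0" "!!p q. \<bar>F q-F p\<bar><=L * norm (q-p)" using Cc_Lipschitz[OF F] by blast
 let ?K = "cball (0::'a) (R+2) \<times> sphere 0 1"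
 have Ks: "?K\<in>sets ?M"
  using sets.top[of "sphere_measure :: 'a measure"] by (intro pair_measureI) (auto simp: space_sphere_measure)
 define m where "m=sqrt (measure ?M ?K)"
 have m0: "m \<ge> 0" by (simp add: m_def)
 define e where "e=min 1 (d/(2 * L * (m+1)))"
 have e: "e > 0" "e<=1" using d L m0 by (auto simp: e_def)
 have "2 * L * e * m < 2 * L * e * (m+1)" using e L by simp
 also have "...<=d"
 proof -
  have "e<=d/(2 * L * (m+1))" by (simp add: e_def)
  moreover have "2 * L * (m+1) > 0" using L m0 by (intro mult_pos_pos) auto
  ultimately have "e * (2 * L * (m+1))<=d" by (simp add: pos_le_divide_eq)
  then show ?thesis by (simp add: mult_ac)
 qed
 finally have small: "2 * L * e * m < d" .
 note \<eta> = mollifier_Cc[OF e(1), where ?'a = 'a] mollifier_nonneg[OF e(1), where ?'a = 'a]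
  integral_mollifier[OF e(1), where ?'a = 'a] mollifier_eq_0[OF e(1), where ?'a = 'a]
 have pt: "\<bar>mollify (mollifier e) F p-F p\<bar><=2 * L * e" for p
 proof -
  have i: "integrable lborel (%z. F p * mollifier e (z::'a))"
   by (intro integrable_mult_right Cc_integrable_lborel \<eta>(1))
  have "mollify (mollifier e) F p-F p=(\<integral>z. F (p-(z, 0)) * mollifier e z-F p * mollifier e z\<partial>lborel)"
   using integrable_mollify[OF F \<eta>(1), of p] i \<eta>(3) by (simp add: mollify_def)
  also have "\<bar>...\<bar><=(\<integral>z. (2 * L * e) * mollifier e (z::'a)\<partial>lborel)"
  proof (rule order_trans[OF integral_abs_bound], rule integral_mono)
   show "integrable lborel (%z. \<bar>F (p-(z, 0)) * mollifier e z-F p * mollifier e z\<bar>)"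
    using integrable_mollify[OF F \<eta>(1), of p] i by auto
   show "integrable lborel (%z. (2 * L * e) * mollifier e (z::'a))"
    by (intro integrable_mult_right Cc_integrable_lborel \<eta>(1))
   fix z :: 'a
   show "\<bar>F (p-(z, 0)) * mollifier e z-F p * mollifier e z\<bar><=(2 * L * e) * mollifier e z"
   proof (cases "norm z \<ge> 2 * e")
    case True
    then show ?thesis using \<eta>(4) by simp
   next
    case False
    have "\<bar>F (p-(z, 0))-F p\<bar><=L * norm z" using L(2)[of "p-(z, 0)" p] by (simp add: norm_Pair)
    also have "...<=L * (2 * e)" using False L(1) by (intro mult_left_mono) auto
    finally have "\<bar>F (p-(z, 0))-F p\<bar> * mollifier e z<=(2 * L * e) * mollifier e z"
     using \<eta>(2)[of z] by (intro mult_right_mono) auto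
    then show ?thesis using \<eta>(2)[of z] by (simp add: left_diff_distrib[symmetric] abs_mult)
   qed
  qed
  also have "...=2 * L * e" using \<eta>(3) by simp
  finally show ?thesis .
 qed
 have z: "mollify (mollifier e) F p-F p=0" if "norm (fst p) > R+2" for p
 proof -
  have "F (p-(z, 0)) * mollifier e z=0" for z
  proof (cases "norm z \<ge> 2 * e")
   case False
   then have "norm (fst (p-(z, 0))) > R"
    using that e norm_triangle_ineq2[of "fst p" z] by simp
   then show ?thesis using R(2) by simp
  qed (use \<eta>(4) in simp)
  then have "(%z. F (p-(z, 0)) * mollifier e z)=(%_. 0)" by (rule ext)
  then show ?thesis using R(2)[of p] that R(1) unfolding mollify_def by (simp only:) simp
 qed
 have J: "mollify (mollifier e) F\<in>Cc" by (rule Cc_mollify[OF F \<eta>(1)])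
 have "l2_norm ?M (%p. mollify (mollifier e) F p-F p)<=l2_norm ?M (%p. (2 * L * e) * indicator ?K p)"
 proof (rule l2_norm_mono)
  show "(%p. mollify (mollifier e) F p-F p)\<in>borel_measurable ?M"
   by (rule measurable_phase[OF Cc_measurable[OF Cc_diff[OF J F]]])
  have sq: "(%p. (indicator ?K p :: real)\<^sup>2)=indicator ?K" by (auto simp: indicator_def)
  have "indicator ?K\<in>L2 ?M"
   unfolding L2_def mem_Collect_eq sq
   by (intro conjI borel_measurable_indicator integrable_real_indicator Ks emeasure_phase_bounded)
  then show "(%p. (2 * L * e) * indicator ?K p)\<in>L2 ?M" by (rule L2_cmult)
  show "AE p in ?M. \<bar>mollify (mollifier e) F p-F p\<bar><=\<bar>(2 * L * e) * indicator ?K p\<bar>"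
  proof (rule AE_I2)
   fix p assume "p\<in>space ?M"
   then have p: "p\<in>phase_space" by (simp add: space_phase_measure)
   show "\<bar>mollify (mollifier e) F p-F p\<bar><=\<bar>(2 * L * e) * indicator ?K p\<bar>"
   proof (cases "norm (fst p)<=R+2")
    case True
    then have "p\<in>?K" using p by (auto simp: phase_space_def)
    then show ?thesis using pt[of p] e L by simp
   qed (use z[of p] in simp)
  qed
 qed
 also have "...=2 * L * e * m" using l2_norm_indicator[OF Ks, of "2 * L * e"] L e by (simp add: m_def)
 finally show thesis using that[OF e(1)] small by simp
qed

text \<open>Solve with the transport replaced by a difference quotient, for mollified data, and mollify the solution: mollification commutes with both operators, and the mollified solution is smooth enough for the quotient to approximate the derivative with an error that the step size controls.\<close>

theorem dense_range_free:
 assumes c: "c > 0"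
 shows "dense_range (phaseM :: ('a::euclidean_space \<times> 'a) measure) Cc
  (%F p. (F p-c * sphere_lap F p)-transport F p)"
 unfolding dense_range_def
proof (intro ballI allI impI)
 let ?M = "phaseM :: ('a \<times> 'a) measure"
 fix h :: "'a \<times> 'a => real" and d :: real assume h: "h\<in>L2 ?M" and d: "d > 0"
 then have d4: "d/4 > 0" by simp
 obtain F0 where F0: "F0\<in>Cc" "l2_norm ?M (%p. h p-(F0 p-c * sphere_lap F0 p)) < d/4"
  using dense_range_sphere_resolvent[OF c, where ?'a = 'a] h d4 unfolding dense_range_def by blast
 define h0 where "h0 p=F0 p-c * sphere_lap F0 p" for p
 have hh: "l2_norm ?M (%p. h p-h0 p) < d/4" using F0(2) by (simp add: h0_def)
 have h0: "h0\<in>Cc" unfolding h0_def using F0(1) by (intro Cc_diff Cc_cmult Cc_sphere_lap)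
 obtain e where e: "e > 0" "l2_norm ?M (%p. mollify (mollifier e) h0 p-h0 p) < d/4"
  using mollify_approx[OF h0 d4] by blast
 let ?\<eta> = "mollifier e :: 'a => real"
 note \<eta> = mollifier_Cc[OF e(1), where ?'a = 'a] mollifier_nonneg[OF e(1), where ?'a = 'a]
  integral_mollifier[OF e(1), where ?'a = 'a]
 obtain C where C: "C \<ge> 0" "!!s F. 0 < s ==> s<=1 ==> F\<in>Cc ==>
   l2_norm ?M (%p. shift_quot s (mollify ?\<eta> F) p-transport (mollify ?\<eta> F) p)<=C * s * l2_norm ?M F"
  using shift_quot_mollify_error[OF \<eta>(1)] by metis
 define N where "N=l2_norm ?M h0+d"
 have N: "N > 0" using l2_norm_nonneg[of ?M h0] d by (simp add: N_def)
 define s where "s=min 1 (d/4/((C+1) * N))"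
 have CN: "(C+1) * N > 0" using C N by (intro mult_pos_pos) auto
 have s: "0 < s" "s<=1" using d4 CN by (auto simp: s_def)
 have "s<=d/4/((C+1) * N)" by (simp add: s_def)
 then have "s * ((C+1) * N)<=d/4" using CN by (simp add: pos_le_divide_eq)
 moreover have "C * s * N < s * ((C+1) * N)" using s N by (simp add: algebra_simps)
 ultimately have sm: "C * s * N < d/4" by linarith
 obtain \<psi> where \<psi>: "\<psi>\<in>Cc" "l2_norm ?M (%p. h0 p-((\<psi> p-c * sphere_lap \<psi> p)-shift_quot s \<psi> p)) < d/4"
  using dense_range_shift[OF c s(1), where ?'a = 'a] L2_phase_Cc[OF h0] d4 unfolding dense_range_def by blast
 define P where "P p=(\<psi> p-c * sphere_lap \<psi> p)-shift_quot s \<psi> p" for p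
 have P: "P\<in>Cc" unfolding P_def using \<psi>(1) by (intro Cc_diff Cc_cmult Cc_sphere_lap Cc_shift_quot)
 note L\<psi> = L2_phase_Cc[OF \<psi>(1)]
 have "l2_norm ?M \<psi><=l2_norm ?M (%p. \<psi> p-(c * sphere_lap \<psi> p+1 * shift_quot s \<psi> p))"
 proof (rule dissipative_lower_bound[OF L\<psi>])
  note L = L2_phase_Cc[OF Cc_sphere_lap[OF \<psi>(1)]] L2_phase_Cc[OF Cc_shift_quot[OF \<psi>(1), of s]]
  show "(%p. c * sphere_lap \<psi> p+1 * shift_quot s \<psi> p)\<in>L2 ?M" by (rule L2_lincomb[OF L])
  show "l2_inner ?M (%p. c * sphere_lap \<psi> p+1 * shift_quot s \<psi> p) \<psi><=0"
   unfolding l2_inner_lincomb[OF L L\<psi>]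
   using mult_nonneg_nonpos[of c, OF _ sphere_lap_inner_nonpos[OF \<psi>(1)]] shift_quot_bound(2)[OF \<psi>(1) s(1)] c by simp
 qed
 also have "(%p. \<psi> p-(c * sphere_lap \<psi> p+1 * shift_quot s \<psi> p))=P" by (simp add: P_def fun_eq_iff)
 also have "l2_norm ?M P<=l2_norm ?M (%p. P p-h0 p)+l2_norm ?M h0"
  by (rule l2_norm_le_diff[OF L2_phase_Cc[OF P] L2_phase_Cc[OF h0]])
 also have "...<=N" using \<psi>(2) l2_norm_minus[of ?M P h0] d by (simp add: N_def P_def)
 finally have \<psi>N: "l2_norm ?M \<psi><=N" .
 define \<phi> where "\<phi>=mollify ?\<eta> \<psi>"
 have \<phi>: "\<phi>\<in>Cc" unfolding \<phi>_def by (rule Cc_mollify[OF \<psi>(1) \<eta>(1)])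
 have JP: "mollify ?\<eta> P=(%p. (\<phi> p-c * sphere_lap \<phi> p)-shift_quot s \<phi> p)"
 proof -
  have S: "sphere_lap \<psi>\<in>Cc" "(%p. c * sphere_lap \<psi> p)\<in>Cc" "shift_quot s \<psi>\<in>Cc"
   using \<psi>(1) by (auto intro!: Cc_cmult Cc_sphere_lap Cc_shift_quot)
  show ?thesis
   unfolding P_def[abs_def] mollify_diff[OF Cc_diff[OF \<psi>(1) S(2)] S(3) \<eta>(1)] mollify_diff[OF \<psi>(1) S(2) \<eta>(1)]
    mollify_cmult \<phi>_def sphere_lap_mollify[OF \<psi>(1) \<eta>(1)] shift_quot_mollify[OF \<psi>(1) \<eta>(1)] ..
 qed
 have J1: "l2_norm ?M (%p. mollify ?\<eta> h0 p-mollify ?\<eta> P p) < d/4"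
 proof -
  have "l2_norm ?M (mollify ?\<eta> (%p. h0 p-P p))<=l2_norm ?M (%p. h0 p-P p)"
   by (rule mollify_contraction[OF Cc_diff[OF h0 P] \<eta>])
  then show ?thesis unfolding mollify_diff[OF h0 P \<eta>(1)] using \<psi>(2) by (simp add: P_def)
 qed
 have J2: "l2_norm ?M (%p. shift_quot s \<phi> p-transport \<phi> p) < d/4"
 proof -
  have "l2_norm ?M (%p. shift_quot s \<phi> p-transport \<phi> p)<=C * s * l2_norm ?M \<psi>"
   unfolding \<phi>_def by (rule C(2)[OF s \<psi>(1)])
  also have "...<=C * s * N" using \<psi>N C(1) s by (intro mult_left_mono) auto
  finally show ?thesis using sm by simp
 qed
 let ?Q = "%p. (\<phi> p-c * sphere_lap \<phi> p)-transport \<phi> p"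
 have Q: "?Q\<in>Cc" using \<phi> by (intro Cc_diff Cc_cmult Cc_sphere_lap Cc_transport)
 have Jh: "mollify ?\<eta> h0\<in>Cc" "mollify ?\<eta> P\<in>Cc"
  using Cc_mollify[OF h0 \<eta>(1)] Cc_mollify[OF P \<eta>(1)] by auto
 have "l2_norm ?M (%p. h p-?Q p)<=l2_norm ?M (%p. h p-h0 p)+l2_norm ?M (%p. h0 p-?Q p)"
  by (rule l2_triangle_diff[OF h L2_phase_Cc[OF h0] L2_phase_Cc[OF Q]])
 also have "l2_norm ?M (%p. h0 p-?Q p)<=l2_norm ?M (%p. h0 p-mollify ?\<eta> h0 p)+l2_norm ?M (%p. mollify ?\<eta> h0 p-?Q p)"
  by (rule l2_triangle_diff[OF L2_phase_Cc[OF h0] L2_phase_Cc[OF Jh(1)] L2_phase_Cc[OF Q]])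
 also have "l2_norm ?M (%p. mollify ?\<eta> h0 p-?Q p)
   <= l2_norm ?M (%p. mollify ?\<eta> h0 p-mollify ?\<eta> P p)+l2_norm ?M (%p. mollify ?\<eta> P p-?Q p)"
  by (rule l2_triangle_diff[OF L2_phase_Cc[OF Jh(1)] L2_phase_Cc[OF Jh(2)] L2_phase_Cc[OF Q]])
 also have "(%p. mollify ?\<eta> P p-?Q p)=(%p. transport \<phi> p-shift_quot s \<phi> p)"
  unfolding JP by (simp add: fun_eq_iff)
 finally have "l2_norm ?M (%p. h p-?Q p) < d"
  using hh e(2) J1 J2 l2_norm_minus[of ?M h0 "mollify ?\<eta> h0"] l2_norm_minus[of ?M "transport \<phi>" "shift_quot s \<phi>"]
  by linarith
 then show "\<exists>\<phi>\<in>Cc. l2_norm ?M (%p. h p-((\<phi> p-c * sphere_lap \<phi> p)-transport \<phi> p)) < d"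
  by (rule bexI[OF _ \<phi>])
qed

section \<open>Bounded drifts\<close>

text \<open>Conjugation with \<open>exp (V / 2)\<close> turns the drift of the Langevin operator into this antisymmetric
  operator, with \<open>b\<close> the gradient of \<open>V\<close>. It makes sense, and is antisymmetric, for any field \<open>b\<close>.\<close>

definition drift :: "('a::euclidean_space => 'a) => ('a \<times> 'a => real) => 'a \<times> 'a => real" where
 "drift b F p=(\<Sum>c\<in>Basis. (b (fst p)\<bullet>c)*(1/2*(snd p\<bullet>c) * F p-1/(real DIM('a)-1) * tan_deriv c F p))"

lemma Cc_drift_term:
 "F\<in>Cc ==> (%p. 1/2*(snd p\<bullet>c) * F p-k * tan_deriv c F p)\<in>Cc"
proof -
 assume F: "F\<in>Cc"
 have "smooth_on UNIV (%p. snd p\<bullet>c)"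
  by (intro smooth_on_linear open_UNIV bounded_linear_compose[OF bounded_linear_inner_left bounded_linear_snd])
 from Cc_diff[OF Cc_cmult[OF Cc_mult[OF this F], of "1/2"] Cc_cmult[OF Cc_tan_deriv[OF F], of k c]]
 show ?thesis by (simp add: mult.assoc)
qed

lemma L2_drift:
 fixes b :: "'a::euclidean_space => 'a"
 assumes b: "!!c. loc_bounded (%x. b x\<bullet>c)" and F: "F\<in>Cc" shows "drift b F\<in>L2 phaseM"
 unfolding drift_def by (intro L2_sum L2_phase_weighted[OF b] Cc_drift_term F)

lemma drift_antisymmetric:
 fixes b :: "'a::euclidean_space => 'a"
 assumes b: "!!c. loc_bounded (%x. b x\<bullet>c)" and F: "F\<in>Cc" and d: "DIM('a) \<ge> 2"
 shows "l2_inner phaseM (drift b F) F=0"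
proof -
 let ?k = "1/(real DIM('a)-1)"
 have one: "(\<integral>p. (b (fst p)\<bullet>c)*((1/2*(snd p\<bullet>c) * F p-?k * tan_deriv c F p) * F p)\<partial>phaseM)=0" for c
 proof -
  have sc: "smooth_on UNIV (%p::'a \<times> 'a. snd p\<bullet>c)"
   by (intro smooth_on_linear open_UNIV bounded_linear_compose[OF bounded_linear_inner_left bounded_linear_snd])
  have i1: "integrable phaseM (%p. (b (fst p)\<bullet>c)*((snd p\<bullet>c)*(F p)\<^sup>2))"
   unfolding power2_eq_square by (rule integrable_weighted_Cc[OF b Cc_mult[OF sc Cc_prod[OF F F]]])
  have i2: "integrable phaseM (%p. (b (fst p)\<bullet>c)*(tan_deriv c F p * F p))"
   by (rule integrable_weighted_Cc[OF b Cc_prod[OF Cc_tan_deriv[OF F] F]])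
  have "(\<integral>p. (b (fst p)\<bullet>c)*((1/2*(snd p\<bullet>c) * F p-?k * tan_deriv c F p) * F p)\<partial>phaseM)
    = (\<integral>p. 1/2*((b (fst p)\<bullet>c)*((snd p\<bullet>c)*(F p)\<^sup>2))-?k * ((b (fst p)\<bullet>c)*(tan_deriv c F p * F p))\<partial>phaseM)"
   by (intro Bochner_Integration.integral_cong) (simp_all add: power2_eq_square algebra_simps)
  also have "...=1/2*(\<integral>p. (b (fst p)\<bullet>c)*((snd p\<bullet>c)*(F p)\<^sup>2)\<partial>phaseM)
    - ?k * (\<integral>p. (b (fst p)\<bullet>c)*(tan_deriv c F p * F p)\<partial>phaseM)"
   using i1 i2 by (subst Bochner_Integration.integral_diff) simp_all
  also have "...=0" unfolding tan_deriv_by_parts[OF b F] using d by (simp add: field_simps)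
  finally show ?thesis .
 qed
 have "l2_inner phaseM (drift b F) F
   = (\<integral>p. (\<Sum>c\<in>Basis. (b (fst p)\<bullet>c)*((1/2*(snd p\<bullet>c) * F p-?k * tan_deriv c F p) * F p))\<partial>phaseM)"
  unfolding l2_inner_def drift_def by (simp add: sum_distrib_right mult.assoc)
 also have "...=(\<Sum>c\<in>Basis. \<integral>p. (b (fst p)\<bullet>c)*((1/2*(snd p\<bullet>c) * F p-?k * tan_deriv c F p) * F p)\<partial>phaseM)"
  by (rule Bochner_Integration.integral_sum) (rule integrable_weighted_Cc[OF b Cc_prod[OF Cc_drift_term[OF F] F]])
 finally show ?thesis by (simp only: one sum.neutral_const)
qed

lemma l2_norm_weight_le:
 fixes F :: "'a::euclidean_space \<times> 'a => real"
 assumes "F\<in>Cc" "g\<in>borel_measurable phaseM" "!!p. p\<in>phase_space ==> \<bar>g p\<bar><=k * \<bar>F p\<bar>" "k \<ge> 0"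
 shows "l2_norm phaseM g<=k * l2_norm phaseM F"
proof -
 have "l2_norm phaseM g<=l2_norm phaseM (%p. k * F p)"
  by (rule l2_norm_mono[OF assms(2) L2_cmult[OF L2_phase_Cc[OF assms(1)]]])
    (use assms(3,4) in \<open>auto intro!: AE_I2 simp: space_phase_measure abs_mult\<close>)
 then show ?thesis using assms(4) by (simp add: l2_norm_cmult)
qed

lemma drift_bound:
 fixes b :: "'a::euclidean_space => 'a" and F :: "'a \<times> 'a => real"
 assumes bm: "!!c. loc_bounded (%x. b x\<bullet>c)" and \<beta>: "!!x. norm (b x)<=\<beta>" and F: "F\<in>Cc" and d: "DIM('a) \<ge> 2"
 shows "l2_norm phaseM (drift b F)<=real DIM('a)*\<beta> *
  (l2_norm phaseM F+(\<Sum>b\<in>Basis. \<Sum>b'\<in>Basis. l2_norm phaseM (rot_deriv b b' F)))"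
proof -
 let ?M = "phaseM :: ('a \<times> 'a) measure" and ?k = "1/(real DIM('a)-1)"
 let ?S = "\<Sum>b\<in>Basis. \<Sum>b'\<in>Basis. l2_norm ?M (rot_deriv b b' F)"
 have \<beta>0: "\<beta> \<ge> 0" using \<beta>[of 0] norm_ge_zero order_trans by blast
 have k: "0<=?k" "?k<=1" using d by auto
 have m: "(%p. (b (fst p)\<bullet>c) * G p)\<in>borel_measurable ?M" if "G\<in>Cc" for c G
  using L2_meas[OF L2_phase_weighted[OF bm that]] .
 have tan: "l2_norm ?M (tan_deriv c F)<=?S" if c: "c\<in>Basis" for c
 proof -
  let ?t = "%b b' p. (rot_gen b b' (snd p)\<bullet>c) * rot_deriv b b' F p"
  have t: "?t b b'\<in>Cc" for b b'
   by (intro Cc_mult Cc_rot_deriv smooth_on_linear bounded_linear_rot_gen_snd open_UNIV F)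
  have one: "l2_norm ?M (?t b b')<=2 * l2_norm ?M (rot_deriv b b' F)" if b: "b\<in>Basis" "b'\<in>Basis" for b b'
  proof (rule l2_norm_weight_le[OF Cc_rot_deriv[OF F] measurable_phase[OF Cc_measurable[OF t]]])
   fix p :: "'a \<times> 'a" assume p: "p\<in>phase_space"
   have y: "\<bar>snd p\<bullet>b\<bar><=1" "\<bar>snd p\<bullet>b'\<bar><=1"
    using p Basis_le_norm[OF b(1), of "snd p"] Basis_le_norm[OF b(2), of "snd p"] by (auto simp: phase_space_def)
   have cb: "\<bar>c\<bullet>b\<bar><=1" "\<bar>c\<bullet>b'\<bar><=1" using b c by (auto simp: inner_Basis)
   have "\<bar>(snd p\<bullet>b)*(c\<bullet>b')\<bar><=1*1" "\<bar>(snd p\<bullet>b')*(c\<bullet>b)\<bar><=1*1"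
    unfolding abs_mult using y cb by (intro mult_mono; simp)+
   then have "\<bar>rot_gen b b' (snd p)\<bullet>c\<bar><=2" unfolding rot_gen_inner by linarith
   then show "\<bar>?t b b' p\<bar><=2*\<bar>rot_deriv b b' F p\<bar>" by (simp add: abs_mult mult_right_mono)
  qed simp
  have "l2_norm ?M (tan_deriv c F)=1/2 * l2_norm ?M (%p. \<Sum>b\<in>Basis. \<Sum>b'\<in>Basis. ?t b b' p)"
   unfolding tan_deriv_def l2_norm_cmult by simp
  also have "...<=1/2*(\<Sum>b\<in>Basis. l2_norm ?M (%p. \<Sum>b'\<in>Basis. ?t b b' p))"
   by (intro mult_left_mono l2_norm_sum L2_sum L2_phase_Cc t) auto
  also have "...<=1/2*(\<Sum>b\<in>Basis. \<Sum>b'\<in>Basis. l2_norm ?M (?t b b'))"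
   by (intro mult_left_mono sum_mono l2_norm_sum L2_phase_Cc t) auto
  also have "...<=1/2*(\<Sum>b\<in>Basis. \<Sum>b'\<in>Basis. 2 * l2_norm ?M (rot_deriv b b' F))"
   by (intro mult_left_mono sum_mono one) auto
  finally show ?thesis by (simp add: sum_distrib_left[symmetric])
 qed
 have sc: "smooth_on UNIV (%p::'a \<times> 'a. snd p\<bullet>c)" for c
  by (intro smooth_on_linear open_UNIV bounded_linear_compose[OF bounded_linear_inner_left bounded_linear_snd])
 have summand: "l2_norm ?M (%p. (b (fst p)\<bullet>c)*(1/2*(snd p\<bullet>c) * F p-?k * tan_deriv c F p))<=\<beta>*(l2_norm ?M F+?S)"
  if c: "c\<in>Basis" for c
 proof -
  have G: "(%p. 1/2*(snd p\<bullet>c) * F p-?k * tan_deriv c F p)\<in>Cc" by (rule Cc_drift_term[OF F])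
  have "l2_norm ?M (%p. (b (fst p)\<bullet>c)*(1/2*(snd p\<bullet>c) * F p-?k * tan_deriv c F p))
    <= \<beta> * l2_norm ?M (%p. 1/2*(snd p\<bullet>c) * F p-?k * tan_deriv c F p)"
  proof (rule l2_norm_weight_le[OF G m[OF G] _ \<beta>0])
   fix p :: "'a \<times> 'a"
   have "\<bar>b (fst p)\<bullet>c\<bar><=\<beta>" using Basis_le_norm[OF c, of "b (fst p)"] \<beta>[of "fst p"] by linarith
   then show "\<bar>(b (fst p)\<bullet>c)*(1/2*(snd p\<bullet>c) * F p-?k * tan_deriv c F p)\<bar><=\<beta>*\<bar>1/2*(snd p\<bullet>c) * F p-?k * tan_deriv c F p\<bar>"
    unfolding abs_mult[of "b (fst p)\<bullet>c"] by (rule mult_right_mono) simp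
  qed
  also have "l2_norm ?M (%p. 1/2*(snd p\<bullet>c) * F p-?k * tan_deriv c F p)<=l2_norm ?M F+?S"
  proof -
   have H: "(%p. 1/2*(snd p\<bullet>c) * F p)\<in>Cc"
    using Cc_cmult[OF Cc_mult[OF sc F], of "1/2"] by (simp add: mult.assoc)
   have "l2_norm ?M (%p. 1/2*(snd p\<bullet>c) * F p)<=1 * l2_norm ?M F"
   proof (rule l2_norm_weight_le[OF F measurable_phase[OF Cc_measurable[OF H]]])
    fix p :: "'a \<times> 'a" assume "p\<in>phase_space"
    then have "\<bar>snd p\<bullet>c\<bar><=1" using Basis_le_norm[OF c, of "snd p"] by (auto simp: phase_space_def)
    then have "\<bar>1/2*(snd p\<bullet>c)\<bar><=1" by simp
    then show "\<bar>1/2*(snd p\<bullet>c) * F p\<bar><=1*\<bar>F p\<bar>" unfolding abs_mult[of "1/2*(snd p\<bullet>c)"] by (rule mult_right_mono) simp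
   qed simp
   moreover have "l2_norm ?M (%p. ?k * tan_deriv c F p)<=1*?S"
    unfolding l2_norm_cmult using k tan[OF c] by (intro mult_mono) (auto simp: l2_norm_nonneg)
   ultimately show ?thesis
    using l2_triangle_minus[OF L2_phase_Cc[OF H] L2_cmult[OF L2_phase_Cc[OF Cc_tan_deriv[OF F, of c]], of ?k]] by simp
  qed
  finally show ?thesis using \<beta>0 by (simp add: mult_left_mono)
 qed
 have "l2_norm ?M (drift b F)<=(\<Sum>c\<in>Basis. l2_norm ?M (%p. (b (fst p)\<bullet>c)*(1/2*(snd p\<bullet>c) * F p-?k * tan_deriv c F p)))"
  unfolding drift_def by (intro l2_norm_sum finite_Basis L2_phase_weighted[OF bm] Cc_drift_term F)
 also have "...<=(\<Sum>c\<in>(Basis::'a set). \<beta>*(l2_norm ?M F+?S))" by (intro sum_mono summand)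
 finally show ?thesis by (simp add: mult.assoc)
qed

lemma tan_deriv_add:
 assumes "F\<in>Cc" "G\<in>Cc" shows "tan_deriv c (%p. F p+G p)=(%p. tan_deriv c F p+tan_deriv c G p)"
 unfolding tan_deriv_def lin_field_add[OF Cc_smooth[OF assms(1)] Cc_smooth[OF assms(2)]]
 by (simp add: distrib_left sum.distrib add_divide_distrib)

text \<open>The energy identity bounds the spherical derivatives of \<open>F\<close> by the residual, uniformly in the
  strength \<open>t\<close> of the drift, so the continuity method applies.\<close>

theorem dense_range_drift:
 fixes b :: "'a::euclidean_space => 'a"
 assumes c: "c > 0" and d: "DIM('a) \<ge> 2"
  and bm: "!!c. loc_bounded (%x. b x\<bullet>c)" and \<beta>: "!!x. norm (b x)<=\<beta>"
 shows "dense_range phaseM Cc (%F p. ((F p-c * sphere_lap F p)-transport F p)-drift b F p)"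
proof -
 let ?M = "phaseM :: ('a \<times> 'a) measure"
 have \<beta>0: "\<beta> \<ge> 0" using \<beta>[of 0] norm_ge_zero order_trans by blast
 define N where "N=real DIM('a)"
 define C where "C=N * \<beta>*(1+N * N * sqrt (2/c))"
 show ?thesis
 proof (rule dense_range_perturb[where C = C])
  show "dense_range ?M Cc (%F p. F p-c * sphere_lap F p-transport F p)" by (rule dense_range_free[OF c])
  show "(%p. (F p+G p)-c * sphere_lap (%p. F p+G p) p-transport (%p. F p+G p) p)
    = (%p. (F p-c * sphere_lap F p-transport F p)+(G p-c * sphere_lap G p-transport G p))"
   if "F\<in>Cc" "G\<in>Cc" for F G :: "'a \<times> 'a => real"
   unfolding sphere_lap_add[OF that] lin_field_add[OF Cc_smooth[OF that(1)] Cc_smooth[OF that(2)]]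
   by (simp add: algebra_simps)
  show "drift b (%p. F p+G p)=(%p. drift b F p+drift b G p)" if "F\<in>Cc" "G\<in>Cc" for F G
   unfolding drift_def tan_deriv_add[OF that] by (simp add: sum.distrib[symmetric] algebra_simps add_divide_distrib)
  fix F :: "'a \<times> 'a => real" and t :: real assume F: "F\<in>Cc" and t: "0<=t" "t<=1"
  note L = L2_phase_Cc[OF F] L2_phase_Cc[OF Cc_sphere_lap[OF F]] L2_phase_Cc[OF Cc_transport[OF F]] L2_drift[OF bm F]
  let ?R = "%p. (F p-c * sphere_lap F p-transport F p)-t * drift b F p"
  let ?K = "%p. 1*(c * sphere_lap F p+1 * transport F p)+t * drift b F p"
  have LK: "?K\<in>L2 ?M" by (intro L2_lincomb L)
  have R: "?R=(%p. F p-?K p)" by (simp add: fun_eq_iff)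
  have K: "l2_inner ?M ?K F=c * l2_inner ?M (sphere_lap F) F"
   unfolding l2_inner_lincomb[OF L2_lincomb[OF L(2,3)] L(4,1)] l2_inner_lincomb[OF L(2,3,1)]
    drift_antisymmetric[OF bm F d] l2_inner_transport[OF F] by simp
  have K0: "l2_inner ?M ?K F<=0" unfolding K using c sphere_lap_inner_nonpos[OF F] by (simp add: mult_nonneg_nonpos)
  have FR: "l2_norm ?M F<=l2_norm ?M ?R" unfolding R by (rule dissipative_lower_bound[OF L(1) LK K0])
  have LR: "?R\<in>L2 ?M" unfolding R by (rule L2_diff[OF L(1) LK])
  have X: "l2_norm ?M (rot_deriv b b' F)<=sqrt (2/c) * l2_norm ?M ?R" if b: "b\<in>Basis" "b'\<in>Basis" for b b'
  proof (rule power2_le_imp_le)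
   have "(l2_norm ?M (rot_deriv b b' F))\<^sup>2<=(\<Sum>b'\<in>Basis. (l2_norm ?M (rot_deriv b b' F))\<^sup>2)"
    using b by (intro member_le_sum) auto
   also have "...<=(\<Sum>b\<in>Basis. \<Sum>b'\<in>Basis. (l2_norm ?M (rot_deriv b b' F))\<^sup>2)"
    using b member_le_sum[of b Basis "%b. \<Sum>b'\<in>Basis. (l2_norm ?M (rot_deriv b b' F))\<^sup>2"] by (simp add: sum_nonneg)
   also have "... =-2/c * l2_inner ?M ?K F" unfolding K sphere_lap_nonpos[OF F] using c by simp
   also have "...<=2/c * (l2_norm ?M ?R * l2_norm ?M F)"
   proof -
    have "- l2_inner ?M ?K F<=(l2_norm ?M F)\<^sup>2-l2_inner ?M ?K F" by simp
    also have "...=l2_inner ?M ?R F" unfolding R l2_inner_diff[OF L(1) LK L(1)] l2_inner_self ..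
    also have "...<=l2_norm ?M ?R * l2_norm ?M F" by (rule l2_Cauchy_Schwarz[OF LR L(1)])
    finally have "2/c * (- l2_inner ?M ?K F)<=2/c * (l2_norm ?M ?R * l2_norm ?M F)"
     using c by (intro mult_left_mono) auto
    then show ?thesis by simp
   qed
   also have "...<=2/c * (l2_norm ?M ?R * l2_norm ?M ?R)"
    using c FR by (intro mult_left_mono) (auto simp: l2_norm_nonneg)
   also have "...=(sqrt (2/c) * l2_norm ?M ?R)\<^sup>2" using c by (simp add: power_mult_distrib power2_eq_square[of "l2_norm ?M ?R"])
   finally show "(l2_norm ?M (rot_deriv b b' F))\<^sup>2<=(sqrt (2/c) * l2_norm ?M ?R)\<^sup>2" .
  qed (use c in \<open>simp add: l2_norm_nonneg\<close>)
  have "(\<Sum>b\<in>Basis. \<Sum>b'\<in>Basis. l2_norm ?M (rot_deriv b b' F))<=(\<Sum>b\<in>(Basis::'a set). \<Sum>b'\<in>(Basis::'a set). sqrt (2/c) * l2_norm ?M ?R)"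
   by (intro sum_mono X)
  also have "...=N * N * sqrt (2/c) * l2_norm ?M ?R" by (simp add: N_def)
  finally have "N * \<beta>*(l2_norm ?M F+(\<Sum>b\<in>Basis. \<Sum>b'\<in>Basis. l2_norm ?M (rot_deriv b b' F)))
    <= N * \<beta>*(l2_norm ?M ?R+N * N * sqrt (2/c) * l2_norm ?M ?R)"
   using FR \<beta>0 by (intro mult_left_mono add_mono) (auto simp: N_def)
  also have "...=C * l2_norm ?M ?R" by (simp add: C_def algebra_simps)
  finally show "l2_norm ?M (drift b F)<=C * l2_norm ?M ?R"
   using drift_bound[OF bm \<beta> F d] by (simp add: N_def)
 qed (auto intro!: Cc_0 Cc_add L2_phase_Cc Cc_diff Cc_cmult Cc_sphere_lap Cc_transport L2_drift[OF bm])
qed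

section \<open>Rademacher's theorem\<close>

text \<open>Points at which difference quotients over intervals around the point drop below \<open>p\<close> and exceed \<open>q\<close> at arbitrarily small scales. Quotients over intervals, rather than one-sided ones, make the set a countable intersection of open sets.\<close>

definition osc_set :: "('a::euclidean_space => real) => 'a => real => real => 'a set" where
 "osc_set f e p q={x.
   (\<forall>n::nat. \<exists>u v. u < 0 \<and> 0 < v \<and> v-u < 1/Suc n \<and> f (x+v *\<^sub>R e)-f (x+u *\<^sub>R e) < p * (v-u)) \<and>
   (\<forall>n::nat. \<exists>u v. u < 0 \<and> 0 < v \<and> v-u < 1/Suc n \<and> f (x+v *\<^sub>R e)-f (x+u *\<^sub>R e) > q * (v-u))}"

lemma osc_set_borel:
 assumes f: "continuous_on UNIV f" shows "osc_set f e p q\<in>sets borel"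
proof -
 define O1 where "O1 n=(\<Union>u\<in>{u. u < 0}. \<Union>v\<in>{v. 0 < v \<and> v-u < 1/Suc n}. {x. f (x+v *\<^sub>R e)-f (x+u *\<^sub>R e) < p * (v-u)})" for n :: nat
 define O2 where "O2 n=(\<Union>u\<in>{u. u < 0}. \<Union>v\<in>{v. 0 < v \<and> v-u < 1/Suc n}. {x. f (x+v *\<^sub>R e)-f (x+u *\<^sub>R e) > q * (v-u)})" for n :: nat
 have c: "continuous_on UNIV (%x. f (x+v *\<^sub>R e))" for v
  by (rule continuous_on_compose2[OF f]) (auto intro!: continuous_intros)
 have "open (O1 n)" "open (O2 n)" for n
  unfolding O1_def O2_def by (auto intro!: open_UN open_Collect_less continuous_on_diff c continuous_on_const)
 then have "(\<Inter>n. O1 n) \<inter> (\<Inter>n. O2 n)\<in>sets borel" by (intro sets.Int sets.countable_INT'') auto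
 moreover have "osc_set f e p q=(\<Inter>n. O1 n) \<inter> (\<Inter>n. O2 n)"
  unfolding osc_set_def O1_def O2_def by blast
 ultimately show ?thesis by simp
qed

lemma osc_set_real:
 fixes g :: "real => real"
 assumes "x\<in>osc_set g 1 p q" "d > 0"
 shows "\<exists>u v. u < x \<and> x < v \<and> v-u < d \<and> g v-g u < p * (v-u)"
  and "\<exists>u v. u < x \<and> x < v \<and> v-u < d \<and> g v-g u > q * (v-u)"
proof -
 obtain n where n: "1/real (Suc n) < d" using assms(2) nat_approx_posE by blast
 obtain u v where "u < 0" "0 < v" "v-u < 1/Suc n" "g (x+v *\<^sub>R 1)-g (x+u *\<^sub>R 1) < p * (v-u)"
  using assms(1) unfolding osc_set_def by blast
 then show "\<exists>u v. u < x \<and> x < v \<and> v-u < d \<and> g v-g u < p * (v-u)"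
  using n by (intro exI[of _ "x+u"] exI[of _ "x+v"]) auto
 obtain u v where "u < 0" "0 < v" "v-u < 1/Suc n" "g (x+v *\<^sub>R 1)-g (x+u *\<^sub>R 1) > q * (v-u)"
  using assms(1) unfolding osc_set_def by blast
 then show "\<exists>u v. u < x \<and> x < v \<and> v-u < d \<and> g v-g u > q * (v-u)"
  using n by (intro exI[of _ "x+u"] exI[of _ "x+v"]) auto
qed

text \<open>Vitali's covering theorem for balls, restated for open intervals.\<close>

lemma vitali_intervals:
 fixes E :: "real set"
 assumes "!!x d. x\<in>E ==> d > 0 ==> \<exists>u v. (u, v)\<in>K \<and> u < x \<and> x < v \<and> v-u < d"
 obtains C where "countable C" "C \<subseteq> K" "disjoint_family_on (%(u, v). {u<..<v}) C"
  "negligible (E-(\<Union>(u, v)\<in>C. {u<..<v}))"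
proof -
 let ?a = "%(u, v). (u+v)/2 :: real" and ?r = "%(u, v). (v-u)/2 :: real"
 have b: "ball (?a i) (?r i)=(case i of (u, v) => {u<..<v})" for i
  by (auto simp: dist_real_def split: prod.split) (auto simp: abs_if field_simps split: if_splits)
 obtain C where C: "countable C" "C \<subseteq> K" "pairwise (%i j. disjnt (ball (?a i) (?r i)) (ball (?a j) (?r j))) C"
  "negligible (E-(\<Union>i\<in>C. ball (?a i) (?r i)))"
 proof (rule Vitali_covering_theorem_balls[where S = E and K = K and a = ?a and r = ?r])
  fix x d :: real assume "x\<in>E" "0 < d"
  then obtain u v where "(u, v)\<in>K" "u < x" "x < v" "v-u < d" using assms by blast
  then show "\<exists>i. i\<in>K \<and> x\<in>ball (?a i) (?r i) \<and> ?r i < d"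
   unfolding b by (intro exI[of _ "(u, v)"]) auto
 qed blast
 show thesis
  by (rule that[OF C(1,2)]) (use C(3,4) in \<open>auto simp: b disjoint_family_on_def pairwise_def disjnt_def\<close>)
qed

lemma emeasure_disjoint_intervals_le:
 assumes C: "countable C" "disjoint_family_on (%(u, v). {u<..<v::real}) C"
  and sM: "sets M=sets borel" and sN: "sets N=sets borel"
  and le: "!!u v. (u, v)\<in>C ==> emeasure M {u<..<v}<=k * emeasure N {u<..<v}"
 shows "emeasure M (\<Union>(u, v)\<in>C. {u<..<v})<=k * emeasure N (\<Union>(u, v)\<in>C. {u<..<v})"
proof -
 let ?X = "%(u, v). {u<..<v::real}"
 have "emeasure M (\<Union>i\<in>C. ?X i)=(\<integral>\<^sup>+i. emeasure M (?X i)\<partial>count_space C)"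
  by (rule emeasure_UN_countable[OF _ C(1,2)]) (auto simp: sM split: prod.split)
 also have "...<=(\<integral>\<^sup>+i. k * emeasure N (?X i)\<partial>count_space C)"
  by (rule nn_integral_mono) (use le in auto)
 also have "...=k * (\<integral>\<^sup>+i. emeasure N (?X i)\<partial>count_space C)" by (rule nn_integral_cmult) simp
 also have "(\<integral>\<^sup>+i. emeasure N (?X i)\<partial>count_space C)=emeasure N (\<Union>i\<in>C. ?X i)"
  by (rule emeasure_UN_countable[OF _ C(1,2), symmetric]) (auto simp: sN split: prod.split)
 finally show ?thesis .
qed

text \<open>Lebesgue's differentiation theorem for monotone functions, by covering twice: intervals of slope
  below \<open>p\<close> cover the oscillation set up to a null set, and inside them so do intervals of slope above
  \<open>q\<close>; comparing the Stieltjes measures of the two families gives \<open>q |E| \<le> p |E|\<close>.\<close>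

lemma osc_set_null_mono:
 fixes g :: "real \<Rightarrow> real"
 assumes mono: "\<And>x y. x \<le> y \<Longrightarrow> g x \<le> g y" and cont: "continuous_on UNIV g" and pq: "p < q"
 shows "osc_set g 1 p q \<in> null_sets lborel"
proof -
 have null: "emeasure lborel (osc_set g 1 p q \<inter> {-N<..<N}) = 0" for N :: real
 proof -
  define E where "E = osc_set g 1 p q \<inter> {-N<..<N}"
  have Eb: "E \<in> sets borel" unfolding E_def using osc_set_borel[OF cont] by auto
  have Ef: "emeasure lborel E < \<infinity>"
  proof -
   have "emeasure lborel E<=emeasure lborel {-N<..<N}" by (rule emeasure_mono) (auto simp: E_def)
   also have "... < \<infinity>" by (cases "-N<=N") auto
   finally show ?thesis .
  qed
  define m where "m=measure lborel E"
  have Em: "emeasure lborel E=ennreal m" unfolding m_def using Ef by (intro emeasure_eq_ennreal_measure) auto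
  have m0: "m \<ge> 0" by (simp add: m_def)
  define G where "G=interval_measure g"
  have Gs: "sets G=sets borel" by (simp add: G_def)
  have Goo: "emeasure G {u<..<v}=ennreal (g v-g u)" if "u < v" for u v
  proof -
   have gc: "isCont g x" for x using cont by (simp add: continuous_on_eq_continuous_at)
   have r: "continuous (at_right a) g" for a using gc[of a] by (rule continuous_at_imp_continuous_at_within)
   have Ioc: "emeasure G {a<..b}=ennreal (g b-g a)" if "a<=b" for a b
    unfolding G_def using that mono r by (intro emeasure_interval_measure_Ioc) auto
   have lim: "(%n. g (v-(v-u)/real (Suc (Suc n)))) ----> g v"
   proof (rule isCont_tendsto_compose[OF gc])
    have "(%n. 1/real (Suc (Suc n))) ----> 0"
     using LIMSEQ_ignore_initial_segment[OF step_sequence(3), of 1] by simp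
    from tendsto_diff[OF tendsto_const[of v] tendsto_mult_left[OF this, of "v-u"]]
    show "(%n. v-(v-u)/real (Suc (Suc n))) ----> v" by simp
   qed
   have "emeasure G {u<..<v}<=ennreal (g v-g u)"
    using emeasure_mono[of "{u<..<v}" "{u<..v}" G] Ioc[of u v] that Gs by (simp add: subset_eq)
   moreover have "ennreal (g v-g u)<=emeasure G {u<..<v}"
   proof (rule LIMSEQ_le_const2)
    show "(%n. ennreal (g (v-(v-u)/real (Suc (Suc n)))-g u)) ----> ennreal (g v-g u)"
     by (intro tendsto_ennrealI tendsto_diff lim tendsto_const)
    show "\<exists>n0. \<forall>n\<ge>n0. ennreal (g (v-(v-u)/real (Suc (Suc n)))-g u)<=emeasure G {u<..<v}"
    proof (intro exI allI impI)
     fix n :: nat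
     let ?w = "v-(v-u)/real (Suc (Suc n))"
     have "(v-u)/real (Suc (Suc n))<=(v-u)/1" using that by (intro divide_left_mono) auto
     moreover have "0 < (v-u)/real (Suc (Suc n))" using that by simp
     ultimately have w: "u<=?w" "?w < v" unfolding div_by_1 using le_diff_eq add.commute diff_less_eq less_add_same_cancel1 by metis+
     have "ennreal (g ?w-g u)=emeasure G {u<..?w}" using Ioc[OF w(1)] by simp
     also have "...<=emeasure G {u<..<v}" using w(2) Gs by (intro emeasure_mono) auto
     finally show "ennreal (g ?w-g u)<=emeasure G {u<..<v}" .
    qed
   qed
   ultimately show ?thesis by (rule antisym)
  qed
  have "q * m<=p * (m+e)" if e: "e > 0" and p: "p > 0" for e
  proof -
   obtain U where U: "open U" "E \<subseteq> U" "emeasure lebesgue (U-E) < ennreal e"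
    using sets_lebesgue_outer_open[of E e] e Eb by (metis sets_completionI_sets sets_lborel)
   have Ub: "U\<in>sets borel" using U(1) by simp
   have mU: "emeasure lborel U<=ennreal (m+e)"
   proof -
    have "emeasure lborel U=emeasure lborel E+emeasure lborel (U-E)"
     using U(2) Eb Ub by (subst plus_emeasure) (auto intro: arg_cong[of _ _ "emeasure lborel"])
    also have "...<=ennreal m+ennreal e"
     using U(3) Ub Eb by (intro add_mono) (auto simp: Em)
    finally show ?thesis using m0 e by simp
   qed
   define K1 where "K1={(u, v). u < v \<and> {u<..<v} \<subseteq> U \<and> g v-g u < p * (v-u)}"
   obtain C1 where C1: "countable C1" "C1 \<subseteq> K1" "disjoint_family_on (%(u, v). {u<..<v}) C1"
    "negligible (E-(\<Union>(u, v)\<in>C1. {u<..<v}))"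
   proof (rule vitali_intervals[of E K1])
    fix x d :: real assume x: "x\<in>E" and d: "d > 0"
    obtain r where r: "r > 0" "ball x r \<subseteq> U" using U(1,2) x openE by blast
    obtain u v where uv: "u < x" "x < v" "v-u < min d r" "g v-g u < p * (v-u)"
     using osc_set_real(1)[of x g p q "min d r"] x d r(1) by (auto simp: E_def)
    have "{u<..<v} \<subseteq> ball x r" using uv by (auto simp: dist_real_def)
    then show "\<exists>u v. (u, v)\<in>K1 \<and> u < x \<and> x < v \<and> v-u < d"
     using uv r(2) by (intro exI[of _ u] exI[of _ v]) (auto simp: K1_def)
   qed blast
   define U1 where "U1=(\<Union>(u, v)\<in>C1. {u<..<v})"
   define K2 where "K2={(u, v). u < v \<and> {u<..<v} \<subseteq> U1 \<and> g v-g u > q * (v-u)}"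
   have U1: "open U1" unfolding U1_def by (auto split: prod.split)
   obtain C2 where C2: "countable C2" "C2 \<subseteq> K2" "disjoint_family_on (%(u, v). {u<..<v}) C2"
    "negligible (E \<inter> U1-(\<Union>(u, v)\<in>C2. {u<..<v}))"
   proof (rule vitali_intervals[of "E \<inter> U1" K2])
    fix x d :: real assume x: "x\<in>E \<inter> U1" and d: "d > 0"
    obtain r where r: "r > 0" "ball x r \<subseteq> U1" using U1 x openE by blast
    obtain u v where uv: "u < x" "x < v" "v-u < min d r" "g v-g u > q * (v-u)"
     using osc_set_real(2)[of x g p q "min d r"] x d r(1) by (auto simp: E_def)
    have "{u<..<v} \<subseteq> ball x r" using uv by (auto simp: dist_real_def)
    then show "\<exists>u v. (u, v)\<in>K2 \<and> u < x \<and> x < v \<and> v-u < d"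
     using uv r(2) by (intro exI[of _ u] exI[of _ v]) (auto simp: K2_def)
   qed blast
   define U2 where "U2=(\<Union>(u, v)\<in>C2. {u<..<v})"
   have U2: "open U2" unfolding U2_def by (auto split: prod.split)
   have U21: "U2 \<subseteq> U1" unfolding U2_def using C2(2) by (auto simp: K2_def)
   have U1U: "U1 \<subseteq> U" unfolding U1_def using C1(2) by (auto simp: K1_def)
   have "ennreal m<=emeasure lborel U2"
   proof -
    have "negligible ((E-U1) \<union> (E \<inter> U1-U2))"
     using C1(4) C2(4) unfolding U1_def[symmetric] U2_def[symmetric] by (rule negligible_Un)
    then have n0: "negligible (E-U2)" by (rule negligible_subset) auto
    have "E-U2\<in>sets borel" using Eb U2 by auto
    then have z: "emeasure lborel (E-U2)=0"
     using n0 by (simp add: negligible_iff_null_sets null_sets_completion_iff null_setsD1)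
    have "ennreal m<=emeasure lborel ((E-U2) \<union> U2)" unfolding Em[symmetric]
     using Eb U2 by (intro emeasure_mono) auto
    also have "...<=emeasure lborel (E-U2)+emeasure lborel U2"
     using Eb U2 by (intro emeasure_subadditive) auto
    finally show ?thesis by (simp add: z)
   qed
   then have "ennreal q * ennreal m<=ennreal q * emeasure lborel U2" by (rule mult_left_mono) simp
   also have "...<=emeasure G U2"
   proof -
    have "emeasure lborel (\<Union>(u, v)\<in>C2. {u<..<v})<=ennreal (1/q) * emeasure G (\<Union>(u, v)\<in>C2. {u<..<v})"
    proof (rule emeasure_disjoint_intervals_le[OF C2(1,3)])
     fix u v assume "(u, v)\<in>C2"
     then have uv: "u < v" "g v-g u > q * (v-u)" using C2(2) by (auto simp: K2_def)
     have "v-u<=1/q * (g v-g u)" using uv p pq by (simp add: field_simps)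
     then show "emeasure lborel {u<..<v}<=ennreal (1/q) * emeasure G {u<..<v}"
      using uv p pq mono[of u v] by (simp add: Goo ennreal_mult[symmetric] ennreal_leI)
    qed (simp_all add: Gs)
    then have "ennreal q * emeasure lborel U2<=ennreal q * (ennreal (1/q) * emeasure G U2)"
     unfolding U2_def by (rule mult_left_mono) simp
    also have "...=emeasure G U2" using p pq by (simp add: mult.assoc[symmetric] ennreal_mult[symmetric])
    finally show ?thesis .
   qed
   also have "...<=emeasure G U1" using U21 U1 Gs by (intro emeasure_mono) auto
   also have "...<=ennreal p * emeasure lborel U1"
    unfolding U1_def
   proof (rule emeasure_disjoint_intervals_le[OF C1(1,3)])
    fix u v assume "(u, v)\<in>C1"
    then have uv: "u < v" "g v-g u < p * (v-u)" using C1(2) by (auto simp: K1_def)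
    then show "emeasure G {u<..<v}<=ennreal p * emeasure lborel {u<..<v}"
     using p by (simp add: Goo ennreal_mult[symmetric] ennreal_leI)
   qed (simp_all add: Gs)
   also have "...<=ennreal p * ennreal (m+e)"
    using emeasure_mono[OF U1U, of lborel] Ub mU by (intro mult_left_mono) auto
   finally have "ennreal (q * m)<=ennreal (p * (m+e))"
    using p pq m0 e by (simp add: ennreal_mult)
   then show "q * m<=p * (m+e)" using p m0 e by (subst (asm) ennreal_le_iff) auto
  qed
  note key = this
  have qp: "q * m<=p * m" if p: "p > 0"
  proof (rule field_le_epsilon)
   fix e :: real assume "e > 0"
   then show "q * m<=p * m+e" using key[of "e/p"] p by (simp add: distrib_left)
  qed
  have "m=0"
  proof (cases "p > 0")
   case True
   then show ?thesis using qp[OF True] pq m0 by (metis mult_le_cancel_right not_le order_antisym)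
  next
   case False
   have "osc_set g 1 p q={}"
   proof (rule equals0I)
    fix x assume "x\<in>osc_set g 1 p q"
    then obtain u v where "u < x" "x < v" "g v-g u < p * (v-u)" using osc_set_real(1)[of x g p q 1] by auto
    moreover have "p * (v-u)<=0" using False calculation by (intro mult_nonpos_nonneg) auto
    ultimately show False using mono[of u v] by simp
   qed
   then show ?thesis by (simp add: m_def E_def)
  qed
  then show ?thesis using Em by (simp add: E_def)
 qed
 have ob: "osc_set g 1 p q\<in>sets borel" by (rule osc_set_borel[OF cont])
 have "osc_set g 1 p q=(\<Union>n::nat. osc_set g 1 p q \<inter> {-real n<..<real n})"
 proof (intro set_eqI iffI)
  fix x assume x: "x\<in>osc_set g 1 p q"
  obtain n :: nat where "\<bar>x\<bar> < real n" using reals_Archimedean2 by blast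
  then show "x\<in>(\<Union>n::nat. osc_set g 1 p q \<inter> {-real n<..<real n})" using x by (intro UN_I[of n]) auto
 qed auto
 moreover have "(\<Union>n::nat. osc_set g 1 p q \<inter> {-real n<..<real n})\<in>null_sets lborel"
  using null ob by (intro null_sets_UN) (auto simp: null_sets_def)
 ultimately show ?thesis by simp
qed

text \<open>Adding a linear function makes a Lipschitz function monotone and shifts the slopes.\<close>

lemma osc_set_null_real:
 fixes f :: "real \<Rightarrow> real"
 assumes lip: "\<And>x y. \<bar>f x - f y\<bar> \<le> L * \<bar>x - y\<bar>" and pq: "p < q"
 shows "osc_set f 1 p q \<in> null_sets lborel"
proof -
 let ?g = "\<lambda>x. f x + L * x"
 have "osc_set f 1 p q = osc_set ?g 1 (p + L) (q + L)"
  unfolding osc_set_def by (simp add: algebra_simps)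
 moreover have "osc_set ?g 1 (p + L) (q + L) \<in> null_sets lborel"
 proof (rule osc_set_null_mono)
  show "?g x<=?g y" if "x<=y" for x y using lip[of x y] that by (simp add: algebra_simps)
  have "\<bar>L\<bar>-lipschitz_on UNIV f"
   by (rule lipschitz_onI) (auto simp: dist_real_def intro: order_trans[OF lip mult_right_mono[OF abs_ge_self]])
  then show "continuous_on UNIV ?g" by (intro continuous_intros lipschitz_on_continuous_on)
 qed (use pq in simp)
 ultimately show ?thesis by simp
qed

text \<open>Fubini along the lines in direction \<open>e\<close>: averaging the measure over the translates by \<open>t e\<close> avoids a
  change of coordinates.\<close>

lemma osc_set_null:
 fixes f :: "'a::euclidean_space => real"
 assumes lip: "!!x y. \<bar>f x-f y\<bar><=L * norm (x-y)" and pq: "p < q"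
 shows "osc_set f e p q\<in>null_sets lborel"
proof -
 have "\<bar>L\<bar>-lipschitz_on UNIV f"
  by (rule lipschitz_onI) (auto simp: dist_norm intro: order_trans[OF lip mult_right_mono[OF abs_ge_self]])
 then have cont: "continuous_on UNIV f" by (rule lipschitz_on_continuous_on)
 let ?E = "osc_set f e p q"
 have Eb[measurable]: "?E\<in>sets borel" by (rule osc_set_borel[OF cont])
 have line: "x+t *\<^sub>R e\<in>?E \<longleftrightarrow> t\<in>osc_set (%t. f (x+t *\<^sub>R e)) 1 p q" for x t
  unfolding osc_set_def by (simp add: algebra_simps)
 have zero: "(\<integral>\<^sup>+t. indicator ?E (x+t *\<^sub>R e) * indicator {0..1} t\<partial>lborel)=0" for x
 proof -
  have "osc_set (%t. f (x+t *\<^sub>R e)) 1 p q\<in>null_sets lborel"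
  proof (rule osc_set_null_real[OF _ pq])
   show "\<bar>f (x+s *\<^sub>R e)-f (x+t *\<^sub>R e)\<bar><=(L * norm e)*\<bar>s-t\<bar>" for s t
    using lip[of "x+s *\<^sub>R e" "x+t *\<^sub>R e"] by (simp add: scaleR_diff_left[symmetric] mult_ac)
  qed
  from AE_not_in[OF this] have "AE t in lborel. indicator ?E (x+t *\<^sub>R e) * indicator {0..1} t=(0::ennreal)"
   by eventually_elim (simp add: line[symmetric] indicator_def)
  from nn_integral_cong_AE[OF this] show ?thesis by simp
 qed
 have meas: "(%(t, x). indicator ?E (x+t *\<^sub>R e) * indicator {0..1} t :: ennreal)\<in>borel_measurable (lborel \<Otimes>\<^sub>M lborel)"
  by measurable
 have tr: "(\<integral>\<^sup>+x. indicator ?E (x+t *\<^sub>R e)\<partial>lborel)=emeasure lborel ?E" for t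
 proof -
  have "(\<integral>\<^sup>+x. indicator ?E x\<partial>distr lborel borel ((+) (t *\<^sub>R e)))=(\<integral>\<^sup>+x. indicator ?E (t *\<^sub>R e+x)\<partial>lborel)"
   by (rule nn_integral_distr) auto
  then show ?thesis unfolding lborel_distr_plus by (simp add: add.commute)
 qed
 have "emeasure lborel ?E=(\<integral>\<^sup>+t. emeasure lborel ?E * indicator {0..1} t\<partial>(lborel :: real measure))"
  by (subst nn_integral_cmult) auto
 also have "...=(\<integral>\<^sup>+t. (\<integral>\<^sup>+x. indicator ?E (x+t *\<^sub>R e) * indicator {0..1} t\<partial>lborel)\<partial>lborel)"
 proof (rule nn_integral_cong)
  fix t :: real
  have "(\<integral>\<^sup>+x. indicator ?E (x+t *\<^sub>R e) * indicator {0..1} t\<partial>lborel)=(\<integral>\<^sup>+x. indicator ?E (x+t *\<^sub>R e)\<partial>lborel) * indicator {0..1} t"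
   by (rule nn_integral_multc) measurable
  then show "emeasure lborel ?E * indicator {0..1} t=(\<integral>\<^sup>+x. indicator ?E (x+t *\<^sub>R e) * indicator {0..1} t\<partial>lborel)"
   by (simp add: tr)
 qed
 also have "...=(\<integral>\<^sup>+x. (\<integral>\<^sup>+t. indicator ?E (x+t *\<^sub>R e) * indicator {0..1} t\<partial>lborel)\<partial>lborel)"
  by (rule lborel_pair.Fubini'[symmetric]) (use meas in \<open>simp add: split_beta'\<close>)
 also have "...=0" by (simp add: zero)
 finally show ?thesis using Eb by (simp add: null_sets_def)
qed

text \<open>If slopes do not oscillate across any rational gap, then the infimum of the eventual upper slopes is also the limit of all slopes; intervals around the point shrink to one-sided ones by continuity.\<close>

lemma not_osc_imp_deriv:
 fixes f :: "real => real"
 assumes lip: "!!x y. \<bar>f x-f y\<bar><=L * \<bar>x-y\<bar>"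
  and no: "!!p q. p\<in>\<rat> ==> q\<in>\<rat> ==> p < q ==> 0 \<notin> osc_set f 1 p q"
 obtains D where "(f has_real_derivative D) (at 0)"
proof -
 define Q where "Q={q. \<exists>n::nat. \<forall>u v. u < 0 \<and> 0 < v \<and> v-u < 1/Suc n \<longrightarrow> f v-f u<=q * (v-u)}"
 define D where "D=Inf Q"
 have L: "L\<in>Q" unfolding Q_def
 proof (intro CollectI exI allI impI)
  fix u v :: real assume "u < 0 \<and> 0 < v \<and> v-u < 1/Suc 0"
  then show "f v-f u<=L * (v-u)" using lip[of v u] by simp
 qed
 have lower: "- L<=q" if "q\<in>Q" for q
 proof -
  obtain n :: nat where n: "!!u v. u < 0 ==> 0 < v ==> v-u < 1/Suc n ==> f v-f u<=q * (v-u)"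
   using \<open>q \<in> Q\<close> unfolding Q_def by blast
  define h where "h=1/(3 * real (Suc n))"
  have h: "h > 0" "h-(-h) < 1/Suc n" by (auto simp: h_def field_simps)
  have "- L * (2 * h)<=f h-f (-h)" using lip[of h "-h"] h by simp
  also have "...<=q * (2 * h)" using n[of "-h" h] h by simp
  finally show ?thesis by (rule mult_right_le_imp_le) (use h(1) in simp)
 qed
 have bdd: "bdd_below Q" using lower by (auto simp: bdd_below_def)
 have ev: "\<exists>n::nat. \<forall>u v. u < 0 \<and> 0 < v \<and> v-u < 1/Suc n \<longrightarrow> \<bar>f v-f u-D * (v-u)\<bar><=e * (v-u)" if e: "e > 0" for e
 proof -
  obtain q where q: "q\<in>Q" "q < D+e" using cInf_lessD[of Q "D+e"] L e unfolding D_def by auto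
  obtain n where n: "!!u v. u < 0 ==> 0 < v ==> v-u < 1/Suc n ==> f v-f u<=q * (v-u)"
   using q(1) unfolding Q_def by blast
  have "\<exists>n::nat. \<forall>u v. u < 0 \<and> 0 < v \<and> v-u < 1/Suc n \<longrightarrow> f v-f u \<ge> (D-e)*(v-u)"
  proof (rule ccontr)
   assume "\<not> ?thesis"
   then have a: "\<exists>u v. u < 0 \<and> 0 < v \<and> v-u < 1/Suc n \<and> f v-f u < (D-e)*(v-u)" for n :: nat
    by (meson not_le)
   obtain p where p: "p\<in>\<rat>" "D-e < p" "p < D" using Rats_dense_in_real[of "D-e" D] e by auto
   obtain r where r: "r\<in>\<rat>" "p < r" "r < D" using Rats_dense_in_real[OF p(3)] by auto
   have rQ: "r \<notin> Q" using r(3) cInf_lower[OF _ bdd, of r] unfolding D_def by auto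
   have b: "\<exists>u v. u < 0 \<and> 0 < v \<and> v-u < 1/Suc n \<and> f v-f u > r * (v-u)" for n :: nat
    using rQ unfolding Q_def by (auto simp: not_le)
   have c: "\<exists>u v. u < 0 \<and> 0 < v \<and> v-u < 1/Suc n \<and> f v-f u < p * (v-u)" for n :: nat
   proof -
    obtain u v where uv: "u < 0" "0 < v" "v-u < 1/Suc n" "f v-f u < (D-e)*(v-u)" using a by blast
    have "(D-e)*(v-u)<=p * (v-u)" using uv p(2) by (intro mult_right_mono) auto
    then have "f v-f u < p * (v-u)" using uv(4) by linarith
    then show ?thesis using uv(1,2,3) by blast
   qed
   have "0\<in>osc_set f 1 p r" unfolding osc_set_def using b c by simp
   then show False using no[OF p(1) r(1,2)] by blast
  qed
  then obtain n' :: nat where n': "!!u v. u < 0 ==> 0 < v ==> v-u < 1/Suc n' ==> f v-f u \<ge> (D-e)*(v-u)" by blast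
  show ?thesis
  proof (intro exI[of _ "max n n'"] allI impI)
   fix u v :: real assume uv: "u < 0 \<and> 0 < v \<and> v-u < 1/Suc (max n n')"
   have "1/real (Suc (max n n'))<=1/real (Suc n)" "1/real (Suc (max n n'))<=1/real (Suc n')"
    by (auto intro!: divide_left_mono)
   then have "f v-f u<=q * (v-u)" "f v-f u \<ge> (D-e)*(v-u)" using uv n[of u v] n'[of u v] by auto
   moreover have "q * (v-u)<=(D+e)*(v-u)" using q(2) uv by (intro mult_right_mono) auto
   ultimately show "\<bar>f v-f u-D * (v-u)\<bar><=e * (v-u)" by (simp add: algebra_simps abs_le_iff)
  qed
 qed
 have "\<bar>L\<bar>-lipschitz_on UNIV f"
  by (rule lipschitz_onI) (auto simp: dist_real_def intro: order_trans[OF lip mult_right_mono[OF abs_ge_self]])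
 then have cont: "continuous_on UNIV f" by (rule lipschitz_on_continuous_on)
 have one: "\<exists>d>0. \<forall>h. \<bar>h\<bar> < d \<longrightarrow> \<bar>f h-f 0-D * h\<bar><=e * \<bar>h\<bar>" if e: "e > 0" for e
 proof -
  obtain n :: nat where n: "!!u v. u < 0 ==> 0 < v ==> v-u < 1/Suc n ==> \<bar>f v-f u-D * (v-u)\<bar><=e * (v-u)"
   using ev[OF e] by blast
  let ?s = "%k::nat. 1/real (Suc k)"
  have "\<bar>f h-f 0-D * h\<bar><=e * \<bar>h\<bar>" if h: "\<bar>h\<bar> < 1/Suc n" for h
  proof -
   have fc: "(%k. f (s * ?s k)) ----> f 0" for s
   proof (rule continuous_on_tendsto_compose[OF cont])
    show "(%k. s * ?s k) ----> 0" using tendsto_mult_left[OF step_sequence(3), of s] by simp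
   qed auto
   have small: "eventually (%k. ?s k < 1/Suc n-\<bar>h\<bar>) sequentially"
    using h by (intro order_tendstoD(2)[OF step_sequence(3)]) simp
   consider "h=0" | "h > 0" | "h < 0" by linarith
   then show ?thesis
   proof cases
    case 2
    have "(%k. e * (h+?s k)-\<bar>f h-f ((-1)*?s k)-D * (h+?s k)\<bar>) ----> e * (h+0)-\<bar>f h-f 0-D * (h+0)\<bar>"
     by (intro tendsto_intros fc step_sequence(3))
    moreover have "eventually (%k. 0<=e * (h+?s k)-\<bar>f h-f ((-1)*?s k)-D * (h+?s k)\<bar>) sequentially"
     using small by eventually_elim (use n[of "- ?s k" h for k] 2 in auto)
    ultimately have "0<=e * (h+0)-\<bar>f h-f 0-D * (h+0)\<bar>" by (rule tendsto_lowerbound) simp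
    then show ?thesis using 2 by simp
   next
    case 3
    have "(%k. e * (?s k-h)-\<bar>f (1*?s k)-f h-D * (?s k-h)\<bar>) ----> e * (0-h)-\<bar>f 0-f h-D * (0-h)\<bar>"
     by (intro tendsto_intros fc step_sequence(3))
    moreover have "eventually (%k. 0<=e * (?s k-h)-\<bar>f (1*?s k)-f h-D * (?s k-h)\<bar>) sequentially"
     using small by eventually_elim (use n[of h "?s k" for k] 3 in auto)
    ultimately have "0<=e * (0-h)-\<bar>f 0-f h-D * (0-h)\<bar>" by (rule tendsto_lowerbound) simp
    then show ?thesis using 3 by (simp add: abs_minus_commute algebra_simps)
   qed simp
  qed
  then show ?thesis by (intro exI[of _ "1/Suc n"]) auto
 qed
 have "(f has_real_derivative D) (at 0)"
  unfolding DERIV_def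
 proof (rule LIM_I)
  fix r :: real assume r: "r > 0"
  obtain d where d: "d > 0" "!!h. \<bar>h\<bar> < d ==> \<bar>f h-f 0-D * h\<bar><=(r/2)*\<bar>h\<bar>" using one[of "r/2"] r by auto
  show "\<exists>s>0. \<forall>h. h \<noteq> 0 \<and> norm (h-0) < s \<longrightarrow> norm ((f (0+h)-f 0)/h-D) < r"
  proof (intro exI[of _ d] conjI allI impI d(1))
   fix h :: real assume h: "h \<noteq> 0 \<and> norm (h-0) < d"
   have "(f h-f 0)/h-D=(f h-f 0-D * h)/h" using h by (simp add: field_simps)
   then have "\<bar>(f h-f 0)/h-D\<bar><=r/2" using d(2)[of h] h by (simp add: abs_divide pos_divide_le_eq)
   then show "norm ((f (0+h)-f 0)/h-D) < r" using r by simp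
  qed
 qed
 then show thesis by (rule that)
qed

lemma real_derivative_sequence:
 assumes "(g has_real_derivative D) (at 0)"
 shows "(%n. (g (1/real (Suc n))-g 0)/(1/real (Suc n))) ----> D"
proof -
 have "filterlim (%n. 1/real (Suc n)) (at 0) sequentially"
  unfolding filterlim_at using step_sequence(3) by (auto intro!: always_eventually)
 moreover have "((%h. (g h-g 0)/h) \<longlongrightarrow> D) (at 0)" using assms unfolding DERIV_def by simp
 ultimately show ?thesis by (rule filterlim_compose[rotated])
qed

lemma Cc_line_derivative:
 assumes F: "F\<in>Cc"
 shows "((%t. F (p+t *\<^sub>R v)) has_real_derivative dderiv v F p) (at 0)"
proof -
 have l: "((%t. p+t *\<^sub>R v) has_derivative (%t. t *\<^sub>R v)) (at (0::real))" by (auto intro!: derivative_eq_intros)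
 have "(F has_derivative (%v. dderiv v F p)) (at (p+0 *\<^sub>R v))" using Cc_has_derivative[OF F, of p] by simp
 from has_derivative_compose[OF l this]
 have "((%t. F (p+t *\<^sub>R v)) has_derivative (%t. dderiv (t *\<^sub>R v) F p)) (at 0)" .
 then show ?thesis unfolding has_field_derivative_def
  by (rule has_derivative_eq_rhs)
    (simp add: fun_eq_iff linear_cmul[OF dderiv_linear[OF smooth_on_differentiable[OF Cc_smooth[OF F] UNIV_I]]] mult.commute)
qed

lemma loc_bounded_diff: assumes "loc_bounded m" "loc_bounded n" shows "loc_bounded (%x. m x-n x)"
 unfolding loc_bounded_def
proof (intro conjI allI borel_measurable_diff loc_boundedD(1) assms)
 fix R
 obtain C D where "\<forall>x. norm x<=R \<longrightarrow> \<bar>m x\<bar><=C" "\<forall>x. norm x<=R \<longrightarrow> \<bar>n x\<bar><=D"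
  using loc_boundedD(2)[OF assms(1)] loc_boundedD(2)[OF assms(2)] by blast
 then have "\<bar>m x-n x\<bar><=C+D" if "norm x<=R" for x using that by (smt (verit))
 then show "\<exists>C. \<forall>x. norm x<=R \<longrightarrow> \<bar>m x-n x\<bar><=C" by blast
qed

lemma loc_bounded_sum: "(!!i. i\<in>I ==> loc_bounded (m i)) ==> loc_bounded (%x. \<Sum>i\<in>I. m i x)"
proof (induction I rule: infinite_finite_induct)
 case (insert i I)
 have "loc_bounded (%x. m i x-(0-(\<Sum>i\<in>I. m i x)))"
  by (intro loc_bounded_diff loc_bounded_const insert.IH insert.prems) auto
 then show ?case using insert.hyps by simp
qed (simp_all add: loc_bounded_const)

text \<open>The limit of difference quotients, clipped to the a priori bound so that it is a bounded Borel function everywhere.\<close>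

lemma lipschitz_line_derivative:
 fixes f :: "'a::euclidean_space => real"
 assumes lip: "!!x y. \<bar>f x-f y\<bar><=L * norm (x-y)"
 obtains G where "loc_bounded G" "AE x in lborel. ((%t. f (x+t *\<^sub>R e)) has_real_derivative G x) (at 0)"
proof -
 have Ll: "\<bar>L\<bar>-lipschitz_on UNIV f"
  by (rule lipschitz_onI) (auto simp: dist_norm intro: order_trans[OF lip mult_right_mono[OF abs_ge_self]])
 then have cont: "continuous_on UNIV f" by (rule lipschitz_on_continuous_on)
 define q where "q n x=(f (x+(1/real (Suc n)) *\<^sub>R e)-f x) * real (Suc n)" for n x
 define K where "K=\<bar>L\<bar> * norm e"
 define G where "G x=max (- K) (min K (lim (%n. q n x)))" for x
 have qm: "q n\<in>borel_measurable borel" for n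
  unfolding q_def by (intro borel_measurable_continuous_onI continuous_intros continuous_on_compose2[OF cont]) auto
 have Gm: "G\<in>borel_measurable borel"
  unfolding G_def by (intro borel_measurable_max borel_measurable_min borel_measurable_const borel_measurable_lim_metric qm)
 have "\<bar>G x\<bar><=K" for x unfolding G_def K_def by (auto simp: abs_le_iff max_def min_def)
 with Gm have "loc_bounded G" unfolding loc_bounded_def by blast
 moreover have "AE x in lborel. ((%t. f (x+t *\<^sub>R e)) has_real_derivative G x) (at 0)"
 proof -
  have "AE x in lborel. \<forall>p\<in>\<rat>. \<forall>r\<in>\<rat>. p < r \<longrightarrow> x \<notin> osc_set f e p r"
   using AE_not_in[OF osc_set_null[OF lip]] by (intro AE_ball_countable'[OF _ countable_rat]) (auto intro!: AE_I2)
  then show ?thesis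
  proof eventually_elim
   case (elim x)
   let ?g = "%t. f (x+t *\<^sub>R e)"
   have gl: "\<bar>?g s-?g t\<bar><=K * \<bar>s-t\<bar>" for s t
    using order_trans[OF lip[of "x+s *\<^sub>R e" "x+t *\<^sub>R e"] mult_right_mono[OF abs_ge_self norm_ge_zero]]
    by (simp add: K_def scaleR_diff_left[symmetric] mult_ac)
   have "0 \<notin> osc_set ?g 1 p r" if "p\<in>\<rat>" "r\<in>\<rat>" "p < r" for p r
    using elim that unfolding osc_set_def by simp
   then obtain D where D: "(?g has_real_derivative D) (at 0)" using not_osc_imp_deriv[OF gl] by blast
   from real_derivative_sequence[OF D] have lim: "(%n. q n x) ----> D" by (simp add: q_def)
   have "\<bar>q n x\<bar><=K" for n
   proof -
    have "\<bar>?g (1/real (Suc n))-?g 0\<bar><=K * (1/real (Suc n))" using gl[of "1/real (Suc n)" 0] by simp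
    then show ?thesis by (simp add: q_def abs_mult pos_le_divide_eq)
   qed
   then have "\<bar>D\<bar><=K" by (intro tendsto_upperbound[OF tendsto_rabs[OF lim]]) auto
   then have "G x=D" unfolding G_def limI[OF lim] by (simp add: max_def min_def abs_le_iff)
   then show ?case using D by simp
  qed
 qed
 ultimately show thesis by (rule that)
qed

lemma AE_phase_fst:
 assumes "AE x in lborel. P (x::'a::euclidean_space)"
 shows "AE p in phaseM. P (fst p)"
proof -
 obtain N where N: "{x. \<not> P x} \<subseteq> N" "N\<in>null_sets lborel" using assms by (auto elim!: AE_E simp: null_sets_def)
 have "emeasure phaseM (N \<times> sphere (0::'a) 1)=emeasure lborel N * emeasure sphere_measure (sphere (0::'a) 1)"
  by (rule sphere_measure.emeasure_pair_measure_Times)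
    (use N sets.top[of "sphere_measure :: 'a measure"] in \<open>auto simp: null_sets_def space_sphere_measure\<close>)
 then have "emeasure phaseM (N \<times> sphere (0::'a) 1)=0" using N by (simp add: null_sets_def)
 moreover have "N \<times> sphere (0::'a) 1\<in>sets phaseM"
  using N sets.top[of "sphere_measure :: 'a measure"] by (intro pair_measureI) (auto simp: null_sets_def space_sphere_measure)
 ultimately show ?thesis
  using N(1) by (intro AE_I[of _ _ "N \<times> sphere 0 1"]) (auto simp: space_phase_measure phase_space_def)
qed

lemma Cc_tensor:
 fixes a b :: "'a::euclidean_space => real"
 assumes a: "a\<in>Cc" and b: "smooth_on UNIV b"
 obtains F where "F\<in>Cc" "!!p. p\<in>phase_space ==> F p=a (fst p) * b (snd p)"
proof -
 let ?F = "%p. a (fst p)*(cutoff 1 (snd p) * b (snd p))"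
 obtain R where R: "R > 0" "!!x. R < norm x ==> a x=0" using Cc_support[OF a] by blast
 have "?F\<in>Cc"
 proof (rule CcI[where R = "R+2"])
  show "smooth_on UNIV ?F"
   by (intro smooth_on_mult open_UNIV smooth_on_compose_linear[OF bounded_linear_fst Cc_smooth[OF a]]
     smooth_on_compose_linear[OF bounded_linear_snd cutoff_smooth] smooth_on_compose_linear[OF bounded_linear_snd b])
  fix p :: "'a \<times> 'a" assume "R+2 < norm p"
  then have "R < norm (fst p) \<or> 2*1<=norm (snd p)" using norm_Pair_le[of "fst p" "snd p"] by auto
  then show "?F p=0" using R(2)[of "fst p"] cutoff_eq_0[of 1 "snd p"] by auto
 qed
 moreover have "?F p=a (fst p) * b (snd p)" if "p\<in>phase_space" for p
 proof -
  have "cutoff 1 (snd p)=1" using that by (intro cutoff_eq_1) (auto simp: phase_space_def)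
  then show ?thesis by simp
 qed
 ultimately show thesis by (rule that)
qed

text \<open>The fundamental lemma of the calculus of variations on the phase space, from the density of tensor products.\<close>

lemma AE_fst_zeroI:
 fixes h :: "'a::euclidean_space => real"
 assumes h: "loc_bounded h" and z: "!!F. F\<in>Cc ==> (\<integral>p. h (fst p) * F p\<partial>(phaseM :: ('a \<times> 'a) measure))=0"
 shows "AE p in (phaseM :: ('a \<times> 'a) measure). h (fst p)=0"
proof -
 let ?M = "phaseM :: ('a \<times> 'a) measure"
 have "AE p in ?M. cutoff (real (Suc n)) (fst p) * h (fst p)=0" for n :: nat
 proof -
  let ?k = "%p::'a\<times>'a. cutoff (real (Suc n)) (fst p) * h (fst p)"
  have smk: "smooth_on UNIV (cutoff (real (Suc n)) :: 'a => real)" by (rule cutoff_smooth)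
  obtain E where EC: "E\<in>Cc" and E: "!!p::'a\<times>'a. p\<in>phase_space ==> E p=cutoff (real (Suc n)) (fst p)*1"
   using Cc_tensor[OF cutoff_Cc smooth_on_const[OF open_UNIV]] by (metis of_nat_0_less_iff zero_less_Suc)
  have kL: "?k\<in>L2 ?M"
  proof (rule L2_bounded_by[OF _ L2_phase_weighted[OF h EC]])
   show "?k\<in>borel_measurable ?M"
    by (rule measurable_phase_fst[where m = "%x. cutoff (real (Suc n)) x * h x"])
      (intro borel_measurable_times loc_boundedD(1)[OF h] borel_measurable_continuous_onI smooth_on_continuous cutoff_smooth)
   show "AE p in ?M. \<bar>?k p\<bar><=\<bar>h (fst p) * E p\<bar>"
    by (rule AE_I2) (simp add: space_phase_measure E abs_mult)
  qed
  define G where "G={g\<in>L2 ?M. l2_inner ?M g ?k=0}"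
  have "?k\<in>G"
  proof (rule tensor_dense[where M = ?M])
   show "emeasure ?M (cball 0 R \<times> sphere 0 1) < \<infinity>" for R by (rule emeasure_phase_bounded)
   show "(%p. f p+g p)\<in>G" if "f\<in>G" "g\<in>G" for f g
    using that l2_inner_lincomb[of f ?M g ?k 1 1] kL by (auto simp: G_def intro: L2_add)
   show "(%p. c * f p)\<in>G" if "f\<in>G" for f c
    using that l2_inner_lincomb[of f ?M f ?k c 0] kL by (auto simp: G_def intro: L2_cmult)
   show "f\<in>G" if f: "f\<in>L2 ?M" and a: "!!e. e > 0 ==> \<exists>g\<in>G. l2_norm ?M (%p. f p-g p) < e" for f
   proof -
    have "\<bar>l2_inner ?M f ?k\<bar><=0"
    proof (rule field_le_epsilon)
     fix e :: real assume e: "e > 0"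
     let ?K = "l2_norm ?M ?k+1"
     have K: "?K > 0" using l2_norm_nonneg[of ?M ?k] by linarith
     obtain g where g: "g\<in>G" "l2_norm ?M (%p. f p-g p) < e/?K" using a[of "e/?K"] e K by auto
     have gL: "g\<in>L2 ?M" and g0: "l2_inner ?M g ?k=0" using g(1) by (auto simp: G_def)
     have "l2_inner ?M (%p. f p-g p) ?k=l2_inner ?M f ?k-l2_inner ?M g ?k"
      by (rule l2_inner_diff[OF f gL kL])
     moreover have "l2_inner ?M (%p. g p-f p) ?k=l2_inner ?M g ?k-l2_inner ?M f ?k"
      by (rule l2_inner_diff[OF gL f kL])
     ultimately have "\<bar>l2_inner ?M f ?k\<bar><=l2_norm ?M (%p. f p-g p) * l2_norm ?M ?k"
      using l2_Cauchy_Schwarz[OF L2_diff[OF f gL] kL] l2_Cauchy_Schwarz[OF L2_diff[OF gL f] kL]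
       l2_norm_minus[of ?M f g] g0 by simp
     also have "...<=(e/?K)*?K" using g(2) K e by (intro mult_mono) (auto simp: l2_norm_nonneg)
     finally show "\<bar>l2_inner ?M f ?k\<bar><=0+e" using K by simp
    qed
    then show ?thesis using f by (simp add: G_def)
   qed
   show "(%p. a (fst p) * exp (v\<bullet>snd p))\<in>G" if a: "a\<in>Cc" for a v
   proof -
    obtain F where F: "F\<in>Cc" "!!p::'a\<times>'a. p\<in>phase_space ==> F p=a (fst p) * exp (v\<bullet>snd p)"
     by (rule Cc_tensor[OF a smooth_on_exp[OF open_UNIV smooth_on_linear[OF open_UNIV bounded_linear_inner_right]]]) blast
    let ?g = "%p::'a\<times>'a. a (fst p) * exp (v\<bullet>snd p)"
    have gm: "?g\<in>borel_measurable ?M"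
     by (rule measurable_phase, rule borel_measurable_continuous_onI, rule smooth_on_continuous)
       (intro smooth_on_mult open_UNIV smooth_on_compose_linear[OF bounded_linear_fst Cc_smooth[OF a]]
        smooth_on_exp smooth_on_linear bounded_linear_compose[OF bounded_linear_inner_right bounded_linear_snd])
    have ae: "AE p in ?M. F p=?g p" by (rule AE_I2) (simp add: space_phase_measure F(2))
    have gL: "?g\<in>L2 ?M"
     by (rule L2_bounded_by[OF gm L2_phase_Cc[OF F(1)]]) (use ae in auto)
    have cF: "(%p. cutoff (real (Suc n)) (fst p) * F p)\<in>Cc"
     by (rule Cc_mult[OF smooth_on_compose_linear[OF bounded_linear_fst smk] F(1)])
    have "l2_inner ?M ?g ?k=(\<integral>p. h (fst p)*(cutoff (real (Suc n)) (fst p) * F p)\<partial>?M)"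
     unfolding l2_inner_def by (rule Bochner_Integration.integral_cong) (simp_all add: space_phase_measure F(2) mult_ac)
    then show ?thesis using gL z[OF cF] by (simp add: G_def)
   qed
  qed (use kL in \<open>auto simp: G_def simp del: of_nat_Suc\<close>)
  then have "l2_inner ?M ?k ?k=0" by (simp add: G_def)
  then have "l2_norm ?M ?k=0" by (simp add: l2_inner_self)
  then show ?thesis using l2_norm_eq_0_iff[OF kL] by simp
 qed
 then have "AE p in ?M. \<forall>n. cutoff (real (Suc n)) (fst p) * h (fst p)=0" unfolding AE_all_countable by (rule allI)
 then show ?thesis
 proof eventually_elim
  case (elim p)
  obtain n :: nat where "norm (fst p)<=real n" using real_arch_simple by blast
  then have "cutoff (real (Suc n)) (fst p)=1" by (intro cutoff_eq_1) auto
  then show ?case using elim[rule_format, of n] by simp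
 qed
qed

text \<open>Moving the difference quotient from \<open>f\<close> to the test function shows that the line derivative is the weak derivative, which is linear in the direction.\<close>

lemma line_derivative_by_parts:
 fixes f :: "'a::euclidean_space => real" and e :: 'a
 assumes lip: "!!x y. \<bar>f x-f y\<bar><=L * norm (x-y)" and G: "loc_bounded G"
  and d: "AE x in lborel. ((%t. f (x+t *\<^sub>R e)) has_real_derivative G x) (at 0)" and F: "F\<in>Cc"
 shows "(\<integral>p. G (fst p) * F p\<partial>(phaseM :: ('a \<times> 'a) measure)) =-(\<integral>p. f (fst p) * dderiv (e, 0) F p\<partial>(phaseM :: ('a \<times> 'a) measure))"
proof -
 let ?M = "phaseM :: ('a \<times> 'a) measure" and ?s = "%n. 1/real (Suc n)"
 have fb: "loc_bounded f"
  by (rule loc_bounded_continuous, rule lipschitz_on_continuous_on[of "\<bar>L\<bar>"], rule lipschitz_onI)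
    (auto simp: dist_norm intro: order_trans[OF lip mult_right_mono[OF abs_ge_self]])
 note fm = loc_boundedD(1)[OF fb] and Fm = Cc_measurable[OF F]
 define a where "a n p=(f (fst p+?s n *\<^sub>R e)-f (fst p))/?s n * F p" for n and p :: "'a \<times> 'a"
 define b where "b n p=f (fst p)*((F (fst p-?s n *\<^sub>R e, snd p)-F p)/?s n)" for n and p :: "'a \<times> 'a"
 have ft: "loc_bounded (%x. f (x+u))" for u
  by (rule loc_bounded_continuous, rule lipschitz_on_continuous_on[of "\<bar>L\<bar>"], rule lipschitz_onI)
    (auto simp: dist_norm intro: order_trans[OF lip[of "x+u" "y+u" for x y, simplified] mult_right_mono[OF abs_ge_self]])
 have i1: "integrable ?M (%p. f (fst p+u) * F p)" for u
  by (rule integrable_weighted_Cc[OF ft F])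
 have tr: "(\<integral>p. f (fst p) * F (fst p-u, snd p)\<partial>?M)=(\<integral>p. f (fst p+u) * F p\<partial>?M)"
   "integrable ?M (%p. f (fst p) * F (fst p-u, snd p))" for u
 proof -
  note T = phase_measure_translate[of u]
  have "(\<integral>p. f (fst p+u) * F p\<partial>distr ?M ?M (%p. (fst p-u, snd p)))=(\<integral>p. f (fst p) * F (fst p-u, snd p)\<partial>?M)"
   by (subst integral_distr[OF T(1) borel_measurable_integrable[OF i1]]) simp
  then show "(\<integral>p. f (fst p) * F (fst p-u, snd p)\<partial>?M)=(\<integral>p. f (fst p+u) * F p\<partial>?M)" by (simp only: T(2))
  have "integrable (distr ?M ?M (%p. (fst p-u, snd p))) (%p. f (fst p+u) * F p)" unfolding T(2) by (rule i1)
  from integrable_distr[OF T(1) this] show "integrable ?M (%p. f (fst p) * F (fst p-u, snd p))" by simp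
 qed
 have ab: "(\<integral>p. a n p\<partial>?M)=(\<integral>p. b n p\<partial>?M)" and am: "a n\<in>borel_measurable ?M" and bm: "b n\<in>borel_measurable ?M" for n
 proof -
  have ae: "a n=(%p. (f (fst p+?s n *\<^sub>R e) * F p-f (fst p+0) * F p)/?s n)"
   unfolding a_def by (simp add: fun_eq_iff left_diff_distrib)
  have be: "b n=(%p. (f (fst p) * F (fst p-?s n *\<^sub>R e, snd p)-f (fst p) * F (fst p-0, snd p))/?s n)"
   unfolding b_def by (simp add: fun_eq_iff right_diff_distrib)
  show "(\<integral>p. a n p\<partial>?M)=(\<integral>p. b n p\<partial>?M)"
   unfolding ae be by (simp only: integral_divide_zero Bochner_Integration.integral_diff[OF i1 i1] Bochner_Integration.integral_diff[OF tr(2) tr(2)] tr(1))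
  show "a n\<in>borel_measurable ?M" "b n\<in>borel_measurable ?M"
   unfolding ae be by (intro borel_measurable_divide borel_measurable_diff borel_measurable_const borel_measurable_integrable[OF i1] borel_measurable_integrable[OF tr(2)])+
 qed
 have A: "(%n. \<integral>p. a n p\<partial>?M) ----> (\<integral>p. G (fst p) * F p\<partial>?M)"
 proof (rule integral_dominated_convergence[where w = "%p. (L * norm e)*\<bar>F p\<bar>"])
  show "integrable ?M (%p. (L * norm e)*\<bar>F p\<bar>)"
   using integrable_weighted_Cc[OF loc_bounded_const[of 1] F] by simp
  show "AE p in ?M. (%n. a n p) ----> G (fst p) * F p"
   using AE_phase_fst[OF d]
  proof eventually_elim
   case (elim p)
   from real_derivative_sequence[OF elim]
   show ?case unfolding a_def by (intro tendsto_mult tendsto_const) simp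
  qed
  show "AE p in ?M. norm (a n p)<=(L * norm e)*\<bar>F p\<bar>" for n
  proof (rule AE_I2)
   fix p :: "'a \<times> 'a"
   have "\<bar>f (fst p+?s n *\<^sub>R e)-f (fst p)\<bar><=(L * norm e)*?s n"
    using lip[of "fst p+?s n *\<^sub>R e" "fst p"] by (simp add: mult_ac)
   then have "\<bar>(f (fst p+?s n *\<^sub>R e)-f (fst p))/?s n\<bar><=L * norm e"
    unfolding abs_divide by (simp add: pos_divide_le_eq pos_le_divide_eq del: of_nat_Suc)
   then show "norm (a n p)<=(L * norm e)*\<bar>F p\<bar>" unfolding a_def by (simp add: abs_mult mult_right_mono del: of_nat_Suc)
  qed
 qed (use am loc_boundedD(1)[OF G] measurable_phase_fst measurable_phase[OF Fm] in auto)
 have B: "(%n. \<integral>p. b n p\<partial>?M) ----> (\<integral>p. f (fst p) * dderiv (- e, 0) F p\<partial>?M)"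
 proof -
  obtain K where K: "K > 0" "!!p q. \<bar>F q-F p\<bar><=K * norm (q-p)" using Cc_Lipschitz[OF F] by blast
  obtain R where R: "R > 0" "!!p. R < norm (fst p) ==> F p=0" using Cc_support_fst[OF F] by blast
  let ?R = "R+norm e"
  obtain B where B: "!!x. norm x<=?R ==> \<bar>f x\<bar><=B" using loc_boundedD(2)[OF fb] by blast
  have B0: "B \<ge> 0" using B[of 0] R(1) by (auto intro: order_trans[OF abs_ge_zero])
  have sm: "?s n * norm e<=norm e" for n using mult_right_mono[OF step_sequence(2) norm_ge_zero, of n e] by (simp only: mult_1)
  have bn: "\<bar>b n p\<bar><=B * (K * norm e) * indicator (cball 0 ?R) (fst p)" for n p
  proof (cases "norm (fst p)<=?R")
   case True
   have "\<bar>F (fst p-?s n *\<^sub>R e, snd p)-F p\<bar><=K * norm ((fst p-?s n *\<^sub>R e, snd p)-p)" by (rule K(2))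
   also have "(fst p-?s n *\<^sub>R e, snd p)-p=(- (?s n *\<^sub>R e), 0)" by (simp add: prod_eq_iff)
   finally have "\<bar>(F (fst p-?s n *\<^sub>R e, snd p)-F p)/?s n\<bar><=K * norm e"
    unfolding abs_divide by (simp add: pos_divide_le_eq pos_le_divide_eq mult_ac norm_Pair del: of_nat_Suc)
   then have "\<bar>b n p\<bar><=B * (K * norm e)" unfolding b_def abs_mult using B[OF True] B0 by (intro mult_mono) auto
   then show ?thesis using True by simp
  next
   case False
   have "norm (fst p)<=norm (fst p-?s n *\<^sub>R e)+norm (?s n *\<^sub>R e)"
    using norm_triangle_ineq[of "fst p-?s n *\<^sub>R e" "?s n *\<^sub>R e"] by simp
   moreover have "norm (?s n *\<^sub>R e)=?s n * norm e" by (simp del: of_nat_Suc)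
   ultimately have "R < norm (fst p-?s n *\<^sub>R e)" using False sm[of n] by linarith
   moreover have "R < norm (fst p)" using False norm_ge_zero[of e] by linarith
   ultimately show ?thesis using R(2)[of p] R(2)[of "(fst p-?s n *\<^sub>R e, snd p)"] False by (simp add: b_def)
  qed
  show ?thesis
  proof (rule integral_dominated_convergence[where w = "%p. B * (K * norm e) * indicator (cball 0 ?R) (fst p)"])
   show "integrable ?M (%p. B * (K * norm e) * indicator (cball 0 ?R) (fst p))"
    by (rule integrable_phase_bounded[where C = "B * (K * norm e)" and R = ?R])
      (use B0 K(1) in \<open>auto simp: indicator_def intro!: measurable_phase_fst[where m = "%x. B * (K * norm e) * indicator (cball 0 ?R) x"]\<close>)
   show "AE p in ?M. norm (b n p)<=B * (K * norm e) * indicator (cball 0 ?R) (fst p)" for n using bn by simp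
   show "AE p in ?M. (%n. b n p) ----> f (fst p) * dderiv (- e, 0) F p"
   proof (rule AE_I2)
    fix p :: "'a \<times> 'a"
    note real_derivative_sequence[OF Cc_line_derivative[OF F, of p "(- e, 0)"]]
    moreover have "p+?s n *\<^sub>R (- e, 0)=(fst p-?s n *\<^sub>R e, snd p)" for n by (simp add: prod_eq_iff)
    ultimately show "(%n. b n p) ----> f (fst p) * dderiv (- e, 0) F p"
     unfolding b_def by (intro tendsto_mult tendsto_const) (simp add: zero_prod_def[symmetric])
   qed
  qed (use bm measurable_phase_fst[OF fm] measurable_phase[OF Cc_measurable[OF Cc_dderiv[OF F]]] in auto)
 qed
 have "(\<integral>p. G (fst p) * F p\<partial>?M)=(\<integral>p. f (fst p) * dderiv (- e, 0) F p\<partial>?M)"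
  using LIMSEQ_unique[OF A B[folded ab]] .
 moreover have "dderiv (- e, 0) F p =-dderiv (e, 0) F p" for p
  using linear_neg[OF dderiv_linear[OF smooth_on_differentiable[OF Cc_smooth[OF F] UNIV_I]], of p "(e, 0)"] by simp
 ultimately show ?thesis by simp
qed

text \<open>Compactness of the unit sphere turns differentiability along a dense set of lines into Frechet differentiability, the Lipschitz bound controlling the directions in between.\<close>

lemma gderiv_from_lines:
 fixes f :: "'a::euclidean_space => real"
 assumes lip: "!!x y. \<bar>f x-f y\<bar><=L * norm (x-y)"
  and E: "!!X. open X ==> X \<noteq> {} ==> \<exists>e\<in>E. e\<in>X"
  and d: "!!e. e\<in>E ==> ((%t. f (x+t *\<^sub>R e)) has_real_derivative w\<bullet>e) (at 0)"
 shows "GDERIV f x :> w"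
proof -
 have L: "L \<ge> 0"
 proof -
  obtain b :: 'a where "b\<in>Basis" using nonempty_Basis by blast
  then show ?thesis using lip[of b 0] by (auto simp: intro: order_trans[OF abs_ge_zero])
 qed
 have "\<exists>\<delta>>0. \<forall>y. norm (y-x) < \<delta> \<longrightarrow> norm (f y-f x-(y-x)\<bullet>w)<=\<epsilon> * norm (y-x)" if \<epsilon>: "\<epsilon> > 0" for \<epsilon> :: real
 proof -
  define \<eta> where "\<eta>=\<epsilon>/(2*(L+norm w+1))"
  have s: "L+norm w+1 > 0" using L norm_ge_zero[of w] by linarith
  have \<eta>: "\<eta> > 0" using \<epsilon> s by (simp add: \<eta>_def)
  have \<eta>2: "(L+norm w)*\<eta><=\<epsilon>/2"
  proof -
   have "(L+norm w)*\<eta><=(L+norm w+1)*\<eta>" using \<eta> by (intro mult_right_mono) auto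
   also have "...=\<epsilon>/2" using s by (simp add: \<eta>_def field_simps)
   finally show ?thesis .
  qed
  have "sphere 0 1 \<subseteq> (\<Union>e\<in>E. ball e \<eta>)"
  proof
   fix u :: 'a
   obtain e where "e\<in>E" "e\<in>ball u \<eta>" using E[of "ball u \<eta>"] \<eta> by auto
   then show "u\<in>(\<Union>e\<in>E. ball e \<eta>)" by (auto simp: dist_commute)
  qed
  then obtain C where C: "C \<subseteq> E" "finite C" "sphere 0 1 \<subseteq> (\<Union>e\<in>C. ball e \<eta>)"
   using compactE_image[OF compact_sphere, of E "%e. ball e \<eta>"] by blast
  have "\<exists>\<delta>>0. \<forall>t. \<bar>t\<bar> < \<delta> \<longrightarrow> \<bar>f (x+t *\<^sub>R e)-f x-t * (w\<bullet>e)\<bar><=\<epsilon>/2*\<bar>t\<bar>" if "e\<in>E" for e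
  proof -
   have "((%t. f (x+t *\<^sub>R e)) has_derivative (%t. t * (w\<bullet>e))) (at 0)"
    using d[OF that] unfolding has_field_derivative_def by (rule has_derivative_eq_rhs) (simp add: fun_eq_iff)
   then show ?thesis using \<epsilon> unfolding has_derivative_at_alt
    by (elim conjE allE[of _ "\<epsilon>/2"]) simp
  qed
  then obtain \<delta> where \<delta>: "!!e. e\<in>E ==> \<delta> e > 0"
   "!!e t. e\<in>E ==> \<bar>t\<bar> < \<delta> e ==> \<bar>f (x+t *\<^sub>R e)-f x-t * (w\<bullet>e)\<bar><=\<epsilon>/2*\<bar>t\<bar>"
   by metis
  define r where "r=Min (insert 1 (\<delta> ` C))"
  have r: "r > 0" "!!e. e\<in>C ==> r<=\<delta> e" unfolding r_def using C(1,2) \<delta>(1) by (auto simp: subset_iff)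
  show ?thesis
  proof (intro exI[of _ r] conjI r(1) allI impI)
   fix y assume y: "norm (y-x) < r"
   show "norm (f y-f x-(y-x)\<bullet>w)<=\<epsilon> * norm (y-x)"
   proof (cases "y=x")
    case False
    define t where "t=norm (y-x)"
    have t: "t > 0" using False by (simp add: t_def)
    define u where "u=(y-x) /\<^sub>R t"
    have u: "norm u=1" "y=x+t *\<^sub>R u" using t by (auto simp: u_def t_def)
    have "u\<in>(\<Union>e\<in>C. ball e \<eta>)" by (rule subsetD[OF C(3)]) (simp add: u(1))
    then obtain e where e: "e\<in>C" "norm (e-u) < \<eta>" by (auto simp: dist_norm)
    have eE: "e\<in>E" using e(1) C(1) by blast
    have "\<bar>f (x+t *\<^sub>R e)-f x-t * (w\<bullet>e)\<bar><=\<epsilon>/2 * t"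
     using \<delta>(2)[OF eE, of t] y r(2)[OF e(1)] t by (simp add: t_def)
    moreover have "\<bar>f y-f (x+t *\<^sub>R e)\<bar><=t * (L * \<eta>)"
    proof -
     have "\<bar>f y-f (x+t *\<^sub>R e)\<bar><=L * norm (t *\<^sub>R (e-u))"
      using lip[of y "x+t *\<^sub>R e"] by (simp add: u(2) scaleR_diff_right norm_minus_commute)
     also have "...=t * (L * norm (e-u))" using t by simp
     also have "...<=t * (L * \<eta>)" using t L e(2) by (intro mult_left_mono) auto
     finally show ?thesis .
    qed
    moreover have "\<bar>t * (w\<bullet>e)-(y-x)\<bullet>w\<bar><=t * (norm w * \<eta>)"
    proof -
     have "t * (w\<bullet>e)-(y-x)\<bullet>w=t * (w\<bullet>(e-u))"
      by (simp add: u(2) inner_commute inner_diff_right right_diff_distrib)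
     then have "\<bar>t * (w\<bullet>e)-(y-x)\<bullet>w\<bar>=t * \<bar>w\<bullet>(e-u)\<bar>" using t by (simp add: abs_mult)
     also have "...<=t * (norm w * \<eta>)"
      using t e(2) by (intro mult_left_mono order_trans[OF Cauchy_Schwarz_ineq2]) auto
     finally show ?thesis .
    qed
    ultimately have "\<bar>f y-f x-(y-x)\<bullet>w\<bar><=\<epsilon>/2 * t+t * (L * \<eta>)+t * (norm w * \<eta>)" by linarith
    also have "...=\<epsilon>/2 * t+t * ((L+norm w)*\<eta>)" by (simp add: algebra_simps)
    also have "...<=\<epsilon>/2 * t+t * (\<epsilon>/2)" using t \<eta>2 by (intro add_left_mono mult_left_mono) auto
    finally show ?thesis by (simp add: t_def)
   qed simp
  qed
 qed
 then show ?thesis unfolding gderiv_def has_derivative_at_alt by (simp add: bounded_linear_inner_left)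
qed

text \<open>Almost everywhere all line derivatives in a countable dense set of directions exist and depend linearly on the direction.\<close>

theorem Rademacher:
 fixes f :: "'a::euclidean_space => real"
 assumes lip: "!!x y. \<bar>f x-f y\<bar><=L * norm (x-y)"
 shows "AE p in (phaseM :: ('a \<times> 'a) measure). \<exists>w. GDERIV f (fst p) :> w"
proof -
 let ?M = "phaseM :: ('a \<times> 'a) measure"
 have "\<exists>G. loc_bounded G \<and> (AE x in lborel. ((%t. f (x+t *\<^sub>R e)) has_real_derivative G x) (at 0))" for e
  by (rule lipschitz_line_derivative[OF lip, of e]) (intro exI conjI)
 then have "\<exists>G. \<forall>e. loc_bounded (G e) \<and> (AE x in lborel. ((%t. f (x+t *\<^sub>R e)) has_real_derivative G e x) (at 0))"
  by (intro choice allI)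
 then obtain G where G: "!!e. loc_bounded (G e)"
  "!!e. AE x in lborel. ((%t. f (x+t *\<^sub>R e)) has_real_derivative G e x) (at 0)" by auto
 have lin: "AE p in ?M. G e (fst p)=(\<Sum>b\<in>Basis. G b (fst p) *\<^sub>R b)\<bullet>e" for e
 proof -
  let ?h = "%x. G e x-(\<Sum>b\<in>Basis. (e\<bullet>b) * G b x)"
  have hb: "loc_bounded ?h"
   by (intro loc_bounded_diff loc_bounded_sum loc_bounded_mult loc_bounded_const G(1))
  have "AE p in ?M. ?h (fst p)=0"
  proof (rule AE_fst_zeroI[OF hb])
   fix F :: "'a \<times> 'a => real" assume F: "F\<in>Cc"
   have i: "integrable ?M (%p. G e (fst p) * F p)" for e by (rule integrable_weighted_Cc[OF G(1) F])
   have fb: "loc_bounded f"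
    by (rule loc_bounded_continuous, rule lipschitz_on_continuous_on[of "\<bar>L\<bar>"], rule lipschitz_onI)
      (auto simp: dist_norm intro: order_trans[OF lip mult_right_mono[OF abs_ge_self]])
   have j: "integrable ?M (%p. f (fst p) * dderiv v F p)" for v by (rule integrable_weighted_Cc[OF fb Cc_dderiv[OF F]])
   have dd: "dderiv (e, 0) F p=(\<Sum>b\<in>Basis. (e\<bullet>b) * dderiv (b, 0) F p)" for p
   proof -
    interpret l: linear "%v. dderiv v F p"
     by (rule dderiv_linear, rule smooth_on_differentiable[OF Cc_smooth[OF F] UNIV_I])
    have "(e, 0::'a)=(\<Sum>b\<in>Basis. (e\<bullet>b) *\<^sub>R (b, 0::'a))"
     by (simp add: prod_eq_iff fst_sum snd_sum euclidean_representation)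
    then have "dderiv (e, 0) F p=dderiv (\<Sum>b\<in>Basis. (e\<bullet>b) *\<^sub>R (b, 0::'a)) F p" by simp
    then show ?thesis by (simp only: l.sum l.scale real_scaleR_def)
   qed
   have "(\<integral>p. ?h (fst p) * F p\<partial>?M)=(\<integral>p. G e (fst p) * F p\<partial>?M)-(\<Sum>b\<in>Basis. (e\<bullet>b)*(\<integral>p. G b (fst p) * F p\<partial>?M))"
    by (simp add: left_diff_distrib sum_distrib_right mult.assoc i)
   also have "... =-(\<integral>p. f (fst p) * dderiv (e, 0) F p\<partial>?M)+(\<Sum>b\<in>Basis. (e\<bullet>b)*(\<integral>p. f (fst p) * dderiv (b, 0) F p\<partial>?M))"
    by (simp add: line_derivative_by_parts[OF lip G F] sum_negf)
   also have "(\<Sum>b\<in>Basis. (e\<bullet>b)*(\<integral>p. f (fst p) * dderiv (b, 0) F p\<partial>?M))=(\<integral>p. (\<Sum>b\<in>Basis. (e\<bullet>b)*(f (fst p) * dderiv (b, 0) F p))\<partial>?M)"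
    by (simp add: j)
   also have "...=(\<integral>p. f (fst p) * dderiv (e, 0) F p\<partial>?M)"
    by (simp add: dd sum_distrib_left mult.left_commute)
   finally show "(\<integral>p. ?h (fst p) * F p\<partial>?M)=0" by simp
  qed
  then show ?thesis by eventually_elim (simp add: inner_sum_left inner_commute[of e] mult.commute)
 qed
 obtain E :: "'a set" where E: "countable E" "!!X. open X ==> X \<noteq> {} ==> \<exists>e\<in>E. e\<in>X"
  using countable_dense_setE by blast
 have "AE p in ?M. \<forall>e\<in>E. ((%t. f (fst p+t *\<^sub>R e)) has_real_derivative G e (fst p)) (at 0)"
  by (rule AE_ball_countable'[OF AE_phase_fst[OF G(2)] E(1)])
 moreover have "AE p in ?M. \<forall>e\<in>E. G e (fst p)=(\<Sum>b\<in>Basis. G b (fst p) *\<^sub>R b)\<bullet>e"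
  by (rule AE_ball_countable'[OF lin E(1)])
 ultimately show ?thesis
 proof eventually_elim
  case (elim p)
  have "GDERIV f (fst p) :> (\<Sum>b\<in>Basis. G b (fst p) *\<^sub>R b)"
   by (rule gderiv_from_lines[OF lip E(2)]) (use elim in auto)
  then show ?case by blast
 qed
qed

lemma locally_lipschitz_ball:
 fixes V :: "'a::euclidean_space => real"
 assumes loc: "!!x. \<exists>r>0. \<exists>C. C-lipschitz_on (ball x r) V"
 obtains L where "L \<ge> 0" "!!x y. norm x<=R ==> norm y<=R ==> \<bar>V x-V y\<bar><=L * norm (x-y)"
proof -
 have "local_lipschitz {0::real} (cball 0 R) (%_. V)"
  unfolding local_lipschitz_def
 proof (intro ballI)
  fix x :: 'a and t :: real
  obtain r C where r: "r > 0" "C-lipschitz_on (ball x r) V" using loc by blast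
  have "C-lipschitz_on (cball x (r/2) \<inter> cball 0 R) V" by (rule lipschitz_on_subset[OF r(2)]) (use r(1) in auto)
  then show "\<exists>u>0. \<exists>L. \<forall>t\<in>cball t u \<inter> {0}. L-lipschitz_on (cball x u \<inter> cball 0 R) V"
   using r(1) by (intro exI[of _ "r/2"]) auto
 qed
 from local_lipschitz_compact_implies_lipschitz[OF this compact_cball compact_sing continuous_on_const]
 obtain L where L: "!!t. t\<in>{0::real} ==> L-lipschitz_on (cball 0 R) V" by blast
 have "L-lipschitz_on (cball 0 R) V" using L by simp
 from lipschitz_on_nonneg[OF this] lipschitz_onD[OF this] show thesis
  by (intro that[of L]) (simp_all add: dist_norm)
qed

lemma locally_lipschitz_continuous:
 fixes V :: "'a::euclidean_space => real"
 assumes loc: "!!x. \<exists>r>0. \<exists>C. C-lipschitz_on (ball x r) V"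
 shows "continuous_on UNIV V"
 unfolding continuous_on_eq_continuous_at[OF open_UNIV]
proof
 fix x
 obtain r C where r: "r > 0" "C-lipschitz_on (ball x r) V" using loc by blast
 show "isCont V x"
  using lipschitz_on_continuous_on[OF r(2)] r(1) by (auto simp: continuous_on_eq_continuous_at)
qed

text \<open>Composing with the projection onto a ball gives a globally Lipschitz function that agrees with \<open>V\<close> inside.\<close>

theorem Rademacher_local:
 fixes V :: "'a::euclidean_space => real"
 assumes loc: "!!x. \<exists>r>0. \<exists>C. C-lipschitz_on (ball x r) V"
 shows "AE p in (phaseM :: ('a \<times> 'a) measure). GDERIV V (fst p) :> grad V (fst p)"
proof -
 let ?M = "phaseM :: ('a \<times> 'a) measure"
 have "AE p in ?M. norm (fst p) < real n \<longrightarrow> (\<exists>w. GDERIV V (fst p) :> w)" for n :: nat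
 proof -
  let ?c = "closest_point (cball (0::'a) (real n))"
  obtain L where L: "L \<ge> 0" "!!x y. norm x<=real n ==> norm y<=real n ==> \<bar>V x-V y\<bar><=L * norm (x-y)"
   using locally_lipschitz_ball[OF loc] by blast
  have inb: "norm (?c x)<=real n" for x
   using closest_point_in_set[of "cball (0::'a) (real n)" x] by simp
  have "\<bar>V (?c x)-V (?c y)\<bar><=L * norm (x-y)" for x y
  proof -
   have "dist (?c x) (?c y)<=dist x y" by (rule closest_point_lipschitz) auto
   then have "L * norm (?c x-?c y)<=L * norm (x-y)" using L(1) by (intro mult_left_mono) (simp add: dist_norm)
   then show ?thesis using L(2)[OF inb inb, of x y] by linarith
  qed
  from Rademacher[OF this] show ?thesis
  proof eventually_elim
   case (elim p)
   then obtain w where w: "GDERIV (%x. V (?c x)) (fst p) :> w" by blast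
   have "GDERIV V (fst p) :> w" if "norm (fst p) < real n"
    unfolding gderiv_def
    by (rule has_derivative_transform_within_open[OF w[unfolded gderiv_def], of "ball 0 (real n)"])
      (use that in \<open>auto simp: closest_point_self\<close>)
   then show ?case by blast
  qed
 qed
 then have "AE p in ?M. \<forall>n::nat. norm (fst p) < real n \<longrightarrow> (\<exists>w. GDERIV V (fst p) :> w)"
  unfolding AE_all_countable by (rule allI)
 then show ?thesis
 proof eventually_elim
  case (elim p)
  obtain n :: nat where "norm (fst p) < real n" using reals_Archimedean2 by blast
  then obtain w where "GDERIV V (fst p) :> w" using elim by blast
  then show ?case using grad_eqI by metis
 qed
qed

lemma gderiv_bound:
 fixes f :: "'a::euclidean_space => real"
 assumes w: "GDERIV f x :> w" and r: "r > 0" and b: "!!h. norm h < r ==> \<bar>f (x+h)-f x-v\<bullet>h\<bar><=C * norm h"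
 shows "norm (w-v)<=C"
proof (rule field_le_epsilon)
 fix e :: real assume e: "e > 0"
 obtain d where d: "d > 0" "!!y. norm (y-x) < d ==> norm (f y-f x-(y-x)\<bullet>w)<=e * norm (y-x)"
  using w e unfolding gderiv_def has_derivative_at_alt by blast
 show "norm (w-v)<=C+e"
 proof (cases "w=v")
  case True
  obtain c :: 'a where c: "c\<in>Basis" using nonempty_Basis by blast
  let ?h = "(r/2) *\<^sub>R c"
  have "0<=C * norm ?h" by (rule order_trans[OF abs_ge_zero b]) (use r c in simp)
  then have "0<=C" using r c by (simp add: zero_le_mult_iff)
  then show ?thesis using True e by simp
 next
  case False
  define k where "k=min r d/(2 * norm (w-v))"
  have k: "k > 0" using r d(1) False by (simp add: k_def)
  let ?h = "k *\<^sub>R (w-v)"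
  have nh: "norm ?h=min r d/2" using False k r d(1) by (simp add: k_def)
  have "\<bar>f (x+?h)-f x-v\<bullet>?h\<bar><=C * norm ?h" by (rule b) (use nh r d(1) in auto)
  moreover have "\<bar>f (x+?h)-f x-?h\<bullet>w\<bar><=e * norm ?h" using d(2)[of "x+?h"] nh r d(1) by auto
  ultimately have "\<bar>?h\<bullet>w-v\<bullet>?h\<bar><=(C+e) * norm ?h" by (simp add: distrib_right)
  moreover have "?h\<bullet>w-v\<bullet>?h=norm (w-v) * norm ?h"
  proof -
   have "?h\<bullet>w-v\<bullet>?h=?h\<bullet>(w-v)" by (simp only: inner_diff_right inner_commute[of v])
   also have "...=k * (norm (w-v))\<^sup>2" by (simp only: inner_scaleR_left power2_norm_eq_inner)
   finally show ?thesis using k by (simp add: power2_eq_square)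
  qed
  ultimately have "norm (w-v) * norm ?h<=(C+e) * norm ?h" by simp
  then show ?thesis by (rule mult_right_le_imp_le) (use k False in simp)
 qed
qed

text \<open>Differentiability is expressed by affine approximations with slopes in a countable dense set: the slopes that work at accuracies \<open>1 / n\<close> form a Cauchy sequence, and its limit is the gradient.\<close>

lemma gderiv_points_borel:
 fixes f :: "'a::euclidean_space => real"
 assumes f: "continuous_on UNIV f" shows "{x. \<exists>w. GDERIV f x :> w}\<in>sets borel"
proof -
 obtain E :: "'a set" where E: "countable E" "!!X. open X ==> X \<noteq> {} ==> \<exists>e\<in>E. e\<in>X"
  using countable_dense_setE by blast
 let ?s = "%n::nat. 1/real (Suc n)"
 define A where "A n m v={x. \<forall>h\<in>ball 0 (?s m). \<bar>f (x+h)-f x-v\<bullet>h\<bar><=?s n * norm h}" for n m and v :: 'a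
 have Ac: "closed (A n m v)" for n m v
 proof -
  have "A n m v=(\<Inter>h\<in>ball 0 (?s m). {x. \<bar>f (x+h)-f x-v\<bullet>h\<bar><=?s n * norm h})" by (auto simp: A_def)
  moreover have "closed {x. \<bar>f (x+h)-f x-v\<bullet>h\<bar><=?s n * norm h}" for h
   by (intro closed_Collect_le continuous_intros f continuous_on_compose2[OF f]) auto
  ultimately show ?thesis by (simp add: closed_INT)
 qed
 have "{x. \<exists>w. GDERIV f x :> w}=(\<Inter>n. \<Union>m. \<Union>v\<in>E. A n m v)"
 proof (intro equalityI subsetI INT_I)
  fix x n assume "x\<in>{x. \<exists>w. GDERIV f x :> w}"
  then obtain w where w: "GDERIV f x :> w" by blast
  have n0: "?s n/2 > 0" by simp
  obtain v where v: "v\<in>E" "norm (w-v) < ?s n/2" using E(2)[of "ball w (?s n/2)"] n0 by (auto simp: dist_norm)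
  obtain d where d: "d > 0" "!!y. norm (y-x) < d ==> norm (f y-f x-(y-x)\<bullet>w)<=?s n/2 * norm (y-x)"
   using w n0 unfolding gderiv_def has_derivative_at_alt by blast
  obtain m where m: "?s m < d" using nat_approx_posE[OF d(1)] by blast
  have "x\<in>A n m v" unfolding A_def
  proof (intro CollectI ballI)
   fix h :: 'a assume "h\<in>ball 0 (?s m)"
   then have "norm h < d" using m by simp
   then have "\<bar>f (x+h)-f x-h\<bullet>w\<bar><=?s n/2 * norm h" using d(2)[of "x+h"] by simp
   moreover have "\<bar>h\<bullet>w-v\<bullet>h\<bar><=?s n/2 * norm h"
   proof -
    have "h\<bullet>w-v\<bullet>h=(w-v)\<bullet>h" by (simp only: inner_diff_left inner_commute[of h])
    also have "\<bar>...\<bar><=norm (w-v) * norm h" by (rule Cauchy_Schwarz_ineq2)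
    also have "...<=?s n/2 * norm h" using v(2) by (intro mult_right_mono) auto
    finally show ?thesis .
   qed
   moreover have "\<bar>a-c\<bar><=d+e" if "\<bar>a-b\<bar><=d" "\<bar>b-c\<bar><=e" for a b c d e :: real using that by linarith
   ultimately have "\<bar>f (x+h)-f x-v\<bullet>h\<bar><=?s n/2 * norm h+?s n/2 * norm h" by blast
   then show "\<bar>f (x+h)-f x-v\<bullet>h\<bar><=?s n * norm h" by (simp only: distrib_right[symmetric] field_sum_of_halves)
  qed
  then show "x\<in>(\<Union>m. \<Union>v\<in>E. A n m v)" using v(1) by blast
 next
  fix x assume x: "x\<in>(\<Inter>n. \<Union>m. \<Union>v\<in>E. A n m v)"
  have "\<exists>v m. x\<in>A n m v" for n using x by blast
  then have "\<exists>v. \<forall>n. \<exists>m. x\<in>A n m (v n)" by (intro choice allI)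
  then obtain v where v: "!!n. \<exists>m. x\<in>A n m (v n)" by blast
  have close: "norm (v n-v n')<=?s n+?s n'" for n n'
  proof -
   obtain m m' where m: "x\<in>A n m (v n)" "x\<in>A n' m' (v n')" using v by blast
   have "0 < min (?s m) (?s m')" by (simp del: of_nat_Suc)
   then obtain r where "0 < r" "r < min (?s m) (?s m')" using dense by blast
   then have r: "r > 0" "r < ?s m" "r < ?s m'" by (simp_all del: of_nat_Suc)
   let ?u = "sgn (v n-v n')"
   show ?thesis
   proof (cases "v n=v n'")
    case False
    let ?h = "r *\<^sub>R ?u"
    have nh: "norm ?h=r" using r(1) False by (simp add: norm_sgn)
    have "\<bar>f (x+?h)-f x-v n\<bullet>?h\<bar><=?s n * norm ?h" "\<bar>f (x+?h)-f x-v n'\<bullet>?h\<bar><=?s n' * norm ?h"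
     by (rule bspec[OF m(1)[unfolded A_def mem_Collect_eq]], simp only: mem_ball_0 nh r)
       (rule bspec[OF m(2)[unfolded A_def mem_Collect_eq]], simp only: mem_ball_0 nh r)
    moreover have "\<bar>b-c\<bar><=d+e" if "\<bar>a-b\<bar><=d" "\<bar>a-c\<bar><=e" for a b c d e :: real using that by linarith
    ultimately have "\<bar>(v n-v n')\<bullet>?h\<bar><=(?s n+?s n') * r"
     unfolding nh inner_diff_left distrib_right by blast
    moreover have "(v n-v n')\<bullet>?h=norm (v n-v n') * r"
     using False by (simp add: sgn_div_norm power2_norm_eq_inner[symmetric] power2_eq_square)
    ultimately have "\<bar>norm (v n-v n') * r\<bar><=(?s n+?s n') * r" by (simp only:)
    from order_trans[OF abs_ge_self this] r(1) show ?thesis by (rule mult_right_le_imp_le)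
   qed (simp del: of_nat_Suc)
  qed
  have s0: "?s ----> 0" by (rule step_sequence(3))
  have "Cauchy v"
  proof (rule metric_CauchyI)
   fix e :: real assume e: "e > 0"
   then have "eventually (%n. ?s n < e/2) sequentially" by (intro order_tendstoD(2)[OF s0]) simp
   then obtain N where N: "!!n. n \<ge> N ==> ?s n < e/2" unfolding eventually_sequentially by blast
   show "\<exists>M. \<forall>m\<ge>M. \<forall>n\<ge>M. dist (v m) (v n) < e"
   proof (intro exI allI impI)
    fix m n assume "m \<ge> N" "n \<ge> N"
    then have "?s m < e/2" "?s n < e/2" using N by blast+
    then show "dist (v m) (v n) < e" using close[of m n] unfolding dist_norm by linarith
   qed
  qed
  then obtain w where w: "v ----> w" using convergent_eq_Cauchy[of v] by blast
  have vw: "norm (v n-w)<=?s n" for n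
  proof (rule tendsto_le[OF sequentially_bot])
   show "(%k. norm (v n-v k)) ----> norm (v n-w)" by (intro tendsto_intros w)
   show "(%k. ?s n+?s k) ----> ?s n" using tendsto_add[OF tendsto_const s0, of "?s n"] by simp
   show "eventually (%k. norm (v n-v k)<=?s n+?s k) sequentially" using close by simp
  qed
  have "GDERIV f x :> w" unfolding gderiv_def has_derivative_at_alt
  proof (intro conjI allI impI bounded_linear_inner_left)
   fix e :: real assume "e > 0"
   then have "eventually (%n. ?s n < e/2) sequentially" by (intro order_tendstoD(2)[OF s0]) simp
   then obtain n where n: "?s n < e/2" unfolding eventually_sequentially by blast
   obtain m where m: "x\<in>A n m (v n)" using v by blast
   show "\<exists>d>0. \<forall>y. norm (y-x) < d \<longrightarrow> norm (f y-f x-(y-x)\<bullet>w)<=e * norm (y-x)"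
   proof (intro exI[of _ "?s m"] conjI allI impI)
    fix y assume y: "norm (y-x) < ?s m"
    have "\<bar>f (x+(y-x))-f x-v n\<bullet>(y-x)\<bar><=?s n * norm (y-x)"
     by (rule bspec[OF m[unfolded A_def mem_Collect_eq]], simp only: mem_ball_0 y)
    then have "\<bar>f y-f x-v n\<bullet>(y-x)\<bar><=?s n * norm (y-x)" by (simp only: add.commute[of x] diff_add_cancel)
    moreover have "\<bar>(v n-w)\<bullet>(y-x)\<bar><=?s n * norm (y-x)"
     by (rule order_trans[OF Cauchy_Schwarz_ineq2 mult_right_mono[OF vw]]) simp
    then have "\<bar>v n\<bullet>(y-x)-(y-x)\<bullet>w\<bar><=?s n * norm (y-x)"
     by (simp only: inner_diff_left[of "v n"] inner_commute[of w])
    moreover have "\<bar>a-c\<bar><=d+e" if "\<bar>a-b\<bar><=d" "\<bar>b-c\<bar><=e" for a b c d e :: real using that by linarith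
    ultimately have "\<bar>f y-f x-(y-x)\<bullet>w\<bar><=?s n * norm (y-x)+?s n * norm (y-x)" by blast
    also have "...<=e/2 * norm (y-x)+e/2 * norm (y-x)" using n by (intro add_mono mult_right_mono) auto
    finally have "\<bar>f y-f x-(y-x)\<bullet>w\<bar><=e/2 * norm (y-x)+e/2 * norm (y-x)" .
    then show "norm (f y-f x-(y-x)\<bullet>w)<=e * norm (y-x)" by simp
   qed (simp del: of_nat_Suc)
  qed
  then show "x\<in>{x. \<exists>w. GDERIV f x :> w}" by blast
 qed
 moreover have "(\<Inter>n. \<Union>m. \<Union>v\<in>E. A n m v)\<in>sets borel"
  by (intro sets.countable_INT'' sets.countable_UN'' E(1) borel_closed Ac) auto
 ultimately show ?thesis by simp
qed

lemma loc_bounded_grad: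
 fixes V :: "'a::euclidean_space => real"
 assumes loc: "!!x. \<exists>r>0. \<exists>C. C-lipschitz_on (ball x r) V"
 shows "\<exists>C. \<forall>x. norm x<=R \<longrightarrow> norm (grad V x)<=C" and "loc_bounded (%x. grad V x\<bullet>c)"
proof -
 have cont: "continuous_on UNIV V" by (rule locally_lipschitz_continuous[OF loc])
 show bd: "\<exists>C. \<forall>x. norm x<=R \<longrightarrow> norm (grad V x)<=C" for R
 proof -
  obtain L where L: "L \<ge> 0" "!!x y. norm x<=R+1 ==> norm y<=R+1 ==> \<bar>V x-V y\<bar><=L * norm (x-y)"
   using locally_lipschitz_ball[OF loc] by blast
  have "norm (grad V x)<=L" if x: "norm x<=R" for x
  proof (cases "\<exists>w. GDERIV V x :> w")
   case True
   then obtain w where w: "GDERIV V x :> w" by blast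
   have "norm (w-0)<=L"
   proof (rule gderiv_bound[OF w zero_less_one])
    fix h :: 'a assume "norm h < 1"
    then have "norm (x+h)<=R+1" using x norm_triangle_ineq[of x h] by linarith
    then show "\<bar>V (x+h)-V x-0\<bullet>h\<bar><=L * norm h" using L(2)[of "x+h" x] x by simp
   qed
   then show ?thesis using grad_eqI[OF w] by simp
  qed (use L(1) in \<open>simp add: grad_def\<close>)
  then show ?thesis by blast
 qed
 let ?D = "{x. \<exists>w. GDERIV V x :> w}"
 let ?q = "%n x. indicator ?D x * ((V (x+(1/real (Suc n)) *\<^sub>R c)-V x)/(1/real (Suc n)))"
 have ql: "(%n. ?q n x) ----> grad V x\<bullet>c" for x
 proof (cases "x\<in>?D")
  case True
  then obtain w where w: "GDERIV V x :> w" by blast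
  have l: "((%t. x+t *\<^sub>R c) has_derivative (%t. t *\<^sub>R c)) (at (0::real))" by (auto intro!: derivative_eq_intros)
  have "(V has_derivative (%h. h\<bullet>w)) (at (x+0 *\<^sub>R c))" using w by (simp add: gderiv_def)
  from has_derivative_compose[OF l this] have "((%t. V (x+t *\<^sub>R c)) has_derivative (%t. t *\<^sub>R c\<bullet>w)) (at 0)" .
  then have "((%t. V (x+t *\<^sub>R c)) has_real_derivative w\<bullet>c) (at 0)"
   unfolding has_field_derivative_def by (rule has_derivative_eq_rhs) (simp add: fun_eq_iff inner_commute)
  from real_derivative_sequence[OF this] show ?thesis using True grad_eqI[OF w] by simp
 next
  case False
  then have "grad V x=0" by (simp add: grad_def)
  then show ?thesis using False by simp
 qed
 have qm: "?q n\<in>borel_measurable borel" for n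
  by (intro borel_measurable_times borel_measurable_indicator gderiv_points_borel[OF cont] borel_measurable_continuous_onI
    continuous_intros cont continuous_on_compose2[OF cont]) auto
 have "(%x. grad V x\<bullet>c)\<in>borel_measurable borel"
  by (rule borel_measurable_LIMSEQ_real[where u = ?q, OF ql qm])
 moreover have "\<exists>C. \<forall>x. norm x<=R \<longrightarrow> \<bar>grad V x\<bullet>c\<bar><=C" for R
 proof -
  obtain C where C: "!!x. norm x<=R ==> norm (grad V x)<=C" using bd by blast
  have "\<bar>grad V x\<bullet>c\<bar><=C * norm c" if "norm x<=R" for x
   by (rule order_trans[OF Cauchy_Schwarz_ineq2 mult_right_mono[OF C[OF that]]]) simp
  then show ?thesis by blast
 qed
 ultimately show "loc_bounded (%x. grad V x\<bullet>c)" unfolding loc_bounded_def by blast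
qed

section \<open>Smooth approximations of a locally Lipschitz potential\<close>

lemma integral_lborel_reflect:
 fixes f :: "'a::euclidean_space => real"
 assumes f: "f\<in>borel_measurable borel"
 shows "(\<integral>z. f (x-z)\<partial>lborel)=(\<integral>z. f z\<partial>lborel)"
proof -
 have fx: "(%z. f (x+z))\<in>borel_measurable borel" using measurable_compose[OF _ f, of "%z. x+z"] by simp
 have u: "distr lborel borel (uminus :: 'a => 'a)=lborel"
  by (rule lborel_distr_isometry) (auto intro!: linearI)
 have "(\<integral>z. f (x-z)\<partial>lborel)=(\<integral>z. f (x+z)\<partial>distr lborel borel uminus)"
  by (subst integral_distr) (use fx in auto)
 also have "...=(\<integral>z. f z\<partial>distr lborel borel ((+) x))"
  unfolding u by (subst integral_distr) (use f in auto)
 finally show ?thesis unfolding lborel_distr_plus .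
qed

lemma dderiv_eq_0:
 assumes "open S" "x\<in>S" "!!y. y\<in>S ==> f y=0" shows "dderiv v f x=0"
proof -
 have "(f has_derivative (%_. 0)) (at x)"
  by (rule has_derivative_transform_within_open[OF _ assms(1,2), of "%_. 0"]) (use assms(3) in auto)
 then show ?thesis by (rule dderiv_eqI)
qed

text \<open>The potential is truncated before it is convolved, so that convolution results for integrable weights
  apply; inside the ball of radius \<open>R + 1\<close> the truncation is invisible.\<close>

definition smear :: "nat => real => ('a::euclidean_space => real) => 'a => real" where
 "smear k R g x=(\<integral>z. mollifier (1/real (Suc k)) (x-z)*(g z * indicator (cball 0 (R+3)) z)\<partial>lborel)"

context
 fixes k :: nat and R :: real and \<rho> :: "'a::euclidean_space => real" and d :: real
 defines "\<rho> \<equiv> mollifier (1/real (Suc k))" and "d \<equiv> 2*(1/real (Suc k))"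
begin

lemma kernel: "\<rho>\<in>Cc" "\<rho> z \<ge> 0" "(\<integral>z. \<rho> z\<partial>lborel)=1" "norm z \<ge> d ==> \<rho> z=0" "0 < d" "d<=2"
proof -
 have e: "1/real (Suc k) > 0" "1/real (Suc k)<=1" using step_sequence(1,2) by blast+
 show "\<rho>\<in>Cc" "\<rho> z \<ge> 0" "(\<integral>z. \<rho> z\<partial>lborel)=1" "norm z \<ge> d ==> \<rho> z=0"
  unfolding \<rho>_def d_def using mollifier_Cc[OF e(1)] mollifier_nonneg[OF e(1)] integral_mollifier[OF e(1)] mollifier_eq_0[OF e(1)] by blast+
 show "0 < d" unfolding d_def using e(1) by (rule mult_pos_pos[rotated]) simp
 show "d<=2" unfolding d_def by (rule order_trans[OF mult_left_mono[OF e(2)]]) simp_all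
qed

lemma smear_weight:
 fixes g :: "'a => real"
 assumes g: "continuous_on UNIV g" shows "integrable lborel (%z::'a. g z * indicator (cball 0 (R+3)) z)"
 using borel_integrable_compact[of "cball 0 (R+3)" g] continuous_on_subset[OF g] by (simp add: mult.commute)

lemma smooth_on_smear:
 assumes g: "continuous_on UNIV g" shows "smooth_on UNIV (smear k R g :: 'a => real)"
 using smooth_on_weighted_translate[OF kernel(1) _ smear_weight[OF g], of "%z. z"] unfolding smear_def[abs_def] \<rho>_def by simp

lemma dderiv_smear:
 assumes g: "continuous_on UNIV g"
 shows "dderiv v (smear k R g) x=(\<integral>z. dderiv v \<rho> (x-z)*(g z * indicator (cball 0 (R+3)) z)\<partial>lborel)"
 using dderiv_eqI[OF weighted_translate_has_derivative[OF kernel(1) _ smear_weight[OF g], of "%z. z" x]] unfolding smear_def[abs_def] \<rho>_def by simp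

lemma smear_affine:
 assumes x: "norm x < R+1"
 shows "smear k R (%z. a+w\<bullet>z) x=a+w\<bullet>x-(\<integral>u. \<rho> u * (w\<bullet>u)\<partial>lborel)"
proof -
 have sm: "smooth_on UNIV (%u. w\<bullet>u)" by (intro smooth_on_linear open_UNIV bounded_linear_inner_right)
 have i: "integrable lborel \<rho>" "integrable lborel (%u. \<rho> u * (w\<bullet>u))"
  using Cc_integrable_lborel[OF kernel(1)] Cc_integrable_lborel[OF Cc_mult[OF sm kernel(1)]] by (simp_all add: mult.commute)
 have "smear k R (%z. a+w\<bullet>z) x=(\<integral>z. \<rho> (x-z)*(a+w\<bullet>(x-(x-z)))\<partial>lborel)"
  unfolding smear_def \<rho>_def[symmetric]
 proof (rule Bochner_Integration.integral_cong[OF refl])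
  fix z :: 'a
  have "\<rho> (x-z)=0" if "z \<notin> cball 0 (R+3)"
   using that x kernel(6) norm_triangle_ineq2[of z x] by (intro kernel(4)) (auto simp: norm_minus_commute)
  then show "\<rho> (x-z)*((a+w\<bullet>z) * indicator (cball 0 (R+3)) z)=\<rho> (x-z)*(a+w\<bullet>(x-(x-z)))"
   by (cases "z\<in>cball 0 (R+3)") auto
 qed
 also have "...=(\<integral>u. \<rho> u * (a+w\<bullet>(x-u))\<partial>lborel)"
  by (rule integral_lborel_reflect[of "%u. \<rho> u * (a+w\<bullet>(x-u))"])
    (intro borel_measurable_continuous_onI continuous_intros Cc_continuous[OF kernel(1)])
 also have "...=(\<integral>u. (a+w\<bullet>x)*\<rho> u-\<rho> u * (w\<bullet>u)\<partial>lborel)"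
  by (rule Bochner_Integration.integral_cong) (simp_all add: inner_diff_right algebra_simps)
 also have "...=a+w\<bullet>x-(\<integral>u. \<rho> u * (w\<bullet>u)\<partial>lborel)" using i by (simp add: kernel(3))
 finally show ?thesis .
qed

text \<open>Convolution reproduces affine functions up to a constant, so only the deviation of \<open>g\<close> from an affine function contributes; the gradient of the kernel has integral of order \<open>1 / d\<close> over a ball of radius \<open>d\<close>, and this factor is compensated by the size of the deviation.\<close>

lemma smear_bounds:
 fixes g :: "'a => real"
 assumes g: "continuous_on UNIV g" and x: "norm x<=R" and \<epsilon>: "\<epsilon> \<ge> 0"
  and e: "!!z. norm (z-x)<=d ==> \<bar>g z-g x-w\<bullet>(z-x)\<bar><=\<epsilon> * norm (z-x)"
  and C: "C \<ge> 0" "!!R v x::'a. R > 0 ==> \<bar>dderiv v (cutoff R) x\<bar><=C/R * norm v"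
 shows "\<bar>smear k R g x-g x\<bar><=(norm w+\<epsilon>) * d"
  and "\<bar>dderiv v (smear k R g) x-w\<bullet>v\<bar><=2 * C * 2 ^ DIM('a)*\<epsilon> * norm v"
proof -
 let ?I = "indicator (cball 0 (R+3)) :: 'a => real" and ?E = "1/real (Suc k)"
 have e0: "?E > 0" by (rule step_sequence(1))
 have x1: "norm x < R+1" using x by simp
 have cc: "continuous_on UNIV (%z. a+w\<bullet>z)" for a and w :: 'a by (intro continuous_intros)
 have far: "norm (x-z) > d ==> \<rho> (x-z)=0" for z using kernel(4)[of "x-z"] by simp
 note it = integrable_weighted_translate[OF kernel(1) _ smear_weight, where \<iota> = "%z. z" and x = x, simplified]
 note it' = integrable_weighted_translate[OF Cc_dderiv[OF kernel(1)] _ smear_weight, where \<iota> = "%z. z" and x = x, simplified]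
 have const: "smear k R (%z. c+0\<bullet>z) x=c" for c using smear_affine[OF x1, of c 0] by simp
 have "smear k R g x-g x=smear k R g x-smear k R (%z. g x+0\<bullet>z) x" by (simp only: const)
 also have "...=(\<integral>z. \<rho> (x-z)*(g z * ?I z)-\<rho> (x-z)*((g x+0\<bullet>z)*?I z)\<partial>lborel)"
  unfolding smear_def \<rho>_def[symmetric] by (rule Bochner_Integration.integral_diff[OF it[OF g] it[OF cc], symmetric])
 finally have eq: "smear k R g x-g x=(\<integral>z. \<rho> (x-z)*(g z * ?I z)-\<rho> (x-z)*((g x+0\<bullet>z)*?I z)\<partial>lborel)" .
 have "\<bar>smear k R g x-g x\<bar><=(\<integral>z. \<rho> (x-z)*(((norm w+\<epsilon>) * d+0\<bullet>z)*?I z)\<partial>lborel)"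
  unfolding eq real_norm_def[symmetric]
 proof (rule Bochner_Integration.integral_norm_bound_integral[OF Bochner_Integration.integrable_diff[OF it[OF g] it[OF cc]] it[OF cc]])
  fix z
  show "norm (\<rho> (x-z)*(g z * ?I z)-\<rho> (x-z)*((g x+0\<bullet>z)*?I z))<=\<rho> (x-z)*(((norm w+\<epsilon>) * d+0\<bullet>z)*?I z)"
  proof (cases "norm (x-z) > d")
   case False
   then have n: "norm (z-x)<=d" by (simp add: norm_minus_commute)
   have "\<bar>w\<bullet>(z-x)\<bar><=norm w * d"
    by (rule order_trans[OF Cauchy_Schwarz_ineq2 mult_left_mono[OF n]]) simp
   moreover have "\<epsilon> * norm (z-x)<=\<epsilon> * d" by (rule mult_left_mono[OF n \<epsilon>])
   ultimately have "\<bar>g z-g x\<bar><=(norm w+\<epsilon>) * d" using e[OF n] unfolding distrib_right by linarith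
   then have "\<rho> (x-z)*\<bar>g z-g x\<bar>*?I z<=\<rho> (x-z)*((norm w+\<epsilon>) * d)*?I z"
    by (intro mult_right_mono mult_left_mono kernel(2)) auto
   moreover have "norm (\<rho> (x-z)*(g z * ?I z)-\<rho> (x-z)*((g x+0\<bullet>z)*?I z))=\<rho> (x-z)*\<bar>g z-g x\<bar>*?I z"
   proof -
    have "\<rho> (x-z)*(g z * ?I z)-\<rho> (x-z)*((g x+0\<bullet>z)*?I z)=\<rho> (x-z)*(g z-g x)*?I z" by (simp add: algebra_simps)
    then show ?thesis by (simp add: abs_mult kernel(2))
   qed
   ultimately show ?thesis by (simp add: mult.assoc)
  qed (simp add: far)
 qed
 also have "...=(norm w+\<epsilon>) * d" using const unfolding smear_def \<rho>_def[symmetric] .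
 finally show "\<bar>smear k R g x-g x\<bar><=(norm w+\<epsilon>) * d" .
 define I where "I=(\<integral>x. cutoff ?E (x::'a)\<partial>lborel)"
 have I: "I > 0" unfolding I_def by (rule integral_cutoff_pos[OF e0])
 have \<rho>I: "\<rho>=(%z. inverse I * cutoff ?E z)" unfolding \<rho>_def mollifier_def[abs_def] I_def ..
 have kb: "\<bar>dderiv v \<rho> u\<bar><=inverse I * (C/?E * norm v)" for u
 proof -
  have "dderiv v \<rho> u=inverse I * dderiv v (cutoff ?E) u"
   unfolding \<rho>I by (rule dderiv_eqI[OF has_derivative_mult_right[OF Cc_has_derivative[OF cutoff_Cc[OF e0]]]])
  then show ?thesis using I C(2)[OF e0, of u v] by (simp add: abs_mult mult.assoc mult_left_mono del: of_nat_Suc)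
 qed
 let ?a = "%z. (g x-w\<bullet>x)+w\<bullet>z"
 let ?b = "inverse I * (C/?E * norm v)*(\<epsilon> * d)"
 have "dderiv v (smear k R ?a) x=w\<bullet>v"
 proof (rule dderiv_eqI[where f' = "%v. w\<bullet>v"])
  have "((%x. (g x0-w\<bullet>x0)+w\<bullet>x-c) has_derivative (%v. w\<bullet>v)) (at x)" for x0 c
   by (auto intro!: derivative_eq_intros)
  from has_derivative_transform_within_open[OF this, of "ball 0 (R+1)"]
  show "(smear k R ?a has_derivative (%v. w\<bullet>v)) (at x)" using x1 smear_affine[of _ "g x-w\<bullet>x" w] by auto
 qed
 then have "dderiv v (smear k R g) x-w\<bullet>v=dderiv v (smear k R g) x-dderiv v (smear k R ?a) x" by simp
 also have "...=(\<integral>z. dderiv v \<rho> (x-z)*(g z * ?I z)-dderiv v \<rho> (x-z)*(?a z * ?I z)\<partial>lborel)"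
  unfolding dderiv_smear[OF g] dderiv_smear[OF cc]
  by (rule Bochner_Integration.integral_diff[OF it'[OF g] it'[OF cc], symmetric])
 finally have eq: "dderiv v (smear k R g) x-w\<bullet>v=(\<integral>z. dderiv v \<rho> (x-z)*(g z * ?I z)-dderiv v \<rho> (x-z)*(?a z * ?I z)\<partial>lborel)" .
 have "\<bar>dderiv v (smear k R g) x-w\<bullet>v\<bar><=(\<integral>z. ?b * indicator (cball x d) z\<partial>lborel)"
  unfolding eq real_norm_def[symmetric]
 proof (rule Bochner_Integration.integral_norm_bound_integral[OF Bochner_Integration.integrable_diff[OF it'[OF g] it'[OF cc]]])
  show "integrable lborel (%z. ?b * indicator (cball x d) z)"
   by (rule integrable_mult_right, rule integrable_real_indicator[OF _ emeasure_lborel_cball_finite]) simp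
  fix z
  have eq': "dderiv v \<rho> (x-z)*(g z * ?I z)-dderiv v \<rho> (x-z)*(?a z * ?I z)=dderiv v \<rho> (x-z)*(g z-g x-w\<bullet>(z-x))*?I z"
   by (simp add: inner_diff_right algebra_simps)
  show "norm (dderiv v \<rho> (x-z)*(g z * ?I z)-dderiv v \<rho> (x-z)*(?a z * ?I z))<=?b * indicator (cball x d) z"
  proof (cases "norm (x-z) > d")
   case True
   have "dderiv v \<rho> (x-z)=0"
    by (rule dderiv_eq_0[of "{u. norm u > d}"]) (use True kernel(4) in \<open>auto intro!: open_Collect_less continuous_intros\<close>)
   then show ?thesis using True by (simp add: dist_norm)
  next
   case False
   then have n: "norm (z-x)<=d" by (simp add: norm_minus_commute)
   have "\<bar>g z-g x-w\<bullet>(z-x)\<bar><=\<epsilon> * d" by (rule order_trans[OF e[OF n] mult_left_mono[OF n \<epsilon>]])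
   then have "\<bar>dderiv v \<rho> (x-z)\<bar>*\<bar>g z-g x-w\<bullet>(z-x)\<bar>*\<bar>?I z\<bar><=?b * 1"
    using \<epsilon> kernel(5) I C(1) by (intro mult_mono kb) (auto simp: indicator_def intro!: mult_nonneg_nonneg divide_nonneg_nonneg)
   then show ?thesis using False unfolding eq' real_norm_def abs_mult by (simp add: dist_norm)
  qed
 qed
 also have "...=?b * measure lborel (cball x d)" by (simp only: integral_mult_right_zero Bochner_Integration.integral_indicator Int_UNIV_right space_lborel space_borel)
 also have "...=?b * (2 ^ DIM('a) * measure lborel (cball (0::'a) ?E))"
  using content_cball[of d x] content_cball[of ?E "0::'a"] kernel(5) e0 unfolding d_def by (simp only: power_mult_distrib less_imp_le mult_ac)
 also have "...<=?b * (2 ^ DIM('a) * I)"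
 proof (intro mult_left_mono)
  have "(\<integral>z. indicator (cball (0::'a) ?E) z\<partial>lborel)<=(\<integral>z. cutoff ?E (z::'a)\<partial>lborel)"
  proof (rule Bochner_Integration.integral_mono)
   show "indicator (cball 0 ?E) z<=cutoff ?E z" for z :: 'a
    using cutoff_eq_1[OF e0, of z] cutoff_bounds(1)[of ?E z] by (simp add: indicator_def del: of_nat_Suc)
  qed (rule integrable_real_indicator[OF _ emeasure_lborel_cball_finite], simp, rule Cc_integrable_lborel[OF cutoff_Cc[OF e0]])
  then show "measure lborel (cball (0::'a) ?E)<=I" by (simp add: I_def del: of_nat_Suc)
  show "0<=?b" using \<epsilon> kernel(5) I C(1) by (intro mult_nonneg_nonneg divide_nonneg_nonneg) auto
 qed auto
 also have "...=2 * C * 2 ^ DIM('a)*\<epsilon> * norm v"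
  unfolding d_def using I e0 by (simp add: field_simps del: of_nat_Suc)
 finally show "\<bar>dderiv v (smear k R g) x-w\<bullet>v\<bar><=2 * C * 2 ^ DIM('a)*\<epsilon> * norm v" .
qed

end

text \<open>A constant affine approximation gives the uniform bounds, and the first order Taylor polynomial gives convergence of the gradients at points of differentiability.\<close>

lemma smooth_potentials:
 fixes V :: "'a::euclidean_space => real"
 assumes loc: "!!x. \<exists>r>0. \<exists>C. C-lipschitz_on (ball x r) V"
 obtains W B where "!!k::nat. smooth_on UNIV (W k)" "B \<ge> 0"
  "!!k x. norm x<=R ==> \<bar>W k x\<bar><=B" "!!k x v. norm x<=R ==> \<bar>dderiv v (W k) x\<bar><=B * norm v"
  "!!x. norm x<=R ==> (%k. W k x) ----> V x"
  "!!x w v. norm x<=R ==> GDERIV V x :> w ==> (%k. dderiv v (W k) x) ----> w\<bullet>v"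
proof -
 have cont: "continuous_on UNIV V" by (rule locally_lipschitz_continuous[OF loc])
 obtain C where C: "C > 0" "!!R v x::'a. R > 0 ==> \<bar>dderiv v (cutoff R) x\<bar><=C/R * norm v"
  using cutoff_dderiv_bound[where ?'a = 'a] by blast
 then have C0: "C \<ge> 0" by simp
 note sb = smear_bounds[OF cont _ _ _ C0 C(2)]
 define K where "K=2 * C * 2 ^ DIM('a)"
 have K: "K \<ge> 0" using C0 by (simp add: K_def)
 obtain L where L: "L \<ge> 0" "!!x y. norm x<=R+2 ==> norm y<=R+2 ==> \<bar>V x-V y\<bar><=L * norm (x-y)"
  using locally_lipschitz_ball[OF loc] by blast
 obtain B0 where B0: "!!x. norm x<=R ==> \<bar>V x\<bar><=B0" using loc_boundedD(2)[OF loc_bounded_continuous[OF cont]] by blast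
 let ?d = "%k::nat. 2*(1/real (Suc k))"
 have d2: "?d k<=2" for k by (rule order_trans[OF mult_left_mono[OF step_sequence(2)]]) simp_all
 have dl: "?d ----> 0" using tendsto_mult_left[OF step_sequence(3), of 2] by simp
 have near: "\<bar>V z-V x-0\<bullet>(z-x)\<bar><=L * norm (z-x)" if "norm x<=R" "norm (z-x)<=?d k" for x z k
 proof -
  have "norm z<=R+2" using norm_triangle_ineq[of x "z-x"] that d2[of k] unfolding add_diff_cancel_left' add.commute[of x] diff_add_cancel by linarith
  then show ?thesis using L(2)[of z x] that(1) by simp
 qed
 note nb = sb[OF _ L(1) near]
 have b1: "\<bar>smear k R V x-V x\<bar><=L * ?d k" if "norm x<=R" for k x using nb(1)[OF that that, of k] by simp
 have b2: "\<bar>dderiv v (smear k R V) x\<bar><=K * L * norm v" if "norm x<=R" for k x v using nb(2)[OF that that, where v = v and k = k] by (simp add: K_def)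
 define B where "B=\<bar>B0\<bar>+L * 2+K * L"
 show thesis
 proof (rule that[of "%k. smear k R V" B])
  show "smooth_on UNIV (smear k R V)" for k by (rule smooth_on_smear[OF cont])
  show "B \<ge> 0" using L(1) K by (simp add: B_def)
  show "\<bar>smear k R V x\<bar><=B" if "norm x<=R" for k x
   using b1[OF that, of k] B0[OF that] mult_left_mono[OF d2(1)[of k] L(1)] mult_nonneg_nonneg[OF K L(1)] unfolding B_def by linarith
  show "\<bar>dderiv v (smear k R V) x\<bar><=B * norm v" if "norm x<=R" for k x v
   by (rule order_trans[OF b2[OF that] mult_right_mono]) (use L(1) in \<open>auto simp: B_def\<close>)
  show "(%k. smear k R V x) ----> V x" if "norm x<=R" for x
  proof (rule Lim_null_comparison[THEN Lim_null[THEN iffD2]])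
   show "eventually (%k. norm (smear k R V x-V x)<=L * ?d k) sequentially" using b1[OF that] by simp
   show "(%k. L * ?d k) ----> 0" using tendsto_mult_left[OF dl, of L] by simp
  qed
  show "(%k. dderiv v (smear k R V) x) ----> w\<bullet>v" if x: "norm x<=R" and w: "GDERIV V x :> w" for x w v
  proof (rule LIMSEQ_I)
   fix r :: real assume r: "r > 0"
   have Kv: "K * norm v+1 > 0" using K by (simp add: add_nonneg_pos)
   define \<epsilon> where "\<epsilon>=r/(K * norm v+1)"
   have \<epsilon>: "\<epsilon> > 0" using r Kv by (simp add: \<epsilon>_def)
   obtain \<delta> where \<delta>: "\<delta> > 0" "!!y. norm (y-x) < \<delta> ==> norm (V y-V x-(y-x)\<bullet>w)<=\<epsilon> * norm (y-x)"
    using w \<epsilon> unfolding gderiv_def has_derivative_at_alt by blast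
   have "eventually (%k. ?d k < \<delta>) sequentially" by (rule order_tendstoD(2)[OF dl \<delta>(1)])
   then obtain N where N: "!!k. k \<ge> N ==> ?d k < \<delta>" unfolding eventually_sequentially by blast
   show "\<exists>no. \<forall>k\<ge>no. norm (dderiv v (smear k R V) x-w\<bullet>v) < r"
   proof (intro exI allI impI)
    fix k assume k: "k \<ge> N"
    have "\<bar>V z-V x-w\<bullet>(z-x)\<bar><=\<epsilon> * norm (z-x)" if "norm (z-x)<=?d k" for z
     using \<delta>(2)[of z] that N[OF k] by (simp add: inner_commute[of w])
    from sb(2)[OF x less_imp_le[OF \<epsilon>] this, where v = v]
    have "\<bar>dderiv v (smear k R V) x-w\<bullet>v\<bar><=K * \<epsilon> * norm v" by (simp add: K_def)
    also have "... < r" using r Kv K by (simp add: \<epsilon>_def field_simps)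
    finally show "norm (dderiv v (smear k R V) x-w\<bullet>v) < r" by simp
   qed
  qed
 qed
qed

section \<open>The Langevin operator on compactly supported smooth functions\<close>

text \<open>The Langevin operator in terms of linear vector fields on the ambient space.\<close>

definition langevin :: "('a::euclidean_space => real) => real => ('a \<times> 'a => real) => 'a \<times> 'a => real" where
 "langevin V \<sigma> F p=transport F p
  - 1/(real DIM('a)-1)*(\<Sum>c\<in>Basis. (grad V (fst p)\<bullet>c) * tan_deriv c F p)+\<sigma>\<^sup>2/2 * sphere_lap F p"

lemma smooth_on_fst:
 fixes a :: "'a::euclidean_space => real"
 shows "smooth_on UNIV a ==> smooth_on UNIV (%p::'a \<times> 'b::euclidean_space. a (fst p))"
 by (rule smooth_on_compose_linear[OF bounded_linear_fst])

lemma transport_fst: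
 fixes a :: "'a::euclidean_space => real"
 assumes a: "smooth_on UNIV a" shows "transport (%p. a (fst p)) p=dderiv (snd p) a (fst p)"
proof -
 have "(a has_derivative (%v. dderiv v a (fst p))) (at (fst p))" by (rule smooth_on_has_derivative[OF a UNIV_I])
 from has_derivative_compose[OF has_derivative_fst[OF has_derivative_ident] this]
 have "dderiv (snd p, 0) (%p. a (fst p)) p=dderiv (fst (snd p, 0::'a)) a (fst p)" by (rule dderiv_eqI)
 then show ?thesis by (simp add: lin_field_def transport_field_def)
qed

text \<open>Functions of the position alone commute with the spherical part.\<close>

lemma langevin_mult_fst:
 fixes F :: "'a::euclidean_space \<times> 'a => real"
 assumes a: "smooth_on UNIV a" and F: "F\<in>Cc"
 shows "langevin V \<sigma> (%p. a (fst p) * F p) p=a (fst p) * langevin V \<sigma> F p+transport (%p. a (fst p)) p * F p"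
proof -
 have r: "rot_deriv b b' (%p. a (fst p) * G p)=(%p. a (fst p) * rot_deriv b b' G p)" if "G\<in>Cc" for b b' and G :: "'a \<times> 'a => real"
  by (simp add: lin_field_mult[OF smooth_on_fst[OF a] Cc_smooth[OF that]] rot_deriv_fst[OF a])
 have s: "sphere_lap (%p. a (fst p) * F p) p=a (fst p) * sphere_lap F p"
  unfolding sphere_lap_def r[OF F] r[OF Cc_rot_deriv[OF F]] sum_distrib_left[symmetric] by (rule mult.left_commute)
 have t: "tan_deriv c (%p. a (fst p) * F p) p=a (fst p) * tan_deriv c F p" for c
  unfolding tan_deriv_def r[OF F] mult.left_commute[of _ "a (fst p)"] sum_distrib_left[symmetric] by (rule refl)
 have u: "transport (%p. a (fst p) * F p) p=a (fst p) * transport F p+transport (%p. a (fst p)) p * F p"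
  by (simp add: lin_field_mult[OF smooth_on_fst[OF a] Cc_smooth[OF F]])
 show ?thesis
  unfolding langevin_def s t u mult.left_commute[of _ "a (fst p)"] sum_distrib_left[symmetric] by (simp add: algebra_simps)
qed

lemma langevin_lincomb:
 assumes "F\<in>Cc" "G\<in>Cc"
 shows "langevin V \<sigma> (%p. a * F p+b * G p) p=a * langevin V \<sigma> F p+b * langevin V \<sigma> G p"
proof -
 have c: "langevin V \<sigma> (%p. a * F p) p=a * langevin V \<sigma> F p" if "F\<in>Cc" for a F
  using langevin_mult_fst[OF smooth_on_const[OF open_UNIV, of a] that, of V \<sigma> p] by (simp add: lin_field_const)
 note C = Cc_cmult[OF assms(1), of a] Cc_cmult[OF assms(2), of b]
 have "langevin V \<sigma> (%p. a * F p+b * G p) p=langevin V \<sigma> (%p. a * F p) p+langevin V \<sigma> (%p. b * G p) p"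
  unfolding langevin_def sphere_lap_add[OF C] tan_deriv_add[OF C] lin_field_add[OF Cc_smooth[OF C(1)] Cc_smooth[OF C(2)]]
  by (simp add: sum.distrib algebra_simps)
 then show ?thesis by (simp add: c assms)
qed

lemma L2_langevin:
 fixes F :: "'a::euclidean_space \<times> 'a => real"
 assumes g: "!!c. loc_bounded (%x. grad V x\<bullet>c)" and m: "loc_bounded m" and F: "F\<in>Cc"
 shows "(%p. m (fst p) * langevin V \<sigma> F p)\<in>L2 phaseM"
proof -
 have "(%p. m (fst p) * langevin V \<sigma> F p)=(%p. m (fst p)*(transport F p+\<sigma>\<^sup>2/2 * sphere_lap F p)
   - 1/(real DIM('a)-1)*(\<Sum>c\<in>Basis. (m (fst p)*(grad V (fst p)\<bullet>c)) * tan_deriv c F p))"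
  by (simp add: fun_eq_iff langevin_def algebra_simps sum_distrib_left)
 moreover have "...\<in>L2 phaseM"
  by (intro L2_diff L2_cmult L2_sum L2_phase_weighted[OF m] L2_phase_weighted[OF loc_bounded_mult[OF m g]]
    Cc_add Cc_transport Cc_cmult Cc_sphere_lap Cc_tan_deriv F)
 ultimately show ?thesis by simp
qed

lemma integral_gibbs_transport_smooth:
 fixes F :: "'a::euclidean_space \<times> 'a => real"
 assumes W: "smooth_on UNIV W" and F: "F\<in>Cc"
 shows "(\<integral>p. exp (- W (fst p))*(transport F p * F p)\<partial>phaseM)
  = 1/2*(\<integral>p. exp (- W (fst p))*(transport (%p. W (fst p)) p * (F p)\<^sup>2)\<partial>phaseM)"
proof -
 let ?M = "phaseM :: ('a \<times> 'a) measure" and ?w = "%p::'a\<times>'a. W (fst p)" and ?e = "%p::'a\<times>'a. exp (- W (fst p))"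
 have mw: "smooth_on UNIV (%x.-W x)" using smooth_on_diff[OF open_UNIV smooth_on_const[OF open_UNIV, of 0] W] by simp
 have es: "smooth_on UNIV ?e" by (rule smooth_on_fst[OF smooth_on_exp[OF open_UNIV mw]])
 have te: "transport ?e p =-(?e p * transport ?w p)" for p
 proof -
  have "((%s. exp (- s)) has_real_derivative-exp (- s)) (at s)" for s :: real by (auto intro!: derivative_eq_intros)
  from fun_cong[OF lin_field_compose[OF smooth_on_fst[OF W] this, of transport_field], of p] show ?thesis by simp
 qed
 have tF: "transport (%p. ?e p * F p) p=?e p * transport F p-?e p * transport ?w p * F p" for p
  by (simp add: lin_field_mult[OF es Cc_smooth[OF F]] te)
 have int: "integrable ?M G" if "G\<in>Cc" for G :: "'a \<times> 'a => real"
  using integrable_weighted_Cc[OF loc_bounded_const[of 1] that] by simp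
 note ws = smooth_on_lin_field[OF smooth_on_fst[OF W] bounded_linear_transport_field]
 have i1: "integrable ?M (%p. ?e p * (transport F p * F p))"
  by (intro int Cc_mult es Cc_prod Cc_transport F)
 have i2: "integrable ?M (%p. ?e p * (transport ?w p * (F p)\<^sup>2))"
  unfolding power2_eq_square by (intro int Cc_mult es ws Cc_prod F)
 have "(\<integral>p. ?e p * (transport F p * F p)\<partial>?M)=(\<integral>p. transport F p * (?e p * F p)\<partial>?M)" by (simp add: mult_ac)
 also have "... =-(\<integral>p. F p * transport (%p. ?e p * F p) p\<partial>?M)" by (rule transport_by_parts[OF F Cc_mult[OF es F]])
 also have "(\<integral>p. F p * transport (%p. ?e p * F p) p\<partial>?M)=(\<integral>p. ?e p * (transport F p * F p)-?e p * (transport ?w p * (F p)\<^sup>2)\<partial>?M)"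
  unfolding tF by (rule Bochner_Integration.integral_cong) (simp_all add: power2_eq_square algebra_simps)
 also have "...=(\<integral>p. ?e p * (transport F p * F p)\<partial>?M)-(\<integral>p. ?e p * (transport ?w p * (F p)\<^sup>2)\<partial>?M)"
  by (rule Bochner_Integration.integral_diff[OF i1 i2])
 finally show ?thesis by simp
qed

context
 fixes V :: "'a::euclidean_space => real"
 assumes loc: "!!x. \<exists>r>0. \<exists>C. C-lipschitz_on (ball x r) V"
begin

lemma V_borel: "V\<in>borel_measurable borel"
 by (rule borel_measurable_continuous_onI[OF locally_lipschitz_continuous[OF loc]])

lemma gibbs_loc_bounded: "loc_bounded (%x. exp (- V x/k))"
 unfolding divide_inverse by (rule loc_bounded_continuous) (intro continuous_intros locally_lipschitz_continuous[OF loc])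

lemma grad_snd_measurable: "(%p. grad V (fst p)\<bullet>snd p)\<in>borel_measurable (phaseM :: ('a \<times> 'a) measure)"
proof -
 have "(%p. \<Sum>c\<in>Basis. (grad V (fst p)\<bullet>c)*(snd p\<bullet>c))\<in>borel_measurable (phaseM :: ('a \<times> 'a) measure)"
  by (intro borel_measurable_sum borel_measurable_times measurable_phase_fst[OF loc_boundedD(1)[OF loc_bounded_grad(2)[OF loc]]]
    measurable_phase borel_measurable_continuous_onI continuous_intros)
 then show ?thesis by (simp add: euclidean_inner[symmetric])
qed

text \<open>The gradient of \<open>V\<close> exists only almost everywhere, so the integration by parts is done for smooth potentials and passed to the limit.\<close>

lemma integral_gibbs_transport:
 assumes F: "F\<in>Cc"
 shows "(\<integral>p. exp (- V (fst p))*(transport F p * F p)\<partial>(phaseM :: ('a \<times> 'a) measure))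
  = 1/2*(\<integral>p. exp (- V (fst p))*((grad V (fst p)\<bullet>snd p)*(F p)\<^sup>2)\<partial>phaseM)"
proof -
 let ?M = "phaseM :: ('a \<times> 'a) measure"
 obtain R where R: "R > 0" "!!p. R < norm (fst p) ==> F p=0" using Cc_support_fst[OF F] by blast
 obtain W B where W: "!!k::nat. smooth_on UNIV (W k)" "B \<ge> 0"
  "!!k x. norm x<=R ==> \<bar>W k x\<bar><=B" "!!k x v. norm x<=R ==> \<bar>dderiv v (W k) x\<bar><=B * norm v"
  "!!x. norm x<=R ==> (%k. W k x) ----> V x"
  "!!x w v. norm x<=R ==> GDERIV V x :> w ==> (%k. dderiv v (W k) x) ----> w\<bullet>v"
  using smooth_potentials[OF loc, of R] by blast
 have Wm: "(%p. exp (- W k (fst p)))\<in>borel_measurable ?M" for k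
  by (rule measurable_phase_fst[of "%x. exp (- W k x)"]) (intro borel_measurable_continuous_onI continuous_intros smooth_on_continuous W(1))
 have Vm: "(%p. exp (- V (fst p)))\<in>borel_measurable ?M"
  by (rule measurable_phase_fst[of "%x. exp (- V x)"]) (use V_borel in simp)
 have tm: "transport (%p. W k (fst p))\<in>borel_measurable ?M" for k
  by (rule measurable_phase, rule borel_measurable_continuous_onI, rule smooth_on_continuous)
    (rule smooth_on_lin_field[OF smooth_on_fst[OF W(1)] bounded_linear_transport_field])
 note Fm = measurable_phase[OF Cc_measurable[OF F]] measurable_phase[OF Cc_measurable[OF Cc_transport[OF F]]]
 have eB: "exp (- W k x)<=exp B" if "norm x<=R" for k x using W(3)[OF that, of k] by (simp add: abs_le_iff)
 have A: "(%k. \<integral>p. exp (- W k (fst p))*(transport F p * F p)\<partial>?M) ----> (\<integral>p. exp (- V (fst p))*(transport F p * F p)\<partial>?M)"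
 proof (rule integral_dominated_convergence[where w = "%p. exp B * \<bar>transport F p * F p\<bar>"])
  show "integrable ?M (%p. exp B * \<bar>transport F p * F p\<bar>)"
   using integrable_weighted_Cc[OF loc_bounded_const[of 1] Cc_prod[OF Cc_transport[OF F] F]] by simp
  show "AE p in ?M. (%k. exp (- W k (fst p))*(transport F p * F p)) ----> exp (- V (fst p))*(transport F p * F p)"
  proof (rule AE_I2)
   fix p :: "'a \<times> 'a"
   show "(%k. exp (- W k (fst p))*(transport F p * F p)) ----> exp (- V (fst p))*(transport F p * F p)"
   proof (cases "norm (fst p)<=R")
    case True
    then show ?thesis by (intro tendsto_intros W(5))
   qed (simp add: R(2))
  qed
  show "AE p in ?M. norm (exp (- W k (fst p))*(transport F p * F p))<=exp B * \<bar>transport F p * F p\<bar>" for k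
  proof (rule AE_I2)
   fix p :: "'a \<times> 'a"
   show "norm (exp (- W k (fst p))*(transport F p * F p))<=exp B * \<bar>transport F p * F p\<bar>"
   proof (cases "norm (fst p)<=R")
    case True
    then show ?thesis unfolding real_norm_def abs_mult[of "exp (- W k (fst p))"] by (intro mult_right_mono) (use eB[OF True, of k] in simp_all)
   qed (simp add: R(2))
  qed
 qed (intro borel_measurable_times Wm Vm Fm)+
 have Bl: "(%k. \<integral>p. exp (- W k (fst p))*(transport (%p. W k (fst p)) p * (F p)\<^sup>2)\<partial>?M) ---->
   (\<integral>p. exp (- V (fst p))*((grad V (fst p)\<bullet>snd p)*(F p)\<^sup>2)\<partial>?M)"
 proof (rule integral_dominated_convergence[where w = "%p. exp B * B * (F p)\<^sup>2"])
  show "integrable ?M (%p. exp B * B * (F p)\<^sup>2)"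
   using integrable_weighted_Cc[OF loc_bounded_const[of "exp B * B"] Cc_prod[OF F F]] by (simp add: power2_eq_square mult.assoc)
  show "AE p in ?M. (%k. exp (- W k (fst p))*(transport (%p. W k (fst p)) p * (F p)\<^sup>2)) ----> exp (- V (fst p))*((grad V (fst p)\<bullet>snd p)*(F p)\<^sup>2)"
   using Rademacher_local[OF loc]
  proof eventually_elim
   case (elim p)
   show ?case
   proof (cases "norm (fst p)<=R")
    case True
    then show ?thesis unfolding transport_fst[OF W(1)] by (intro tendsto_intros W(5) W(6) elim)
   qed (simp add: R(2))
  qed
  show "AE p in ?M. norm (exp (- W k (fst p))*(transport (%p. W k (fst p)) p * (F p)\<^sup>2))<=exp B * B * (F p)\<^sup>2" for k
  proof (rule AE_I2)
   fix p :: "'a \<times> 'a" assume "p\<in>space ?M"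
   then have n: "norm (snd p)=1" by (auto simp: space_phase_measure phase_space_def)
   show "norm (exp (- W k (fst p))*(transport (%p. W k (fst p)) p * (F p)\<^sup>2))<=exp B * B * (F p)\<^sup>2"
   proof (cases "norm (fst p)<=R")
    case True
    have "\<bar>exp (- W k (fst p))\<bar>*(\<bar>dderiv (snd p) (W k) (fst p)\<bar>*(F p)\<^sup>2)<=exp B * (B * (F p)\<^sup>2)"
     by (intro mult_mono mult_right_mono) (use W(4)[OF True, where v = "snd p" and k = k] eB[OF True, of k] in \<open>auto simp: n W(2)\<close>)
    then show ?thesis unfolding transport_fst[OF W(1)] by (simp add: abs_mult mult.assoc)
   qed (simp add: R(2))
  qed
 qed (intro borel_measurable_times borel_measurable_power Wm Vm tm Fm grad_snd_measurable)+
 show ?thesis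
  using LIMSEQ_unique[OF A tendsto_mult_left[OF Bl, of "1/2", folded integral_gibbs_transport_smooth[OF W(1) F]]] .
qed

text \<open>The transport and the spherical drift produce the same integral with opposite signs: \<open>1/2\<close> from the Gibbs factor, and \<open>- 1/2\<close> because the tangential field has divergence \<open>- (d - 1)\<close> times the velocity component.\<close>

lemma langevin_nonpos:
 assumes F: "F\<in>Cc" and d: "DIM('a) \<ge> 2"
 shows "(\<integral>p. exp (- V (fst p))*(langevin V \<sigma> F p * F p)\<partial>(phaseM :: ('a \<times> 'a) measure))<=0"
proof -
 let ?M = "phaseM :: ('a \<times> 'a) measure" and ?m = "%x. exp (- V x)"
 have m: "loc_bounded ?m" using gibbs_loc_bounded[of 1] by simp
 have mg: "loc_bounded (%x. ?m x * (grad V x\<bullet>c))" for c by (rule loc_bounded_mult[OF m loc_bounded_grad(2)[OF loc]])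
 let ?k = "1/(real DIM('a)-1)"
 have k: "?k * ((real DIM('a)-1)/2)=1/2" using d by simp
 let ?T = "%p. ?m (fst p)*(transport F p * F p)" and ?S = "%p. ?m (fst p)*(sphere_lap F p * F p)"
 let ?t = "%c p. (?m (fst p)*(grad V (fst p)\<bullet>c))*(tan_deriv c F p * F p)"
 let ?y = "%c p. (?m (fst p)*(grad V (fst p)\<bullet>c))*((snd p\<bullet>c)*(F p)\<^sup>2)"
 have iT: "integrable ?M ?T" and iS: "integrable ?M ?S" and it: "integrable ?M (?t c)" for c
  by (intro integrable_weighted_Cc[OF m] integrable_weighted_Cc[OF mg] Cc_prod Cc_transport Cc_sphere_lap Cc_tan_deriv F)+
 have iy: "integrable ?M (?y c)" for c
  unfolding power2_eq_square
  by (intro integrable_weighted_Cc[OF mg] Cc_mult Cc_prod F smooth_on_linear open_UNIV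
    bounded_linear_compose[OF bounded_linear_inner_left bounded_linear_snd])
 have "(\<integral>p. ?m (fst p)*(langevin V \<sigma> F p * F p)\<partial>?M)=(\<integral>p. ?T p-?k * (\<Sum>c\<in>Basis. ?t c p)+\<sigma>\<^sup>2/2*?S p\<partial>?M)"
  by (rule Bochner_Integration.integral_cong) (simp_all add: langevin_def sum_distrib_left sum_distrib_right algebra_simps)
 also have "...=(\<integral>p. ?T p\<partial>?M)-?k * (\<Sum>c\<in>Basis. \<integral>p. ?t c p\<partial>?M)+\<sigma>\<^sup>2/2*(\<integral>p. ?S p\<partial>?M)"
  using iT iS it by simp
 also have "?k * (\<Sum>c\<in>Basis. \<integral>p. ?t c p\<partial>?M)=1/2*(\<Sum>c\<in>Basis. \<integral>p. ?y c p\<partial>?M)"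
 proof -
  have "(\<integral>p. ?t c p\<partial>?M)=(real DIM('a)-1)/2*(\<integral>p. ?y c p\<partial>?M)" for c by (rule tan_deriv_by_parts[OF mg F])
  then have "(\<Sum>c\<in>Basis. \<integral>p. ?t c p\<partial>?M)=(real DIM('a)-1)/2*(\<Sum>c\<in>Basis. \<integral>p. ?y c p\<partial>?M)"
   by (simp only: sum_distrib_left)
  then show ?thesis by (simp only: mult.assoc[symmetric] k)
 qed
 also have "(\<Sum>c\<in>Basis. \<integral>p. ?y c p\<partial>?M)=(\<integral>p. ?m (fst p)*((grad V (fst p)\<bullet>snd p)*(F p)\<^sup>2)\<partial>?M)"
  unfolding Bochner_Integration.integral_sum[OF iy, symmetric] euclidean_inner[of "grad V (fst _)" "snd _"]
  by (rule Bochner_Integration.integral_cong) (simp_all add: sum_distrib_left sum_distrib_right mult_ac)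
 also have "(\<integral>p. ?T p\<partial>?M)=1/2*(\<integral>p. ?m (fst p)*((grad V (fst p)\<bullet>snd p)*(F p)\<^sup>2)\<partial>?M)"
  by (rule integral_gibbs_transport[OF F])
 finally have "(\<integral>p. ?m (fst p)*(langevin V \<sigma> F p * F p)\<partial>?M)=\<sigma>\<^sup>2/2*(\<integral>p. ?S p\<partial>?M)" by simp
 moreover have "(\<integral>p. ?S p\<partial>?M)<=0" unfolding sphere_lap_by_parts[OF m F] by (simp add: sum_nonneg)
 ultimately show ?thesis by (simp only:) (rule mult_nonneg_nonpos, simp)
qed

section \<open>The weighted $L^2$ space\<close>

lemma langevin_measure_eq: "langevin_measure V=density (phaseM :: ('a \<times> 'a) measure) (%p. ennreal (exp (- V (fst p))))"
 by (simp add: langevin_measure_def split_beta')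

lemma gibbs_measurable: "(%p. exp (- V (fst p)))\<in>borel_measurable (phaseM :: ('a \<times> 'a) measure)"
  "(%p. exp (- V (fst p)/2))\<in>borel_measurable (phaseM :: ('a \<times> 'a) measure)"
 using measurable_phase_fst[OF loc_boundedD(1)[OF gibbs_loc_bounded[of 1]]] measurable_phase_fst[OF loc_boundedD(1)[OF gibbs_loc_bounded[of 2]]] by simp_all

lemma measurable_langevin_measure: "borel_measurable (langevin_measure V)=borel_measurable (phaseM :: ('a \<times> 'a) measure)"
 by (rule measurable_cong_sets) (simp_all add: langevin_measure_eq)

lemma gibbs_square: "exp (- V x) * y\<^sup>2=(exp (- V x/2) * y)\<^sup>2"
 by (simp add: power_mult_distrib exp_double[symmetric])

lemma L2_langevin_measure: "f\<in>L2 (langevin_measure V) \<longleftrightarrow> (%p. exp (- V (fst p)/2) * f p)\<in>L2 (phaseM :: ('a \<times> 'a) measure)"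
proof -
 let ?M = "phaseM :: ('a \<times> 'a) measure"
 have m: "f\<in>borel_measurable ?M \<longleftrightarrow> (%p. exp (- V (fst p)/2) * f p)\<in>borel_measurable ?M"
 proof
  assume "(%p. exp (- V (fst p)/2) * f p)\<in>borel_measurable ?M"
  from borel_measurable_divide[OF this gibbs_measurable(2)] show "f\<in>borel_measurable ?M" by simp
 qed (intro borel_measurable_times gibbs_measurable)
 have "integrable (langevin_measure V) (%p. (f p)\<^sup>2) \<longleftrightarrow> integrable ?M (%p. (exp (- V (fst p)/2) * f p)\<^sup>2)" if "f\<in>borel_measurable ?M"
  unfolding langevin_measure_eq gibbs_square[symmetric]
  by (rule integrable_real_density) (use that gibbs_measurable in auto)
 then show ?thesis unfolding L2_def measurable_langevin_measure using m by blast
qed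

lemma integral_langevin_measure:
 assumes "f\<in>borel_measurable (phaseM :: ('a \<times> 'a) measure)"
 shows "(\<integral>p. f p\<partial>langevin_measure V)=(\<integral>p. exp (- V (fst p)) * f p\<partial>phaseM)"
 unfolding langevin_measure_eq by (rule integral_real_density) (use assms gibbs_measurable in auto)

lemma l2_norm_langevin_measure:
 assumes "f\<in>borel_measurable (phaseM :: ('a \<times> 'a) measure)"
 shows "l2_norm (langevin_measure V) f=l2_norm phaseM (%p. exp (- V (fst p)/2) * f p)"
 unfolding l2_norm_def gibbs_square[symmetric] using assms by (subst integral_langevin_measure) auto

lemma L2_langevin_measure_Cc: "F\<in>Cc ==> F\<in>L2 (langevin_measure V)"
 unfolding L2_langevin_measure using L2_phase_weighted[OF gibbs_loc_bounded[of 2]] by simp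

text \<open>Products of test functions with exponentials are restrictions of test functions, and their span is dense.\<close>

lemma Cc_dense:
 assumes h: "h\<in>L2 (langevin_measure V)" and e: "e > 0"
 shows "\<exists>F\<in>Cc. l2_norm (langevin_measure V) (%p. h p-F p) < e"
proof -
 let ?M = "langevin_measure V"
 define G where "G={f\<in>L2 ?M. \<forall>e>0. \<exists>F\<in>Cc. l2_norm ?M (%p. f p-F p) < e}"
 have R: "Cc \<subseteq> L2 ?M" using L2_langevin_measure_Cc by blast
 have "h\<in>G"
 proof (rule tensor_dense[where M = ?M, OF _ _ _ _ _ _ _ h])
  show "sets ?M=sets phaseM" by (simp add: langevin_measure_eq)
  show "emeasure ?M (cball 0 r \<times> sphere 0 1) < \<infinity>" for r
  proof -
   obtain C where C: "!!x. norm x<=r ==> \<bar>exp (- V x/1)\<bar><=C" using loc_boundedD(2)[OF gibbs_loc_bounded[of 1]] by blast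
   let ?A = "cball (0::'a) r \<times> sphere (0::'a) 1"
   have A: "?A\<in>sets phaseM" using sets.top[of "sphere_measure :: 'a measure"] by (intro pair_measureI) (auto simp: space_sphere_measure)
   have "emeasure ?M ?A=(\<integral>\<^sup>+p. ennreal (exp (- V (fst p))) * indicator ?A p\<partial>phaseM)"
    unfolding langevin_measure_eq by (rule emeasure_density[OF _ A]) (use gibbs_measurable in simp)
   also have "...<=(\<integral>\<^sup>+p. ennreal C * indicator ?A p\<partial>phaseM)"
    by (rule nn_integral_mono) (use C in \<open>auto simp: indicator_def intro!: ennreal_leI\<close>)
   also have "...=ennreal C * emeasure phaseM ?A" using A by (rule nn_integral_cmult_indicator)
   also have "... < \<infinity>" using emeasure_phase_bounded[of r, where ?'a = 'a] by (simp add: ennreal_mult_less_top)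
   finally show ?thesis .
  qed
  show "G \<subseteq> L2 ?M" by (auto simp: G_def)
  show "(%p. f p+g p)\<in>G" if "f\<in>G" "g\<in>G" for f g
   using approx_add[OF R] Cc_add Cc_cmult that unfolding G_def by blast
  show "(%p. c * f p)\<in>G" if "f\<in>G" for f c
   using approx_cmult[OF R] Cc_add Cc_cmult that unfolding G_def by blast
  show "f\<in>G" if "f\<in>L2 ?M" "!!e. e > 0 ==> \<exists>g\<in>G. l2_norm ?M (%p. f p-g p) < e" for f
   using approx_closed[OF R] that unfolding G_def by blast
  show "(%p. a (fst p) * exp (v\<bullet>snd p))\<in>G" if a: "a\<in>Cc" for a v
  proof -
   let ?f = "%p::'a\<times>'a. a (fst p) * exp (v\<bullet>snd p)"
   obtain F where F: "F\<in>Cc" "!!p::'a\<times>'a. p\<in>phase_space ==> F p=?f p"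
    by (rule Cc_tensor[OF a smooth_on_exp[OF open_UNIV smooth_on_linear[OF open_UNIV bounded_linear_inner_right]]]) blast
   have fm: "?f\<in>borel_measurable ?M"
    unfolding measurable_langevin_measure
    by (rule measurable_phase, rule borel_measurable_continuous_onI, rule smooth_on_continuous)
      (intro smooth_on_mult open_UNIV smooth_on_compose_linear[OF bounded_linear_fst Cc_smooth[OF a]]
       smooth_on_exp smooth_on_linear bounded_linear_compose[OF bounded_linear_inner_right bounded_linear_snd])
   have sp: "space ?M=phase_space" by (rule space_langevin_measure)
   have fL: "?f\<in>L2 ?M" by (rule L2_bounded_by[OF fm L2_langevin_measure_Cc[OF F(1)]]) (rule AE_I2, simp add: sp F(2))
   have "l2_norm ?M (%p. ?f p-F p)=0"
    unfolding l2_norm_eq_0_iff[OF L2_diff[OF fL L2_langevin_measure_Cc[OF F(1)]]] by (rule AE_I2) (simp add: sp F(2))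
   then show ?thesis unfolding G_def using fL F(1) by (auto intro!: bexI[OF _ F(1)])
  qed
 qed
 then show ?thesis using e unfolding G_def by blast
qed

section \<open>Range of the resolvent equation\<close>

lemma l2_multiplier_tendsto:
 assumes X: "X\<in>L2 M" and a: "!!k. a k\<in>borel_measurable M" "a0\<in>borel_measurable M"
  and b: "!!k. AE p in M. \<bar>a k p\<bar><=C" and l: "AE p in M. (%k. a k p) ----> a0 p"
 shows "(%k::nat. l2_norm M (%p. a k p * X p-a0 p * X p)) ----> 0"
proof (rule l2_dominated_convergence[where w = "%p. 2 * C * \<bar>X p\<bar>"])
 have "(%p. \<bar>X p\<bar>)\<in>L2 M" using X by (auto simp: L2_def)
 then show "(%p. 2 * C * \<bar>X p\<bar>)\<in>L2 M" by (rule L2_cmult)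
 have "AE p in M. \<forall>k. \<bar>a k p\<bar><=C" unfolding AE_all_countable using b by (rule allI)
 with l show "AE p in M. \<bar>a k p * X p-a0 p * X p\<bar><=2 * C * \<bar>X p\<bar>" for k
 proof eventually_elim
  case (elim p)
  have "\<bar>a0 p\<bar><=C" by (rule tendsto_upperbound[OF tendsto_rabs[OF elim(1)]]) (use elim(2) in auto)
  then have "\<bar>a k p-a0 p\<bar><=2 * C" using elim(2)[rule_format, of k] by linarith
  then show ?case unfolding left_diff_distrib[symmetric] abs_mult by (rule mult_right_mono) simp
 qed
 show "AE p in M. (%k. a k p * X p) ----> a0 p * X p" using l by eventually_elim (intro tendsto_intros)
qed (use X a L2_meas in auto)

text \<open>The approximate solution is the cutoff at scale \<open>r\<close> times \<open>exp (W k / 2)\<close> times the solution \<open>\<phi>\<close> of the problem with the truncated drift. As \<open>k\<close> grows, the mollified potential is replaced by \<open>V\<close>, and where the cutoff lives the truncation is invisible. The four quarters of \<open>e\<close> are: the mollification error, the residual of \<open>\<phi>\<close>, the tail of \<open>h\<close>, and the commutator of the cutoff with the transport. The radius is fixed first; this is possible because the bound \<open>N\<close> on \<open>\<phi>\<close> comes from dissipativity and does not depend on the drift.\<close>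

lemma langevin_range:
 assumes h: "h\<in>L2 (phaseM :: ('a \<times> 'a) measure)" and e: "e > 0" and d: "DIM('a) \<ge> 2" and s: "\<sigma> > 0"
 shows "\<exists>F\<in>Cc. l2_norm phaseM (%p. exp (- V (fst p)/2)*(F p-langevin V \<sigma> F p)-h p) < e"
proof -
 let ?M = "phaseM :: ('a \<times> 'a) measure"
 note gl = loc_bounded_grad(2)[OF loc]
 have e4: "e/4 > 0" using e by simp
 obtain C where C: "C > 0" "!!R v x::'a. R > 0 ==> \<bar>dderiv v (cutoff R) x\<bar><=C/R * norm v"
  using cutoff_dderiv_bound[where ?'a = 'a] by blast
 have cm: "(%p. cutoff r (fst p))\<in>borel_measurable ?M" for r
  by (rule measurable_phase_fst[of "cutoff r"]) (intro borel_measurable_continuous_onI smooth_on_continuous cutoff_smooth)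
 define N where "N=l2_norm ?M h+e"
 have N: "N > 0" using l2_norm_nonneg[of ?M h] e by (simp add: N_def)
 have "(%k. l2_norm ?M (%p. cutoff (real (Suc k)) (fst p) * h p-1 * h p)) ----> 0"
 proof (rule l2_multiplier_tendsto[OF h cm, where C = 1 and ?a0.0 = "%_. 1"])
  show "AE p in ?M. \<bar>cutoff (real (Suc k)) (fst p)\<bar><=1" for k by (simp add: abs_le_iff cutoff_bounds(2) order_trans[OF _ cutoff_bounds(1)] del: of_nat_Suc)
  show "AE p in ?M. (%k. cutoff (real (Suc k)) (fst p)) ----> 1"
  proof (rule AE_I2, rule tendsto_eventually)
   fix p :: "'a \<times> 'a"
   obtain n :: nat where n: "norm (fst p)<=real n" using real_arch_simple by blast
   show "eventually (%k. cutoff (real (Suc k)) (fst p)=1) sequentially"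
    using eventually_ge_at_top[of n] by eventually_elim (rule cutoff_eq_1, use n in auto)
  qed
 qed simp
 from order_tendstoD(2)[OF this e4] have ev1: "eventually (%k. l2_norm ?M (%p. cutoff (real (Suc k)) (fst p) * h p-h p) < e/4) sequentially" by simp
 have "(%k. C * N * (1/real (Suc k))) ----> 0" using tendsto_mult_left[OF step_sequence(3), of "C * N"] by simp
 from order_tendstoD(2)[OF this e4] have ev2: "eventually (%k. C * N * (1/real (Suc k)) < e/4) sequentially" .
 obtain k0 where k0: "l2_norm ?M (%p. cutoff (real (Suc k0)) (fst p) * h p-h p) < e/4" "C * N * (1/real (Suc k0)) < e/4"
  using eventually_happens[OF eventually_conj[OF ev1 ev2]] by auto
 define r where "r=real (Suc k0)"
 have r: "r > 0" by (simp add: r_def)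
 have r2: "C * N/r < e/4" using k0(2) by (simp add: r_def)
 let ?x = "%p::'a\<times>'a. cutoff r (fst p)"
 let ?dx = "transport ?x"
 have dx: "?dx p=dderiv (snd p) (cutoff r) (fst p)" for p by (rule transport_fst[OF cutoff_smooth])
 have snd1: "norm (snd p)=1" if "p\<in>space ?M" for p using that by (auto simp: space_phase_measure phase_space_def)
 have dxb: "\<bar>?dx p\<bar><=C/r" if "p\<in>space ?M" for p using C(2)[OF r, where v = "snd p" and x = "fst p"] snd1[OF that] by (simp add: dx)
 have dx0: "?dx p=0" if "norm (fst p) > 2 * r" for p
  unfolding dx by (rule dderiv_eq_0[of "{x. norm x > 2 * r}"]) (use that in \<open>auto intro!: open_Collect_less continuous_intros cutoff_eq_0[OF r]\<close>)
 have dxm: "?dx\<in>borel_measurable ?M"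
  by (rule measurable_phase, rule borel_measurable_continuous_onI, rule smooth_on_continuous)
    (rule smooth_on_lin_field[OF smooth_on_fst[OF cutoff_smooth] bounded_linear_transport_field])
 define b where "b x=indicator (cball 0 (2 * r)) x *\<^sub>R grad V x" for x
 obtain \<beta> where \<beta>: "!!x. norm x<=2 * r ==> norm (grad V x)<=\<beta>" using loc_bounded_grad(1)[OF loc, of "2 * r"] by blast
 have bl: "loc_bounded (%x. b x\<bullet>c)" for c
 proof -
  have "loc_bounded (%x::'a. indicator (cball 0 (2 * r)) x :: real)" unfolding loc_bounded_def
   by (intro conjI borel_measurable_indicator allI exI[of _ 1]) (auto simp: indicator_def)
  from loc_bounded_mult[OF this gl[of c]] show ?thesis by (simp add: b_def)
 qed
 have bb: "norm (b x)<=\<bar>\<beta>\<bar>" for x using \<beta>[of x] by (auto simp: b_def indicator_def)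
 have c: "\<sigma>\<^sup>2/2 > 0" using s by simp
 obtain \<phi> where \<phi>: "\<phi>\<in>Cc"
  "l2_norm ?M (%p. h p-(((\<phi> p-\<sigma>\<^sup>2/2 * sphere_lap \<phi> p)-transport \<phi> p)-drift b \<phi> p)) < e/4"
  using dense_range_drift[OF c d bl bb] h e4 unfolding dense_range_def by blast
 define P where "P p=((\<phi> p-\<sigma>\<^sup>2/2 * sphere_lap \<phi> p)-transport \<phi> p)-drift b \<phi> p" for p
 note L\<phi> = L2_phase_Cc[OF \<phi>(1)] and Ll = L2_phase_Cc[OF Cc_sphere_lap[OF \<phi>(1)]]
  and Lt = L2_phase_Cc[OF Cc_transport[OF \<phi>(1)]] and Ld = L2_drift[OF bl \<phi>(1)]
 have PL: "P\<in>L2 ?M" unfolding P_def by (intro L2_diff L2_cmult L\<phi> Ll Lt Ld)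
 have hP: "l2_norm ?M (%p. P p-h p) < e/4" using \<phi>(2) unfolding P_def[symmetric] l2_norm_minus[of ?M h P] .
 have "l2_norm ?M \<phi><=l2_norm ?M (%p. \<phi> p-((\<sigma>\<^sup>2/2) * sphere_lap \<phi> p+1*(1 * transport \<phi> p+1 * drift b \<phi> p)))"
 proof (rule dissipative_lower_bound[OF L\<phi>])
  show "(%p. (\<sigma>\<^sup>2/2) * sphere_lap \<phi> p+1*(1 * transport \<phi> p+1 * drift b \<phi> p))\<in>L2 ?M" by (intro L2_lincomb Ll Lt Ld)
  show "l2_inner ?M (%p. (\<sigma>\<^sup>2/2) * sphere_lap \<phi> p+1*(1 * transport \<phi> p+1 * drift b \<phi> p)) \<phi><=0"
   unfolding l2_inner_lincomb[OF Ll L2_lincomb[OF Lt Ld] L\<phi>] l2_inner_lincomb[OF Lt Ld L\<phi>]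
    l2_inner_transport[OF \<phi>(1)] drift_antisymmetric[OF bl \<phi>(1) d]
   using mult_nonneg_nonpos[OF less_imp_le[OF c] sphere_lap_inner_nonpos[OF \<phi>(1)]] by simp
 qed
 also have "(%p. \<phi> p-((\<sigma>\<^sup>2/2) * sphere_lap \<phi> p+1*(1 * transport \<phi> p+1 * drift b \<phi> p)))=P" by (simp add: P_def fun_eq_iff)
 also have "l2_norm ?M P<=N" using l2_norm_le_diff[OF PL h] hP e by (simp add: N_def)
 finally have \<phi>N: "l2_norm ?M \<phi><=N" .
 define X where "X p=\<phi> p-langevin V \<sigma> \<phi> p" for p
 have XL: "X\<in>L2 ?M" unfolding X_def using L2_langevin[OF gl loc_bounded_const[of 1] \<phi>(1)] by (intro L2_diff L\<phi>) simp
 obtain W B where W: "!!k::nat. smooth_on UNIV (W k)" "B \<ge> 0"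
  "!!k x. norm x<=2 * r ==> \<bar>W k x\<bar><=B" "!!k x v. norm x<=2 * r ==> \<bar>dderiv v (W k) x\<bar><=B * norm v"
  "!!x. norm x<=2 * r ==> (%k. W k x) ----> V x"
  "!!x w v. norm x<=2 * r ==> GDERIV V x :> w ==> (%k. dderiv v (W k) x) ----> w\<bullet>v"
  using smooth_potentials[OF loc, of "2 * r"] by blast
 have VB: "\<bar>V x\<bar><=B" if "norm x<=2 * r" for x
  by (rule tendsto_upperbound[OF tendsto_rabs[OF W(5)[OF that]]]) (use W(3)[OF that] in auto)
 define E where "E k p=exp ((W k (fst p)-V (fst p))/2)" for k and p :: "'a \<times> 'a"
 have EB: "\<bar>E k p\<bar><=exp B" if "norm (fst p)<=2 * r" for k p using W(3)[OF that, of k] VB[OF that] by (simp add: E_def abs_le_iff)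
 have El: "(%k. E k p) ----> 1" if "norm (fst p)<=2 * r" for p
 proof -
  have "(%k. E k p) ----> exp ((V (fst p)-V (fst p))/2)" unfolding E_def by (intro tendsto_intros W(5) that) simp
  then show ?thesis by simp
 qed
 have Em: "E k\<in>borel_measurable ?M" for k
  unfolding E_def using V_borel
  by (intro measurable_phase_fst[of "%x. exp ((W k x-V x)/2)"] borel_measurable_exp borel_measurable_divide borel_measurable_diff
    borel_measurable_const borel_measurable_continuous_onI[OF smooth_on_continuous[OF W(1)]] measurable_compose[OF _ borel_measurable_exp]) auto
 let ?dW = "%k. transport (%p. W k (fst p))"
 have dWm: "?dW k\<in>borel_measurable ?M" for k
  by (rule measurable_phase, rule borel_measurable_continuous_onI, rule smooth_on_continuous)
    (rule smooth_on_lin_field[OF smooth_on_fst[OF W(1)] bounded_linear_transport_field])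
 let ?a = "%k p. ?x p * E k p" and ?c = "%k p.-(E k p * (1/2*(?x p * ?dW k p)+?dx p))"
 let ?cl = "%p.-(1/2*(?x p * (grad V (fst p)\<bullet>snd p))+?dx p)"
 have xb: "\<bar>?x p\<bar><=1" for p using cutoff_bounds[of r "fst p"] by (simp add: abs_le_iff)
 have x0: "?x p=0" if "norm (fst p) > 2 * r" for p using cutoff_eq_0[OF r, of "fst p"] that by simp
 have ab: "\<bar>?a k p\<bar><=1 * exp B" for k p
 proof (cases "norm (fst p)<=2 * r")
  case True
  then show ?thesis unfolding abs_mult by (intro mult_mono xb EB) auto
 qed (simp add: x0)
 have A1: "(%k. l2_norm ?M (%p. ?a k p * X p-?x p * X p)) ----> 0"
 proof (rule l2_multiplier_tendsto[OF XL _ cm, where C = "1 * exp B"])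
  show "?a k\<in>borel_measurable ?M" for k by (intro borel_measurable_times cm Em)
  show "AE p in ?M. \<bar>?a k p\<bar><=1 * exp B" for k by (rule AE_I2) (rule ab)
  show "AE p in ?M. (%k. ?a k p) ----> ?x p"
  proof (rule AE_I2)
   fix p :: "'a \<times> 'a" show "(%k. ?a k p) ----> ?x p"
    using tendsto_mult_left[OF El, of p "?x p"] by (cases "norm (fst p)<=2 * r") (simp_all add: x0)
  qed
 qed
 have A2: "(%k. l2_norm ?M (%p. ?c k p * \<phi> p-?cl p * \<phi> p)) ----> 0"
 proof (rule l2_multiplier_tendsto[OF L\<phi>, where C = "exp B * (1/2*(1 * B)+C/r)"])
  show "?c k\<in>borel_measurable ?M" "?cl\<in>borel_measurable ?M" for k
   by (intro borel_measurable_uminus borel_measurable_times borel_measurable_add borel_measurable_const cm Em dWm dxm grad_snd_measurable)+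
  show "AE p in ?M. \<bar>?c k p\<bar><=exp B * (1/2*(1 * B)+C/r)" for k
  proof (rule AE_I2)
   fix p assume p: "p\<in>space ?M"
   show "\<bar>?c k p\<bar><=exp B * (1/2*(1 * B)+C/r)"
   proof (cases "norm (fst p)<=2 * r")
    case True
    have "\<bar>?dW k p\<bar><=B" using W(4)[OF True, where v = "snd p" and k = k] snd1[OF p] by (simp add: transport_fst[OF W(1)])
    then have "\<bar>?x p * ?dW k p\<bar><=1 * B" unfolding abs_mult by (intro mult_mono xb) auto
    then have "\<bar>1/2*(?x p * ?dW k p)+?dx p\<bar><=1/2*(1 * B)+C/r" using dxb[OF p] by linarith
    then show ?thesis unfolding abs_minus_cancel abs_mult[of "E k p"] by (intro mult_mono EB True) auto
   next
    case False
    then have "?x p=0" "?dx p=0" using x0 dx0 by auto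
    then show ?thesis using W(2) C(1) r by simp
   qed
  qed
  show "AE p in ?M. (%k. ?c k p) ----> ?cl p"
   using Rademacher_local[OF loc]
  proof eventually_elim
   case (elim p)
   show ?case
   proof (cases "norm (fst p)<=2 * r")
    case True
    have "(%k. ?c k p) ---->-(1*(1/2*(?x p * (grad V (fst p)\<bullet>snd p))+?dx p))"
     unfolding transport_fst[OF W(1)] by (intro tendsto_intros El W(6) elim True)
    then show ?thesis by simp
   next
    case False
    then have "?x p=0" "?dx p=0" using x0 dx0 by auto
    then show ?thesis by simp
   qed
  qed
 qed
 from order_tendstoD(2)[OF tendsto_add[OF A1 A2], of "e/4"] e4
 have "eventually (%k. l2_norm ?M (%p. ?a k p * X p-?x p * X p)+l2_norm ?M (%p. ?c k p * \<phi> p-?cl p * \<phi> p) < e/4) sequentially" by simp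
 then obtain k where k: "l2_norm ?M (%p. ?a k p * X p-?x p * X p)+l2_norm ?M (%p. ?c k p * \<phi> p-?cl p * \<phi> p) < e/4"
  using eventually_happens by fastforce
 define a where "a x=cutoff r x * exp (W k x/2)" for x
 have Ws: "smooth_on UNIV (%x. exp (W k x/2))"
  using smooth_on_exp[OF open_UNIV smooth_on_mult[OF open_UNIV smooth_on_const[OF open_UNIV, of "1/2"] W(1)[of k]]] by simp
 have as: "smooth_on UNIV a" unfolding a_def by (intro smooth_on_mult open_UNIV cutoff_smooth Ws)
 define F where "F p=a (fst p)*\<phi> p" for p
 have F: "F\<in>Cc" unfolding F_def by (rule Cc_mult[OF smooth_on_fst[OF as] \<phi>(1)])
 have dE: "transport (%p. exp (W k (fst p)/2)) p=1/2 * exp (W k (fst p)/2)*?dW k p" for p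
 proof -
  have "((%s. exp (s/2)) has_real_derivative 1/2 * exp (s/2)) (at s)" for s :: real by (auto intro!: derivative_eq_intros)
  from fun_cong[OF lin_field_compose[OF smooth_on_fst[OF W(1)[of k]] this, of transport_field], of p] show ?thesis by simp
 qed
 have ta: "transport (%p. a (fst p)) p=?x p * (1/2 * exp (W k (fst p)/2)*?dW k p)+?dx p * exp (W k (fst p)/2)" for p
  unfolding a_def by (simp add: lin_field_mult[OF smooth_on_fst[OF cutoff_smooth] smooth_on_fst[OF Ws]] dE)
 have main: "exp (- V (fst p)/2)*(F p-langevin V \<sigma> F p)=?a k p * X p+?c k p * \<phi> p" for p
 proof -
  have E: "E k p=exp (- V (fst p)/2) * exp (W k (fst p)/2)" by (simp add: E_def exp_add[symmetric] diff_divide_distrib)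
  show ?thesis
   unfolding F_def langevin_mult_fst[OF as \<phi>(1)] ta E X_def by (simp add: a_def algebra_simps)
 qed
 have lim: "?x p * X p+?cl p * \<phi> p=?x p * P p-?dx p * \<phi> p" for p
 proof (cases "norm (fst p)<=2 * r")
  case True
  then have b: "b (fst p)=grad V (fst p)" by (simp add: b_def)
  define T where "T=1/(real DIM('a)-1)*(\<Sum>c\<in>Basis. (grad V (fst p)\<bullet>c) * tan_deriv c \<phi> p)"
  have "langevin V \<sigma> \<phi> p=transport \<phi> p-T+\<sigma>\<^sup>2/2 * sphere_lap \<phi> p" unfolding langevin_def T_def ..
  moreover have "drift b \<phi> p=1/2*(grad V (fst p)\<bullet>snd p)*\<phi> p-T"
   unfolding drift_def b T_def euclidean_inner[of "grad V (fst p)" "snd p"]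
   by (simp add: sum_distrib_left sum_distrib_right sum_subtractf right_diff_distrib mult_ac)
  ultimately show ?thesis unfolding X_def P_def by (simp only:) (simp add: algebra_simps)
 next
  case False
  then have "?x p=0" "?dx p=0" using x0 dx0 by auto
  then show ?thesis by simp
 qed
 have mulL: "(%p. m p * Y p)\<in>L2 ?M" if "Y\<in>L2 ?M" "m\<in>borel_measurable ?M" "!!p. p\<in>space ?M ==> \<bar>m p\<bar><=K" for m Y K
  by (rule L2_bounded_by[OF _ L2_cmult[OF that(1), of K]])
    (use that(2) L2_meas[OF that(1)] in \<open>auto intro!: AE_I2 simp: abs_mult intro: mult_right_mono order_trans[OF that(3) abs_ge_self]\<close>)
 have xP: "(%p. ?x p * P p)\<in>L2 ?M" and xh: "(%p. ?x p * h p)\<in>L2 ?M" and xX: "(%p. ?x p * X p)\<in>L2 ?M"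
  by (rule mulL[OF _ cm xb], rule PL h XL)+
 have dp: "(%p. ?dx p * \<phi> p)\<in>L2 ?M" by (rule mulL[OF L\<phi> dxm dxb])
 have c0: "(%p. ?cl p * \<phi> p)\<in>L2 ?M"
 proof -
  have "(%p. ?cl p * \<phi> p)=(%p. (?x p * P p-?dx p * \<phi> p)-?x p * X p)" using lim by (simp add: fun_eq_iff algebra_simps)
  then show ?thesis using L2_diff[OF L2_diff[OF xP dp] xX] by simp
 qed
 have FL: "(%p. exp (- V (fst p)/2)*(F p-langevin V \<sigma> F p))\<in>L2 ?M"
  unfolding right_diff_distrib
  by (intro L2_diff L2_phase_weighted[OF gibbs_loc_bounded[of 2]] L2_langevin[OF gl gibbs_loc_bounded[of 2]] F)
 have aX: "(%p. ?a k p * X p)\<in>L2 ?M" by (rule mulL[OF XL _ ab]) (intro borel_measurable_times cm Em)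
 have cp: "(%p. ?c k p * \<phi> p)\<in>L2 ?M"
 proof -
  have "(%p. ?c k p * \<phi> p)=(%p. exp (- V (fst p)/2)*(F p-langevin V \<sigma> F p)-?a k p * X p)"
   by (simp only: main add_diff_cancel_left')
  then show ?thesis using L2_diff[OF FL aX] by (simp only:)
 qed
 have xc: "(%p. ?x p * X p+?cl p * \<phi> p)\<in>L2 ?M" by (rule L2_add[OF xX c0])
 have "l2_norm ?M (%p. exp (- V (fst p)/2)*(F p-langevin V \<sigma> F p)-h p)
   <= l2_norm ?M (%p. exp (- V (fst p)/2)*(F p-langevin V \<sigma> F p)-(?x p * X p+?cl p * \<phi> p))
    + l2_norm ?M (%p. (?x p * X p+?cl p * \<phi> p)-h p)"
  by (rule l2_triangle_diff[OF FL xc h])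
 moreover have "l2_norm ?M (%p. exp (- V (fst p)/2)*(F p-langevin V \<sigma> F p)-(?x p * X p+?cl p * \<phi> p)) < e/4"
 proof -
  have "(%p. exp (- V (fst p)/2)*(F p-langevin V \<sigma> F p)-(?x p * X p+?cl p * \<phi> p))
    = (%p. (?a k p * X p-?x p * X p)+(?c k p * \<phi> p-?cl p * \<phi> p))" by (simp only: main add_diff_add)
  then show ?thesis using l2_triangle[OF L2_diff[OF aX xX] L2_diff[OF cp c0]] k by simp
 qed
 moreover have "l2_norm ?M (%p. (?x p * X p+?cl p * \<phi> p)-h p) < 3*(e/4)"
 proof -
  have eq: "(%p. (?x p * X p+?cl p * \<phi> p)-h p)=(%p. ((?x p * P p-?x p * h p)+(?x p * h p-h p))-?dx p * \<phi> p)"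
   unfolding lim by (simp add: fun_eq_iff)
  note L1 = L2_diff[OF xP xh] and L2' = L2_diff[OF xh h]
  have "l2_norm ?M (%p. ?x p * P p-?x p * h p)<=l2_norm ?M (%p. P p-h p)"
  proof (rule l2_norm_mono[OF L2_meas[OF L1] L2_diff[OF PL h]], rule AE_I2)
   fix p show "\<bar>?x p * P p-?x p * h p\<bar><=\<bar>P p-h p\<bar>"
    unfolding right_diff_distrib[symmetric] abs_mult using mult_right_mono[OF xb abs_ge_zero, of p "P p-h p"] by simp
  qed
  moreover have "l2_norm ?M (%p. ?dx p * \<phi> p)<=C * N/r"
  proof -
   have "l2_norm ?M (%p. ?dx p * \<phi> p)<=l2_norm ?M (%p. (C/r)*\<phi> p)"
   proof (rule l2_norm_mono[OF L2_meas[OF dp] L2_cmult[OF L\<phi>]], rule AE_I2)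
    fix p assume "p\<in>space ?M"
    then show "\<bar>?dx p * \<phi> p\<bar><=\<bar>(C/r)*\<phi> p\<bar>"
     unfolding abs_mult by (intro mult_right_mono order_trans[OF dxb abs_ge_self]) auto
   qed
   also have "...=C/r * l2_norm ?M \<phi>" unfolding l2_norm_cmult using C(1) r by simp
   also have "...<=C/r * N" using C(1) r \<phi>N by (intro mult_left_mono) auto
   finally show ?thesis by simp
  qed
  ultimately show ?thesis
   unfolding eq using l2_triangle_minus[OF L2_add[OF L1 L2'] dp] l2_triangle[OF L1 L2'] hP k0(1)[folded r_def] r2 by linarith
 qed
 ultimately have "l2_norm ?M (%p. exp (- V (fst p)/2)*(F p-langevin V \<sigma> F p)-h p) < e" by linarith
 then show ?thesis by (rule bexI[OF _ F])
qed

end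

section \<open>Test functions on the phase space\<close>

lemma Cc_test_functions:
 fixes F :: "'a::euclidean_space \<times> 'a => real"
 assumes F: "F\<in>Cc" shows "F\<in>test_functions"
proof -
 obtain R where R: "R > 0" "!!p. R < norm p ==> F p=0" using Cc_support[OF F] by blast
 have "{p\<in>phase_space. F p \<noteq> 0} \<subseteq> cball 0 R" using R(2) by (auto simp: not_less[symmetric])
 then have "compact (closure {p\<in>phase_space. F p \<noteq> 0})" unfolding compact_closure by (rule bounded_subset[OF bounded_cball])
 then show ?thesis unfolding test_functions_def using Cc_smooth[OF F]
  by (intro CollectI conjI exI[of _ UNIV] exI[of _ F]) auto
qed

text \<open>The local extension is multiplied by a cutoff in \<open>x\<close> and a bump in the distance of the velocity from the unit sphere; by compactness a uniform neighbourhood of the relevant part of the phase space lies inside the domain of the extension.\<close>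

lemma test_function_extension:
 fixes f :: "'a::euclidean_space \<times> 'a => real"
 assumes "f\<in>test_functions"
 obtains F where "F\<in>Cc" "!!p. p\<in>phase_space ==> f p=F p"
proof -
 obtain U G where U: "open U" "phase_space \<subseteq> U" and G: "smooth_on U G" "!!p. p\<in>phase_space ==> G p=f p"
  and K: "compact (closure {p\<in>phase_space. f p \<noteq> 0})"
  using assms unfolding test_functions_def by blast
 have "bounded {p\<in>phase_space. f p \<noteq> 0}" using K unfolding compact_closure .
 then obtain R where R: "R > 0" "\<forall>p\<in>{p\<in>phase_space. f p \<noteq> 0}. norm p<=R" using bounded_pos by blast
 have f0: "f p=0" if "p\<in>phase_space" "R < norm (fst p)" for p
 proof (rule ccontr)
  assume "f p \<noteq> 0"
  then have "norm p<=R" using R(2) that(1) by blast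
  then show False using that(2) norm_fst_le[of "fst p" "snd p"] by simp
 qed
 define q where "q p=((norm (snd p))\<^sup>2-1)\<^sup>2" for p :: "'a \<times> 'a"
 have qc: "continuous_on S q" for S unfolding q_def by (intro continuous_intros)
 define C where "C=(cball 0 (2 * R) \<times> cball 0 2)-U"
 have C: "compact C" unfolding C_def by (intro compact_diff compact_Times compact_cball U(1))
 have qpos: "q p > 0" if "p\<in>C" for p
 proof -
  have "p \<notin> phase_space" using that U(2) by (auto simp: C_def)
  then have "norm (snd p) \<noteq> 1" by (cases p) (auto simp: phase_space_def)
  then have "(norm (snd p))\<^sup>2 \<noteq> 1" using power2_eq_imp_eq[of "norm (snd p)" 1] by auto
  then show ?thesis by (simp add: q_def)
 qed
 obtain \<theta> where \<theta>: "\<theta> > 0" "\<theta><=1" "!!p. p\<in>C ==> \<theta> < q p"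
 proof (cases "C={}")
  case False
  obtain p0 where p0: "p0\<in>C" "!!p. p\<in>C ==> q p0<=q p" using continuous_attains_inf[OF C False qc] by blast
  have w: "min 1 (q p0/2) < q p" if "p\<in>C" for p
   using p0(2)[OF that] qpos[OF p0(1)] min.cobounded2[of 1 "q p0/2"] by linarith
  show thesis by (rule that[OF _ _ w]) (use qpos[OF p0(1)] in simp_all)
 next
  case True
  show thesis by (rule that[of 1]) (simp_all add: True)
 qed
 have inU: "p\<in>U" if "norm (fst p)<=2 * R" "q p<=\<theta>" for p
 proof (rule ccontr)
  assume "p \<notin> U"
  have "\<bar>(norm (snd p))\<^sup>2-1\<bar><=1" using that(2) \<theta>(2) unfolding q_def by (intro power2_le_imp_le[of "\<bar>(norm (snd p))\<^sup>2-1\<bar>" 1]) auto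
  then have "(norm (snd p))\<^sup>2<=2\<^sup>2" by simp
  then have "norm (snd p)<=2" by (rule power2_le_imp_le) simp
  then have "p\<in>C" using \<open>p \<notin> U\<close> that(1) by (cases p) (auto simp: C_def)
  then show False using \<theta>(3)[of p] that(2) by simp
 qed
 define \<psi> where "\<psi> p=cutoff R (fst p) * smooth_step (2-2/\<theta> * q p)" for p :: "'a \<times> 'a"
 have qs: "smooth_on UNIV q"
  unfolding q_def power2_norm_eq_inner
  by (intro smooth_on_power smooth_on_diff smooth_on_const open_UNIV
    smooth_on_compose_linear[OF bounded_linear_snd smooth_on_norm_sq[OF open_UNIV]])
 have \<psi>s: "smooth_on UNIV \<psi>" unfolding \<psi>_def
  by (intro smooth_on_mult smooth_on_fst cutoff_smooth smooth_on_smooth_step smooth_on_diff smooth_on_const open_UNIV qs)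
 have \<psi>0: "\<psi> p=0" if "2 * R < norm (fst p) \<or> \<theta> < q p" for p
 proof (cases "2 * R < norm (fst p)")
  case True then show ?thesis using cutoff_eq_0[OF R(1), of "fst p"] by (simp add: \<psi>_def)
 next
  case False
  then have "2-2/\<theta> * q p<=0" using that \<theta>(1) by (simp add: field_simps)
  then show ?thesis by (simp add: \<psi>_def smooth_step_eq_0)
 qed
 let ?W = "{p. 2 * R < norm (fst p) \<or> \<theta> < q p}"
 have W: "open ?W" by (intro open_Collect_disj open_Collect_less continuous_intros qc)
 define F where "F p=(if p\<in>U then \<psi> p * G p else 0)" for p
 have "smooth_on (U \<union> ?W) F"
 proof (rule smooth_on_Un[OF U(1) W])
  show "smooth_on U F"
   by (rule smooth_on_cong[OF U(1), of "%p. \<psi> p * G p"])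
     (simp add: F_def, rule smooth_on_mult[OF U(1) smooth_on_subset[OF \<psi>s subset_UNIV] G(1)])
  show "smooth_on ?W F"
   by (rule smooth_on_cong[OF W, of "%p. 0"]) (simp add: F_def \<psi>0, rule smooth_on_const[OF W])
 qed
 moreover have "U \<union> ?W=UNIV"
 proof (intro equalityI subsetI UNIV_I)
  fix p show "p\<in>U \<union> ?W" using inU[of p] by (cases "2 * R < norm (fst p) \<or> \<theta> < q p") auto
 qed
 ultimately have Fs: "smooth_on UNIV F" by simp
 have "F\<in>Cc"
 proof (rule CcI[OF Fs, of "2 * R+2"])
  fix p :: "'a \<times> 'a" assume p: "2 * R+2 < norm p"
  have "2 * R < norm (fst p) \<or> 2 < norm (snd p)" using p norm_Pair_le[of "fst p" "snd p"] by auto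
  moreover have "\<theta> < q p" if "2 < norm (snd p)"
  proof -
   have "2\<^sup>2 < (norm (snd p))\<^sup>2" using that by (intro power_strict_mono) auto
   then have "2 < (norm (snd p))\<^sup>2-1" by simp
   then have "2\<^sup>2 < q p" unfolding q_def by (intro power_strict_mono) auto
   then show ?thesis using \<theta>(2) by simp
  qed
  ultimately show "F p=0" using \<psi>0[of p] by (auto simp: F_def)
 qed
 moreover have "f p=F p" if p: "p\<in>phase_space" for p
 proof (cases "R < norm (fst p)")
  case True
  then show ?thesis using f0[OF p] G(2)[OF p] by (simp add: F_def)
 next
  case False
  have "q p=0" using p by (cases p) (auto simp: q_def phase_space_def)
  then have "\<psi> p=1" using cutoff_eq_1[OF R(1), of "fst p"] False by (simp add: \<psi>_def smooth_step_eq_1)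
  then show ?thesis using p U(2) G(2)[OF p] by (auto simp: F_def)
 qed
 ultimately show thesis by (rule that)
qed

section \<open>Essential m-dissipativity\<close>

theorem langevin_essentially_m_dissipative:
 fixes V :: "'a::euclidean_space => real"
 assumes d: "DIM('a) \<ge> 2" and s: "\<sigma> > 0" and loc: "!!x. \<exists>r>0. \<exists>C. C-lipschitz_on (ball x r) V"
 shows "essentially_m_dissipative (langevin_measure V) (langevin_graph V \<sigma>)"
proof (rule essentially_m_dissipativeI)
 let ?M = "langevin_measure V" and ?A = "langevin_graph V \<sigma>" and ?P = "phaseM :: ('a \<times> 'a) measure"
 note gl = loc_bounded_grad(2)[OF loc]
 have sp: "space ?M=phase_space" by (rule space_langevin_measure)
 have op: "langevin_op V \<sigma> F p=langevin V \<sigma> F p" if "F\<in>Cc" "p\<in>phase_space" for F p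
  unfolding langevin_def by (rule langevin_op_eq[OF Cc_smooth[OF that(1)] that(2)])
 have rep: "\<exists>F\<in>Cc. \<forall>p\<in>phase_space. f p=F p \<and> g p=langevin V \<sigma> F p" if fg: "(f, g)\<in>?A" for f g
 proof -
  have f: "f\<in>test_functions" and g: "g=langevin_op V \<sigma> f" using fg by (auto simp: langevin_graph_def)
  obtain F where F: "F\<in>Cc" "!!p. p\<in>phase_space ==> f p=F p" using test_function_extension[OF f] by blast
  have "g p=langevin V \<sigma> F p" if "p\<in>phase_space" for p
   unfolding g op[OF F(1) that, symmetric] by (rule langevin_op_cong[OF F(2) that])
  then show ?thesis using F by blast
 qed
 have inA: "(F, langevin_op V \<sigma> F)\<in>?A" if "F\<in>Cc" for F
  using Cc_test_functions[OF that] by (auto simp: langevin_graph_def)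
 have LF: "langevin V \<sigma> F\<in>L2 ?M" if "F\<in>Cc" for F
  unfolding L2_langevin_measure[OF loc] using L2_langevin[OF gl gibbs_loc_bounded[OF loc, of 2] that] by simp
 have cong: "f\<in>L2 ?M" if "g\<in>L2 ?M" "!!p. p\<in>phase_space ==> f p=g p" for f g
 proof -
  have "f\<in>borel_measurable ?M \<longleftrightarrow> g\<in>borel_measurable ?M" by (rule measurable_cong) (simp add: sp that(2))
  moreover have "integrable ?M (%p. (f p)\<^sup>2) \<longleftrightarrow> integrable ?M (%p. (g p)\<^sup>2)" by (rule Bochner_Integration.integrable_cong) (simp_all add: sp that(2))
  ultimately show ?thesis using that(1) by (simp add: L2_def)
 qed
 show "?A \<subseteq> L2 ?M \<times> L2 ?M"
 proof
  fix u assume u: "u\<in>?A"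
  obtain F where F: "F\<in>Cc" "!!p. p\<in>phase_space ==> fst u p=F p" "!!p. p\<in>phase_space ==> snd u p=langevin V \<sigma> F p"
   using rep[of "fst u" "snd u"] u by auto
  have "fst u\<in>L2 ?M" by (rule cong[OF L2_langevin_measure_Cc[OF loc F(1)] F(2)])
  moreover have "snd u\<in>L2 ?M" by (rule cong[OF LF[OF F(1)] F(3)])
  ultimately show "u\<in>L2 ?M \<times> L2 ?M" by (simp add: mem_Times_iff)
 qed
 show "?A \<noteq> {}" using inA[OF Cc_0] by blast
 show "\<exists>(h, k)\<in>?A. (AE p in ?M. h p=a * f p+b * f' p) \<and> (AE p in ?M. k p=a * g p+b * g' p)"
  if fg: "(f, g)\<in>?A" "(f', g')\<in>?A" for f g f' g' a b
 proof -
  obtain F where F: "F\<in>Cc" "!!p. p\<in>phase_space ==> f p=F p \<and> g p=langevin V \<sigma> F p" using rep[OF fg(1)] by blast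
  obtain F' where F': "F'\<in>Cc" "!!p. p\<in>phase_space ==> f' p=F' p \<and> g' p=langevin V \<sigma> F' p" using rep[OF fg(2)] by blast
  let ?H = "%p. a * F p+b * F' p"
  have H: "?H\<in>Cc" by (intro Cc_add Cc_cmult F(1) F'(1))
  have "AE p in ?M. ?H p=a * f p+b * f' p" by (rule AE_I2) (simp add: sp F(2) F'(2))
  moreover have "AE p in ?M. langevin_op V \<sigma> ?H p=a * g p+b * g' p"
   by (rule AE_I2) (simp add: sp F(2) F'(2) op[OF H] langevin_lincomb[OF F(1) F'(1)])
  ultimately show ?thesis by (intro bexI[OF _ inA[OF H]]) simp
 qed
 show "dissipative ?M ?A"
  unfolding dissipative_def
 proof (intro ballI)
  fix u assume "u\<in>?A"
  moreover obtain f g where u: "u=(f, g)" by (cases u)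
  ultimately obtain F where F: "F\<in>Cc" "!!p. p\<in>phase_space ==> f p=F p \<and> g p=langevin V \<sigma> F p" using rep by blast
  have "l2_inner ?M g f=(\<integral>p. langevin V \<sigma> F p * F p\<partial>?M)"
   unfolding l2_inner_def by (rule Bochner_Integration.integral_cong) (simp_all add: sp F(2))
  also have "...=(\<integral>p. exp (- V (fst p))*(langevin V \<sigma> F p * F p)\<partial>?P)"
   by (rule integral_langevin_measure[OF loc], rule borel_measurable_times)
     (use L2_meas[OF LF[OF F(1)]] measurable_phase[OF Cc_measurable[OF F(1)]] in \<open>simp_all only: measurable_langevin_measure[OF loc]\<close>)
  also have "...<=0" by (rule langevin_nonpos[OF loc F(1) d])
  finally show "case u of (f, g) => l2_inner ?M g f<=0" by (simp add: u)
 qed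
 show "densely_defined ?M ?A"
  unfolding densely_defined_def l2_dist_norm
 proof (intro ballI allI impI)
  fix h e assume "h\<in>L2 ?M" "(e::real) > 0"
  then obtain F where F: "F\<in>Cc" "l2_norm ?M (%p. h p-F p) < e" using Cc_dense[OF loc] by blast
  show "\<exists>(f, g)\<in>?A. l2_norm ?M (%p. h p-f p) < e" using F(2) by (intro bexI[OF _ inA[OF F(1)]]) simp
 qed
 show "\<exists>(f, g)\<in>?A. l2_norm ?M (%p. f p-g p-h p) < e" if h: "h\<in>L2 ?M" and e: "e > 0" for h e
 proof -
  have hP: "(%p. exp (- V (fst p)/2) * h p)\<in>L2 ?P" using h unfolding L2_langevin_measure[OF loc] .
  obtain F where F: "F\<in>Cc" "l2_norm ?P (%p. exp (- V (fst p)/2)*(F p-langevin V \<sigma> F p)-exp (- V (fst p)/2) * h p) < e"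
   using langevin_range[OF loc hP e d s] by blast
  note L = L2_diff[OF L2_diff[OF L2_langevin_measure_Cc[OF loc F(1)] LF[OF F(1)]] h]
  have "l2_norm ?M (%p. F p-langevin_op V \<sigma> F p-h p)=l2_norm ?M (%p. F p-langevin V \<sigma> F p-h p)"
   unfolding l2_norm_def by (intro arg_cong[of _ _ sqrt] Bochner_Integration.integral_cong) (simp_all add: sp op[OF F(1)])
  also have "...=l2_norm ?P (%p. exp (- V (fst p)/2)*(F p-langevin V \<sigma> F p-h p))"
   by (rule l2_norm_langevin_measure[OF loc]) (use L2_meas[OF L] in \<open>simp only: measurable_langevin_measure[OF loc]\<close>)
  also have "... < e" using F(2) by (simp only: right_diff_distrib)
  finally show ?thesis by (intro bexI[OF _ inA[OF F(1)]]) simp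
 qed
qed

theorem theorem4p7:
  fixes V :: "real ^ 'd \<Rightarrow> real" and \<sigma> :: real
  assumes "CARD('d) \<ge> 2"
    and "\<sigma> > 0"
    and "\<And>x. \<exists>r>0. \<exists>C. C-lipschitz_on (ball x r) V"
    and "bdd_below (range V)"
  shows "essentially_m_dissipative (langevin_measure V) (langevin_graph V \<sigma>)"
  by (rule langevin_essentially_m_dissipative[OF _ assms(2,3)]) (use assms(1) in simp)

end
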